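(* Let $\mathfrak{g}$ be a finite-dimensional nilpotent $K$-Lie algebra with $\mathcal{O}$-Lie lattice $\mathcal{L}$, and let $\lambda\in\mathfrak{g}^*$ with $\lambda(\mathcal{L})\subseteq\mathcal{O}$. Then there exists a polarisation $\mathfrak{b}$ of $\mathfrak{g}$ at $\lambda$ such that the affinoid Dixmier module $\widehat{D(\lambda)}_{\mathfrak{b}}$ of $\mathcal{L}$ at $\lambda$ with respect to $\mathfrak{b}$ is irreducible as a $\widehat{U(\mathcal{L})}_K$-module.
   Context: $p$ is a prime, $K/\mathbb{Q}_p$ is a finite extension with valuation ring $\mathcal{O}$ and uniformiser $\pi$. An $\mathcal{O}$-Lie lattice $\mathcal{L}$ in $\mathfrak{g}$ is an $\mathcal{O}$-submodule closed under the Lie bracket with $\bigcap_n\pi^n\mathcal{L}=0$ and $\mathcal{L}\otimes_{\mathcal{O}}K=\mathfrak{g}$. $\widehat{U(\mathcal{L})}:=\varprojlim_n U(\mathcal{L})/\pi^nU(\mathcal{L})$ and $\widehat{U(\mathcal{L})}_K:=\widehat{U(\mathcal{L})}\otimes_{\mathcal{O}}K$. A polarisation of $\mathfrak{g}$ at $\lambda\in\mathfrak{g}^*$ is a solvable subalgebra $\mathfrak{b}$ of $\mathfrak{g}$ such that for all $u\in\mathfrak{g}$: $\lambda([u,\mathfrak{b}])=0$ if and only if $u\in\mathfrak{b}$. Given such $\mathfrak{b}$ and $\lambda(\mathcal{L})\subseteq\mathcal{O}$, put $\mathcal{B}:=\mathfrak{b}\cap\mathcal{L}$, an $\mathcal{O}$-Lie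 lattice in $\mathfrak{b}$; $\lambda$ restricts to a character of $\mathfrak{b}$, and $K_\lambda$ denotes the one-dimensional $\widehat{U(\mathcal{B})}_K$-module on which each $x\in\mathcal{B}$ acts by $\lambda(x)$. The affinoid Dixmier module is $\widehat{D(\lambda)}_{\mathfrak{b}}:=\widehat{U(\mathcal{L})}_K\otimes_{\widehat{U(\mathcal{B})}_K}K_\lambda$. *)

theory Defs
  imports
    "HOL-Algebra.Algebra"
    "HOL-Algebra.Algebraic_Closure_Type"
    "HOL-Library.Poly_Mapping"
begin

section \<open>p-adic fields\<close>

definition padic_abs :: "nat \<Rightarrow> rat \<Rightarrow> real" where
  "padic_abs p x = (case quotient_of x of (a, b) \<Rightarrow>
     if a = 0 then 0
     else real p powi (int (multiplicity (int p) b) - int (multiplicity (int p) a)))"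

definition padic_Cauchy_ring :: "nat \<Rightarrow> (nat \<Rightarrow> rat) ring" where
  "padic_Cauchy_ring p =
     \<lparr> carrier = {x. \<forall>e>0. \<exists>N. \<forall>m\<ge>N. \<forall>n\<ge>N. padic_abs p (x m - x n) < e},
       monoid.mult = (\<lambda>x y n. x n * y n), monoid.one = (\<lambda>_. 1),
       ring.zero = (\<lambda>_. 0), ring.add = (\<lambda>x y n. x n + y n) \<rparr>"

definition padic_null :: "nat \<Rightarrow> (nat \<Rightarrow> rat) set" where
  "padic_null p = {x. (\<lambda>n. padic_abs p (x n)) \<longlonglongrightarrow> 0}"

text \<open>The field of p-adic numbers, as the completion of the rationals.\<close>

definition Qp :: "nat \<Rightarrow> (nat \<Rightarrow> rat) set ring" where
  "Qp p = padic_Cauchy_ring p Quot padic_null p"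

definition Qp_abs :: "nat \<Rightarrow> (nat \<Rightarrow> rat) set \<Rightarrow> real" where
  "Qp_abs p V = (THE r. \<forall>x\<in>V. (\<lambda>n. padic_abs p (x n)) \<longlonglongrightarrow> r)"

text \<open>
  A finite extension of the p-adic numbers: the field \<^typ>\<open>'k\<close>, embedded via \<open>\<iota>\<close>,
  together with the (unique) extension \<open>absv\<close> of the p-adic absolute value to it.
\<close>

locale padic_extension =
  fixes p :: nat and \<iota> :: "(nat \<Rightarrow> rat) set \<Rightarrow> 'k::field" and absv :: "'k \<Rightarrow> real"
  assumes prime_p: "Factorial_Ring.prime p"
    and embedding: "\<iota> \<in> ring_hom (Qp p) ring_of_type_algebra"
    and finite_degree:
      "\<exists>B. finite B \<and> (\<forall>x. \<exists>a \<in> B \<rightarrow> carrier (Qp p). x = (\<Sum>b\<in>B. \<iota> (a b) * b))"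
    and absv_nonneg: "absv x \<ge> 0"
    and absv_eq_0: "absv x = 0 \<longleftrightarrow> x = 0"
    and absv_mult: "absv (x * y) = absv x * absv y"
    and absv_ultrametric: "absv (x + y) \<le> max (absv x) (absv y)"
    and absv_extends: "a \<in> carrier (Qp p) \<Longrightarrow> absv (\<iota> a) = Qp_abs p a"

definition valuation_ring :: "('k::field \<Rightarrow> real) \<Rightarrow> 'k set" where
  "valuation_ring absv = {x. absv x \<le> 1}"

text \<open>A uniformiser is a generator of the maximal ideal of the valuation ring.\<close>

definition uniformiser :: "('k::field \<Rightarrow> real) \<Rightarrow> 'k \<Rightarrow> bool" where
  "uniformiser absv \<pi> \<longleftrightarrow> (\<lambda>c. \<pi> * c) ` valuation_ring absv = {x. absv x < 1}"


section \<open>Modules over arbitrary rings\<close>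

text \<open>
  The locale \<^locale>\<open>module\<close> requires a commutative ring of scalars; \<^locale>\<open>submodule\<close> does not.
\<close>

locale left_module = R?: ring R + M?: abelian_group M
  for R :: "('r, 's) ring_scheme" (structure) and M :: "('r, 'm, 't) module_scheme" (structure) +
  assumes smult_closed:
      "\<lbrakk>a \<in> carrier R; x \<in> carrier M\<rbrakk> \<Longrightarrow> a \<odot>\<^bsub>M\<^esub> x \<in> carrier M"
    and smult_l_distr:
      "\<lbrakk>a \<in> carrier R; b \<in> carrier R; x \<in> carrier M\<rbrakk> \<Longrightarrow>
        (a \<oplus>\<^bsub>R\<^esub> b) \<odot>\<^bsub>M\<^esub> x = a \<odot>\<^bsub>M\<^esub> x \<oplus>\<^bsub>M\<^esub> b \<odot>\<^bsub>M\<^esub> x"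
    and smult_r_distr:
      "\<lbrakk>a \<in> carrier R; x \<in> carrier M; y \<in> carrier M\<rbrakk> \<Longrightarrow>
        a \<odot>\<^bsub>M\<^esub> (x \<oplus>\<^bsub>M\<^esub> y) = a \<odot>\<^bsub>M\<^esub> x \<oplus>\<^bsub>M\<^esub> a \<odot>\<^bsub>M\<^esub> y"
    and smult_assoc:
      "\<lbrakk>a \<in> carrier R; b \<in> carrier R; x \<in> carrier M\<rbrakk> \<Longrightarrow>
        (a \<otimes>\<^bsub>R\<^esub> b) \<odot>\<^bsub>M\<^esub> x = a \<odot>\<^bsub>M\<^esub> (b \<odot>\<^bsub>M\<^esub> x)"
    and smult_one: "x \<in> carrier M \<Longrightarrow> \<one>\<^bsub>R\<^esub> \<odot>\<^bsub>M\<^esub> x = x"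

definition irreducible_module :: "('r, 's) ring_scheme \<Rightarrow> ('r, 'm, 't) module_scheme \<Rightarrow> bool" where
  "irreducible_module R M \<longleftrightarrow>
     left_module R M \<and> carrier M \<noteq> {\<zero>\<^bsub>M\<^esub>} \<and>
     (\<forall>H. submodule H R M \<longrightarrow> H = {\<zero>\<^bsub>M\<^esub>} \<or> H = carrier M)"

text \<open>
  The tensor product of abelian groups \<open>M\<close> and \<open>N\<close> (written multiplicatively), balanced over a set
  \<open>S\<close> of scalars acting by \<open>ra\<close> from the right on \<open>M\<close> and by \<open>la\<close> from the left on \<open>N\<close>: the free
  abelian group on pairs modulo the subgroup generated by the relations of bilinearity and balance.
\<close>

definition tensor_relators ::
  "('a, 'x) monoid_scheme \<Rightarrow> ('b, 'y) monoid_scheme \<Rightarrow> 's set \<Rightarrow>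
   ('a \<Rightarrow> 's \<Rightarrow> 'a) \<Rightarrow> ('s \<Rightarrow> 'b \<Rightarrow> 'b) \<Rightarrow> ('a \<times> 'b \<Rightarrow>\<^sub>0 int) set" where
  "tensor_relators M N S ra la =
     {frag_of (m \<otimes>\<^bsub>M\<^esub> m', n) - frag_of (m, n) - frag_of (m', n) | m m' n.
        m \<in> carrier M \<and> m' \<in> carrier M \<and> n \<in> carrier N} \<union>
     {frag_of (m, n \<otimes>\<^bsub>N\<^esub> n') - frag_of (m, n) - frag_of (m, n') | m n n'.
        m \<in> carrier M \<and> n \<in> carrier N \<and> n' \<in> carrier N} \<union>
     {frag_of (ra m s, n) - frag_of (m, la s n) | m s n.
        m \<in> carrier M \<and> s \<in> S \<and> n \<in> carrier N}"

definition tensor_kernel ::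
  "('a, 'x) monoid_scheme \<Rightarrow> ('b, 'y) monoid_scheme \<Rightarrow> 's set \<Rightarrow>
   ('a \<Rightarrow> 's \<Rightarrow> 'a) \<Rightarrow> ('s \<Rightarrow> 'b \<Rightarrow> 'b) \<Rightarrow> ('a \<times> 'b \<Rightarrow>\<^sub>0 int) set" where
  "tensor_kernel M N S ra la =
     generate (free_Abelian_group (carrier M \<times> carrier N)) (tensor_relators M N S ra la)"

definition tensor_product ::
  "('a, 'x) monoid_scheme \<Rightarrow> ('b, 'y) monoid_scheme \<Rightarrow> 's set \<Rightarrow>
   ('a \<Rightarrow> 's \<Rightarrow> 'a) \<Rightarrow> ('s \<Rightarrow> 'b \<Rightarrow> 'b) \<Rightarrow> ('a \<times> 'b \<Rightarrow>\<^sub>0 int) set monoid" where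
  "tensor_product M N S ra la =
     free_Abelian_group (carrier M \<times> carrier N) Mod tensor_kernel M N S ra la"

definition tensor_class ::
  "('a, 'x) monoid_scheme \<Rightarrow> ('b, 'y) monoid_scheme \<Rightarrow> 's set \<Rightarrow>
   ('a \<Rightarrow> 's \<Rightarrow> 'a) \<Rightarrow> ('s \<Rightarrow> 'b \<Rightarrow> 'b) \<Rightarrow> ('a \<times> 'b \<Rightarrow>\<^sub>0 int) \<Rightarrow> ('a \<times> 'b \<Rightarrow>\<^sub>0 int) set" where
  "tensor_class M N S ra la c =
     tensor_kernel M N S ra la #>\<^bsub>free_Abelian_group (carrier M \<times> carrier N)\<^esub> c"

text \<open>
  Operations on tensors are given on representatives; the union over all representatives of a coset
  is a union of equal cosets.
\<close>

definition tensor_algebra ::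
  "('a, 'x) ring_scheme \<Rightarrow> ('b, 'y) ring_scheme \<Rightarrow> 's set \<Rightarrow>
   ('a \<Rightarrow> 's \<Rightarrow> 'a) \<Rightarrow> ('s \<Rightarrow> 'b \<Rightarrow> 'b) \<Rightarrow> ('a \<times> 'b \<Rightarrow>\<^sub>0 int) set ring" where
  "tensor_algebra A B S ra la =
     (let T = tensor_product (add_monoid A) (add_monoid B) S ra la;
          cls = tensor_class (add_monoid A) (add_monoid B) S ra la
      in \<lparr> carrier = carrier T,
           monoid.mult = (\<lambda>V W. \<Union>c\<in>V. \<Union>d\<in>W. cls
             (frag_extend (\<lambda>(a, b).
                frag_extend (\<lambda>(a', b'). frag_of (a \<otimes>\<^bsub>A\<^esub> a', b \<otimes>\<^bsub>B\<^esub> b')) d) c)),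
           monoid.one = cls (frag_of (\<one>\<^bsub>A\<^esub>, \<one>\<^bsub>B\<^esub>)),
           ring.zero = \<one>\<^bsub>T\<^esub>,
           ring.add = (\<otimes>\<^bsub>T\<^esub>) \<rparr>)"

text \<open>
  For a ring homomorphism \<open>\<phi>\<close> from \<open>R\<close> to \<open>A\<close> and a left \<open>R\<close>-module \<open>N\<close>, the left \<open>A\<close>-module
  obtained by tensoring \<open>A\<close> with \<open>N\<close> over \<open>R\<close>. The multiplicative components of a module record
  are irrelevant.
\<close>

definition induced_module ::
  "('a, 'x) ring_scheme \<Rightarrow> ('r, 'y) ring_scheme \<Rightarrow> ('r \<Rightarrow> 'a) \<Rightarrow> ('r, 'b, 'z) module_scheme \<Rightarrow>
   ('a, ('a \<times> 'b \<Rightarrow>\<^sub>0 int) set) module" where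
  "induced_module A R \<phi> N =
     (let ra = (\<lambda>a r. a \<otimes>\<^bsub>A\<^esub> \<phi> r);
          la = (\<lambda>r n. r \<odot>\<^bsub>N\<^esub> n);
          T = tensor_product (add_monoid A) (add_monoid N) (carrier R) ra la;
          cls = tensor_class (add_monoid A) (add_monoid N) (carrier R) ra la
      in \<lparr> carrier = carrier T, monoid.mult = undefined, monoid.one = undefined,
           ring.zero = \<one>\<^bsub>T\<^esub>,
           ring.add = (\<otimes>\<^bsub>T\<^esub>),
           module.smult = (\<lambda>a V. \<Union>c\<in>V. cls (frag_extend (\<lambda>(x, n). frag_of (a \<otimes>\<^bsub>A\<^esub> x, n)) c)) \<rparr>)"


section \<open>Lie algebras\<close>

locale lie_algebra = vector_space scale
  for scale :: "'k::field \<Rightarrow> 'g::ab_group_add \<Rightarrow> 'g" +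
  fixes bracket :: "'g \<Rightarrow> 'g \<Rightarrow> 'g"
  assumes bracket_add_left: "bracket (x + y) z = bracket x z + bracket y z"
    and bracket_add_right: "bracket x (y + z) = bracket x y + bracket x z"
    and bracket_scale_left: "bracket (scale c x) y = scale c (bracket x y)"
    and bracket_scale_right: "bracket x (scale c y) = scale c (bracket x y)"
    and bracket_alternating: "bracket x x = 0"
    and jacobi:
      "bracket x (bracket y z) + bracket y (bracket z x) + bracket z (bracket x y) = 0"
begin

primrec lower_central :: "nat \<Rightarrow> 'g set" where
  "lower_central 0 = UNIV"
| "lower_central (Suc n) = span {bracket x y | x y. y \<in> lower_central n}"

definition nilpotent :: bool where
  "nilpotent \<longleftrightarrow> (\<exists>n. lower_central n = {0})"

definition subalgebra :: "'g set \<Rightarrow> bool" where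
  "subalgebra \<bb> \<longleftrightarrow> subspace \<bb> \<and> (\<forall>x\<in>\<bb>. \<forall>y\<in>\<bb>. bracket x y \<in> \<bb>)"

primrec derived_series :: "'g set \<Rightarrow> nat \<Rightarrow> 'g set" where
  "derived_series \<bb> 0 = \<bb>"
| "derived_series \<bb> (Suc n) =
     span {bracket x y | x y. x \<in> derived_series \<bb> n \<and> y \<in> derived_series \<bb> n}"

definition solvable :: "'g set \<Rightarrow> bool" where
  "solvable \<bb> \<longleftrightarrow> (\<exists>n. derived_series \<bb> n = {0})"

definition polarisation :: "('g \<Rightarrow> 'k) \<Rightarrow> 'g set \<Rightarrow> bool" where
  "polarisation lam \<bb> \<longleftrightarrow> subalgebra \<bb> \<and> solvable \<bb> \<and>
     (\<forall>u. (\<forall>y\<in>\<bb>. lam (bracket u y) = 0) \<longleftrightarrow> u \<in> \<bb>)"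

end

text \<open>
  The canonical map from the tensor product of a lattice \<open>L\<close> and the ground field over \<open>\<O>\<close> to the
  Lie algebra, sending \<open>x \<otimes> a\<close> to \<open>scale a x\<close>.
\<close>

definition lattice_tensor ::
  "'k::field set \<Rightarrow> ('k \<Rightarrow> 'g::ab_group_add \<Rightarrow> 'g) \<Rightarrow> 'g set \<Rightarrow> ('g \<times> 'k \<Rightarrow>\<^sub>0 int) set monoid" where
  "lattice_tensor \<O> scale L =
     tensor_product \<lparr>carrier = L, monoid.mult = (+), monoid.one = 0\<rparr> (add_monoid ring_of_type_algebra)
       \<O> (\<lambda>x c. scale c x) (*)"

definition lattice_tensor_map ::
  "('k::field \<Rightarrow> 'g::ab_group_add \<Rightarrow> 'g) \<Rightarrow> ('g \<times> 'k \<Rightarrow>\<^sub>0 int) set \<Rightarrow> 'g" where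
  "lattice_tensor_map scale V =
     the_elem ((\<lambda>c. \<Sum>(x, a)\<in>Poly_Mapping.keys c.
       scale (of_int (Poly_Mapping.lookup c (x, a)) * a) x) ` V)"

definition lie_lattice ::
  "'k::field set \<Rightarrow> 'k \<Rightarrow> ('k \<Rightarrow> 'g::ab_group_add \<Rightarrow> 'g) \<Rightarrow> ('g \<Rightarrow> 'g \<Rightarrow> 'g) \<Rightarrow> 'g set \<Rightarrow> bool" where
  "lie_lattice \<O> \<pi> scale bracket L \<longleftrightarrow>
     0 \<in> L \<and> (\<forall>x\<in>L. \<forall>y\<in>L. x + y \<in> L) \<and> (\<forall>c\<in>\<O>. \<forall>x\<in>L. scale c x \<in> L) \<and>
     (\<forall>x\<in>L. \<forall>y\<in>L. bracket x y \<in> L) \<and>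
     (\<Inter>n::nat. scale (\<pi> ^ n) ` L) = {0} \<and>
     bij_betw (lattice_tensor_map scale) (carrier (lattice_tensor \<O> scale L)) UNIV"


section \<open>Enveloping algebras\<close>

datatype 'g word = Word (letters: "'g list")

text \<open>
  Words form a monoid under concatenation, so that \<^typ>\<open>'g word \<Rightarrow>\<^sub>0 'k\<close> with its convolution product
  is the free associative \<^typ>\<open>'k\<close>-algebra on \<^typ>\<open>'g\<close>.
\<close>

instantiation word :: (type) monoid_add
begin

definition zero_word :: "'g word" where
  "zero_word = Word []"

definition plus_word :: "'g word \<Rightarrow> 'g word \<Rightarrow> 'g word" where
  "plus_word u v = Word (letters u @ letters v)"

instance
  by standard (simp_all add: zero_word_def plus_word_def)

end

definition free_algebra :: "'k::field set \<Rightarrow> 'g set \<Rightarrow> ('g word \<Rightarrow>\<^sub>0 'k) ring" where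
  "free_algebra \<O> L =
     \<lparr> carrier = {q. (\<forall>w\<in>Poly_Mapping.keys q. set (letters w) \<subseteq> L) \<and>
                      (\<forall>w. Poly_Mapping.lookup q w \<in> \<O>)},
       monoid.mult = (*), monoid.one = 1, ring.zero = 0, ring.add = (+) \<rparr>"

definition free_gen :: "'g \<Rightarrow> ('g word \<Rightarrow>\<^sub>0 'k::field)" where
  "free_gen x = Poly_Mapping.single (Word [x]) 1"

definition free_scalar :: "'k::field \<Rightarrow> ('g word \<Rightarrow>\<^sub>0 'k)" where
  "free_scalar c = Poly_Mapping.single 0 c"

text \<open>
  The generators are indexed by the elements of \<open>L\<close>, so the linear structure of \<open>L\<close> has to be
  imposed as well: the first two families of relators present the tensor algebra of \<open>L\<close> over \<open>\<O>\<close>.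
\<close>

definition env_relators ::
  "'k::field set \<Rightarrow> ('k \<Rightarrow> 'g::ab_group_add \<Rightarrow> 'g) \<Rightarrow> ('g \<Rightarrow> 'g \<Rightarrow> 'g) \<Rightarrow> 'g set \<Rightarrow> ('g word \<Rightarrow>\<^sub>0 'k) set"
  where
  "env_relators \<O> scale bracket L =
     {free_gen (x + y) - free_gen x - free_gen y | x y. x \<in> L \<and> y \<in> L} \<union>
     {free_gen (scale c x) - free_scalar c * free_gen x | c x. c \<in> \<O> \<and> x \<in> L} \<union>
     {free_gen x * free_gen y - free_gen y * free_gen x - free_gen (bracket x y) | x y.
        x \<in> L \<and> y \<in> L}"

text \<open>The completion of a ring with respect to the powers of a central element.\<close>

definition power_ideal :: "('a, 'x) ring_scheme \<Rightarrow> 'a \<Rightarrow> nat \<Rightarrow> 'a set" where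
  "power_ideal A t n = (\<lambda>u. (t [^]\<^bsub>A\<^esub> n) \<otimes>\<^bsub>A\<^esub> u) ` carrier A"

text \<open>
  The transition map of the inverse system sends a coset of the \<open>Suc n\<close>-th ideal to the coset of the
  \<open>n\<close>-th ideal containing it.
\<close>

definition adic_completion :: "('a, 'x) ring_scheme \<Rightarrow> 'a \<Rightarrow> (nat \<Rightarrow> 'a set) ring" where
  "adic_completion A t =
     (let Q = (\<lambda>n. A Quot power_ideal A t n)
      in \<lparr> carrier = {f. (\<forall>n. f n \<in> carrier (Q n)) \<and> (\<forall>n. f (Suc n) \<subseteq> f n)},
           monoid.mult = (\<lambda>f g n. f n \<otimes>\<^bsub>Q n\<^esub> g n),
           monoid.one = (\<lambda>n. \<one>\<^bsub>Q n\<^esub>),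
           ring.zero = (\<lambda>n. \<zero>\<^bsub>Q n\<^esub>),
           ring.add = (\<lambda>f g n. f n \<oplus>\<^bsub>Q n\<^esub> g n) \<rparr>)"

definition to_completion :: "('a, 'x) ring_scheme \<Rightarrow> 'a \<Rightarrow> 'a \<Rightarrow> (nat \<Rightarrow> 'a set)" where
  "to_completion A t u = (\<lambda>n. power_ideal A t n +>\<^bsub>A\<^esub> u)"


section \<open>The affinoid Dixmier module\<close>

type_synonym ('k, 'g) env = "('g word \<Rightarrow>\<^sub>0 'k) set"
type_synonym ('k, 'g) env_hat = "nat \<Rightarrow> ('k, 'g) env set"
type_synonym ('k, 'g) env_K = "(('k, 'g) env_hat \<times> 'k \<Rightarrow>\<^sub>0 int) set"

locale affinoid_enveloping =
  fixes \<O> :: "'k::field set" and \<pi> :: 'k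
    and scale :: "'k \<Rightarrow> 'g::ab_group_add \<Rightarrow> 'g" and bracket :: "'g \<Rightarrow> 'g \<Rightarrow> 'g"
begin

definition env_ideal :: "'g set \<Rightarrow> ('g word \<Rightarrow>\<^sub>0 'k) set" where
  "env_ideal L = genideal (free_algebra \<O> L) (env_relators \<O> scale bracket L)"

definition U :: "'g set \<Rightarrow> ('k, 'g) env ring" where
  "U L = free_algebra \<O> L Quot env_ideal L"

definition U_class :: "'g set \<Rightarrow> ('g word \<Rightarrow>\<^sub>0 'k) \<Rightarrow> ('k, 'g) env" where
  "U_class L q = env_ideal L +>\<^bsub>free_algebra \<O> L\<^esub> q"

definition U_hat :: "'g set \<Rightarrow> ('k, 'g) env_hat ring" where
  "U_hat L = adic_completion (U L) (U_class L (free_scalar \<pi>))"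

definition U_hat_class :: "'g set \<Rightarrow> ('k, 'g) env \<Rightarrow> ('k, 'g) env_hat" where
  "U_hat_class L u = to_completion (U L) (U_class L (free_scalar \<pi>)) u"

definition U_hat_act :: "'g set \<Rightarrow> ('k, 'g) env_hat \<Rightarrow> 'k \<Rightarrow> ('k, 'g) env_hat" where
  "U_hat_act L f c = f \<otimes>\<^bsub>U_hat L\<^esub> U_hat_class L (U_class L (free_scalar c))"

definition U_K :: "'g set \<Rightarrow> ('k, 'g) env_K ring" where
  "U_K L = tensor_algebra (U_hat L) ring_of_type_algebra \<O> (U_hat_act L) (*)"

definition U_K_class :: "'g set \<Rightarrow> (('k, 'g) env_hat \<times> 'k \<Rightarrow>\<^sub>0 int) \<Rightarrow> ('k, 'g) env_K" where
  "U_K_class L = tensor_class (add_monoid (U_hat L)) (add_monoid ring_of_type_algebra)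
     \<O> (U_hat_act L) (*)"

definition U_K_gen :: "'g set \<Rightarrow> 'g \<Rightarrow> ('k, 'g) env_K" where
  "U_K_gen L x = U_K_class L (frag_of (U_hat_class L (U_class L (free_gen x)), 1))"

definition U_K_scalar :: "'g set \<Rightarrow> 'k \<Rightarrow> ('k, 'g) env_K" where
  "U_K_scalar L a = U_K_class L (frag_of (\<one>\<^bsub>U_hat L\<^esub>, a))"

text \<open>The homomorphisms induced by an inclusion \<open>B \<subseteq> L\<close> of Lie lattices.\<close>

definition U_incl :: "'g set \<Rightarrow> ('k, 'g) env \<Rightarrow> ('k, 'g) env" where
  "U_incl L u = (\<Union>q\<in>u. U_class L q)"

definition U_hat_incl :: "'g set \<Rightarrow> ('k, 'g) env_hat \<Rightarrow> ('k, 'g) env_hat" where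
  "U_hat_incl L f = (\<lambda>n. \<Union>u\<in>f n. U_hat_class L (U_incl L u) n)"

definition U_K_incl :: "'g set \<Rightarrow> ('k, 'g) env_K \<Rightarrow> ('k, 'g) env_K" where
  "U_K_incl L V =
     (\<Union>c\<in>V. U_K_class L (frag_extend (\<lambda>(f, a). frag_of (U_hat_incl L f, a)) c))"

text \<open>
  The one-dimensional module given by a character of \<open>B\<close>. The action of \<open>U_K B\<close> is through a
  homomorphism of \<^typ>\<open>'k\<close>-algebras to \<^typ>\<open>'k\<close>. On the carrier of \<open>U_K B\<close> the chosen homomorphism
  is unique: every element \<open>1 + \<pi> c u\<close>, with \<open>u\<close> in \<open>U_hat B\<close> and \<open>c\<close> in \<open>\<O>\<close>, is invertible, which
  forces such a homomorphism to be bounded by 1 on \<open>U_hat B\<close>, hence to be continuous.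
\<close>

definition is_character :: "('g \<Rightarrow> 'k) \<Rightarrow> 'g set \<Rightarrow> (('k, 'g) env_K \<Rightarrow> 'k) \<Rightarrow> bool" where
  "is_character lam B \<chi> \<longleftrightarrow>
     \<chi> \<in> ring_hom (U_K B) ring_of_type_algebra \<and>
     (\<forall>a. \<chi> (U_K_scalar B a) = a) \<and>
     (\<forall>x\<in>B. \<chi> (U_K_gen B x) = lam x)"

definition K_module :: "('g \<Rightarrow> 'k) \<Rightarrow> 'g set \<Rightarrow> (('k, 'g) env_K, 'k) module" where
  "K_module lam B =
     \<lparr> carrier = UNIV, monoid.mult = (*), monoid.one = 1, ring.zero = 0, ring.add = (+),
       module.smult = (\<lambda>r k. (SOME \<chi>. is_character lam B \<chi>) r * k) \<rparr>"

definition dixmier_module ::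
  "'g set \<Rightarrow> ('g \<Rightarrow> 'k) \<Rightarrow> 'g set \<Rightarrow>
   (('k, 'g) env_K, (('k, 'g) env_K \<times> 'k \<Rightarrow>\<^sub>0 int) set) module" where
  "dixmier_module L lam \<bb> =
     (let B = \<bb> \<inter> L in induced_module (U_K L) (U_K B) (U_K_incl L) (K_module lam B))"

end

end

theory Submission
  imports Defs
begin

text \<open>
  If \<open>lam\<close> does not vanish on \<open>[h, h]\<close>, let \<open>n\<close> be maximal such that \<open>lam\<close> does not vanish on the bracket of
  \<open>h\<close> with the \<open>n\<close>-th term of its lower central series, choose \<open>y\<close> in that term with \<open>lam [h, y] \<noteq> 0\<close>, and
  replace \<open>h\<close> by the subalgebra of all \<open>u\<close> with \<open>lam [u, y] = 0\<close>, complemented by an element \<open>x\<close> of the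
  lattice maximising \<open>\<bar>lam [x, y]\<bar>\<close>. Starting from the whole Lie algebra this ends with a polarisation,
  and the elements \<open>x\<^sub>1, \<dots>, x\<^sub>d\<close> split off on the way are coordinates: the Lie algebra acts by explicit
  formulas, integrally on the lattice, on the space \<open>M\<close> of power series in \<open>x\<^sub>1, \<dots>, x\<^sub>d\<close> with coefficients
  tending to \<open>0\<close>, and this action extends to the completed enveloping algebra.

  A nonzero closed stable subspace of \<open>M\<close> contains \<open>1\<close>, since \<open>y\<^sub>i\<close> acts through the derivative by \<open>x\<^sub>i\<close>, and
  hence all monomials. Every submodule of \<open>M\<close> is closed: reducing modulo \<open>\<pi>\<close> and taking lexicographic
  leading exponents, \<open>x\<^sub>i\<close> shifts the leading exponent, so by Dickson's lemma finitely many elements of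
  the submodule suffice to divide every element of its closure, with quotients converging \<open>\<pi>\<close>-adically.
  Finally the Dixmier module embeds into \<open>M\<close>: an element killing \<open>1\<close> is, modulo every power of \<open>\<pi>\<close>, a left
  combination of the finitely many \<open>b - lam b\<close> for generators \<open>b\<close> of the lattice of the polarisation, with
  coefficients that converge.
\<close>

section \<open>Complete discretely valued fields\<close>

text \<open>What shapes the proof is integrality: the lattice has to act on series by operators of
  norm at most 1, as otherwise the action would not extend to the \<open>\<pi>\<close>-adic
  completion. Maximality of \<open>\<bar>lam [x, y]\<bar>\<close> serves this purpose: it makes
  every lattice vector of \<open>h\<close> an integral multiple of \<open>x\<close> plus a lattice
  vector of the smaller subalgebra. But \<open>lam [x, y]\<close> need not be a unit, and
  derivatives kill p-th powers modulo \<open>\<pi>\<close>, so irreducibility cannot be seen on the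
  reduction. It is proved over the field, where division by \<open>lam [x, y]\<close> and by
  factorials is allowed. The price is that evaluation at \<open>x = 0\<close> is an infinite sum of
  divided derivatives, which a submodule admits only if it is closed; this is why the division
  algorithm is needed. Two further difficulties come from the definitions. The tensor product is not
  completed, so the annihilator of the generator must be reached with finitely many generators of
  the lattice of the polarisation. And the character of that lattice is an arbitrary choice, so its
  continuity has to be derived before it can be compared with the action on
  \<open>M\<close>.\<close>

locale complete_dvf =
  fixes absv :: "'k::field \<Rightarrow> real" and \<pi> :: 'k
  assumes absv_nonneg [simp]: "0 \<le> absv x"
    and absv_eq_0 [simp]: "absv x = 0 \<longleftrightarrow> x = 0"
    and absv_mult: "absv (x * y) = absv x * absv y"
    and absv_ultra: "absv (x + y) \<le> max (absv x) (absv y)"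
    and pi_nonzero [simp]: "\<pi> \<noteq> 0"
    and absv_pi_less_1: "absv \<pi> < 1"
    and absv_less_1: "absv x < 1 \<Longrightarrow> absv x \<le> absv \<pi>"
    and complete: "(\<And>n. absv (a (Suc n) - a n) \<le> absv \<pi> ^ n) \<Longrightarrow>
      \<exists>s. \<forall>n. absv (s - a n) \<le> absv \<pi> ^ n"
    and char_0: "0 < n \<Longrightarrow> (of_nat n :: 'k) \<noteq> 0"
begin

abbreviation r :: real where "r \<equiv> absv \<pi>"

lemma r_pos [simp]: "0 < r"
  using absv_nonneg[of \<pi>] by (simp add: less_le)

lemma r_le_1 [simp]: "r \<le> 1"
  using absv_pi_less_1 by simp

lemma r_power_le_1 [simp]: "r ^ n \<le> 1"
  by (simp add: power_le_one)

lemma absv_0 [simp]: "absv 0 = 0"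
  by simp

lemma absv_1 [simp]: "absv 1 = 1"
proof -
  have "absv 1 * absv 1 = absv 1" by (simp flip: absv_mult)
  then show ?thesis by (metis absv_eq_0 mult_cancel_left2 one_neq_zero)
qed

lemma absv_minus [simp]: "absv (- x) = absv x"
proof -
  have "absv (-1) * absv (-1) = 1" by (simp flip: absv_mult)
  then have "absv (-1) = 1"
    by (metis absv_nonneg abs_of_nonneg power2_eq_1_iff power2_eq_square abs_minus_cancel abs_one)
  then show ?thesis using absv_mult[of "-1" x] by simp
qed

lemma absv_diff: "absv (x - y) \<le> max (absv x) (absv y)"
  using absv_ultra[of x "- y"] by simp

lemma absv_diff_commute: "absv (x - y) = absv (y - x)"
  using absv_minus[of "x - y"] by simp

lemma absv_add_le: "absv x \<le> R \<Longrightarrow> absv y \<le> R \<Longrightarrow> absv (x + y) \<le> R"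
  using absv_ultra[of x y] by auto

lemma absv_diff_le: "absv x \<le> R \<Longrightarrow> absv y \<le> R \<Longrightarrow> absv (x - y) \<le> R"
  using absv_diff[of x y] by auto

lemma absv_sum_le: "0 \<le> R \<Longrightarrow> (\<And>i. i \<in> A \<Longrightarrow> absv (f i) \<le> R) \<Longrightarrow> absv (sum f A) \<le> R"
  by (induction A rule: infinite_finite_induct) (auto intro: absv_add_le)

lemma absv_power [simp]: "absv (x ^ n) = absv x ^ n"
  by (induction n) (auto simp: absv_mult)

lemma absv_inverse: "absv (inverse x) = inverse (absv x)"
proof (cases "x = 0")
  case False
  then have "absv (inverse x) * absv x = 1" by (simp flip: absv_mult)
  then show ?thesis by (metis inverse_unique mult.commute)
qed auto

lemma absv_divide: "absv (x / y) = absv x / absv y"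
  by (simp add: divide_inverse absv_mult absv_inverse)

lemma absv_of_nat_le: "absv (of_nat n) \<le> 1"
  by (induction n) (auto intro: absv_add_le)

lemma absv_mult_le: "absv x \<le> R \<Longrightarrow> absv y \<le> S \<Longrightarrow> absv (x * y) \<le> R * S"
  unfolding absv_mult by (rule mult_mono) (auto intro: order_trans[OF absv_nonneg])

lemma absv_mult_le1: "absv x \<le> 1 \<Longrightarrow> absv y \<le> S \<Longrightarrow> absv (x * y) \<le> S"
  using absv_mult_le[of x 1 y S] by simp

lemma r_power_small: "0 < e \<Longrightarrow> \<exists>n. r ^ n < e"
  using real_arch_pow_inv[OF _ absv_pi_less_1] by blast

lemma absv_le_inverse_power: "\<exists>n. absv x \<le> inverse r ^ n"
proof -
  obtain n where "absv x < inverse r ^ n"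
    using real_arch_pow[of "inverse r"] absv_pi_less_1 by (auto simp: one_less_inverse_iff)
  then show ?thesis by (auto intro: less_imp_le)
qed

text \<open>This is how limits are identified throughout: two candidates are shown to differ by at
  most \<open>r ^ n * R\<close> for every \<open>n\<close>, with \<open>R\<close> independent of
  \<open>n\<close>.\<close>

lemma eq_0_if_absv_le_power: "(\<And>n. absv x \<le> r ^ n * R) \<Longrightarrow> x = 0"
proof (rule ccontr)
  assume le: "\<And>n. absv x \<le> r ^ n * R" and "x \<noteq> 0"
  then have x: "absv x > 0" by (simp add: less_le)
  have "R > 0" using le[of 0] x by simp
  then obtain n where "r ^ n < absv x / R" using r_power_small[of "absv x / R"] x by auto
  then show False using le[of n] \<open>R > 0\<close> by (simp add: field_simps)
qed

lemma absv_eq_1: "absv x \<le> 1 \<Longrightarrow> \<not> absv x \<le> r \<Longrightarrow> absv x = 1"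
  using absv_less_1[of x] by linarith

end

section \<open>Finite extensions of the \<open>p\<close>-adic numbers\<close>

lemma powi_of_nat_less_iff:
  assumes "Factorial_Ring.prime (p::nat)"
  shows "real p powi a \<le> real p powi b \<longleftrightarrow> a \<le> b"
  using prime_gt_1_nat[OF assms] using power_int_increasing[of a b "real p"] power_int_strict_increasing[of b a "real p"] by fastforce

section \<open>The p-adic absolute value on the rationals\<close>

context
  fixes p :: nat
  assumes prime_p: "Factorial_Ring.prime p"
begin

lemma prime_elem_int_p: "prime_elem (int p)"
  using prime_p by (simp add: prime_imp_prime_elem)

lemma padic_abs_0 [simp]: "padic_abs p 0 = 0"
  by (simp add: padic_abs_def)

text \<open>The definition goes through the reduced fraction. Multiplicities are additive, so a
  common factor cancels in the exponent; this is what permits working with a common denominator of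
  two rationals.\<close>

lemma padic_abs_Fract:
  assumes "a \<noteq> 0" "b \<noteq> 0"
  shows "padic_abs p (Rat.Fract a b)
    = real p powi (int (multiplicity (int p) b) - int (multiplicity (int p) a))"
proof -
  obtain c d where q: "quotient_of (Rat.Fract a b) = (c, d)" by fastforce
  then have cd: "Rat.Fract a b = Rat.Fract c d" "d > 0"
    using quotient_of_div[OF q] quotient_of_denom_pos[OF q] by (auto simp: Fract_of_int_quotient)
  then have eq: "a * d = c * b" and "c \<noteq> 0"
    using assms by (auto simp: Rat.eq_rat(1))
  have "multiplicity (int p) a + multiplicity (int p) d = multiplicity (int p) c + multiplicity (int p) b"
    using arg_cong[OF eq, of "multiplicity (int p)"] assms cd(2) \<open>c \<noteq> 0\<close>
    by (simp add: prime_elem_multiplicity_mult_distrib[OF prime_elem_int_p])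
  then show ?thesis
    using q \<open>c \<noteq> 0\<close> by (simp add: padic_abs_def) (smt (verit) of_nat_add)
qed

lemma p_pos: "real p > 0"
  using prime_gt_0_nat[OF prime_p] by simp

lemma padic_abs_nonneg [simp]: "padic_abs p x \<ge> 0"
  using p_pos by (auto simp: padic_abs_def split: prod.split)

lemma rat_common_denominator:
  obtains a b d where "x = Rat.Fract a d" "y = Rat.Fract b d" "d \<noteq> 0"
proof -
  obtain a c where x: "x = Rat.Fract a c" "c > 0" by (cases x rule: Rat_cases) auto
  obtain b d where y: "y = Rat.Fract b d" "d > 0" by (cases y rule: Rat_cases) auto
  show ?thesis by (rule that[of "a * d" "c * d" "b * c"]) (use x y in \<open>simp_all add: Rat.eq_rat(1)\<close>)
qed

lemma padic_abs_eq_0 [simp]: "padic_abs p x = 0 \<longleftrightarrow> x = 0"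
proof (cases x rule: Rat_cases)
  case (Fract a b)
  show ?thesis
  proof (cases "a = 0")
    case True
    then show ?thesis using Fract by (simp add: rat_number_collapse)
  next
    case False
    have "x \<noteq> Rat.Fract 0 1" unfolding Fract(1) using Fract(2) False by (simp add: Rat.eq_rat(1))
    then have "x \<noteq> 0" by (simp add: Zero_rat_def)
    then show ?thesis using Fract False p_pos by (simp add: padic_abs_Fract)
  qed
qed

lemma padic_abs_mult: "padic_abs p (x * y) = padic_abs p x * padic_abs p y"
proof -
  obtain a b d where x: "x = Rat.Fract a d" and y: "y = Rat.Fract b d" and "d \<noteq> 0"
    by (rule rat_common_denominator)
  show ?thesis
  proof (cases "a = 0 \<or> b = 0")
    case True
    then have "x = 0 \<or> y = 0" using x y by (auto simp: rat_number_collapse)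
    then show ?thesis by auto
  next
    case False
    then show ?thesis using \<open>d \<noteq> 0\<close> p_pos unfolding x y mult_rat
      by (simp add: padic_abs_Fract prime_elem_multiplicity_mult_distrib[OF prime_elem_int_p] algebra_simps
          flip: power_int_add)
  qed
qed

lemma padic_abs_ultra: "padic_abs p (x + y) \<le> max (padic_abs p x) (padic_abs p y)"
proof -
  obtain a b d where x: "x = Rat.Fract a d" and y: "y = Rat.Fract b d" and d: "d \<noteq> 0"
    by (rule rat_common_denominator)
  have xy: "x + y = Rat.Fract (a + b) d" using d x y by (simp add: Rat.eq_rat(1) algebra_simps)
  show ?thesis
  proof (cases "a = 0 \<or> b = 0 \<or> a + b = 0")
    case True
    then have "x = 0 \<or> y = 0 \<or> x + y = 0" using x y xy by (auto simp: rat_number_collapse)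
    then show ?thesis by (auto simp: le_max_iff_disj)
  next
    case False
    let ?m = "multiplicity (int p)"
    \<comment> \<open>Both numerators are divisible by this power, hence so is their sum; with a
      common denominator this is the ultrametric inequality.\<close>
    have "(int p) ^ min (?m a) (?m b) dvd a + b"
      by (intro dvd_add) (auto intro: multiplicity_dvd')
    then have "min (?m a) (?m b) \<le> ?m (a + b)"
      using False prime_p by (intro multiplicity_geI) (auto simp: prime_nat_iff)
    then have "?m a \<le> ?m (a + b) \<or> ?m b \<le> ?m (a + b)" by (auto simp: min_le_iff_disj)
    then show ?thesis
      using False d unfolding xy by (auto simp: x y padic_abs_Fract le_max_iff_disj powi_of_nat_less_iff[OF prime_p])
  qed
qed

lemma padic_abs_add_less: "padic_abs p x < e \<Longrightarrow> padic_abs p y < e \<Longrightarrow> padic_abs p (x + y) < e"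
  using padic_abs_ultra[of x y] by linarith

lemma padic_abs_minus [simp]: "padic_abs p (- x) = padic_abs p x"
proof (cases "x = 0")
  case False
  obtain a b where x: "x = Rat.Fract a b" "b > 0" by (cases x rule: Rat_cases)
  with False have "a \<noteq> 0" by (auto simp: rat_number_collapse)
  with x have "x = Rat.Fract a b" "a \<noteq> 0" "b \<noteq> 0" by auto
  then show ?thesis by (simp add: padic_abs_Fract)
qed auto

lemma padic_abs_diff: "padic_abs p (x - y) \<le> max (padic_abs p x) (padic_abs p y)"
  using padic_abs_ultra[of x "- y"] by simp

lemma padic_abs_reverse_triangle: "\<bar>padic_abs p x - padic_abs p y\<bar> \<le> padic_abs p (x - y)"
proof -
  have 1: "padic_abs p x - padic_abs p y \<le> padic_abs p (x - y)" for x y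
    using padic_abs_ultra[of "x - y" y] padic_abs_nonneg[of "x - y"] padic_abs_nonneg[of y] by (simp only: le_max_iff_disj diff_add_cancel) linarith
  show ?thesis
    using 1[of x y] 1[of y x] padic_abs_minus[of "x - y"] by (simp add: abs_le_iff)
qed

section \<open>Cauchy sequences of rationals modulo null sequences\<close>

abbreviation cauchy :: "(nat \<Rightarrow> rat) set" where "cauchy \<equiv> carrier (padic_Cauchy_ring p)"

lemma cauchy_iff:
  "x \<in> cauchy \<longleftrightarrow> (\<forall>e>0. \<exists>N. \<forall>m\<ge>N. \<forall>n\<ge>N. padic_abs p (x m - x n) < e)"
  by (simp add: padic_Cauchy_ring_def)

lemma cauchyD: "x \<in> cauchy \<Longrightarrow> 0 < e \<Longrightarrow> \<exists>N. \<forall>m\<ge>N. \<forall>n\<ge>N. padic_abs p (x m - x n) < e"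
  by (simp add: cauchy_iff)

lemma cauchy_bounded:
  assumes "x \<in> cauchy" shows "\<exists>B>0. \<forall>n. padic_abs p (x n) \<le> B"
proof -
  obtain N where N: "\<And>m n. m \<ge> N \<Longrightarrow> n \<ge> N \<Longrightarrow> padic_abs p (x m - x n) < 1"
    using cauchyD[OF assms, of 1] by auto
  define B where "B = Max (insert 1 ((\<lambda>n. padic_abs p (x n)) ` {..N}))"
  have B: "1 \<le> B" "n \<le> N \<Longrightarrow> padic_abs p (x n) \<le> B" for n
    unfolding B_def by (rule Max_ge; simp)+
  have "padic_abs p (x n) \<le> B" for n
  proof (cases "n \<le> N")
    case False
    then show ?thesis
      using padic_abs_ultra[of "x n - x N" "x N"] N[of n N] B(2)[of N] B(1) by simp
  qed (use B in auto)
  with B(1) show ?thesis by (intro exI[of _ B]) auto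
qed

lemma cauchy_add: "x \<in> cauchy \<Longrightarrow> y \<in> cauchy \<Longrightarrow> (\<lambda>n. x n + y n) \<in> cauchy"
  unfolding cauchy_iff
proof (intro allI impI)
  fix e :: real assume x: "\<forall>e>0. \<exists>N. \<forall>m\<ge>N. \<forall>n\<ge>N. padic_abs p (x m - x n) < e"
    and y: "\<forall>e>0. \<exists>N. \<forall>m\<ge>N. \<forall>n\<ge>N. padic_abs p (y m - y n) < e" and "0 < e"
  then obtain N M where "\<And>m n. m \<ge> N \<Longrightarrow> n \<ge> N \<Longrightarrow> padic_abs p (x m - x n) < e"
    "\<And>m n. m \<ge> M \<Longrightarrow> n \<ge> M \<Longrightarrow> padic_abs p (y m - y n) < e" by metis
  then show "\<exists>N. \<forall>m\<ge>N. \<forall>n\<ge>N. padic_abs p (x m + y m - (x n + y n)) < e"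
    by (intro exI[of _ "max N M"] allI impI)
      (unfold add_diff_add, rule padic_abs_add_less, auto)
qed

lemma cauchy_uminus: "x \<in> cauchy \<Longrightarrow> (\<lambda>n. - x n) \<in> cauchy"
  unfolding cauchy_iff by (metis minus_diff_minus padic_abs_minus)

lemma cauchy_const [simp]: "(\<lambda>_. c) \<in> cauchy"
  unfolding cauchy_iff by auto

lemma cauchy_mult:
  assumes x: "x \<in> cauchy" and y: "y \<in> cauchy" shows "(\<lambda>n. x n * y n) \<in> cauchy"
  unfolding cauchy_iff
proof (intro allI impI)
  fix e :: real assume e: "0 < e"
  obtain B where B: "B > 0" "\<And>n. padic_abs p (x n) \<le> B" using cauchy_bounded[OF x] by auto
  obtain C where C: "C > 0" "\<And>n. padic_abs p (y n) \<le> C" using cauchy_bounded[OF y] by auto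
  obtain N where N: "\<And>m n. m \<ge> N \<Longrightarrow> n \<ge> N \<Longrightarrow> padic_abs p (x m - x n) < e / C"
    using cauchyD[OF x, of "e / C"] e C by auto
  obtain M where M: "\<And>m n. m \<ge> M \<Longrightarrow> n \<ge> M \<Longrightarrow> padic_abs p (y m - y n) < e / B"
    using cauchyD[OF y, of "e / B"] e B by auto
  have "padic_abs p (x m * y m - x n * y n) < e" if "m \<ge> max N M" "n \<ge> max N M" for m n
  proof -
    have "padic_abs p (x m * (y m - y n)) < e"
      using mult_right_mono[OF B(2)[of m], of "padic_abs p (y m - y n)"]
        M[of m n] B(1) that by (simp add: padic_abs_mult pos_less_divide_eq mult.commute)
    moreover have "padic_abs p (y n * (x m - x n)) < e"
      using mult_right_mono[OF C(2)[of n], of "padic_abs p (x m - x n)"]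
        N[of m n] C(1) that by (simp add: padic_abs_mult pos_less_divide_eq mult.commute)
    moreover have "x m * y m - x n * y n = x m * (y m - y n) + y n * (x m - x n)"
      by (simp add: algebra_simps)
    ultimately show ?thesis using padic_abs_add_less by simp
  qed
  then show "\<exists>N. \<forall>m\<ge>N. \<forall>n\<ge>N. padic_abs p (x m * y m - x n * y n) < e" by blast
qed

lemma cauchy_ring_simps [simp]:
  "monoid.mult (padic_Cauchy_ring p) = (\<lambda>x y n. x n * y n)"
  "monoid.one (padic_Cauchy_ring p) = (\<lambda>_. 1)"
  "ring.zero (padic_Cauchy_ring p) = (\<lambda>_. 0)"
  "ring.add (padic_Cauchy_ring p) = (\<lambda>x y n. x n + y n)"
  by (simp_all add: padic_Cauchy_ring_def)

lemma ring_cauchy: "ring (padic_Cauchy_ring p)"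
proof (rule ringI)
  show "abelian_group (padic_Cauchy_ring p)"
  proof (rule abelian_groupI)
    fix x assume "x \<in> cauchy"
    then show "\<exists>y\<in>cauchy. y \<oplus>\<^bsub>padic_Cauchy_ring p\<^esub> x = \<zero>\<^bsub>padic_Cauchy_ring p\<^esub>"
      by (intro bexI[of _ "\<lambda>n. - x n"] cauchy_uminus) simp
  qed (simp_all add: cauchy_add algebra_simps)
  show "Group.monoid (padic_Cauchy_ring p)"
    by (rule monoidI) (simp_all add: cauchy_mult algebra_simps)
qed (simp_all add: algebra_simps)

lemma null_iff: "x \<in> padic_null p \<longleftrightarrow> (\<lambda>n. padic_abs p (x n)) \<longlonglongrightarrow> 0"
  by (simp add: padic_null_def)

lemma null_cauchy: "x \<in> padic_null p \<Longrightarrow> x \<in> cauchy"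
  unfolding cauchy_iff
proof (intro allI impI)
  fix e :: real assume "x \<in> padic_null p" "0 < e"
  then obtain N where "\<And>n. n \<ge> N \<Longrightarrow> padic_abs p (x n) < e"
    unfolding null_iff LIMSEQ_iff by fastforce
  then show "\<exists>N. \<forall>m\<ge>N. \<forall>n\<ge>N. padic_abs p (x m - x n) < e"
    using padic_abs_diff by (intro exI[of _ N] allI impI) (smt (verit))
qed

lemma null_mult:
  assumes "x \<in> padic_null p" "y \<in> cauchy" shows "(\<lambda>n. x n * y n) \<in> padic_null p"
proof -
  obtain B where B: "B > 0" "\<And>n. padic_abs p (y n) \<le> B" using cauchy_bounded[OF assms(2)] by auto
  have "(\<lambda>n. padic_abs p (x n) * B) \<longlonglongrightarrow> 0"
    using tendsto_mult_left_zero[OF assms(1)[unfolded null_iff]] .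
  then show ?thesis unfolding null_iff
    by (rule tendsto_sandwich[OF _ _ tendsto_const, rotated 2])
      (auto simp: padic_abs_mult intro!: always_eventually mult_left_mono B)
qed

lemma null_add:
  assumes "x \<in> padic_null p" "y \<in> padic_null p" shows "(\<lambda>n. x n + y n) \<in> padic_null p"
proof -
  have "(\<lambda>n. padic_abs p (x n) + padic_abs p (y n)) \<longlonglongrightarrow> 0"
    using tendsto_add[OF assms[unfolded null_iff]] by simp
  then show ?thesis unfolding null_iff
  proof (rule tendsto_sandwich[OF _ _ tendsto_const, rotated 2])
    have "padic_abs p (x n + y n) \<le> padic_abs p (x n) + padic_abs p (y n)" for n
      using padic_abs_ultra[of "x n" "y n"] padic_abs_nonneg[of "x n"] padic_abs_nonneg[of "y n"] by linarith
    then show "\<forall>\<^sub>F n in sequentially. padic_abs p (x n + y n) \<le> padic_abs p (x n) + padic_abs p (y n)"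
      by simp
  qed simp
qed

lemma null_ideal: "ideal (padic_null p) (padic_Cauchy_ring p)"
proof (rule idealI)
  interpret ring "padic_Cauchy_ring p" by (rule ring_cauchy)
  show "ring (padic_Cauchy_ring p)" by (rule ring_cauchy)
  show "subgroup (padic_null p) (add_monoid (padic_Cauchy_ring p))"
  proof (rule group.subgroupI)
    show "Group.group (add_monoid (padic_Cauchy_ring p))" by (rule a_group)
    show "padic_null p \<subseteq> carrier (add_monoid (padic_Cauchy_ring p))" using null_cauchy by auto
    show "padic_null p \<noteq> {}" by (auto simp: padic_null_def intro!: exI[of _ "\<lambda>_. 0"])
    fix a assume a: "a \<in> padic_null p"
    have "\<ominus>\<^bsub>padic_Cauchy_ring p\<^esub> a = (\<lambda>n. - a n)"
      using a null_cauchy[OF a] cauchy_uminus[OF null_cauchy[OF a]]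
      by (intro minus_equality) simp_all
    then show "inv\<^bsub>add_monoid (padic_Cauchy_ring p)\<^esub> a \<in> padic_null p"
      using a unfolding a_inv_def[symmetric] by (simp add: null_iff)
  next
    fix a b assume "a \<in> padic_null p" "b \<in> padic_null p"
    then show "a \<otimes>\<^bsub>add_monoid (padic_Cauchy_ring p)\<^esub> b \<in> padic_null p"
      using null_add by simp
  qed
  fix a x assume "a \<in> padic_null p" "x \<in> cauchy"
  from null_mult[OF this]
  show "x \<otimes>\<^bsub>padic_Cauchy_ring p\<^esub> a \<in> padic_null p" "a \<otimes>\<^bsub>padic_Cauchy_ring p\<^esub> x \<in> padic_null p"
    by (simp_all add: mult.commute)
qed

lemma padic_abs_convergent:
  assumes "x \<in> cauchy" obtains l where "(\<lambda>n. padic_abs p (x n)) \<longlonglongrightarrow> l"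
proof -
  have "Cauchy (\<lambda>n. padic_abs p (x n))"
    unfolding Cauchy_def dist_real_def
    using cauchyD[OF assms] padic_abs_reverse_triangle by (meson le_less_trans)
  then show ?thesis using that by (auto simp: Cauchy_convergent_iff convergent_def)
qed

text \<open>By the reverse triangle inequality, adding a null sequence does not change the limit of
  the absolute values. So all representatives share one limit, and the definite description picks
  it.\<close>

lemma Qp_abs_coset:
  assumes x: "x \<in> cauchy" and l: "(\<lambda>n. padic_abs p (x n)) \<longlonglongrightarrow> l"
  shows "Qp_abs p (padic_null p +>\<^bsub>padic_Cauchy_ring p\<^esub> x) = l"
proof -
  let ?V = "padic_null p +>\<^bsub>padic_Cauchy_ring p\<^esub> x"
  have V: "z \<in> ?V \<longleftrightarrow> (\<exists>h\<in>padic_null p. z = (\<lambda>n. h n + x n))" for z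
    by (auto simp: a_r_coset_def r_coset_def)
  have all: "(\<lambda>n. padic_abs p (z n)) \<longlonglongrightarrow> l" if zV: "z \<in> ?V" for z
  proof -
    obtain h where h: "h \<in> padic_null p" "z = (\<lambda>n. h n + x n)" using zV V[of z] by blast
    have "(\<lambda>n. padic_abs p (z n) - padic_abs p (x n)) \<longlonglongrightarrow> 0"
    proof (rule tendsto_rabs_zero_cancel, rule tendsto_sandwich[OF _ _ tendsto_const h(1)[unfolded null_iff]])
      show "\<forall>\<^sub>F n in sequentially. \<bar>padic_abs p (z n) - padic_abs p (x n)\<bar> \<le> padic_abs p (h n)"
        using padic_abs_reverse_triangle[of "z n" "x n" for n] h(2) by simp
    qed simp
    from tendsto_add[OF this l] show ?thesis by simp
  qed
  have "(\<lambda>_. 0) \<in> padic_null p" by (simp add: padic_null_def)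
  then have "x \<in> ?V" unfolding V by (intro bexI[of _ "\<lambda>_. 0"]) auto
  then show ?thesis unfolding Qp_abs_def
    by (intro the_equality) (use all l LIMSEQ_unique in blast)+
qed

end

section \<open>Completeness of the extension field\<close>

context padic_extension
begin

abbreviation j :: "(nat \<Rightarrow> rat) \<Rightarrow> 'k" where
  "j x \<equiv> \<iota> (padic_null p +>\<^bsub>padic_Cauchy_ring p\<^esub> x)"

abbreviation cau :: "(nat \<Rightarrow> rat) set" where "cau \<equiv> carrier (padic_Cauchy_ring p)"

lemma j_hom: "j \<in> ring_hom (padic_Cauchy_ring p) ring_of_type_algebra"
proof -
  interpret ideal "padic_null p" "padic_Cauchy_ring p" by (rule null_ideal[OF prime_p])
  show ?thesis
    using ring_hom_trans[OF rcos_ring_hom embedding[unfolded Qp_def]] by (simp add: comp_def)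
qed

lemma j_add: "x \<in> cau \<Longrightarrow> y \<in> cau \<Longrightarrow> j (\<lambda>n. x n + y n) = j x + j y"
  using ring_hom_add[OF j_hom, of x y] by (simp add: cauchy_ring_simps[OF prime_p] ring_of_type_algebra_def)

lemma j_mult: "x \<in> cau \<Longrightarrow> y \<in> cau \<Longrightarrow> j (\<lambda>n. x n * y n) = j x * j y"
  using ring_hom_mult[OF j_hom, of x y] by (simp add: cauchy_ring_simps[OF prime_p] ring_of_type_algebra_def)

lemma j_1: "j (\<lambda>_. 1) = 1"
  using ring_hom_one[OF j_hom] by (simp add: cauchy_ring_simps[OF prime_p] ring_of_type_algebra_def)

lemma carrier_Qp: "carrier (Qp p) = (\<lambda>x. padic_null p +>\<^bsub>padic_Cauchy_ring p\<^esub> x) ` cau"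
  by (auto simp: Qp_def FactRing_def A_RCOSETS_defs a_r_coset_def r_coset_def)

lemma absv_j: "x \<in> cau \<Longrightarrow> (\<lambda>n. padic_abs p (x n)) \<longlonglongrightarrow> l \<Longrightarrow> absv (j x) = l"
  using absv_extends[of "padic_null p +>\<^bsub>padic_Cauchy_ring p\<^esub> x"] Qp_abs_coset[OF prime_p, of x l]
  by (auto simp: carrier_Qp)

abbreviation emb :: "rat \<Rightarrow> 'k" where "emb q \<equiv> j (\<lambda>_. q)"

lemma absv_emb [simp]: "absv (emb q) = padic_abs p q"
  by (intro absv_j cauchy_const[OF prime_p]) simp

lemma emb_add: "emb (a + b) = emb a + emb b"
  by (intro j_add cauchy_const[OF prime_p])

lemma emb_0: "emb 0 = 0"
  using emb_add[of 0 0] by (metis add_0_left add_cancel_left_left)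

lemma emb_of_nat: "emb (of_nat n) = of_nat n"
  by (induction n) (auto simp: emb_0 emb_add j_1)

lemma of_nat_nonzero: "0 < n \<Longrightarrow> (of_nat n :: 'k) \<noteq> 0"
proof
  assume n: "0 < n" "(of_nat n :: 'k) = 0"
  then have "padic_abs p (of_nat n) = 0" using absv_emb[of "of_nat n"] absv_eq_0[of 0] by (simp add: emb_of_nat)
  with n(1) show False using padic_abs_eq_0[OF prime_p, of "of_nat n"] by simp
qed

lemma j_minus_const:
  assumes "x \<in> cau" shows "j x - emb q = j (\<lambda>n. x n - q)"
proof -
  have "j x = j (\<lambda>n. x n - q) + emb q"
    using j_add[of "\<lambda>n. x n - q" "\<lambda>_. q"] assms cauchy_add[OF prime_p assms cauchy_const[OF prime_p, of "- q"]]
    by (simp add: cauchy_const[OF prime_p])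
  then show ?thesis by simp
qed

lemma absv_minus': "absv (- x) = absv x"
proof -
  have "absv (-1) * absv (-1) = absv 1 * absv 1" by (simp flip: absv_mult)
  then have "absv (-1) = absv 1"
    using absv_nonneg by (metis abs_of_nonneg power2_eq_iff power2_eq_square abs_minus_cancel)
  then show ?thesis using absv_mult[of "-1" x] absv_mult[of 1 x] by simp
qed

lemma absv_diff_ultra: "absv (x - y) \<le> max (absv x) (absv y)"
  using absv_ultrametric[of x "- y"] by (simp add: absv_minus')

lemma absv_add_less: "absv x < e \<Longrightarrow> absv y < e \<Longrightarrow> absv (x + y) < e"
  using absv_ultrametric[of x y] by linarith

lemma absv_diff_less: "absv x < e \<Longrightarrow> absv y < e \<Longrightarrow> absv (x - y) < e"
  using absv_diff_ultra[of x y] by linarith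

lemma absv_less_trans: "absv (x - y) < e \<Longrightarrow> absv (y - z) < e \<Longrightarrow> absv (x - z) < e"
  using absv_add_less[of "x - y" e "y - z"] by simp

lemma absv_less_trans': "absv (x - y) < e \<Longrightarrow> absv (z - y) < e \<Longrightarrow> absv (x - z) < e"
  using absv_diff_less[of "x - y" e "z - y"] by simp

lemma absv_triangle3: "absv (x - z) \<le> max (absv (x - y)) (absv (y - z))"
  using absv_ultrametric[of "x - y" "y - z"] by simp

definition conv :: "(nat \<Rightarrow> 'k) \<Rightarrow> 'k \<Rightarrow> bool" where
  "conv a l \<longleftrightarrow> (\<forall>e>0. \<exists>N. \<forall>n\<ge>N. absv (a n - l) < e)"

definition Cau :: "(nat \<Rightarrow> 'k) \<Rightarrow> bool" where
  "Cau a \<longleftrightarrow> (\<forall>e>0. \<exists>N. \<forall>m\<ge>N. \<forall>n\<ge>N. absv (a m - a n) < e)"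

definition complete_set :: "'k set \<Rightarrow> bool" where
  "complete_set W \<longleftrightarrow> (\<forall>a. (\<forall>n. a n \<in> W) \<and> Cau a \<longrightarrow> (\<exists>l\<in>W. conv a l))"

lemma conv_Cau: "conv a l \<Longrightarrow> Cau a"
  unfolding Cau_def
proof (intro allI impI)
  fix e :: real assume "conv a l" "0 < e"
  then obtain N where "\<forall>n\<ge>N. absv (a n - l) < e" unfolding conv_def by blast
  then have "absv (a m - a n) < e" if "m \<ge> N" "n \<ge> N" for m n
    using absv_less_trans'[of "a m" l e "a n"] that by blast
  then show "\<exists>N. \<forall>m\<ge>N. \<forall>n\<ge>N. absv (a m - a n) < e" by blast
qed

lemma emb_conv:
  assumes "x \<in> cau" shows "conv (\<lambda>n. emb (x n)) (j x)"
  unfolding conv_def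
proof (intro allI impI)
  fix e :: real assume e: "0 < e"
  obtain N where N: "\<And>m n. m \<ge> N \<Longrightarrow> n \<ge> N \<Longrightarrow> padic_abs p (x m - x n) < e / 2"
    using cauchyD[OF prime_p assms, of "e / 2"] e by auto
  have "absv (emb (x n) - j x) < e" if "n \<ge> N" for n
  proof -
    have c: "(\<lambda>m. x m - x n) \<in> cau"
      using cauchy_add[OF prime_p assms cauchy_const[OF prime_p, of "- x n"]] by simp
    obtain l where l: "(\<lambda>m. padic_abs p (x m - x n)) \<longlonglongrightarrow> l"
      using padic_abs_convergent[OF prime_p c] .
    \<comment> \<open>Passing to the limit only preserves weak inequalities; starting from
      \<open>e / 2\<close> recovers the strict one.\<close>
    have "l \<le> e / 2"
      by (rule LIMSEQ_le_const2[OF l]) (use N that less_imp_le in blast)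
    then have "absv (j x - emb (x n)) < e"
      using absv_j[OF c l] e by (simp add: j_minus_const[OF assms])
    then show ?thesis using absv_minus'[of "j x - emb (x n)"] by simp
  qed
  then show "\<exists>N. \<forall>n\<ge>N. absv (emb (x n) - j x) < e" by blast
qed

lemma conv_unique: "conv a l \<Longrightarrow> conv a l' \<Longrightarrow> l = l'"
proof (rule ccontr)
  assume a: "conv a l" "conv a l'" "l \<noteq> l'"
  then have e: "absv (l - l') > 0" using absv_nonneg[of "l - l'"] absv_eq_0[of "l - l'"] by simp
  obtain N N' where "\<forall>n\<ge>N. absv (a n - l) < absv (l - l')" "\<forall>n\<ge>N'. absv (a n - l') < absv (l - l')"
    using a(1,2) e unfolding conv_def by blast
  then have "absv (a (max N N') - l) < absv (l - l')" "absv (a (max N N') - l') < absv (l - l')" by auto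
  then show False
    using absv_triangle3[of l l' "a (max N N')"] absv_minus'[of "l - a (max N N')"] by auto
qed

text \<open>Each term is replaced by a rational within \<open>1 / Suc n\<close> of it. The rationals
  so chosen form a Cauchy sequence, and the p-adic number that this sequence represents is the
  limit.\<close>

lemma complete_k0: "complete_set (j ` cau)"
  unfolding complete_set_def
proof (intro allI impI)
  fix a assume a: "(\<forall>n. a n \<in> j ` cau) \<and> Cau a"
  have "\<exists>q. absv (a n - emb q) < 1 / Suc n" for n
  proof -
    obtain x where x: "x \<in> cau" "a n = j x" using a by auto
    obtain N where "\<forall>m\<ge>N. absv (emb (x m) - j x) < 1 / Suc n"
      using emb_conv[OF x(1)] unfolding conv_def by (meson of_nat_0_less_iff zero_less_Suc zero_less_divide_1_iff)
    then show ?thesis using absv_minus'[of "j x - emb (x N)"] x(2) by (intro exI[of _ "x N"]) auto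
  qed
  then obtain q where q: "\<And>n. absv (a n - emb (q n)) < 1 / Suc n" by metis
  have small: "\<exists>N. \<forall>n\<ge>N. absv (a n - emb (q n)) < e" if "0 < e" for e
  proof -
    obtain N where "1 / Suc N < e" using \<open>0 < e\<close> nat_approx_posE by blast
    then have "absv (a n - emb (q n)) < e" if "n \<ge> N" for n
      using q[of n] frac_le[of 1 1 "real (Suc N)" "real (Suc n)"] that by simp
    then show ?thesis by blast
  qed
  have qc: "q \<in> cau"
    unfolding cauchy_iff[OF prime_p]
  proof (intro allI impI)
    fix e :: real assume e: "0 < e"
    obtain N where N: "\<forall>n\<ge>N. absv (a n - emb (q n)) < e" using small[OF e] by auto
    obtain M where M: "\<forall>m\<ge>M. \<forall>n\<ge>M. absv (a m - a n) < e" using a e unfolding Cau_def by blast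
    have "padic_abs p (q m - q n) < e" if "m \<ge> max N M" "n \<ge> max N M" for m n
    proof -
      have "emb (q m - q n) = emb (q m) - emb (q n)"
        using emb_add[of "q m - q n" "q n"] by simp
      then have "padic_abs p (q m - q n) = absv (emb (q m) - emb (q n))"
        using absv_emb[of "q m - q n"] by simp
      also have "absv (a m - emb (q n)) < e"
        using absv_less_trans[of "a m" "a n" e "emb (q n)"] N M that by auto
      then have "absv (emb (q m) - emb (q n)) < e"
        using absv_less_trans'[of "emb (q n)" "a m" e "emb (q m)"] N that
          absv_minus'[of "a m - emb (q n)"] absv_minus'[of "a m - emb (q m)"]
          absv_minus'[of "emb (q m) - emb (q n)"] by auto
      finally show ?thesis .
    qed
    then show "\<exists>N. \<forall>m\<ge>N. \<forall>n\<ge>N. padic_abs p (q m - q n) < e" by blast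
  qed
  have "conv a (j q)"
    unfolding conv_def
  proof (intro allI impI)
    fix e :: real assume e: "0 < e"
    obtain N M where "\<forall>n\<ge>N. absv (a n - emb (q n)) < e" "\<forall>n\<ge>M. absv (emb (q n) - j q) < e"
      using small[OF e] emb_conv[OF qc] e unfolding conv_def by metis
    then have "absv (a n - j q) < e" if "n \<ge> max N M" for n
      using that absv_less_trans[of "a n" "emb (q n)" e "j q"] by auto
    then show "\<exists>N. \<forall>n\<ge>N. absv (a n - j q) < e" by blast
  qed
  with qc show "\<exists>l\<in>j ` cau. conv a l" by blast
qed

lemma k0_add: "s \<in> j ` cau \<Longrightarrow> t \<in> j ` cau \<Longrightarrow> s + t \<in> j ` cau"
proof -
  assume "s \<in> j ` cau" "t \<in> j ` cau"
  then obtain x y where "x \<in> cau" "y \<in> cau" "s = j x" "t = j y" by blast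
  then show ?thesis using j_add cauchy_add[OF prime_p] by (intro image_eqI[of _ _ "\<lambda>n. x n + y n"]) auto
qed

lemma k0_mult: "s \<in> j ` cau \<Longrightarrow> t \<in> j ` cau \<Longrightarrow> s * t \<in> j ` cau"
proof -
  assume "s \<in> j ` cau" "t \<in> j ` cau"
  then obtain x y where "x \<in> cau" "y \<in> cau" "s = j x" "t = j y" by blast
  then show ?thesis using j_mult cauchy_mult[OF prime_p] by (intro image_eqI[of _ _ "\<lambda>n. x n * y n"]) auto
qed

lemma k0_0: "0 \<in> j ` cau" and k0_1: "1 \<in> j ` cau" and k0_m1: "- 1 \<in> j ` cau"
proof -
  show "0 \<in> j ` cau"
    by (rule image_eqI[of _ _ "\<lambda>_. 0"]) (simp_all add: emb_0 cauchy_const[OF prime_p])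
  show "1 \<in> j ` cau"
    by (rule image_eqI[of _ _ "\<lambda>_. 1"]) (simp_all add: j_1 cauchy_const[OF prime_p])
  have "emb (-1) = -1" using emb_add[of "-1" 1] by (simp add: emb_0 j_1 eq_neg_iff_add_eq_0)
  then show "- 1 \<in> j ` cau"
    by (intro image_eqI[of _ _ "\<lambda>_. - 1"]) (simp_all add: cauchy_const[OF prime_p])
qed

lemma k0_minus: "s \<in> j ` cau \<Longrightarrow> - s \<in> j ` cau"
  using k0_mult[OF k0_m1] by fastforce

text \<open>\<open>Qp\<close> is built as a quotient ring, so inverses have to be constructed. A
  non-null Cauchy sequence eventually stays above half the limit of its absolute values, which makes
  the termwise inverse a Cauchy sequence.\<close>

lemma k0_inverse:
  assumes "t \<in> j ` cau" "t \<noteq> 0" shows "inverse t \<in> j ` cau"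
proof -
  obtain x where x: "x \<in> cau" "t = j x" using assms by auto
  obtain l where l: "(\<lambda>n. padic_abs p (x n)) \<longlonglongrightarrow> l" using padic_abs_convergent[OF prime_p x(1)] .
  have "absv t > 0" using assms(2) absv_nonneg[of t] absv_eq_0[of t] by simp
  then have l0: "l > 0" using absv_j[OF x(1) l] x(2) by simp
  then obtain N where N: "\<And>n. n \<ge> N \<Longrightarrow> padic_abs p (x n) > l / 2"
    using order_tendstoD(1)[OF l, of "l / 2"] by (auto simp: eventually_sequentially)
  \<comment> \<open>The value 0 before \<open>N\<close> is a mere default: finitely many terms
    affect neither the Cauchy condition nor the limit.\<close>
  define y where "y n = (if n \<ge> N then inverse (x n) else 0)" for n
  have nz: "x n \<noteq> 0" if "n \<ge> N" for n using N[OF that] l0 padic_abs_0[OF prime_p] by auto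
  have "y \<in> cau"
    unfolding cauchy_iff[OF prime_p]
  proof (intro allI impI)
    fix e :: real assume e: "0 < e"
    then obtain M where M: "\<And>m n. m \<ge> M \<Longrightarrow> n \<ge> M \<Longrightarrow> padic_abs p (x m - x n) < e * (l / 2 * (l / 2))"
      using cauchyD[OF prime_p x(1), of "e * (l / 2 * (l / 2))"] l0 by auto
    have "padic_abs p (y m - y n) < e" if "m \<ge> max N M" "n \<ge> max N M" for m n
    proof -
      have "(y m - y n) * (x m * x n) = x n - x m" using that nz by (simp add: y_def field_simps)
      then have "padic_abs p (y m - y n) * (padic_abs p (x m) * padic_abs p (x n)) = padic_abs p (x n - x m)"
        by (metis padic_abs_mult[OF prime_p])
      also have "\<dots> < e * (l / 2 * (l / 2))" using M that by simp
      also have "\<dots> \<le> e * (padic_abs p (x m) * padic_abs p (x n))"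
        using N[of m] N[of n] that l0 e by (intro mult_left_mono mult_mono) auto
      finally show ?thesis
        by (meson mult_less_cancel_right padic_abs_nonneg[OF prime_p] mult_nonneg_nonneg leD)
    qed
    then show "\<exists>N. \<forall>m\<ge>N. \<forall>n\<ge>N. padic_abs p (y m - y n) < e" by blast
  qed
  have "conv (\<lambda>n. emb (x n * y n)) 1"
    unfolding conv_def
  proof (intro allI impI exI[of _ N])
    fix e :: real and n assume "0 < e" "N \<le> n"
    then show "absv (emb (x n * y n) - 1) < e" using nz[of n] absv_eq_0[of 0] by (simp add: y_def j_1)
  qed
  moreover have "conv (\<lambda>n. emb (x n * y n)) (j x * j y)"
    using emb_conv[OF cauchy_mult[OF prime_p x(1) \<open>y \<in> cau\<close>]] j_mult[OF x(1) \<open>y \<in> cau\<close>] by simp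
  ultimately have "t * j y = 1" using conv_unique x(2) by metis
  then have "inverse t = j y" by (rule inverse_unique)
  then show ?thesis using \<open>y \<in> cau\<close> by auto
qed

section \<open>Finite-dimensional subspaces over the p-adic numbers are complete\<close>

definition lin_span :: "'k set \<Rightarrow> 'k set" where
  "lin_span B = {\<Sum>b\<in>B. s b * b | s. \<forall>b\<in>B. s b \<in> j ` cau}"

lemma lin_span_add: "v \<in> lin_span B \<Longrightarrow> w \<in> lin_span B \<Longrightarrow> v + w \<in> lin_span B"
proof -
  assume "v \<in> lin_span B" "w \<in> lin_span B"
  then obtain s t where "\<forall>b\<in>B. s b \<in> j ` cau" "v = (\<Sum>b\<in>B. s b * b)"
    "\<forall>b\<in>B. t b \<in> j ` cau" "w = (\<Sum>b\<in>B. t b * b)" unfolding lin_span_def by auto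
  then show ?thesis unfolding lin_span_def
    by (auto intro!: exI[of _ "\<lambda>b. s b + t b"] k0_add simp: sum.distrib distrib_right simp del: image_iff)
qed

lemma lin_span_mult: "v \<in> lin_span B \<Longrightarrow> c \<in> j ` cau \<Longrightarrow> c * v \<in> lin_span B"
proof -
  assume "v \<in> lin_span B" "c \<in> j ` cau"
  then obtain s where "\<forall>b\<in>B. s b \<in> j ` cau" "v = (\<Sum>b\<in>B. s b * b)" unfolding lin_span_def by auto
  with \<open>c \<in> j ` cau\<close> show ?thesis unfolding lin_span_def
    by (auto intro!: exI[of _ "\<lambda>b. c * s b"] k0_mult simp: sum_distrib_left mult.assoc simp del: image_iff)
qed

lemma lin_span_insert:
  assumes "finite B" "b \<notin> B"
  shows "v \<in> lin_span (insert b B) \<longleftrightarrow> (\<exists>w\<in>lin_span B. \<exists>c\<in>j ` cau. v = w + c * b)"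
proof
  assume "v \<in> lin_span (insert b B)"
  then show "\<exists>w\<in>lin_span B. \<exists>c\<in>j ` cau. v = w + c * b"
    using assms unfolding lin_span_def by (force simp del: image_iff simp: add.commute)
next
  assume "\<exists>w\<in>lin_span B. \<exists>c\<in>j ` cau. v = w + c * b"
  then obtain s c where s: "\<forall>b\<in>B. s b \<in> j ` cau" "c \<in> j ` cau" "v = (\<Sum>b\<in>B. s b * b) + c * b"
    unfolding lin_span_def by auto
  have "(\<Sum>x\<in>B. (if x = b then c else s x) * x) = (\<Sum>b\<in>B. s b * b)"
    using assms by (intro sum.cong) auto
  then show "v \<in> lin_span (insert b B)" unfolding lin_span_def
    using s assms by (intro CollectI exI[of _ "\<lambda>x. if x = b then c else s x"]) (auto simp: add.commute)
qed

text \<open>The classical argument for finite-dimensional spaces over a complete field. The span of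
  \<open>B\<close> is complete by induction, hence \<open>- b\<close> has positive distance from it;
  this controls the coefficient of \<open>b\<close>, so coefficients of a Cauchy sequence converge
  separately.\<close>

lemma complete_lin_span: "finite B \<Longrightarrow> complete_set (lin_span B)"
proof (induction B rule: finite_induct)
  case empty
  show ?case unfolding complete_set_def lin_span_def conv_def using absv_eq_0[of 0] by auto
next
  case (insert b B)
  note ins = lin_span_insert[OF insert.hyps]
  show ?case
  \<comment> \<open>The spanning set given by the hypothesis of finite degree may be linearly
    dependent, in which case the new vector adds nothing.\<close>
  proof (cases "b \<in> lin_span B")
    case True
    have "lin_span (insert b B) = lin_span B"
    proof (rule Set.set_eqI, rule iffI)
      fix v assume "v \<in> lin_span (insert b B)"
      then obtain w c where "w \<in> lin_span B" "c \<in> j ` cau" "v = w + c * b" unfolding ins by blast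
      then show "v \<in> lin_span B" using lin_span_add lin_span_mult[OF True] by metis
    next
      fix v assume "v \<in> lin_span B"
      then show "v \<in> lin_span (insert b B)" unfolding ins by (intro bexI[of _ v] bexI[of _ 0] k0_0) simp_all
    qed
    then show ?thesis using insert.IH by simp
  next
    case False
    \<comment> \<open>Without such a distance some sequence in the span would converge to
      \<open>- b\<close>, which would put \<open>b\<close> into the span by completeness.\<close>
    have "\<exists>\<delta>>0. \<forall>w\<in>lin_span B. \<delta> \<le> absv (w + b)"
    proof (rule ccontr)
      assume no: "\<not> ?thesis"
      have "\<forall>n. \<exists>w\<in>lin_span B. absv (w + b) < 1 / Suc n" 
      proof (intro allI)
        fix n
        have "(0::real) < 1 / Suc n" by simp
        with no show "\<exists>w\<in>lin_span B. absv (w + b) < 1 / Suc n" by (meson not_le)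
      qed
      then obtain w where w: "\<And>n. w n \<in> lin_span B" "\<And>n. absv (w n + b) < 1 / Suc n" by metis
      have cw: "conv w (- b)"
        unfolding conv_def
      proof (intro allI impI)
        fix e :: real assume "0 < e"
        then obtain N where N: "1 / Suc N < e" using nat_approx_posE by blast
        then have "absv (w n - - b) < e" if "n \<ge> N" for n
          using w(2)[of n] frac_le[of 1 1 "real (Suc N)" "real (Suc n)"] that by simp
        then show "\<exists>N. \<forall>n\<ge>N. absv (w n - - b) < e" by blast
      qed
      then have "- b \<in> lin_span B"
      proof -
        obtain l where "l \<in> lin_span B" "conv w l"
          using insert.IH conv_Cau[OF cw] w(1) unfolding complete_set_def by blast
        then show ?thesis using conv_unique[OF cw] by simp
      qed
      from lin_span_mult[OF this k0_m1] show False using False by simp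
    qed
    then obtain \<delta> where \<delta>: "\<delta> > 0" "\<And>w. w \<in> lin_span B \<Longrightarrow> \<delta> \<le> absv (w + b)" by auto
    have bound: "\<delta> * absv c \<le> absv (w + c * b)" if "w \<in> lin_span B" "c \<in> j ` cau" for w c
    proof (cases "c = 0")
      case False
      have "\<delta> * absv c \<le> absv (inverse c * w + b) * absv c"
        using \<delta>(2)[OF lin_span_mult[OF that(1) k0_inverse[OF that(2) False]]] absv_nonneg by (rule mult_right_mono)
      also have "\<dots> = absv (w + c * b)"
      proof -
        have "(inverse c * w + b) * c = w + c * b" using False by (simp add: field_simps)
        then show ?thesis by (simp flip: absv_mult)
      qed
      finally show ?thesis .
    qed (use absv_nonneg absv_eq_0[of 0] in auto)
    show ?thesis unfolding complete_set_def
    proof (intro allI impI)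
      fix a assume a: "(\<forall>n. a n \<in> lin_span (insert b B)) \<and> Cau a"
      then obtain w c where wc: "\<And>n. w n \<in> lin_span B" "\<And>n. c n \<in> j ` cau" "\<And>n. a n = w n + c n * b"
        unfolding ins by metis
      have diff: "w m - w n \<in> lin_span B" "c m - c n \<in> j ` cau" for m n
        using lin_span_add[OF wc(1)[of m] lin_span_mult[OF wc(1)[of n] k0_m1]] k0_add[OF wc(2)[of m] k0_minus[OF wc(2)[of n]]] by auto
      have cd: "\<delta> * absv (c m - c n) \<le> absv (a m - a n)" for m n
        using bound[OF diff] by (simp add: wc(3) algebra_simps)
      have "Cau c" unfolding Cau_def
      proof (intro allI impI)
        fix e :: real assume "0 < e"
        then obtain N where "\<forall>m\<ge>N. \<forall>n\<ge>N. absv (a m - a n) < \<delta> * e"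
          using a \<delta>(1) unfolding Cau_def by (meson mult_pos_pos)
        then have "absv (c m - c n) < e" if "m \<ge> N" "n \<ge> N" for m n
          using le_less_trans[OF cd[of m n]] that \<delta>(1) mult_less_cancel_left_pos by blast
        then show "\<exists>N. \<forall>m\<ge>N. \<forall>n\<ge>N. absv (c m - c n) < e" by blast
      qed
      then obtain d where d: "d \<in> j ` cau" "conv c d" using complete_k0 wc(2) unfolding complete_set_def by blast
      have cb: "\<exists>N. \<forall>n\<ge>N. absv (c n * b - d * b) < e" if e0: "e > 0" for e
      proof -
        have pos: "absv b + 1 > 0" using absv_nonneg[of b] by linarith
        obtain N where N: "\<forall>n\<ge>N. absv (c n - d) < e / (absv b + 1)"
          using d(2) divide_pos_pos[OF e0 pos] unfolding conv_def by blast
        have "absv (c n * b - d * b) < e" if "n \<ge> N" for n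
        proof -
          have "absv (c n * b - d * b) = absv (c n - d) * absv b" by (simp add: algebra_simps flip: absv_mult)
          also have "\<dots> \<le> absv (c n - d) * (absv b + 1)" using absv_nonneg by (intro mult_left_mono) auto
          also have "\<dots> < e" using N that pos by (simp add: field_simps)
          finally show ?thesis .
        qed
        then show ?thesis by blast
      qed
      have cb': "conv (\<lambda>n. c n * b) (d * b)" using cb unfolding conv_def by blast
      have "Cau w" unfolding Cau_def
      proof (intro allI impI)
        fix e :: real assume "0 < e"
        then obtain N M where N: "\<forall>m\<ge>N. \<forall>n\<ge>N. absv (a m - a n) < e"
          and M: "\<forall>m\<ge>M. \<forall>n\<ge>M. absv (c m * b - c n * b) < e"
          using a conv_Cau[OF cb'] unfolding Cau_def by metis
        have "absv (w m - w n) < e" if "m \<ge> max N M" "n \<ge> max N M" for m n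
        proof -
          have "w m - w n = (a m - a n) - (c m * b - c n * b)" by (simp add: wc(3))
          then show ?thesis using absv_diff_less[of "a m - a n" e "c m * b - c n * b"] N M that by auto
        qed
        then show "\<exists>N. \<forall>m\<ge>N. \<forall>n\<ge>N. absv (w m - w n) < e" by blast
      qed
      then obtain u where u: "u \<in> lin_span B" "conv w u" using insert.IH wc(1) unfolding complete_set_def by blast
      have "conv a (u + d * b)" unfolding conv_def
      proof (intro allI impI)
        fix e :: real assume "0 < e"
        then obtain N M where NM: "\<forall>n\<ge>N. absv (w n - u) < e" "\<forall>n\<ge>M. absv (c n * b - d * b) < e"
          using u(2) cb unfolding conv_def by metis
        have "absv (a n - (u + d * b)) < e" if "n \<ge> max N M" for n
        proof -
          have "a n - (u + d * b) = (w n - u) + (c n * b - d * b)" by (simp add: wc(3))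
          moreover have "absv ((w n - u) + (c n * b - d * b)) < e"
            using absv_add_less[of "w n - u" e "c n * b - d * b"] NM that by auto
          ultimately show ?thesis by metis
        qed
        then show "\<exists>N. \<forall>n\<ge>N. absv (a n - (u + d * b)) < e" by blast
      qed
      moreover have "u + d * b \<in> lin_span (insert b B)" unfolding ins using u(1) d(1) by blast
      ultimately show "\<exists>l\<in>lin_span (insert b B). conv a l" by blast
    qed
  qed
qed

lemma complete_UNIV: "complete_set UNIV"
proof -
  obtain B where B: "finite B" "\<And>x. \<exists>a \<in> B \<rightarrow> carrier (Qp p). x = (\<Sum>b\<in>B. \<iota> (a b) * b)"
    using finite_degree by auto
  have "x \<in> lin_span B" for x
  proof -
    obtain a where a: "a \<in> B \<rightarrow> carrier (Qp p)" "x = (\<Sum>b\<in>B. \<iota> (a b) * b)" using B(2) by blast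
    have aB: "\<iota> (a b) \<in> j ` cau" if "b \<in> B" for b
    proof -
      have "a b \<in> carrier (Qp p)" using a(1) that by auto
      then obtain x where "x \<in> cau" "a b = padic_null p +>\<^bsub>padic_Cauchy_ring p\<^esub> x" unfolding carrier_Qp by auto
      then show ?thesis by (simp only: image_eqI)
    qed
    then show ?thesis unfolding lin_span_def using a(2) by (intro CollectI exI[of _ "\<lambda>b. \<iota> (a b)"] conjI ballI aB)
  qed
  then have "lin_span B = UNIV" by auto
  then show ?thesis using complete_lin_span[OF B(1)] by simp
qed

lemma complete_dvf_if_uniformiser:
  assumes "uniformiser absv \<pi>" shows "complete_dvf absv \<pi>"
proof
  have uni: "(\<lambda>c. \<pi> * c) ` {x. absv x \<le> 1} = {x. absv x < 1}"
    using assms by (simp add: uniformiser_def valuation_ring_def)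
  \<comment> \<open>The absolute value is nontrivial because \<open>p\<close> has value
    \<open>1/p\<close>. A nonzero element of value below 1 is a multiple of \<open>\<pi>\<close>,
    and this excludes \<open>\<pi> = 0\<close>.\<close>
  have "padic_abs p (of_nat p) = real p powi -1"
    using padic_abs_Fract[OF prime_p, of "int p" 1] prime_p prime_gt_0_nat[OF prime_p]
    by (simp add: Fract_of_int_eq multiplicity_prime[OF prime_elem_int_p[OF prime_p]] prime_nat_iff)
  then have p: "absv (of_nat p) < 1" "of_nat p \<noteq> (0 :: 'k)"
    using absv_emb[of "of_nat p"] prime_gt_1_nat[OF prime_p] of_nat_nonzero[of p]
    by (auto simp: emb_of_nat power_int_minus inverse_less_1_iff)
  then obtain c where "of_nat p = \<pi> * c" using uni by blast
  with p show "\<pi> \<noteq> 0" by auto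
  have one: "absv 1 = 1" using absv_emb[of 1, unfolded j_1] padic_abs_Fract[OF prime_p, of 1 1]
    by (simp add: One_rat_def)
  then have "\<pi> * 1 \<in> (\<lambda>c. \<pi> * c) ` {x. absv x \<le> 1}" by (intro imageI) simp
  then show "absv \<pi> < 1" using uni by auto
  fix x assume "absv x < 1"
  then obtain c where "x = \<pi> * c" "absv c \<le> 1" using uni by blast
  then show "absv x \<le> absv \<pi>" using absv_nonneg[of \<pi>] by (simp add: absv_mult mult_left_le)
next
  fix a assume a: "\<And>n. absv (a (Suc n) - a n) \<le> absv \<pi> ^ n"
  have r: "absv \<pi> < 1" "0 \<le> absv \<pi>"
  proof -
    have uni: "(\<lambda>c. \<pi> * c) ` {x. absv x \<le> 1} = {x. absv x < 1}"
      using assms by (simp add: uniformiser_def valuation_ring_def)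
    have one: "absv 1 = 1" using absv_emb[of 1, unfolded j_1] padic_abs_Fract[OF prime_p, of 1 1]
      by (simp add: One_rat_def)
    then have "\<pi> * 1 \<in> (\<lambda>c. \<pi> * c) ` {x. absv x \<le> 1}" by (intro imageI) simp
    then show "absv \<pi> < 1" using uni by auto
  qed (rule absv_nonneg)
  \<comment> \<open>In an ultrametric field the total change after step \<open>n\<close> is no
    larger than the largest single change, so the limit inherits the rate \<open>r ^ n\<close>
    without a constant.\<close>
  have le: "absv (a (n + k) - a n) \<le> absv \<pi> ^ n" for n k
  proof (induction k)
    case 0
    then show ?case using absv_eq_0[of 0] r by simp
  next
    case (Suc k)
    have "absv \<pi> ^ (n + k) \<le> absv \<pi> ^ n" using r by (intro power_decreasing) auto
    with a[of "n + k"] have "absv (a (n + Suc k) - a (n + k)) \<le> absv \<pi> ^ n" by simp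
    then show ?case using Suc absv_triangle3[of "a (n + Suc k)" "a n" "a (n + k)"] by simp
  qed
  have "Cau a" unfolding Cau_def
  proof (intro allI impI)
    fix e :: real assume "0 < e"
    then obtain N where N: "absv \<pi> ^ N < e" using real_arch_pow_inv r(1) by blast
    have "absv (a m - a n) < e" if "m \<ge> N" "n \<ge> N" for m n
      using le[of N "m - N"] le[of N "n - N"] that N absv_triangle3[of "a m" "a n" "a N"]
        absv_minus'[of "a n - a N"] by auto
    then show "\<exists>N. \<forall>m\<ge>N. \<forall>n\<ge>N. absv (a m - a n) < e" by blast
  qed
  then obtain l where l: "conv a l" using complete_UNIV unfolding complete_set_def by blast
  have "absv (l - a n) \<le> absv \<pi> ^ n" for n
  proof (rule field_le_epsilon)
    fix e :: real assume e: "0 < e"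
    then obtain N where N: "\<forall>m\<ge>N. absv (a m - l) < e" using l unfolding conv_def by blast
    have "absv (l - a n) \<le> max (absv (l - a (n + N))) (absv (a (n + N) - a n))" by (rule absv_triangle3)
    moreover have "absv (l - a (n + N)) < e" using N[rule_format, of "n + N"] absv_minus'[of "l - a (n + N)"] by simp
    moreover have "0 \<le> absv \<pi> ^ n" using r by simp
    ultimately show "absv (l - a n) \<le> absv \<pi> ^ n + e" using le[of n N] e by linarith
  qed
  then show "\<exists>s. \<forall>n. absv (s - a n) \<le> absv \<pi> ^ n" by blast
qed (use absv_nonneg absv_eq_0 absv_mult absv_ultrametric of_nat_nonzero in auto)

end

section \<open>Adic completions\<close>

lemma (in ideal) mem_coset_iff:
  assumes "x \<in> carrier R"
  shows "y \<in> I +> x \<longleftrightarrow> y \<in> carrier R \<and> y \<ominus> x \<in> I"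
proof
  assume "y \<in> I +> x"
  then obtain h where h: "h \<in> I" "y = h \<oplus> x" by (auto simp: a_r_coset_def')
  then have "y \<ominus> x = h" using assms a_Hcarr[OF h(1)] by (simp add: a_minus_def a_assoc r_neg)
  then show "y \<in> carrier R \<and> y \<ominus> x \<in> I" using h assms a_Hcarr by auto
next
  assume y: "y \<in> carrier R \<and> y \<ominus> x \<in> I"
  then have "y = (y \<ominus> x) \<oplus> x" using assms by (simp add: a_minus_def a_assoc l_neg)
  then show "y \<in> I +> x" using y by (auto simp: a_r_coset_def')
qed

lemma (in ideal) coset_rep:
  assumes "V \<in> carrier (R Quot I)" "x \<in> V"
  shows "x \<in> carrier R" "V = I +> x"
proof -
  obtain y where y: "y \<in> carrier R" "V = I +> y" using assms(1) by (auto simp: FactRing_simps)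
  show "x \<in> carrier R" using assms(2) y mem_coset_iff by auto
  show "V = I +> x"
    unfolding y(2) by (rule a_repr_independence[OF _ y(1)]) (use assms(2) y a_subgroup in simp_all)
qed

lemma (in ideal) coset_in_Quot: "x \<in> carrier R \<Longrightarrow> I +> x \<in> carrier (R Quot I)"
  by (auto simp: FactRing_simps)

lemma (in ideal) coset_nonempty: "V \<in> carrier (R Quot I) \<Longrightarrow> \<exists>x. x \<in> V"
  using a_rcos_self by (auto simp: FactRing_simps)

lemma (in ideal) Quot_add: "x \<in> carrier R \<Longrightarrow> y \<in> carrier R \<Longrightarrow>
    (I +> x) \<oplus>\<^bsub>R Quot I\<^esub> (I +> y) = I +> (x \<oplus> y)"
  by (simp add: FactRing_def a_rcos_sum)

lemma (in ideal) Quot_mult: "x \<in> carrier R \<Longrightarrow> y \<in> carrier R \<Longrightarrow>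
    (I +> x) \<otimes>\<^bsub>R Quot I\<^esub> (I +> y) = I +> (x \<otimes> y)"
  by (simp add: FactRing_def rcoset_mult_add)

text \<open>The ring is not commutative. Centrality of \<open>t\<close> is what makes the set of
  left multiples of \<open>t [^] n\<close> a two-sided ideal.\<close>

locale central_element = ring A for A (structure) +
  fixes t
  assumes t_closed [simp]: "t \<in> carrier A"
    and t_central: "x \<in> carrier A \<Longrightarrow> t \<otimes> x = x \<otimes> t"
begin

abbreviation "I n \<equiv> power_ideal A t n"
abbreviation "C \<equiv> adic_completion A t"

lemma t_pow_central: "x \<in> carrier A \<Longrightarrow> t [^] (n::nat) \<otimes> x = x \<otimes> t [^] n"
proof (induction n)
  case (Suc n)
  then show ?case using t_central[of x] by (simp add: m_assoc) (simp add: m_assoc[symmetric])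
qed simp

lemma mem_I_iff: "z \<in> I n \<longleftrightarrow> (\<exists>u\<in>carrier A. z = t [^] n \<otimes> u)"
  by (auto simp: power_ideal_def)

lemma ideal_I: "ideal (I n) A"
proof (rule idealI)
  show "subgroup (I n) (add_monoid A)"
  proof (rule group.subgroupI[OF a_group])
    show "I n \<subseteq> carrier (add_monoid A)" by (auto simp: power_ideal_def)
    show "I n \<noteq> {}" by (auto simp: power_ideal_def)
    fix a assume "a \<in> I n"
    then obtain u where "u \<in> carrier A" "a = t [^] n \<otimes> u" unfolding mem_I_iff by auto
    then have "\<ominus> a = t [^] n \<otimes> (\<ominus> u)" "\<ominus> u \<in> carrier A" by (simp_all add: r_minus)
    then show "inv\<^bsub>add_monoid A\<^esub> a \<in> I n" unfolding a_inv_def[symmetric] mem_I_iff by blast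
  next
    fix a b assume "a \<in> I n" "b \<in> I n"
    then obtain u v where "u \<in> carrier A" "a = t [^] n \<otimes> u" "v \<in> carrier A" "b = t [^] n \<otimes> v"
      unfolding mem_I_iff by auto
    then show "a \<otimes>\<^bsub>add_monoid A\<^esub> b \<in> I n"
      unfolding mem_I_iff by (intro bexI[of _ "u \<oplus> v"]) (simp_all add: r_distr)
  qed
  fix a x assume "a \<in> I n" and x: "x \<in> carrier A"
  then obtain u where u: "u \<in> carrier A" "a = t [^] n \<otimes> u" unfolding mem_I_iff by auto
  show "a \<otimes> x \<in> I n" unfolding mem_I_iff using u x by (intro bexI[of _ "u \<otimes> x"]) (simp_all add: m_assoc)
  have "x \<otimes> a = t [^] n \<otimes> (x \<otimes> u)"
    using u x t_pow_central[of x n] by (simp add: m_assoc[symmetric])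
  then show "x \<otimes> a \<in> I n" unfolding mem_I_iff using u x by (intro bexI[of _ "x \<otimes> u"]) simp_all
qed (rule ring_axioms)

lemma ring_Q: "ring (A Quot I n)"
  by (rule ideal.quotient_is_ring[OF ideal_I])

lemma C_simps:
  "carrier C = {f. (\<forall>n. f n \<in> carrier (A Quot I n)) \<and> (\<forall>n. f (Suc n) \<subseteq> f n)}"
  "f \<otimes>\<^bsub>C\<^esub> g = (\<lambda>n. f n \<otimes>\<^bsub>A Quot I n\<^esub> g n)"
  "\<one>\<^bsub>C\<^esub> = (\<lambda>n. \<one>\<^bsub>A Quot I n\<^esub>)"
  "\<zero>\<^bsub>C\<^esub> = (\<lambda>n. \<zero>\<^bsub>A Quot I n\<^esub>)"
  "f \<oplus>\<^bsub>C\<^esub> g = (\<lambda>n. f n \<oplus>\<^bsub>A Quot I n\<^esub> g n)"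
  by (auto simp: adic_completion_def Let_def)

lemma C_carr: "f \<in> carrier C \<Longrightarrow> x \<in> f n \<Longrightarrow> x \<in> carrier A"
  using ideal.coset_rep(1)[OF ideal_I, of "f n" n x] by (auto simp: C_simps)

lemma C_coset: "f \<in> carrier C \<Longrightarrow> x \<in> f n \<Longrightarrow> f n = I n +> x"
  using ideal.coset_rep(2)[OF ideal_I, of "f n" n x] by (auto simp: C_simps)

lemma C_rep_exists: "f \<in> carrier C \<Longrightarrow> \<exists>x. x \<in> f n"
  using ideal.coset_nonempty[OF ideal_I, of "f n" n] by (auto simp: C_simps)

lemma C_rep_Suc: "f \<in> carrier C \<Longrightarrow> x \<in> f (Suc n) \<Longrightarrow> x \<in> f n"
  by (auto simp: C_simps)

lemma mem_I_coset: "x \<in> carrier A \<Longrightarrow> y \<in> I n +> x \<longleftrightarrow> (\<exists>u\<in>carrier A. y = x \<oplus> t [^] n \<otimes> u)"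
proof -
  assume x: "x \<in> carrier A"
  show ?thesis
  proof
    assume "y \<in> I n +> x"
    then obtain h where h: "h \<in> I n" "y = h \<oplus> x" by (auto simp: a_r_coset_def')
    then obtain u where "u \<in> carrier A" "h = t [^] n \<otimes> u" unfolding mem_I_iff by auto
    with h x show "\<exists>u\<in>carrier A. y = x \<oplus> t [^] n \<otimes> u" by (intro bexI[of _ u]) (simp_all add: a_comm)
  next
    assume "\<exists>u\<in>carrier A. y = x \<oplus> t [^] n \<otimes> u"
    then obtain u where "u \<in> carrier A" "y = t [^] n \<otimes> u \<oplus> x" using x by (auto simp: a_comm)
    then show "y \<in> I n +> x" unfolding a_r_coset_def' using mem_I_iff by blast
  qed
qed

lemma C_diff: "f \<in> carrier C \<Longrightarrow> x \<in> f n \<Longrightarrow> y \<in> f n \<Longrightarrow> \<exists>u\<in>carrier A. y = x \<oplus> t [^] n \<otimes> u"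
  using C_coset[of f x n] mem_I_coset[of x y n] C_carr by auto

lemma C_shift: "f \<in> carrier C \<Longrightarrow> x \<in> f n \<Longrightarrow> u \<in> carrier A \<Longrightarrow> x \<oplus> t [^] n \<otimes> u \<in> f n"
  using C_coset[of f x n] mem_I_coset[of x "x \<oplus> t [^] n \<otimes> u" n] C_carr by auto

lemma C_eqI:
  assumes "f \<in> carrier C" "g \<in> carrier C" "\<And>n. \<exists>x. x \<in> f n \<and> x \<in> g n" shows "f = g"
proof
  fix n
  obtain x where "x \<in> f n" "x \<in> g n" using assms(3) by auto
  then show "f n = g n" using C_coset assms by metis
qed

text \<open>Elements of the completion are produced from sequences of representatives that agree
  modulo \<open>t [^] n\<close> from step \<open>n\<close> on: with
  \<open>x (Suc n) = x n + t^n v\<close>, the next coset lies in the current one since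
  \<open>t^(n+1) u + t^n v = t^n (v + t u)\<close>.\<close>

lemma C_cosetsI:
  assumes "\<And>n. x n \<in> carrier A" "\<And>n. \<exists>u\<in>carrier A. x (Suc n) = x n \<oplus> t [^] n \<otimes> u"
  shows "(\<lambda>n. I n +> x n) \<in> carrier C" "x n \<in> I n +> x n"
proof -
  show "x n \<in> I n +> x n" for n using mem_I_coset assms(1) by (intro iffD2[OF mem_I_coset] bexI[of _ \<zero>]) auto
  have "I (Suc n) +> x (Suc n) \<subseteq> I n +> x n" for n
  proof
    fix y assume "y \<in> I (Suc n) +> x (Suc n)"
    then obtain u where u: "u \<in> carrier A" "y = x (Suc n) \<oplus> t [^] Suc n \<otimes> u"
      using mem_I_coset assms(1) by blast
    obtain v where v: "v \<in> carrier A" "x (Suc n) = x n \<oplus> t [^] n \<otimes> v" using assms(2) by blast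
    have "y = x n \<oplus> t [^] n \<otimes> (v \<oplus> t \<otimes> u)"
      using u v assms(1)[of n] by (simp add: a_assoc r_distr m_assoc)
    then show "y \<in> I n +> x n" using mem_I_coset[OF assms(1)[of n]] u v by (metis a_closed m_closed t_closed)
  qed
  then show "(\<lambda>n. I n +> x n) \<in> carrier C"
    using assms(1) ideal.coset_in_Quot[OF ideal_I] by (simp add: C_simps)
qed

lemma C_mult_rep:
  assumes "f \<in> carrier C" "g \<in> carrier C" "x \<in> f n" "y \<in> g n"
  shows "(f \<otimes>\<^bsub>C\<^esub> g) n = I n +> (x \<otimes> y)" "x \<otimes> y \<in> (f \<otimes>\<^bsub>C\<^esub> g) n"
proof -
  have c: "x \<in> carrier A" "y \<in> carrier A" using assms C_carr by blast+
  show "(f \<otimes>\<^bsub>C\<^esub> g) n = I n +> (x \<otimes> y)"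
    using C_coset[OF assms(1,3)] C_coset[OF assms(2,4)] ideal.Quot_mult[OF ideal_I c] by (simp add: C_simps(2))
  then show "x \<otimes> y \<in> (f \<otimes>\<^bsub>C\<^esub> g) n"
    using c by (simp add: mem_I_coset) (intro bexI[of _ \<zero>]; simp)
qed

lemma C_add_rep:
  assumes "f \<in> carrier C" "g \<in> carrier C" "x \<in> f n" "y \<in> g n"
  shows "(f \<oplus>\<^bsub>C\<^esub> g) n = I n +> (x \<oplus> y)" "x \<oplus> y \<in> (f \<oplus>\<^bsub>C\<^esub> g) n"
proof -
  have c: "x \<in> carrier A" "y \<in> carrier A" using assms C_carr by blast+
  show "(f \<oplus>\<^bsub>C\<^esub> g) n = I n +> (x \<oplus> y)"
    using C_coset[OF assms(1,3)] C_coset[OF assms(2,4)] ideal.Quot_add[OF ideal_I c] by (simp add: C_simps(5))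
  then show "x \<oplus> y \<in> (f \<oplus>\<^bsub>C\<^esub> g) n"
    using c by (simp add: mem_I_coset) (intro bexI[of _ \<zero>]; simp)
qed

lemma to_completion_closed: "u \<in> carrier A \<Longrightarrow> to_completion A t u \<in> carrier C"
  and to_completion_rep: "u \<in> carrier A \<Longrightarrow> u \<in> to_completion A t u n"
proof -
  assume u: "u \<in> carrier A"
  have "\<exists>v\<in>carrier A. u = u \<oplus> t [^] n \<otimes> v" for n :: nat
    using u by (intro bexI[of _ \<zero>]) simp_all
  from C_cosetsI[of "\<lambda>_. u", OF u this]
  show "to_completion A t u \<in> carrier C" "u \<in> to_completion A t u n" by (simp_all add: to_completion_def)
qed

lemma C_one: "\<one>\<^bsub>C\<^esub> = to_completion A t \<one>"
  by (simp add: C_simps to_completion_def FactRing_def)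

lemma C_zero: "\<zero>\<^bsub>C\<^esub> = to_completion A t \<zero>"
  using ideal.Icarr[OF ideal_I] by (auto simp: C_simps to_completion_def FactRing_def a_r_coset_def')

lemma C_closed:
  assumes fg: "f \<in> carrier C" "g \<in> carrier C"
  shows "f \<otimes>\<^bsub>C\<^esub> g \<in> carrier C" "f \<oplus>\<^bsub>C\<^esub> g \<in> carrier C"
proof -
  obtain x y where xy: "\<And>n. x n \<in> f n" "\<And>n. y n \<in> g n" using C_rep_exists fg by metis
  have c: "x n \<in> carrier A" "y n \<in> carrier A" for n using xy C_carr fg by blast+
  have sx: "\<exists>u\<in>carrier A. x (Suc n) = x n \<oplus> t [^] n \<otimes> u" for n using C_diff[OF fg(1) xy(1)[of n]] C_rep_Suc fg xy by blast
  have sy: "\<exists>u\<in>carrier A. y (Suc n) = y n \<oplus> t [^] n \<otimes> u" for n using C_diff[OF fg(2) xy(2)[of n]] C_rep_Suc fg xy by blast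
  have m: "\<exists>u\<in>carrier A. x (Suc n) \<otimes> y (Suc n) = x n \<otimes> y n \<oplus> t [^] n \<otimes> u" for n
  proof -
    obtain u v where u: "u \<in> carrier A" "x (Suc n) = x n \<oplus> t [^] n \<otimes> u" and
      v: "v \<in> carrier A" "y (Suc n) = y n \<oplus> t [^] n \<otimes> v" using sx sy by metis
    have "x n \<otimes> (t [^] n \<otimes> v) = t [^] n \<otimes> (x n \<otimes> v)"
      using c v t_pow_central[OF c(1), of n n] by (simp flip: m_assoc)
    then have "x (Suc n) \<otimes> y (Suc n) = x n \<otimes> y n \<oplus> t [^] n \<otimes> (x n \<otimes> v \<oplus> u \<otimes> y (Suc n))"
      using u v c[of n] by (simp add: l_distr r_distr a_ac m_assoc)
    then show ?thesis using u v c by (intro bexI[of _ "x n \<otimes> v \<oplus> u \<otimes> y (Suc n)"]) auto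
  qed
  have a: "\<exists>u\<in>carrier A. x (Suc n) \<oplus> y (Suc n) = x n \<oplus> y n \<oplus> t [^] n \<otimes> u" for n
  proof -
    obtain u v where u: "u \<in> carrier A" "x (Suc n) = x n \<oplus> t [^] n \<otimes> u" and
      v: "v \<in> carrier A" "y (Suc n) = y n \<oplus> t [^] n \<otimes> v" using sx sy by metis
    have "x (Suc n) \<oplus> y (Suc n) = x n \<oplus> y n \<oplus> t [^] n \<otimes> (u \<oplus> v)"
      using u v c[of n] by (simp add: r_distr a_ac)
    then show ?thesis using u v c by (intro bexI[of _ "u \<oplus> v"]) auto
  qed
  have "f \<otimes>\<^bsub>C\<^esub> g = (\<lambda>n. I n +> (x n \<otimes> y n))" "f \<oplus>\<^bsub>C\<^esub> g = (\<lambda>n. I n +> (x n \<oplus> y n))"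
    using C_mult_rep(1)[OF fg xy] C_add_rep(1)[OF fg xy] by blast+
  then show "f \<otimes>\<^bsub>C\<^esub> g \<in> carrier C" "f \<oplus>\<^bsub>C\<^esub> g \<in> carrier C"
    using C_cosetsI(1)[OF _ m] C_cosetsI(1)[OF _ a] c by simp_all
qed

lemma C_pointwise: "f \<in> carrier C \<Longrightarrow> f n \<in> carrier (A Quot I n)"
  by (simp add: C_simps)

text \<open>The equational axioms hold componentwise in the quotient rings. Only closure and
  negatives involve the compatibility of the components.\<close>

lemma ring_C: "ring C"
proof -
  note Q = ring.ring_simprules[OF ring_Q] C_pointwise
  show ?thesis
proof (rule ringI)
  show "abelian_group C"
  proof (rule abelian_groupI)
    fix f assume f: "f \<in> carrier C"
    obtain x where x: "\<And>n. x n \<in> f n" using C_rep_exists f by metis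
    have c: "x n \<in> carrier A" for n using x C_carr f by blast
    have s: "\<exists>u\<in>carrier A. \<ominus> x (Suc n) = \<ominus> x n \<oplus> t [^] n \<otimes> u" for n
    proof -
      obtain u where "u \<in> carrier A" "x (Suc n) = x n \<oplus> t [^] n \<otimes> u"
        using C_diff[OF f x[of n]] C_rep_Suc f x by blast
      then show ?thesis using c[of n] by (intro bexI[of _ "\<ominus> u"]) (simp_all add: minus_add r_minus)
    qed
    let ?g = "\<lambda>n. I n +> (\<ominus> x n)"
    have g: "?g \<in> carrier C" "\<And>n. \<ominus> x n \<in> ?g n" using C_cosetsI[OF _ s] c by simp_all
    have "?g \<oplus>\<^bsub>C\<^esub> f = \<zero>\<^bsub>C\<^esub>"
    proof (rule C_eqI)
      show "?g \<oplus>\<^bsub>C\<^esub> f \<in> carrier C" using C_closed g f by blast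
      show "\<zero>\<^bsub>C\<^esub> \<in> carrier C" unfolding C_zero by (simp add: to_completion_closed)
      fix n show "\<exists>z. z \<in> (?g \<oplus>\<^bsub>C\<^esub> f) n \<and> z \<in> \<zero>\<^bsub>C\<^esub> n"
        using C_add_rep(2)[OF g(1) f g(2)[of n] x] c[of n] unfolding C_zero
        by (intro exI[of _ \<zero>]) (simp add: l_neg to_completion_rep)
    qed
    with g show "\<exists>y\<in>carrier C. y \<oplus>\<^bsub>C\<^esub> f = \<zero>\<^bsub>C\<^esub>" by blast
  next
    show "\<zero>\<^bsub>C\<^esub> \<in> carrier C" unfolding C_zero by (simp add: to_completion_closed)
  qed (simp_all add: C_closed, simp_all add: C_simps(4,5) Q)
  show "Group.monoid C"
  proof (rule monoidI)
    show "\<one>\<^bsub>C\<^esub> \<in> carrier C" unfolding C_one by (simp add: to_completion_closed)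
  qed (simp_all add: C_closed, simp_all add: C_simps(2,3) Q monoid.r_one[OF ring.is_monoid[OF ring_Q]])
qed (simp_all add: C_simps(2,5) Q)
qed

end

section \<open>Tensor products\<close>

text \<open>The homomorphism from the free abelian group to the field that extends \<open>h\<close>.
  Bilinear maps are evaluated on tensors with it.\<close>

definition frag_sum :: "('a \<Rightarrow> 'k::comm_ring_1) \<Rightarrow> ('a \<Rightarrow>\<^sub>0 int) \<Rightarrow> 'k" where
  "frag_sum h c = (\<Sum>x\<in>Poly_Mapping.keys c. of_int (Poly_Mapping.lookup c x) * h x)"

lemma frag_sum_superset:
  "finite S \<Longrightarrow> Poly_Mapping.keys c \<subseteq> S \<Longrightarrow>
    frag_sum h c = (\<Sum>x\<in>S. of_int (Poly_Mapping.lookup c x) * h x)"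
  unfolding frag_sum_def by (intro sum.mono_neutral_left) (auto simp: in_keys_iff)

lemma frag_sum_0 [simp]: "frag_sum h 0 = 0"
  by (simp add: frag_sum_def)

lemma frag_sum_of [simp]: "frag_sum h (frag_of x) = h x"
  by (simp add: frag_sum_def)

lemma frag_sum_diff: "frag_sum h (c - d) = frag_sum h c - frag_sum h d"
proof -
  let ?S = "Poly_Mapping.keys c \<union> Poly_Mapping.keys d"
  have "Poly_Mapping.keys (c - d) \<subseteq> ?S" by (rule keys_diff)
  then show ?thesis
    by (simp add: frag_sum_superset[of ?S] lookup_minus left_diff_distrib sum_subtractf)
qed

lemma frag_sum_add: "frag_sum h (c + d) = frag_sum h c + frag_sum h d"
  using frag_sum_diff[of h "c + d" d] by simp

lemma frag_extend_fun_diff: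
  "frag_extend (\<lambda>x. f x - g x) c = frag_extend f c - frag_extend g c"
  by (rule frag_induction[of c UNIV]) (simp_all add: frag_extend_diff)

locale tensor =
  fixes M :: "('a, 'x) monoid_scheme" and N :: "('b, 'y) monoid_scheme" and S :: "'s set"
    and ra :: "'a \<Rightarrow> 's \<Rightarrow> 'a" and la :: "'s \<Rightarrow> 'b \<Rightarrow> 'b"
  assumes comm_group_M: "comm_group M" and comm_group_N: "comm_group N"
    and ra_closed: "m \<in> carrier M \<Longrightarrow> s \<in> S \<Longrightarrow> ra m s \<in> carrier M"
    and la_closed: "n \<in> carrier N \<Longrightarrow> s \<in> S \<Longrightarrow> la s n \<in> carrier N"
begin

abbreviation "P \<equiv> carrier M \<times> carrier N"
abbreviation "F \<equiv> free_Abelian_group P"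
abbreviation "Ker \<equiv> tensor_kernel M N S ra la"
abbreviation "cls \<equiv> tensor_class M N S ra la"
abbreviation "T \<equiv> tensor_product M N S ra la"

lemma relators_subset: "tensor_relators M N S ra la \<subseteq> carrier F"
proof -
  interpret M: comm_group M by (rule comm_group_M)
  interpret N: comm_group N by (rule comm_group_N)
  have fr: "frag_of x \<in> carrier F" if "x \<in> P" for x using that by simp
  have d: "a - b \<in> carrier F" if "a \<in> carrier F" "b \<in> carrier F" for a b
    using that keys_diff[of a b] by auto
  show ?thesis
    unfolding tensor_relators_def
    by (intro Un_least subsetI; elim CollectE exE conjE; simp only:; intro d fr)
      (simp_all add: ra_closed la_closed)
qed

lemma Ker_subgroup: "subgroup Ker F"
  unfolding tensor_kernel_def
  by (rule group.generate_is_subgroup[OF group_free_Abelian_group relators_subset])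

lemma Ker_0: "0 \<in> Ker" and Ker_add: "c \<in> Ker \<Longrightarrow> d \<in> Ker \<Longrightarrow> c + d \<in> Ker"
  and Ker_keys: "c \<in> Ker \<Longrightarrow> Poly_Mapping.keys c \<subseteq> P"
  and Ker_minus: "c \<in> Ker \<Longrightarrow> - c \<in> Ker"
proof -
  interpret K: subgroup Ker F by (rule Ker_subgroup)
  show "0 \<in> Ker" using K.one_closed by simp
  show "c \<in> Ker \<Longrightarrow> d \<in> Ker \<Longrightarrow> c + d \<in> Ker" using K.m_closed by simp
  show k: "c \<in> Ker \<Longrightarrow> Poly_Mapping.keys c \<subseteq> P" for c
    using K.mem_carrier[of c] by (simp only: carrier_free_Abelian_group_iff)
  show "c \<in> Ker \<Longrightarrow> - c \<in> Ker" using K.m_inv_closed[of c] k inv_free_Abelian_group by metis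
qed

lemma Ker_diff: "c \<in> Ker \<Longrightarrow> d \<in> Ker \<Longrightarrow> c - d \<in> Ker"
  using Ker_add[of c "- d"] Ker_minus by simp

lemma Ker_rel: "c \<in> tensor_relators M N S ra la \<Longrightarrow> c \<in> Ker"
  unfolding tensor_kernel_def by (rule generate.incl)

text \<open>Closure under differences covers the other two generation rules: the inverse of
  \<open>h\<close> is \<open>0 - h\<close>, and a sum is \<open>c - (0 - d)\<close>.\<close>

lemma Ker_induct [consumes 1, case_names zero rel diff]:
  assumes "c \<in> Ker" "Q 0" "\<And>c. c \<in> tensor_relators M N S ra la \<Longrightarrow> Q c"
    "\<And>c d. Q c \<Longrightarrow> Q d \<Longrightarrow> Q (c - d)"
  shows "Q c"
  using assms(1) unfolding tensor_kernel_def
proof (induction rule: generate.induct)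
  case (inv h)
  have "h \<in> carrier F" using inv relators_subset by blast
  then have "Poly_Mapping.keys h \<subseteq> P" by (simp only: carrier_free_Abelian_group_iff)
  then have "inv\<^bsub>F\<^esub> h = 0 - h" by simp
  then show ?case using assms(2,4) assms(3)[OF inv] by metis
next
  case (eng c d)
  then have "Q (c - (0 - d))" using assms(2,4) by blast
  then show ?case by simp
qed (use assms in auto)

lemma mem_cls_iff: "d \<in> cls c \<longleftrightarrow> d - c \<in> Ker"
  by (auto simp: tensor_class_def r_coset_def intro!: bexI[of _ "d - c"])

lemma self_mem_cls: "c \<in> cls c"
  by (simp add: mem_cls_iff Ker_0)

lemma cls_eq_iff: "cls c = cls d \<longleftrightarrow> c - d \<in> Ker"
proof
  assume "cls c = cls d"
  then show "c - d \<in> Ker" using self_mem_cls[of c] by (simp add: mem_cls_iff)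
next
  assume cd: "c - d \<in> Ker"
  show "cls c = cls d"
  proof (rule Set.set_eqI)
    fix x
    show "x \<in> cls c \<longleftrightarrow> x \<in> cls d"
      using Ker_add[OF _ cd, of "x - c"] Ker_diff[OF _ cd, of "x - d"] by (auto simp: mem_cls_iff)
  qed
qed

lemma carrier_T: "V \<in> carrier T \<longleftrightarrow> (\<exists>c. Poly_Mapping.keys c \<subseteq> P \<and> V = cls c)"
proof -
  have "V \<in> carrier T \<longleftrightarrow> (\<exists>c\<in>carrier F. V = Ker #>\<^bsub>F\<^esub> c)"
    unfolding tensor_product_def FactGroup_def RCOSETS_def by auto
  then show ?thesis unfolding tensor_class_def by (simp only: carrier_free_Abelian_group_iff Bex_def)
qed

lemma cls_in_T: "Poly_Mapping.keys c \<subseteq> P \<Longrightarrow> cls c \<in> carrier T"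
  by (auto simp: carrier_T)

lemma normal_Ker: "Ker \<lhd> F"
  by (rule comm_group.subgroup_imp_normal[OF abelian_free_Abelian_group Ker_subgroup])

lemma T_mult: "Poly_Mapping.keys c \<subseteq> P \<Longrightarrow> Poly_Mapping.keys d \<subseteq> P \<Longrightarrow> cls c \<otimes>\<^bsub>T\<^esub> cls d = cls (c + d)"
  using normal.rcos_sum[OF normal_Ker, of c d] by (simp add: tensor_product_def FactGroup_def tensor_class_def)

lemma T_one: "\<one>\<^bsub>T\<^esub> = cls 0"
proof -
  have "cls 0 = Ker" by (auto simp: mem_cls_iff)
  then show ?thesis by (simp add: tensor_product_def FactGroup_def)
qed

lemma comm_group_T: "comm_group T"
  unfolding tensor_product_def
  by (rule comm_group.abelian_FactGroup[OF abelian_free_Abelian_group Ker_subgroup])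

lemma cls_add_left:
  assumes "m \<in> carrier M" "m' \<in> carrier M" "n \<in> carrier N"
  shows "cls (frag_of (m \<otimes>\<^bsub>M\<^esub> m', n)) = cls (frag_of (m, n) + frag_of (m', n))"
  unfolding cls_eq_iff diff_diff_eq[symmetric] by (rule Ker_rel) (use assms in \<open>auto simp: tensor_relators_def\<close>)

lemma cls_add_right:
  assumes "m \<in> carrier M" "n' \<in> carrier N" "n \<in> carrier N"
  shows "cls (frag_of (m, n \<otimes>\<^bsub>N\<^esub> n')) = cls (frag_of (m, n) + frag_of (m, n'))"
  unfolding cls_eq_iff diff_diff_eq[symmetric] by (rule Ker_rel) (use assms in \<open>auto simp: tensor_relators_def\<close>)

lemma cls_balance:
  assumes "m \<in> carrier M" "s \<in> S" "n \<in> carrier N"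
  shows "cls (frag_of (ra m s, n)) = cls (frag_of (m, la s n))"
  unfolding cls_eq_iff by (rule Ker_rel) (use assms in \<open>auto simp: tensor_relators_def\<close>)

text \<open>The universal property of the tensor product: bilinear and balanced functions do not
  depend on the representative.\<close>

lemma frag_sum_Ker:
  fixes h :: "'a \<times> 'b \<Rightarrow> 'k::comm_ring_1"
  assumes "c \<in> Ker"
    and "\<And>m m' n. m \<in> carrier M \<Longrightarrow> m' \<in> carrier M \<Longrightarrow> n \<in> carrier N \<Longrightarrow>
      h (m \<otimes>\<^bsub>M\<^esub> m', n) = h (m, n) + h (m', n)"
    and "\<And>m n n'. m \<in> carrier M \<Longrightarrow> n \<in> carrier N \<Longrightarrow> n' \<in> carrier N \<Longrightarrow>
      h (m, n \<otimes>\<^bsub>N\<^esub> n') = h (m, n) + h (m, n')"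
    and "\<And>m s n. m \<in> carrier M \<Longrightarrow> s \<in> S \<Longrightarrow> n \<in> carrier N \<Longrightarrow> h (ra m s, n) = h (m, la s n)"
  shows "frag_sum h c = 0"
  using assms(1)
proof (induction rule: Ker_induct)
  case (rel c)
  then show ?case using assms(2-4) unfolding tensor_relators_def by (auto simp: frag_sum_diff)
qed (simp_all add: frag_sum_diff)

lemma frag_extend_Ker:
  assumes "c \<in> Ker" "\<And>c. c \<in> tensor_relators M N S ra la \<Longrightarrow> frag_extend h c \<in> K'"
    and "0 \<in> K'" "\<And>c d. c \<in> K' \<Longrightarrow> d \<in> K' \<Longrightarrow> c - d \<in> K'"
  shows "frag_extend h c \<in> K'"
  using assms(1) by (induction rule: Ker_induct) (use assms in \<open>auto simp: frag_extend_diff\<close>)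

end

text \<open>The integral monoid ring of the set of pairs, of which the tensor algebra is a quotient.\<close>

definition pair_mult :: "('a, 'x) ring_scheme \<Rightarrow> ('b, 'y) ring_scheme \<Rightarrow>
    ('a \<times> 'b \<Rightarrow>\<^sub>0 int) \<Rightarrow> ('a \<times> 'b \<Rightarrow>\<^sub>0 int) \<Rightarrow> ('a \<times> 'b \<Rightarrow>\<^sub>0 int)" where
  "pair_mult A B c d = frag_extend (\<lambda>(a, b).
     frag_extend (\<lambda>(a', b'). frag_of (a \<otimes>\<^bsub>A\<^esub> a', b \<otimes>\<^bsub>B\<^esub> b')) d) c"

definition pair_ring :: "('a, 'x) ring_scheme \<Rightarrow> ('b, 'y) ring_scheme \<Rightarrow> ('a \<times> 'b \<Rightarrow>\<^sub>0 int) ring" where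
  "pair_ring A B = \<lparr>carrier = {c. Poly_Mapping.keys c \<subseteq> carrier A \<times> carrier B},
     monoid.mult = pair_mult A B, monoid.one = frag_of (\<one>\<^bsub>A\<^esub>, \<one>\<^bsub>B\<^esub>), ring.zero = 0, ring.add = (+)\<rparr>"

lemma pair_mult_of [simp]:
  "pair_mult A B (frag_of (a, b)) (frag_of (a', b')) = frag_of (a \<otimes>\<^bsub>A\<^esub> a', b \<otimes>\<^bsub>B\<^esub> b')"
  by (simp add: pair_mult_def)

lemma pair_mult_diff_left: "pair_mult A B (c - c') d = pair_mult A B c d - pair_mult A B c' d"
  by (simp add: pair_mult_def frag_extend_diff)

lemma pair_mult_diff_right: "pair_mult A B c (d - d') = pair_mult A B c d - pair_mult A B c d'"
  unfolding pair_mult_def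
  by (simp add: frag_extend_diff case_prod_unfold frag_extend_fun_diff)

lemma pair_mult_0 [simp]: "pair_mult A B 0 d = 0" "pair_mult A B c 0 = 0"
  using pair_mult_diff_left[of A B 0 0 d] pair_mult_diff_right[of A B c 0 0] by simp_all

lemma pair_mult_add_left: "pair_mult A B (c + c') d = pair_mult A B c d + pair_mult A B c' d"
  using pair_mult_diff_left[of A B "c + c'" c' d] by simp

lemma pair_mult_add_right: "pair_mult A B c (d + d') = pair_mult A B c d + pair_mult A B c d'"
  using pair_mult_diff_right[of A B c "d + d'" d'] by simp

text \<open>All laws are additive in each argument, so induction on one argument after the other
  reduces them to pairs, where they hold componentwise.\<close>

lemma ring_pair_ring:
  assumes "ring A" "ring B" shows "ring (pair_ring A B)"
proof -
  interpret A: ring A by fact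
  interpret B: ring B by fact
  let ?P = "carrier A \<times> carrier B"
  let ?m = "pair_mult A B"
  have diff: "Poly_Mapping.keys (c - d) \<subseteq> ?P"
    if "Poly_Mapping.keys c \<subseteq> ?P" "Poly_Mapping.keys d \<subseteq> ?P" for c d :: "_ \<Rightarrow>\<^sub>0 int"
    using keys_diff[of c d] that by blast
  have 1: "Poly_Mapping.keys (?m c (frag_of y)) \<subseteq> ?P" if "Poly_Mapping.keys c \<subseteq> ?P" "y \<in> ?P" for c y
    using that(1)
  proof (induction rule: frag_induction)
    case (one x)
    then show ?case using that(2) by (cases x; cases y) auto
  qed (simp_all add: pair_mult_diff_left diff)
  have closed: "Poly_Mapping.keys (?m c d) \<subseteq> ?P"
    if "Poly_Mapping.keys c \<subseteq> ?P" "Poly_Mapping.keys d \<subseteq> ?P" for c d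
    using that(2)
    by (induction rule: frag_induction) (simp_all add: pair_mult_diff_right diff 1 that(1))
  have a1: "?m (?m c (frag_of y)) (frag_of z) = ?m c (?m (frag_of y) (frag_of z))"
    if "Poly_Mapping.keys c \<subseteq> ?P" "y \<in> ?P" "z \<in> ?P" for c y z
    using that(1)
  proof (induction rule: frag_induction)
    case (one x)
    then show ?case using that by (cases x; cases y; cases z) (auto simp: A.m_assoc B.m_assoc)
  qed (simp_all add: pair_mult_diff_left)
  have a2: "?m (?m c d) (frag_of z) = ?m c (?m d (frag_of z))"
    if "Poly_Mapping.keys c \<subseteq> ?P" "Poly_Mapping.keys d \<subseteq> ?P" "z \<in> ?P" for c d z
    using that(2)
    by (induction rule: frag_induction)
      (simp_all add: pair_mult_diff_left pair_mult_diff_right a1[OF that(1)] that(3))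
  have assoc: "?m (?m c d) e = ?m c (?m d e)"
    if "Poly_Mapping.keys c \<subseteq> ?P" "Poly_Mapping.keys d \<subseteq> ?P" "Poly_Mapping.keys e \<subseteq> ?P" for c d e
    using that(3)
    by (induction rule: frag_induction)
      (simp_all add: pair_mult_diff_right a2[OF that(1,2)])
  have addc: "Poly_Mapping.keys (c + d) \<subseteq> ?P"
    if "Poly_Mapping.keys c \<subseteq> ?P" "Poly_Mapping.keys d \<subseteq> ?P" for c d :: "_ \<Rightarrow>\<^sub>0 int"
    using keys_add[of c d] that by blast
  have l1: "?m (frag_of (\<one>\<^bsub>A\<^esub>, \<one>\<^bsub>B\<^esub>)) c = c" if "Poly_Mapping.keys c \<subseteq> ?P" for c
    using that
  proof (induction rule: frag_induction)
    case (one x)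
    then show ?case by (cases x) auto
  qed (simp_all add: pair_mult_diff_right)
  have r1: "?m c (frag_of (\<one>\<^bsub>A\<^esub>, \<one>\<^bsub>B\<^esub>)) = c" if "Poly_Mapping.keys c \<subseteq> ?P" for c
    using that
  proof (induction rule: frag_induction)
    case (one x)
    then show ?case by (cases x) auto
  qed (simp_all add: pair_mult_diff_left)
  show ?thesis
  proof (rule ringI)
    show "abelian_group (pair_ring A B)"
    proof (rule abelian_groupI)
      fix c assume "c \<in> carrier (pair_ring A B)"
      then show "\<exists>d\<in>carrier (pair_ring A B). d \<oplus>\<^bsub>pair_ring A B\<^esub> c = \<zero>\<^bsub>pair_ring A B\<^esub>"
        by (intro bexI[of _ "- c"]) (auto simp: pair_ring_def)
    qed (simp_all add: pair_ring_def add_ac addc)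
    show "Group.monoid (pair_ring A B)"
      by (rule monoidI) (simp_all add: pair_ring_def assoc l1 r1 closed)
  qed (simp_all add: pair_ring_def pair_mult_add_left pair_mult_add_right)
qed

locale tensor_alg = A: ring A + B: ring B + tensor "add_monoid A" "add_monoid B" S ra la
  for A :: "('a, 'x) ring_scheme" and B :: "('b, 'y) ring_scheme" and S :: "'s set" and ra la +
  assumes ra_left: "a \<in> carrier A \<Longrightarrow> m \<in> carrier A \<Longrightarrow> s \<in> S \<Longrightarrow> a \<otimes>\<^bsub>A\<^esub> ra m s = ra (a \<otimes>\<^bsub>A\<^esub> m) s"
    and ra_right: "a \<in> carrier A \<Longrightarrow> m \<in> carrier A \<Longrightarrow> s \<in> S \<Longrightarrow> ra m s \<otimes>\<^bsub>A\<^esub> a = ra (m \<otimes>\<^bsub>A\<^esub> a) s"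
    and la_left: "b \<in> carrier B \<Longrightarrow> n \<in> carrier B \<Longrightarrow> s \<in> S \<Longrightarrow> b \<otimes>\<^bsub>B\<^esub> la s n = la s (b \<otimes>\<^bsub>B\<^esub> n)"
    and la_right: "b \<in> carrier B \<Longrightarrow> n \<in> carrier B \<Longrightarrow> s \<in> S \<Longrightarrow> la s n \<otimes>\<^bsub>B\<^esub> b = la s (n \<otimes>\<^bsub>B\<^esub> b)"
begin

abbreviation "TA \<equiv> tensor_algebra A B S ra la"
abbreviation "R0 \<equiv> pair_ring A B"

text \<open>A pair times a relator is again a relator. For the balance relators this is where the
  scalars must commute with multiplication on either side in both factors.\<close>

lemma Ker_mult_of:
  assumes "c \<in> Ker" "a \<in> carrier A" "b \<in> carrier B"
  shows "pair_mult A B (frag_of (a, b)) c \<in> Ker" "pair_mult A B c (frag_of (a, b)) \<in> Ker"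
proof -
  show "pair_mult A B (frag_of (a, b)) c \<in> Ker"
    using assms(1)
  proof (induction rule: Ker_induct)
    case (rel c)
    show ?case
    proof (rule Ker_rel)
      show "pair_mult A B (frag_of (a, b)) c \<in> tensor_relators (add_monoid A) (add_monoid B) S ra la"
        using rel assms(2,3) unfolding tensor_relators_def
        by (elim UnE CollectE exE conjE)
          (auto simp: pair_mult_diff_right A.r_distr B.r_distr ra_left la_left intro: A.m_closed B.m_closed; 
            use A.m_closed B.m_closed in blast)+
    qed
  qed (simp_all add: pair_mult_diff_right Ker_0 Ker_diff)
  show "pair_mult A B c (frag_of (a, b)) \<in> Ker"
    using assms(1)
  proof (induction rule: Ker_induct)
    case (rel c)
    show ?case
    proof (rule Ker_rel)
      show "pair_mult A B c (frag_of (a, b)) \<in> tensor_relators (add_monoid A) (add_monoid B) S ra la"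
        using rel assms(2,3) unfolding tensor_relators_def
        by (elim UnE CollectE exE conjE)
          (auto simp: pair_mult_diff_left A.l_distr B.l_distr ra_right la_right intro: A.m_closed B.m_closed; 
            use A.m_closed B.m_closed in blast)+
    qed
  qed (simp_all add: pair_mult_diff_left Ker_0 Ker_diff)
qed

lemma ideal_Ker: "ideal Ker R0"
proof (rule idealI)
  show "ring R0" by (rule ring_pair_ring) unfold_locales
  have "add_monoid R0 = F" by (simp add: pair_ring_def free_Abelian_group_def)
  then show "subgroup Ker (add_monoid R0)" using Ker_subgroup by simp
  fix c d assume c: "c \<in> Ker" and "d \<in> carrier R0"
  then have "Poly_Mapping.keys d \<subseteq> carrier A \<times> carrier B" by (simp add: pair_ring_def)
  then have "pair_mult A B d c \<in> Ker \<and> pair_mult A B c d \<in> Ker"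
  proof (induction rule: frag_induction)
    case (one x)
    then show ?case using Ker_mult_of[OF c] by (cases x) auto
  qed (simp_all add: Ker_0 Ker_diff pair_mult_diff_left pair_mult_diff_right)
  then show "d \<otimes>\<^bsub>R0\<^esub> c \<in> Ker" "c \<otimes>\<^bsub>R0\<^esub> d \<in> Ker" by (simp_all add: pair_ring_def)
qed

lemma coset_eq_cls: "Ker +>\<^bsub>R0\<^esub> c = cls c"
  by (simp add: a_r_coset_def r_coset_def tensor_class_def pair_ring_def)

text \<open>The multiplication by unions over representatives is literally that of the quotient of
  the pair ring by the ideal \<open>Ker\<close>. Well-definedness and the ring laws are therefore
  inherited.\<close>

lemma TA_eq: "TA = R0 Quot Ker"
proof -
  have "carrier T = a_rcosets\<^bsub>R0\<^esub> Ker"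
    by (rule Set.set_eqI, simp only: carrier_T coset_eq_cls[symmetric] A_RCOSETS_def a_r_coset_def)
      (simp only: RCOSETS_def a_r_coset_def, simp add: pair_ring_def Bex_def)
  moreover have "(\<otimes>\<^bsub>T\<^esub>) = set_add R0"
    by (intro ext) (simp add: tensor_product_def FactGroup_def set_add_def set_mult_def pair_ring_def)
  moreover have "(\<lambda>V W. \<Union>c\<in>V. \<Union>d\<in>W. cls (pair_mult A B c d)) = rcoset_mult R0 Ker"
    by (intro ext) (simp add: rcoset_mult_def coset_eq_cls, simp add: pair_ring_def)
  moreover have "\<one>\<^bsub>T\<^esub> = Ker" by (simp add: tensor_product_def FactGroup_def)
  ultimately show ?thesis
    unfolding tensor_algebra_def FactRing_def Let_def pair_mult_def
    by (simp add: coset_eq_cls, simp add: pair_ring_def)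
qed

lemma ring_TA: "ring TA"
  unfolding TA_eq by (rule ideal.quotient_is_ring[OF ideal_Ker])

lemma carrier_TA: "carrier TA = carrier T"
  by (simp add: tensor_algebra_def Let_def)

lemma TA_add: "V \<oplus>\<^bsub>TA\<^esub> W = V \<otimes>\<^bsub>T\<^esub> W"
  by (simp add: tensor_algebra_def Let_def)

lemma TA_zero: "\<zero>\<^bsub>TA\<^esub> = cls 0"
  by (simp add: tensor_algebra_def Let_def T_one)

lemma TA_one: "\<one>\<^bsub>TA\<^esub> = cls (frag_of (\<one>\<^bsub>A\<^esub>, \<one>\<^bsub>B\<^esub>))"
  by (simp add: tensor_algebra_def Let_def)

lemma TA_mult: "Poly_Mapping.keys c \<subseteq> P \<Longrightarrow> Poly_Mapping.keys d \<subseteq> P \<Longrightarrow>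
    cls c \<otimes>\<^bsub>TA\<^esub> cls d = cls (pair_mult A B c d)"
  using ideal.Quot_mult[OF ideal_Ker, of c d] unfolding TA_eq coset_eq_cls by (simp add: pair_ring_def)

end

section \<open>Induced modules\<close>

locale induced =
  A: ring A + N: abelian_group N +
  tensor "add_monoid A" "add_monoid N" "carrier R" "\<lambda>a r. a \<otimes>\<^bsub>A\<^esub> \<phi> r" "\<lambda>r n. r \<odot>\<^bsub>N\<^esub> n"
  for A :: "('a, 'x) ring_scheme" and R :: "('r, 'y) ring_scheme" and \<phi>
    and N :: "('r, 'b, 'z) module_scheme" +
  assumes phi_closed: "r \<in> carrier R \<Longrightarrow> \<phi> r \<in> carrier A"
begin

abbreviation "D \<equiv> induced_module A R \<phi> N"

definition tr :: "'a \<Rightarrow> ('a \<times> 'b \<Rightarrow>\<^sub>0 int) \<Rightarrow> ('a \<times> 'b \<Rightarrow>\<^sub>0 int)" where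
  "tr a = frag_extend (\<lambda>(x, n). frag_of (a \<otimes>\<^bsub>A\<^esub> x, n))"

lemma tr_of [simp]: "tr a (frag_of (x, n)) = frag_of (a \<otimes>\<^bsub>A\<^esub> x, n)"
  by (simp add: tr_def)

lemma tr_diff: "tr a (c - d) = tr a c - tr a d"
  by (simp add: tr_def frag_extend_diff)

lemma tr_0 [simp]: "tr a 0 = 0"
  by (simp add: tr_def)

lemma tr_add: "tr a (c + d) = tr a c + tr a d"
  by (simp add: tr_def frag_extend_add)

lemma D_simps:
  "carrier D = carrier T" "\<zero>\<^bsub>D\<^esub> = cls 0" "V \<oplus>\<^bsub>D\<^esub> W = V \<otimes>\<^bsub>T\<^esub> W"
  "a \<odot>\<^bsub>D\<^esub> V = (\<Union>c\<in>V. cls (tr a c))"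
  by (simp_all add: induced_module_def Let_def T_one tr_def)

lemma tr_keys: "a \<in> carrier A \<Longrightarrow> Poly_Mapping.keys c \<subseteq> P \<Longrightarrow> Poly_Mapping.keys (tr a c) \<subseteq> P"
proof -
  assume a: "a \<in> carrier A" and c: "Poly_Mapping.keys c \<subseteq> P"
  from c show ?thesis
  proof (induction rule: frag_induction)
    case (one x)
    then show ?case using a by (cases x) auto
  next
    case (diff c d)
    then show ?case using keys_diff[of "tr a c" "tr a d"] by (auto simp: tr_diff)
  qed simp
qed

lemma tr_Ker:
  assumes "a \<in> carrier A" "c \<in> Ker" shows "tr a c \<in> Ker"
  using assms(2)
proof (induction rule: Ker_induct)
  case (rel c)
  show ?case
  proof (rule Ker_rel)
    show "tr a c \<in> tensor_relators (add_monoid A) (add_monoid N) (carrier R) (\<lambda>a r. a \<otimes>\<^bsub>A\<^esub> \<phi> r) (\<lambda>r n. r \<odot>\<^bsub>N\<^esub> n)"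
      using rel assms(1) unfolding tensor_relators_def
      by (elim UnE CollectE exE conjE)
        (auto simp: tr_diff A.r_distr A.m_assoc[symmetric] phi_closed; use A.m_closed in blast)+
  qed
qed (simp_all add: tr_diff Ker_0 Ker_diff)

lemma smult_cls: "a \<in> carrier A \<Longrightarrow> a \<odot>\<^bsub>D\<^esub> cls c = cls (tr a c)"
proof -
  assume a: "a \<in> carrier A"
  have "cls (tr a d) = cls (tr a c)" if "d \<in> cls c" for d
    using tr_Ker[OF a, of "d - c"] that by (simp add: mem_cls_iff cls_eq_iff tr_diff)
  then show ?thesis unfolding D_simps using self_mem_cls[of c] by blast
qed

text \<open>Associativity and the unit law already hold for representatives. Additivity in the
  scalar holds only modulo \<open>Ker\<close>, by the relators for the left factor.\<close>

lemma left_module_D: "left_module A D"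
proof -
  interpret T: comm_group T by (rule comm_group_T)
  have T1: "cls 0 = \<one>\<^bsub>T\<^esub>" by (simp add: T_one)
  have abel: "abelian_group D"
    by (rule abelian_groupI)
      (simp_all add: D_simps(1-3) T1 T.m_ac T.l_inv_ex)
  have P: "\<And>V. V \<in> carrier T \<Longrightarrow> \<exists>c. Poly_Mapping.keys c \<subseteq> P \<and> V = cls c" by (simp add: carrier_T)
  have distr: "cls (tr (a \<oplus>\<^bsub>A\<^esub> b) c) = cls (tr a c + tr b c)"
    if "a \<in> carrier A" "b \<in> carrier A" "Poly_Mapping.keys c \<subseteq> P" for a b c
    using that(3)
  proof (induction rule: frag_induction)
    case (one x)
    then show ?case using that cls_add_left[of "a \<otimes>\<^bsub>A\<^esub> fst x" "b \<otimes>\<^bsub>A\<^esub> fst x" "snd x"]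
      by (cases x) (auto simp: A.l_distr)
  next
    case (diff c d)
    then have "(tr (a \<oplus>\<^bsub>A\<^esub> b) c - (tr a c + tr b c)) - (tr (a \<oplus>\<^bsub>A\<^esub> b) d - (tr a d + tr b d)) \<in> Ker"
      unfolding cls_eq_iff by (rule Ker_diff)
    then show ?case by (simp add: cls_eq_iff tr_diff algebra_simps)
  qed simp
  have assoc: "tr (a \<otimes>\<^bsub>A\<^esub> b) c = tr a (tr b c)"
    if "a \<in> carrier A" "b \<in> carrier A" "Poly_Mapping.keys c \<subseteq> P" for a b c
    using that(3)
  proof (induction rule: frag_induction)
    case (one x)
    then show ?case using that by (cases x) (auto simp: A.m_assoc)
  qed (simp_all add: tr_diff)
  have one: "tr \<one>\<^bsub>A\<^esub> c = c" if "Poly_Mapping.keys c \<subseteq> P" for c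
    using that
  proof (induction rule: frag_induction)
    case (one x)
    then show ?case by (cases x) auto
  qed (simp_all add: tr_diff)
  show ?thesis
  proof (intro left_module.intro left_module_axioms.intro abel A.ring_axioms)
    fix a V assume "a \<in> carrier A" "V \<in> carrier D"
    then show "a \<odot>\<^bsub>D\<^esub> V \<in> carrier D"
      using P[of V] smult_cls tr_keys cls_in_T by (auto simp: D_simps(1) simp del: mem_Times_iff)
  next
    fix a b V assume "a \<in> carrier A" "b \<in> carrier A" "V \<in> carrier D"
    then show "(a \<oplus>\<^bsub>A\<^esub> b) \<odot>\<^bsub>D\<^esub> V = a \<odot>\<^bsub>D\<^esub> V \<oplus>\<^bsub>D\<^esub> b \<odot>\<^bsub>D\<^esub> V"
      using P[of V] distr tr_keys by (auto simp: D_simps(1,3) smult_cls T_mult)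
  next
    fix a V W assume "a \<in> carrier A" "V \<in> carrier D" "W \<in> carrier D"
    then obtain c d where a: "a \<in> carrier A" and c: "Poly_Mapping.keys c \<subseteq> P" "V = cls c"
      and d: "Poly_Mapping.keys d \<subseteq> P" "W = cls d" using P[of V] P[of W] by (auto simp: D_simps(1))
    show "a \<odot>\<^bsub>D\<^esub> (V \<oplus>\<^bsub>D\<^esub> W) = a \<odot>\<^bsub>D\<^esub> V \<oplus>\<^bsub>D\<^esub> a \<odot>\<^bsub>D\<^esub> W"
      unfolding c(2) d(2) D_simps(3) T_mult[OF c(1) d(1)] smult_cls[OF a]
        T_mult[OF tr_keys[OF a c(1)] tr_keys[OF a d(1)]] tr_add ..
  next
    fix a b V assume "a \<in> carrier A" "b \<in> carrier A" "V \<in> carrier D"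
    then show "(a \<otimes>\<^bsub>A\<^esub> b) \<odot>\<^bsub>D\<^esub> V = a \<odot>\<^bsub>D\<^esub> (b \<odot>\<^bsub>D\<^esub> V)"
      using P[of V] assoc by (auto simp: D_simps(1) smult_cls)
  next
    fix V assume "V \<in> carrier D"
    then show "\<one>\<^bsub>A\<^esub> \<odot>\<^bsub>D\<^esub> V = V"
      using P[of V] one by (auto simp: D_simps(1) smult_cls)
  qed
qed

end

section \<open>Lattices\<close>

text \<open>\<open>L_sep\<close> and \<open>L_span\<close> are the two halves of being a lattice in
  usable form: no vector is infinitely divisible, and every vector is carried into \<open>L\<close>
  by a power of \<open>\<pi>\<close>. \<open>N\<close> is a fixed bound for the nilpotency class; it
  also bounds the sums in the definition of the action.\<close>

locale lie_setup = complete_dvf absv \<pi> + lie_algebra scale bracket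
  for absv :: "'k::field \<Rightarrow> real" and \<pi> :: 'k
    and scale :: "'k \<Rightarrow> 'g::ab_group_add \<Rightarrow> 'g" and bracket :: "'g \<Rightarrow> 'g \<Rightarrow> 'g" +
  fixes L :: "'g set" and lam :: "'g \<Rightarrow> 'k" and N :: nat
  assumes finite_dim: "\<exists>basis. finite_dimensional_vector_space scale basis"
    and nilp: "lower_central N = {0}"
    and L_0: "0 \<in> L" and L_add: "x \<in> L \<Longrightarrow> y \<in> L \<Longrightarrow> x + y \<in> L"
    and L_scale: "absv c \<le> 1 \<Longrightarrow> x \<in> L \<Longrightarrow> scale c x \<in> L"
    and L_bracket: "x \<in> L \<Longrightarrow> y \<in> L \<Longrightarrow> bracket x y \<in> L"
    and L_sep: "(\<Inter>n::nat. scale (\<pi> ^ n) ` L) = {0}"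
    and L_span: "\<exists>n. scale (\<pi> ^ n) x \<in> L"
    and lam_add: "lam (x + y) = lam x + lam y"
    and lam_scale: "lam (scale c x) = c * lam x"
    and lam_L: "x \<in> L \<Longrightarrow> absv (lam x) \<le> 1"
begin

lemma bracket_0 [simp]: "bracket 0 x = 0" "bracket x 0 = 0"
  using bracket_add_left[of 0 0 x] bracket_add_right[of x 0 0] by auto

lemma bracket_minus: "bracket (- x) y = - bracket x y" "bracket x (- y) = - bracket x y"
  using bracket_add_left[of x "- x" y] bracket_add_right[of x y "- y"] by (simp_all add: eq_neg_iff_add_eq_0 add.commute)

lemma bracket_diff: "bracket (x - z) y = bracket x y - bracket z y"
  "bracket x (y - z) = bracket x y - bracket x z"
  using bracket_add_left[of x "- z" y] bracket_add_right[of x y "- z"] by (simp_all add: bracket_minus)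

lemma bracket_anti: "bracket x y = - bracket y x"
proof -
  have "bracket x y + bracket y x = 0"
    using bracket_alternating[of "x + y", unfolded bracket_add_left bracket_add_right]
    by (simp add: bracket_alternating add.commute)
  then show ?thesis by (simp add: eq_neg_iff_add_eq_0)
qed

lemma bracket_deriv: "bracket x (bracket u w) = bracket (bracket x u) w + bracket u (bracket x w)"
proof -
  have "bracket x (bracket u w) = - bracket u (bracket w x) - bracket w (bracket x u)"
    using jacobi[of x u w] by (simp add: eq_neg_iff_add_eq_0 add.assoc diff_conv_add_uminus[symmetric] algebra_simps)
  then show ?thesis
    using bracket_anti[of w x] bracket_anti[of w "bracket x u"] by (simp add: bracket_minus)
qed

lemma lam_0 [simp]: "lam 0 = 0" and lam_minus: "lam (- x) = - lam x"
  and lam_diff: "lam (x - y) = lam x - lam y"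
proof -
  show 0: "lam 0 = 0" using lam_add[of 0 0] by (metis add_0_left add_cancel_left_left)
  show m: "lam (- x) = - lam x" for x using lam_add[of x "- x"] 0 by (simp add: eq_neg_iff_add_eq_0 add.commute)
  show "lam (x - y) = lam x - lam y" using lam_add[of x "- y"] m by simp
qed

lemma L_minus: "x \<in> L \<Longrightarrow> - x \<in> L"
  using L_scale[of "-1" x] by simp

lemma L_diff: "x \<in> L \<Longrightarrow> y \<in> L \<Longrightarrow> x - y \<in> L"
  using L_add[of x "- y"] L_minus by simp

definition submod :: "'g set \<Rightarrow> bool" where
  "submod B \<longleftrightarrow> B \<subseteq> L \<and> 0 \<in> B \<and> (\<forall>x\<in>B. \<forall>y\<in>B. x + y \<in> B) \<and> (\<forall>c. \<forall>x\<in>B. absv c \<le> 1 \<longrightarrow> scale c x \<in> B)"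

lemma submodD:
  assumes "submod B"
  shows "B \<subseteq> L" "0 \<in> B" "x \<in> B \<Longrightarrow> y \<in> B \<Longrightarrow> x + y \<in> B" "absv c \<le> 1 \<Longrightarrow> x \<in> B \<Longrightarrow> scale c x \<in> B"
    "x \<in> B \<Longrightarrow> - x \<in> B" "x \<in> B \<Longrightarrow> y \<in> B \<Longrightarrow> x - y \<in> B"
proof -
  show "B \<subseteq> L" "0 \<in> B" and a: "x \<in> B \<Longrightarrow> y \<in> B \<Longrightarrow> x + y \<in> B" and
    c: "absv c \<le> 1 \<Longrightarrow> x \<in> B \<Longrightarrow> scale c x \<in> B" for x y c
    using assms by (auto simp: submod_def)
  show m: "x \<in> B \<Longrightarrow> - x \<in> B" for x using c[of "-1" x] by simp
  show "x \<in> B \<Longrightarrow> y \<in> B \<Longrightarrow> x - y \<in> B" using a[of x "- y"] m by simp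
qed

lemma submod_sum:
  assumes "submod B" "\<And>i. i \<in> A \<Longrightarrow> f i \<in> B" shows "sum f A \<in> B"
  using assms(2) by (induction A rule: infinite_finite_induct) (use submodD[OF assms(1)] in auto)

text \<open>Linear independence, over the residue field, of the images of \<open>F\<close> in
  \<open>B / \<pi> B\<close>.\<close>

definition indep_mod :: "'g set \<Rightarrow> 'g set \<Rightarrow> bool" where
  "indep_mod B F \<longleftrightarrow> (\<forall>c. (\<forall>f\<in>F. absv (c f) \<le> 1) \<longrightarrow>
     (\<Sum>f\<in>F. scale (c f) f) \<in> scale \<pi> ` B \<longrightarrow> (\<forall>f\<in>F. absv (c f) < 1))"

text \<open>A linear relation can be divided by its largest coefficient. It then has integral
  coefficients, one of them equal to 1, and its sum 0 lies in \<open>\<pi> B\<close>.\<close>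

lemma indep_mod_independent:
  assumes B: "submod B" and F: "finite F" "indep_mod B F" shows "independent F"
proof
  assume "dependent F"
  then obtain u where u: "\<exists>v\<in>F. u v \<noteq> 0" "(\<Sum>v\<in>F. scale (u v) v) = 0"
    using dependent_finite[OF F(1)] by auto
  define m where "m = Max ((\<lambda>v. absv (u v)) ` F)"
  have "F \<noteq> {}" using u by auto
  then have "m \<in> (\<lambda>v. absv (u v)) ` F" unfolding m_def using F(1) by (intro Max_in) auto
  then obtain w where w: "w \<in> F" "absv (u w) = m" by auto
  have le: "absv (u v) \<le> absv (u w)" if "v \<in> F" for v using F(1) w that unfolding m_def by simp
  have nz: "u w \<noteq> 0"
  proof
    assume "u w = 0"
    then have "absv (u v) \<le> 0" if "v \<in> F" for v using le[OF that] by simp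
    with u(1) show False by (metis absv_eq_0 absv_nonneg order_antisym)
  qed
  then have pos: "absv (u w) > 0" by (simp add: less_le)
  define c where "c v = u v / u w" for v
  have "absv (c v) \<le> 1" if "v \<in> F" for v using le[OF that] pos by (simp add: c_def absv_divide)
  moreover have "(\<Sum>v\<in>F. scale (c v) v) = scale (inverse (u w)) (\<Sum>v\<in>F. scale (u v) v)"
    unfolding scale_sum_right scale_scale c_def by (simp add: divide_inverse mult.commute)
  then have "(\<Sum>v\<in>F. scale (c v) v) = scale \<pi> 0" using u by simp
  then have "(\<Sum>v\<in>F. scale (c v) v) \<in> scale \<pi> ` B" using submodD(2)[OF B] by blast
  ultimately have "absv (c w) < 1" using F(2) w(1) unfolding indep_mod_def by blast
  then show False using nz by (simp add: c_def)
qed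

text \<open>Nakayama's lemma in complete form. The dimension bounds the size of sets that are
  independent modulo \<open>\<pi>\<close>, so a largest one exists; it spans \<open>B\<close> modulo
  \<open>\<pi>\<close>, and successive approximation improves this to all of
  \<open>B\<close>.\<close>

lemma submod_fg:
  assumes B: "submod B"
  shows "\<exists>F. finite F \<and> F \<subseteq> B \<and> (\<forall>u\<in>B. \<exists>c. (\<forall>f\<in>F. absv (c f) \<le> 1) \<and> u = (\<Sum>f\<in>F. scale (c f) f))"
proof -
  note BD = submodD[OF B]
  obtain basis where "finite_dimensional_vector_space scale basis" using finite_dim by blast
  then interpret fd: finite_dimensional_vector_space scale basis .
  define P where "P n \<longleftrightarrow> (\<exists>F. finite F \<and> F \<subseteq> B \<and> indep_mod B F \<and> card F = n)" for n
  have P0: "P 0" unfolding P_def by (intro exI[of _ "{}"]) (auto simp: indep_mod_def)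
  have Pb: "n \<le> dim UNIV" if "P n" for n
    using that indep_mod_independent[OF B] fd.independent_card_le_dim unfolding P_def by blast
  define n where "n = Greatest P"
  have "P n" unfolding n_def using GreatestI_nat[of P 0 "dim UNIV"] P0 Pb by blast
  then obtain F where F: "finite F" "F \<subseteq> B" "indep_mod B F" "card F = n" unfolding P_def by auto
  have max: "m \<le> n" if "P m" for m unfolding n_def using Greatest_le_nat[of P m "dim UNIV"] that Pb by blast
  have lift: "\<exists>c v. (\<forall>f\<in>F. absv (c f) \<le> 1) \<and> v \<in> B \<and> u = (\<Sum>f\<in>F. scale (c f) f) + scale \<pi> v" if u: "u \<in> B" for u
  proof (cases "u \<in> F")
    case True
    have "(\<Sum>f\<in>F. scale (if f = u then 1 else 0) f) = (\<Sum>f\<in>F. if f = u then f else 0)" by (intro sum.cong) auto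
    also have "\<dots> = u" using F(1) True by simp
    finally show ?thesis using BD(2)
      by (intro exI[of _ "\<lambda>f. if f = u then 1 else 0"] exI[of _ 0]) auto
  next
    case False
    have "\<not> indep_mod B (insert u F)"
    proof
      assume "indep_mod B (insert u F)"
      then have "P (Suc n)" unfolding P_def using F u False by (intro exI[of _ "insert u F"]) auto
      then show False using max by force
    qed
    then obtain c where c: "\<forall>f\<in>insert u F. absv (c f) \<le> 1"
      "(\<Sum>f\<in>insert u F. scale (c f) f) \<in> scale \<pi> ` B" "\<exists>f\<in>insert u F. \<not> absv (c f) < 1"
      unfolding indep_mod_def by auto
    then obtain v where v: "v \<in> B" "scale (c u) u + (\<Sum>f\<in>F. scale (c f) f) = scale \<pi> v"
      using F(1) False by auto
    \<comment> \<open>Otherwise the term with \<open>u\<close> lies in \<open>\<pi> B\<close> and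
      can be moved to the right-hand side, and the remaining relation contradicts the independence
      of \<open>F\<close>.\<close>
    have cu: "absv (c u) = 1"
    proof (rule ccontr)
      assume "absv (c u) \<noteq> 1"
      then have lt: "absv (c u) < 1" using c(1) by (simp add: less_le)
      define d where "d = c u / \<pi>"
      have d: "absv d \<le> 1" "c u = \<pi> * d" using absv_less_1[OF lt] by (auto simp: d_def absv_divide)
      have "(\<Sum>f\<in>F. scale (c f) f) = scale \<pi> (v - scale d u)"
        using v(2) d(2) by (simp add: scale_right_diff_distrib eq_diff_eq add.commute)
      moreover have "v - scale d u \<in> B" using BD(6)[OF v(1) BD(4)[OF d(1) u]] .
      ultimately have "(\<Sum>f\<in>F. scale (c f) f) \<in> scale \<pi> ` B" by blast
      then have "\<forall>f\<in>F. absv (c f) < 1" using F(3) c(1) unfolding indep_mod_def by auto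
      then show False using c(3) lt by auto
    qed
    then have nz: "c u \<noteq> 0" by auto
    define d where "d f = - (inverse (c u) * c f)" for f
    have inv: "absv (inverse (c u)) \<le> 1" using cu by (simp add: absv_inverse)
    have "u = scale (inverse (c u)) (scale (c u) u)" using nz by simp
    also have "scale (c u) u = scale \<pi> v - (\<Sum>f\<in>F. scale (c f) f)" using v(2) by (simp add: eq_diff_eq)
    also have "scale (inverse (c u)) (scale \<pi> v - (\<Sum>f\<in>F. scale (c f) f))
      = (\<Sum>f\<in>F. scale (d f) f) + scale \<pi> (scale (inverse (c u)) v)"
      by (simp add: scale_right_diff_distrib d_def scale_sum_right sum_negf mult.commute)
    finally have "u = (\<Sum>f\<in>F. scale (d f) f) + scale \<pi> (scale (inverse (c u)) v)" .
    moreover have "scale (inverse (c u)) v \<in> B" using BD(4)[OF inv v(1)] .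
    moreover have "\<forall>f\<in>F. absv (d f) \<le> 1"
      using inv c(1) by (auto simp: d_def intro: absv_mult_le1)
    ultimately show ?thesis by blast
  qed
  have "\<exists>c. (\<forall>f\<in>F. absv (c f) \<le> 1) \<and> u = (\<Sum>f\<in>F. scale (c f) f)" if u: "u \<in> B" for u
  proof -
    obtain C V where CV: "\<And>u. u \<in> B \<Longrightarrow> (\<forall>f\<in>F. absv (C u f) \<le> 1) \<and> V u \<in> B \<and>
        u = (\<Sum>f\<in>F. scale (C u f) f) + scale \<pi> (V u)" using lift by metis
    \<comment> \<open>\<open>v k\<close> is the remainder after \<open>k\<close> approximations, and
      \<open>s n f\<close> below collects the coefficients of \<open>f\<close> found so far.\<close>
    define v where "v k = (V ^^ k) u" for k
    have vB: "v k \<in> B" for k by (induction k) (use u CV in \<open>auto simp: v_def\<close>)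
    define s where "s n f = (\<Sum>k<n. \<pi> ^ k * C (v k) f)" for n f
    have us: "u = (\<Sum>f\<in>F. scale (s n f) f) + scale (\<pi> ^ n) (v n)" for n
    proof (induction n)
      case (Suc n)
      have "v n = (\<Sum>f\<in>F. scale (C (v n) f) f) + scale \<pi> (v (Suc n))"
        using CV[OF vB[of n]] by (simp add: v_def)
      from arg_cong[OF this, of "scale (\<pi> ^ n)"]
      have "scale (\<pi> ^ n) (v n) = (\<Sum>f\<in>F. scale (\<pi> ^ n * C (v n) f) f) + scale (\<pi> ^ Suc n) (v (Suc n))"
        by (simp only: scale_right_distrib scale_sum_right scale_scale power_Suc2)
      then show ?case using Suc
        by (simp add: s_def scale_left_distrib sum.distrib add.assoc)
    qed (simp add: s_def v_def)
    have "\<exists>t. \<forall>n. absv (t - s n f) \<le> r ^ n" if "f \<in> F" for f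
    proof (rule complete)
      fix n show "absv (s (Suc n) f - s n f) \<le> r ^ n"
        using absv_mult_le[of "\<pi> ^ n" "r ^ n" "C (v n) f" 1] CV[OF vB[of n]] that by (simp add: s_def)
    qed
    then obtain t where t: "\<And>f n. f \<in> F \<Longrightarrow> absv (t f - s n f) \<le> r ^ n" by metis
    have t1: "absv (t f) \<le> 1" if "f \<in> F" for f using t[OF that, of 0] by (simp add: s_def)
    \<comment> \<open>Replacing the partial coefficients by their limits costs a multiple of
      \<open>\<pi> ^ n\<close>, as does the remainder. Separatedness of the lattice then gives
      equality.\<close>
    have "u - (\<Sum>f\<in>F. scale (t f) f) \<in> scale (\<pi> ^ n) ` L" for n
    proof -
      define e where "e f = (s n f - t f) / \<pi> ^ n" for f
      have e: "absv (e f) \<le> 1" if "f \<in> F" for f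
        using t[OF that, of n] by (simp add: e_def absv_divide absv_diff_commute)
      have "s n f - t f = \<pi> ^ n * e f" for f by (simp add: e_def)
      then have "(\<Sum>f\<in>F. scale (s n f) f) - (\<Sum>f\<in>F. scale (t f) f) = scale (\<pi> ^ n) (\<Sum>f\<in>F. scale (e f) f)"
        by (simp add: sum_subtractf[symmetric] scale_left_diff_distrib[symmetric] scale_sum_right)
      then have "u - (\<Sum>f\<in>F. scale (t f) f) = scale (\<pi> ^ n) ((\<Sum>f\<in>F. scale (e f) f) + v n)"
        using us[of n] by (simp add: scale_right_distrib algebra_simps)
      moreover have "(\<Sum>f\<in>F. scale (e f) f) + v n \<in> B"
        by (intro BD(3) vB submod_sum[OF B] BD(4) e) (use F in auto)
      ultimately show ?thesis using BD(1) by blast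
    qed
    then have "u - (\<Sum>f\<in>F. scale (t f) f) \<in> (\<Inter>n::nat. scale (\<pi> ^ n) ` L)" by blast
    then have "u = (\<Sum>f\<in>F. scale (t f) f)" unfolding L_sep by simp
    then show ?thesis using t1 by blast
  qed
  then show ?thesis using F by blast
qed

lemma subspaceD:
  assumes "subspace h"
  shows "0 \<in> h" "x \<in> h \<Longrightarrow> y \<in> h \<Longrightarrow> x + y \<in> h" "x \<in> h \<Longrightarrow> scale c x \<in> h"
    "x \<in> h \<Longrightarrow> - x \<in> h" "x \<in> h \<Longrightarrow> y \<in> h \<Longrightarrow> x - y \<in> h"
  using assms subspace_0 subspace_add subspace_scale subspace_neg subspace_diff by auto

lemma submod_Int: "subspace h \<Longrightarrow> submod (h \<inter> L)"
  using subspaceD L_0 L_add L_scale unfolding submod_def by auto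

text \<open>Integral combinations of finitely many generators take no larger value than the
  generators themselves, so the maximum is attained at a generator.\<close>

lemma max_functional:
  assumes B: "submod B" and add: "\<And>x y. mu (x + y) = mu x + mu y" and sc: "\<And>c x. mu (scale c x) = c * mu x"
    and ex: "\<exists>u\<in>B. mu u \<noteq> 0"
  shows "\<exists>x\<in>B. mu x \<noteq> 0 \<and> (\<forall>u\<in>B. absv (mu u) \<le> absv (mu x))"
proof -
  obtain F where F: "finite F" "F \<subseteq> B"
    and gen: "\<And>u. u \<in> B \<Longrightarrow> \<exists>c. (\<forall>f\<in>F. absv (c f) \<le> 1) \<and> u = (\<Sum>f\<in>F. scale (c f) f)"
    using submod_fg[OF B] by metis
  have mu0: "mu 0 = 0" using sc[of 0 0] by simp
  have mu_sum: "mu (\<Sum>f\<in>F. scale (c f) f) = (\<Sum>f\<in>F. c f * mu f)" for c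
    using F(1) by (induction F rule: finite_induct) (auto simp: mu0 add sc)
  have "F \<noteq> {}" using ex gen mu0 by (metis sum.empty)
  define m where "m = Max ((\<lambda>v. absv (mu v)) ` F)"
  have "m \<in> (\<lambda>v. absv (mu v)) ` F" unfolding m_def using F(1) \<open>F \<noteq> {}\<close> by (intro Max_in) auto
  then obtain x where x: "x \<in> F" "absv (mu x) = m" by auto
  have le: "absv (mu f) \<le> absv (mu x)" if "f \<in> F" for f using F(1) x that unfolding m_def by simp
  have all: "absv (mu u) \<le> absv (mu x)" if uB: "u \<in> B" for u
  proof -
    obtain c where "\<forall>f\<in>F. absv (c f) \<le> 1" "u = (\<Sum>f\<in>F. scale (c f) f)" using gen[OF uB] by auto
    then show ?thesis using le by (auto simp: mu_sum intro!: absv_sum_le absv_mult_le1)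
  qed
  have "mu x \<noteq> 0"
  proof
    assume "mu x = 0"
    then have "absv (mu u) \<le> 0" if "u \<in> B" for u using all[OF that] by simp
    then show False using ex by (metis absv_eq_0 absv_nonneg order_antisym)
  qed
  then show ?thesis using x F all by blast
qed

section \<open>Adapted chains and polarisations\<close>

primrec central_series :: "'g set \<Rightarrow> nat \<Rightarrow> 'g set" where
  "central_series h 0 = h"
| "central_series h (Suc n) = span {bracket x u | x u. x \<in> h \<and> u \<in> central_series h n}"

lemma central_series_lower_central: "central_series h n \<subseteq> lower_central n"
proof (induction n)
  case (Suc n)
  then show ?case by (auto intro!: span_mono)
qed simp

lemma central_series_subset: "subalgebra h \<Longrightarrow> central_series h n \<subseteq> h"
proof (induction n)
  case (Suc n)
  then have "{bracket x u | x u. x \<in> h \<and> u \<in> central_series h n} \<subseteq> h" by (auto simp: subalgebra_def)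
  then show ?case using Suc(2) by (simp add: span_minimal subalgebra_def)
qed simp

lemma central_series_bracket: "x \<in> h \<Longrightarrow> u \<in> central_series h n \<Longrightarrow> bracket x u \<in> central_series h (Suc n)"
  by (auto intro: span_base)

lemma central_series_decreasing: "subalgebra h \<Longrightarrow> central_series h (Suc n) \<subseteq> central_series h n"
proof (induction n)
  case 0
  then show ?case using central_series_subset[of h "Suc 0"] by simp
next
  case (Suc n)
  have "{bracket x u | x u. x \<in> h \<and> u \<in> central_series h (Suc n)} \<subseteq> {bracket x u | x u. x \<in> h \<and> u \<in> central_series h n}"
    using Suc by blast
  from span_mono[OF this] show ?case by simp
qed

definition lam_cent :: "'g \<Rightarrow> 'g set \<Rightarrow> 'g set" where
  "lam_cent y h = {u \<in> h. lam (bracket u y) = 0}"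

text \<open>Ideals of this kind act as zero in the representation attached to a chain
  (\<open>act_ideal\<close>), so identities that hold modulo \<open>a\<close> become exact
  there.\<close>

definition ideal_in :: "'g set \<Rightarrow> 'g set \<Rightarrow> bool" where
  "ideal_in a h \<longleftrightarrow> a \<subseteq> h \<and> (\<forall>u\<in>a. lam u = 0) \<and> (\<forall>x\<in>h. \<forall>u\<in>a. bracket x u \<in> a)"

text \<open>
  A step \<open>(x, y)\<close> of the chain passes from \<open>h\<close> to the polar \<open>lam_cent y h\<close> of \<open>y\<close>, which is complemented
  by \<open>x\<close>. Maximality of \<open>\<bar>lam [x, y]\<bar>\<close> on the lattice makes the complement integral. The
  ideal \<open>a\<close> is the part of a term of the lower central series of \<open>h\<close> on which \<open>lam\<close> vanishes; modulo \<open>a\<close>,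
  \<open>y\<close> is central in \<open>lam_cent y h\<close> and \<open>[x, y]\<close> is central in \<open>h\<close>.
\<close>

fun adapted :: "('g \<times> 'g) list \<Rightarrow> 'g set \<Rightarrow> bool" where
  "adapted [] h \<longleftrightarrow> subalgebra h \<and> (\<forall>x\<in>h. \<forall>y\<in>h. lam (bracket x y) = 0)"
| "adapted ((x, y) # ps) h \<longleftrightarrow> subalgebra h \<and> x \<in> h \<and> y \<in> h \<and> x \<in> L \<and> lam (bracket x y) \<noteq> 0 \<and>
     (\<forall>u\<in>h \<inter> L. absv (lam (bracket u y)) \<le> absv (lam (bracket x y))) \<and>
     (\<forall>u\<in>h. \<forall>w\<in>h. bracket u w \<in> lam_cent y h) \<and>
     (\<exists>a. ideal_in a h \<and> (\<forall>u\<in>lam_cent y h. bracket u y \<in> a) \<and> (\<forall>u\<in>h. \<forall>w\<in>h. bracket u (bracket w y) \<in> a)) \<and>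
     adapted ps (lam_cent y h)"

fun base :: "('g \<times> 'g) list \<Rightarrow> 'g set \<Rightarrow> 'g set" where
  "base [] h = h"
| "base ((x, y) # ps) h = base ps (lam_cent y h)"

lemma adapted_subalgebra: "adapted ps h \<Longrightarrow> subalgebra h"
  by (cases "(ps, h)" rule: adapted.cases) auto

lemma adapted_subspace: "adapted ps h \<Longrightarrow> subspace h"
  using adapted_subalgebra by (auto simp: subalgebra_def)

lemma lam_cent_subspace: "subspace h \<Longrightarrow> subspace (lam_cent y h)"
  using subspaceD by (intro subspaceI) (auto simp: lam_cent_def bracket_add_left lam_add bracket_scale_left lam_scale)

lemma exists_adapted:
  assumes "subalgebra h" shows "\<exists>ps. adapted ps h"
proof -
  obtain basis where "finite_dimensional_vector_space scale basis" using finite_dim by blast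
  then interpret fd: finite_dimensional_vector_space scale basis .
  show ?thesis using assms
  proof (induction "dim h" arbitrary: h rule: less_induct)
    case less
    note sub = \<open>subalgebra h\<close>
    have ss: "subspace h" using sub by (simp add: subalgebra_def)
    show ?case
    proof (cases "\<forall>x\<in>h. \<forall>y\<in>h. lam (bracket x y) = 0")
      case True
      then show ?thesis using sub by (intro exI[of _ "[]"]) auto
    next
      case False
      \<comment> \<open>Bounded by the nilpotency class, since the relative lower central series
        lies in that of the whole algebra.\<close>
      define Q where "Q n \<longleftrightarrow> (\<exists>x\<in>h. \<exists>y\<in>central_series h n. lam (bracket x y) \<noteq> 0)" for n
      have Q0: "Q 0" using False by (auto simp: Q_def)
      have Qb: "n \<le> N" if "Q n" for n
      proof (rule ccontr)
        assume "\<not> n \<le> N"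
        then have "N \<le> n" by simp
        then have "central_series h n \<subseteq> central_series h N"
          by (induction n rule: dec_induct) (use central_series_decreasing[OF sub] in auto)
        then have "central_series h n \<subseteq> {0}" using central_series_lower_central[of h N] nilp by auto
        with that show False by (auto simp: Q_def)
      qed
      define n where "n = Greatest Q"
      have "Q n" unfolding n_def using GreatestI_nat[of Q 0 N] Q0 Qb by blast
      have "\<not> Q (Suc n)" unfolding n_def using Greatest_le_nat[of Q "Suc (Greatest Q)" N] Qb by fastforce
      obtain x0 y where x0: "x0 \<in> h" and y: "y \<in> central_series h n" and nz: "lam (bracket x0 y) \<noteq> 0"
        using \<open>Q n\<close> by (auto simp: Q_def)
      have yh: "y \<in> h" using central_series_subset[OF sub] y by auto
      define a where "a = {u \<in> central_series h (Suc n). lam u = 0}"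
      \<comment> \<open>Maximality of \<open>n\<close>. Together with the ideal property of the
        series it puts every bracket of \<open>h\<close> with the next term into
        \<open>a\<close>.\<close>
      have lam2: "lam (bracket x u) = 0" if "x \<in> h" "u \<in> central_series h (Suc n)" for x u
        using \<open>\<not> Q (Suc n)\<close> that by (auto simp: Q_def)
      have bra: "bracket x u \<in> a" if "x \<in> h" "u \<in> central_series h (Suc n)" for x u
        using central_series_bracket[OF that] central_series_decreasing[OF sub, of "Suc n"] lam2[OF that] unfolding a_def by blast
      have a_ideal: "ideal_in a h"
        unfolding ideal_in_def using bra central_series_subset[OF sub, of "Suc n"] by (auto simp: a_def)
      have xy: "bracket u y \<in> central_series h (Suc n)" if "u \<in> h" for u using central_series_bracket[OF that y] .
      \<comment> \<open>By the Jacobi identity \<open>[y, [u, w]]\<close> is a difference of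
        brackets of \<open>h\<close> with elements \<open>[u, y]\<close> and \<open>[w, y]\<close>
        of the next term, and \<open>lam\<close> kills those.\<close>
      have brcen: "bracket u w \<in> lam_cent y h" if "u \<in> h" "w \<in> h" for u w
      proof -
        have "bracket y (bracket u w) = bracket (bracket y u) w + bracket u (bracket y w)" by (rule bracket_deriv)
        also have "\<dots> = bracket w (bracket u y) - bracket u (bracket w y)"
          using bracket_anti[of "bracket y u" w] bracket_anti[of y u] bracket_anti[of y w] by (simp add: bracket_minus)
        finally have "lam (bracket y (bracket u w)) = 0"
          using lam2 xy that by (simp add: lam_diff)
        then have "lam (bracket (bracket u w) y) = 0" using bracket_anti[of "bracket u w" y] by (simp add: lam_minus)
        then show ?thesis using sub that by (auto simp: lam_cent_def subalgebra_def)
      qed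
      \<comment> \<open>A multiple of \<open>x0\<close> in the lattice shows that the functional to
        be maximised does not vanish on \<open>h \<inter> L\<close>.\<close>
      obtain m where m: "scale (\<pi> ^ m) x0 \<in> L" using L_span by blast
      have "\<exists>x\<in>h \<inter> L. lam (bracket x y) \<noteq> 0 \<and> (\<forall>u\<in>h \<inter> L. absv (lam (bracket u y)) \<le> absv (lam (bracket x y)))"
      proof (rule max_functional[OF submod_Int[OF ss]])
        show "\<exists>u\<in>h \<inter> L. lam (bracket u y) \<noteq> 0"
          using m nz subspaceD(3)[OF ss x0] by (intro bexI[of _ "scale (\<pi> ^ m) x0"]) (auto simp: bracket_scale_left lam_scale)
      qed (simp_all add: bracket_add_left lam_add bracket_scale_left lam_scale)
      then obtain x where x: "x \<in> h" "x \<in> L" "lam (bracket x y) \<noteq> 0"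
        "\<forall>u\<in>h \<inter> L. absv (lam (bracket u y)) \<le> absv (lam (bracket x y))" by auto
      have "subalgebra (lam_cent y h)" using lam_cent_subspace[OF ss] brcen by (auto simp: subalgebra_def lam_cent_def)
      moreover have "dim (lam_cent y h) < dim h"
      proof (rule fd.dim_psubset)
        have "lam_cent y h \<subset> h" using x by (auto simp: lam_cent_def)
        then show "span (lam_cent y h) \<subset> span h" using ss lam_cent_subspace[OF ss] by (simp add: span_eq_iff[THEN iffD2])
      qed
      ultimately obtain ps where "adapted ps (lam_cent y h)" using less(1) by blast
      moreover have "\<forall>u\<in>lam_cent y h. bracket u y \<in> a" using xy by (auto simp: lam_cent_def a_def)
      moreover have "\<forall>u\<in>h. \<forall>w\<in>h. bracket u (bracket w y) \<in> a" using bra xy by blast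
      ultimately have "adapted ((x, y) # ps) h"
        using sub x yh brcen a_ideal by auto
      then show ?thesis by blast
    qed
  qed
qed

lemma ideal_in_lam_cent: "ideal_in a h \<Longrightarrow> y \<in> h \<Longrightarrow> ideal_in a (lam_cent y h)"
  using bracket_anti[of _ y] unfolding ideal_in_def lam_cent_def by (auto simp: lam_minus)

text \<open>An element that is central modulo an ideal on which \<open>lam\<close> vanishes is
  orthogonal to every \<open>y\<close> of the chain, so no step removes it.\<close>

lemma central_in_base:
  assumes "adapted ps h" "ideal_in a h" "u \<in> h" "\<And>w. w \<in> h \<Longrightarrow> bracket w u \<in> a"
  shows "u \<in> base ps h"
  using assms
proof (induction ps h rule: base.induct)
  case (2 x y ps h)
  have "u \<in> lam_cent y h"
  proof -
    have "bracket y u \<in> a" using 2(2) 2(5)[of y] by simp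
    then have "lam (bracket y u) = 0" using 2(3) by (simp add: ideal_in_def)
    then show ?thesis using 2(4) bracket_anti[of u y] by (simp add: lam_cent_def lam_minus)
  qed
  then show ?case using 2 ideal_in_lam_cent[of a h y] by (auto simp: lam_cent_def)
qed simp

lemma base_subset: "base ps h \<subseteq> h"
  by (induction ps h rule: base.induct) (auto simp: lam_cent_def)

lemma base_subalgebra: "adapted ps h \<Longrightarrow> subalgebra (base ps h)"
  by (induction ps h rule: base.induct) auto

lemma lam_base: "adapted ps h \<Longrightarrow> u \<in> base ps h \<Longrightarrow> w \<in> base ps h \<Longrightarrow> lam (bracket u w) = 0"
  by (induction ps h rule: base.induct) auto

text \<open>By \<open>central_in_base\<close> the element \<open>y\<close> of the first step
  survives to the base. Orthogonality to the base therefore includes orthogonality to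
  \<open>y\<close>, which is membership in the next subalgebra.\<close>

lemma base_maximal:
  assumes "adapted ps h" "u \<in> h" "\<And>w. w \<in> base ps h \<Longrightarrow> lam (bracket u w) = 0"
  shows "u \<in> base ps h"
  using assms
proof (induction ps h rule: base.induct)
  case (2 x y ps h)
  obtain a where a: "ideal_in a h" "\<And>u. u \<in> lam_cent y h \<Longrightarrow> bracket u y \<in> a" using 2(2) by auto
  have yc: "y \<in> lam_cent y h" using 2(2) by (simp add: lam_cent_def bracket_alternating)
  have "y \<in> base ps (lam_cent y h)"
    using 2(2) a yc by (intro central_in_base[of ps "lam_cent y h" a] ideal_in_lam_cent) auto
  then have "u \<in> lam_cent y h" using 2(3,4) by (auto simp: lam_cent_def)
  then show ?case using 2 by auto
qed simp

lemma derived_series_subset: "derived_series b n \<subseteq> lower_central n"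
proof (induction n)
  case (Suc n)
  then show ?case by (auto intro!: span_mono)
qed simp

lemma polarisation_base:
  assumes "adapted ps UNIV" shows "polarisation lam (base ps UNIV)"
proof -
  have "0 \<in> derived_series (base ps UNIV) N"
    using base_subalgebra[OF assms] subspaceD(1) by (cases N) (auto simp: subalgebra_def span_zero)
  then have "derived_series (base ps UNIV) N = {0}"
    using derived_series_subset[of "base ps UNIV" N] nilp by auto
  then have "solvable (base ps UNIV)" unfolding solvable_def by blast
  then show ?thesis
    unfolding polarisation_def
    using base_subalgebra[OF assms] base_maximal[OF assms] lam_base[OF assms] by auto
qed

end

context lie_setup
begin

section \<open>The representation attached to an adapted chain\<close>

abbreviation ad :: "'g \<Rightarrow> nat \<Rightarrow> 'g \<Rightarrow> 'g" where "ad x j u \<equiv> (bracket x ^^ j) u"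

lemma ad_add: "ad x j (u + w) = ad x j u + ad x j w"
  by (induction j) (simp_all add: bracket_add_right)

lemma ad_scale: "ad x j (scale c u) = scale c (ad x j u)"
  by (induction j) (simp_all add: bracket_scale_right)

lemma ad_0 [simp]: "ad x j 0 = 0"
  by (induction j) simp_all

lemma ad_lower_central: "ad x j u \<in> lower_central j"
  by (induction j) (auto intro!: span_base)

lemma ad_vanish: "N \<le> j \<Longrightarrow> ad x j u = 0"
proof -
  assume "N \<le> j"
  then have "ad x j u = ad x (j - N) (ad x N u)" by (metis funpow_add le_add_diff_inverse2 o_apply)
  also have "ad x N u = 0" using ad_lower_central[of N x u] nilp by auto
  finally show ?thesis by simp
qed

lemma ad_Leibniz:
  "ad x n (bracket u w) = (\<Sum>j\<le>n. scale (of_nat (n choose j)) (bracket (ad x j u) (ad x (n - j) w)))"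
proof (induction n)
  case (Suc n)
  let ?h = "\<lambda>j k. bracket (ad x j u) (ad x k w)"
  have "ad x (Suc n) (bracket u w)
    = (\<Sum>j\<le>n. scale (of_nat (n choose j)) (bracket x (?h j (n - j))))"
  proof -
    have "bracket x (\<Sum>j\<le>m. f j) = (\<Sum>j\<le>m. bracket x (f j))" for f and m :: nat
      by (induction m) (simp_all add: bracket_add_right)
    then show ?thesis using Suc by (simp add: bracket_scale_right)
  qed
  also have "\<dots> = (\<Sum>j\<le>n. scale (of_nat (n choose j)) (?h (Suc j) (n - j)))
      + (\<Sum>j\<le>n. scale (of_nat (n choose j)) (?h j (Suc n - j)))"
    by (simp add: bracket_deriv[of x "ad x _ u"] scale_right_distrib sum.distrib Suc_diff_le)
  also have "(\<Sum>j\<le>n. scale (of_nat (n choose j)) (?h j (Suc n - j)))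
    = (\<Sum>j\<le>Suc n. scale (of_nat (n choose j)) (?h j (Suc n - j)))"
    by (simp add: binomial_eq_0 del: binomial_Suc_Suc)
  also have "\<dots> = ?h 0 (Suc n) + (\<Sum>j\<le>n. scale (of_nat (n choose Suc j)) (?h (Suc j) (n - j)))"
    by (subst sum.atMost_Suc_shift) simp
  also have "(\<Sum>j\<le>n. scale (of_nat (n choose j)) (?h (Suc j) (n - j)))
      + (?h 0 (Suc n) + (\<Sum>j\<le>n. scale (of_nat (n choose Suc j)) (?h (Suc j) (n - j))))
    = ?h 0 (Suc n) + (\<Sum>j\<le>n. scale (of_nat (Suc n choose Suc j)) (?h (Suc j) (n - j)))"
    by (simp add: scale_left_distrib sum.distrib add_ac)
  also have "\<dots> = (\<Sum>j\<le>Suc n. scale (of_nat (Suc n choose j)) (?h j (Suc n - j)))"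
    by (subst sum.atMost_Suc_shift) simp
  finally show ?case .
qed simp

text \<open>\<open>mu\<close> and \<open>prj\<close> are the two components of \<open>h\<close> as
  the direct sum of the line through \<open>x\<close> and \<open>lam_cent y h\<close>.\<close>

definition mu :: "'g \<Rightarrow> 'g \<Rightarrow> 'g \<Rightarrow> 'k" where
  "mu x y u = lam (bracket u y) / lam (bracket x y)"

definition prj :: "'g \<Rightarrow> 'g \<Rightarrow> 'g \<Rightarrow> 'g" where
  "prj x y u = u - scale (mu x y u) x"

lemma mu_add: "mu x y (u + w) = mu x y u + mu x y w"
  and mu_scale: "mu x y (scale c u) = c * mu x y u"
  by (simp_all add: mu_def bracket_add_left bracket_scale_left lam_add lam_scale add_divide_distrib)

lemma prj_add: "prj x y (u + w) = prj x y u + prj x y w"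
  by (simp add: prj_def mu_add scale_left_distrib)

lemma prj_scale: "prj x y (scale c u) = scale c (prj x y u)"
  by (simp add: prj_def mu_scale scale_right_diff_distrib)

text \<open>
  A function \<open>f\<close> stands for the series whose \<open>(i\<^sub>1, \<dots>, i\<^sub>d)\<close> coefficient belongs to the monomial
  \<open>x\<^sub>1\<^bsup>i\<^sub>1\<^esup> \<cdots> x\<^sub>d\<^bsup>i\<^sub>d\<^esup>\<close> applied to the generator. The sum implements
  \<open>u x\<^sup>i = \<Sum>\<^sub>j (-1)\<^sup>j (i choose j) x\<^bsup>i-j\<^esup> (ad x)\<^sup>j(u)\<close>.
\<close>

fun act :: "('g \<times> 'g) list \<Rightarrow> 'g \<Rightarrow> (nat list \<Rightarrow> 'k) \<Rightarrow> nat list \<Rightarrow> 'k" where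
  "act [] u f al = lam u * f al"
| "act ((x, y) # ps) u f [] = 0"
| "act ((x, y) # ps) u f (i # al) = (if i = 0 then 0 else mu x y u * f ((i - 1) # al)) +
     (\<Sum>j\<le>N. (-1) ^ j * of_nat ((i + j) choose j) * act ps (ad x j (prj x y u)) (\<lambda>be. f ((i + j) # be)) al)"

lemma act_add_left: "act ps (u + w) f al = act ps u f al + act ps w f al"
proof (induction ps arbitrary: u w f al)
  case (Cons q ps)
  then show ?case
    by (cases q; cases al)
      (simp_all add: mu_add prj_add ad_add Cons.IH distrib_left distrib_right sum.distrib)
qed (simp add: lam_add distrib_right)

lemma act_scale_left: "act ps (scale c u) f al = c * act ps u f al"
proof (induction ps arbitrary: u f al)
  case (Cons q ps)
  then show ?case
    by (cases q; cases al)
      (simp_all add: mu_scale prj_scale ad_scale Cons.IH distrib_left sum_distrib_left mult_ac)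
qed (simp add: lam_scale)

lemma act_add_right: "act ps u (\<lambda>be. f be + g be) al = act ps u f al + act ps u g al"
proof (induction ps arbitrary: u f g al)
  case (Cons q ps)
  then show ?case
    by (cases q; cases al) (simp_all add: Cons.IH distrib_left sum.distrib)
qed (simp add: distrib_left)

lemma act_scale_right: "act ps u (\<lambda>be. c * f be) al = c * act ps u f al"
proof (induction ps arbitrary: u f al)
  case (Cons q ps)
  then show ?case
    by (cases q; cases al) (simp_all add: Cons.IH distrib_left sum_distrib_left mult_ac)
qed simp

lemma act_0_left [simp]: "act ps 0 f al = 0"
  using act_scale_left[of ps 0 0 f al] by simp

lemma act_0_left_fun [simp]: "act ps 0 f = (\<lambda>al. 0)"
  by (rule ext) simp

lemma act_0_right [simp]: "act ps u (\<lambda>be. 0) al = 0"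
  using act_scale_right[of ps u 0 "\<lambda>be. 0" al] by simp

lemma act_diff_right: "act ps u (\<lambda>be. f be - g be) al = act ps u f al - act ps u g al"
  using act_add_right[of ps u "\<lambda>be. f be - g be" g al] by simp

lemma act_sum_left: "act ps (\<Sum>i\<in>A. u i) f al = (\<Sum>i\<in>A. act ps (u i) f al)"
  by (induction A rule: infinite_finite_induct) (simp_all add: act_add_left)

lemma act_sum_right: "act ps u (\<lambda>be. \<Sum>i\<in>A. f i be) al = (\<Sum>i\<in>A. act ps u (f i) al)"
  by (induction A rule: infinite_finite_induct) (simp_all add: act_add_right)

lemma act_support:
  "(\<And>be. f be \<noteq> 0 \<Longrightarrow> length be = length ps) \<Longrightarrow> act ps u f al \<noteq> 0 \<Longrightarrow> length al = length ps"
proof (induction ps arbitrary: u f al)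
  case (Cons q ps)
  obtain x y where q: "q = (x, y)" by (cases q)
  have "False" if ne: "length al \<noteq> length (q # ps)"
  proof (cases al)
    case (Cons i be)
    have "act ps w (\<lambda>be. f (k # be)) be = 0" for w k
    proof (rule ccontr)
      assume "act ps w (\<lambda>be. f (k # be)) be \<noteq> 0"
      then have "length be = length ps"
        using Cons.IH[of "\<lambda>be. f (k # be)" w be] Cons.prems(1)[of "k # _"] by force
      then show False using ne Cons by simp
    qed
    moreover have "f ((i - 1) # be) = 0" using Cons.prems(1)[of "(i - 1) # be"] ne Cons by force
    ultimately show False using Cons.prems(2) Cons q by (simp split: if_splits)
  qed (use Cons.prems q in simp)
  then show ?case by blast
qed force

subsection \<open>The top step of a chain\<close>

context
  fixes x y :: 'g and ps :: "('g \<times> 'g) list" and h :: "'g set"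
  assumes adp: "adapted ((x, y) # ps) h"
begin

lemma h_subspace: "subspace h"
  using adapted_subspace[OF adp] .

lemma lam_xy: "lam (bracket x y) \<noteq> 0"
  using adp by simp

lemma mu_lam_cent: "w \<in> lam_cent y h \<Longrightarrow> mu x y w = 0"
  and prj_lam_cent: "w \<in> lam_cent y h \<Longrightarrow> prj x y w = w"
  by (simp_all add: mu_def prj_def lam_cent_def)

lemma mu_x: "mu x y x = 1" and prj_x: "prj x y x = 0"
  using lam_xy by (simp_all add: mu_def prj_def)

lemma prj_in_lam_cent: "u \<in> h \<Longrightarrow> prj x y u \<in> lam_cent y h"
  using adp subspaceD(3,5)[OF h_subspace] lam_xy
  by (auto simp: prj_def mu_def lam_cent_def bracket_diff lam_diff bracket_scale_left lam_scale)

lemma bracket_in_lam_cent: "u \<in> h \<Longrightarrow> w \<in> h \<Longrightarrow> bracket u w \<in> lam_cent y h"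
  using adp by simp

lemma lam_cent_sub_h: "w \<in> lam_cent y h \<Longrightarrow> w \<in> h"
  by (simp add: lam_cent_def)

lemma x_in: "x \<in> h" "x \<in> L" and y_in: "y \<in> h" "y \<in> lam_cent y h"
  using adp by (auto simp: lam_cent_def bracket_alternating)

lemma ad_in_lam_cent: "w \<in> lam_cent y h \<Longrightarrow> ad x j w \<in> lam_cent y h"
  by (induction j) (auto intro!: bracket_in_lam_cent x_in lam_cent_sub_h)

lemma act_x: "act ((x, y) # ps) x f (i # al) = (if i = 0 then 0 else f ((i - 1) # al))"
  by (simp add: mu_x prj_x)

text \<open>Terms beyond \<open>N\<close> vanish by nilpotency. The freedom in the upper limit
  \<open>K\<close> is used for shifting and regrouping sums.\<close>

lemma act_lam_cent:
  assumes "w \<in> lam_cent y h" "N \<le> K"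
  shows "act ((x, y) # ps) w f (i # al)
    = (\<Sum>j\<le>K. (-1) ^ j * of_nat ((i + j) choose j) * act ps (ad x j w) (\<lambda>be. f ((i + j) # be)) al)"
proof -
  have "act ((x, y) # ps) w f (i # al)
    = (\<Sum>j\<le>N. (-1) ^ j * of_nat ((i + j) choose j) * act ps (ad x j w) (\<lambda>be. f ((i + j) # be)) al)"
    using assms(1) by (simp add: mu_lam_cent prj_lam_cent)
  also have "\<dots> = (\<Sum>j\<le>K. (-1) ^ j * of_nat ((i + j) choose j) * act ps (ad x j w) (\<lambda>be. f ((i + j) # be)) al)"
    using assms(2) by (intro sum.mono_neutral_left) (auto simp: ad_vanish)
  finally show ?thesis .
qed

lemma act_split: "act ((x, y) # ps) u f = (\<lambda>al. mu x y u * act ((x, y) # ps) x f al + act ((x, y) # ps) (prj x y u) f al)"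
proof
  fix al
  have "u = scale (mu x y u) x + prj x y u" by (simp add: prj_def)
  then show "act ((x, y) # ps) u f al = mu x y u * act ((x, y) # ps) x f al + act ((x, y) # ps) (prj x y u) f al"
    by (metis act_add_left act_scale_left)
qed

text \<open>Since \<open>x\<close> only shifts the first exponent, comparing coefficients reduces
  the commutation relation to Pascal's rule.\<close>

lemma act_bracket_x:
  assumes w: "w \<in> lam_cent y h"
  shows "act ((x, y) # ps) (bracket x w) f al
    = act ((x, y) # ps) x (act ((x, y) # ps) w f) al - act ((x, y) # ps) w (act ((x, y) # ps) x f) al"
proof (cases al)
  case (Cons i be)
  let ?A = "\<lambda>j f. act ps (ad x j w) f be"
  have bc: "bracket x w \<in> lam_cent y h" using w by (intro bracket_in_lam_cent x_in lam_cent_sub_h)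
  have ad_Suc: "ad x j (bracket x w) = ad x (Suc j) w" for j by (simp only: funpow_Suc_right o_apply)
  have l: "act ((x, y) # ps) (bracket x w) f al
    = (\<Sum>j\<le>N. (-1) ^ j * of_nat ((i + j) choose j) * ?A (Suc j) (\<lambda>be. f ((i + j) # be)))"
    unfolding Cons by (subst act_lam_cent[OF bc order_refl]) (simp only: ad_Suc)
  \<comment> \<open>One extra term, so that splitting off \<open>j = 0\<close> leaves a sum with the
    same range as in \<open>l\<close>.\<close>
  have r2: "act ((x, y) # ps) w (act ((x, y) # ps) x f) al
    = (\<Sum>j\<le>Suc N. (-1) ^ j * of_nat ((i + j) choose j) *
         ?A j (\<lambda>be. if i + j = 0 then 0 else f ((i + j - 1) # be)))"
    unfolding Cons by (subst act_lam_cent[OF w le_SucI[OF order_refl]]) (simp only: act_x)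
  show ?thesis
  proof (cases i)
    case 0
    have r1: "act ((x, y) # ps) x (act ((x, y) # ps) w f) al = 0" using Cons 0 by (simp only: act_x) simp
    show ?thesis unfolding l r1 r2 unfolding sum.atMost_Suc_shift using 0
      by (simp add: sum_negf[symmetric] del: funpow.simps)
  next
    case (Suc i')
    have r1: "act ((x, y) # ps) x (act ((x, y) # ps) w f) al
      = (\<Sum>j\<le>Suc N. (-1) ^ j * of_nat ((i' + j) choose j) * ?A j (\<lambda>be. f ((i' + j) # be)))"
      unfolding Cons Suc act_x by (simp only: nat.simps if_False diff_Suc_1) (rule act_lam_cent[OF w le_SucI[OF order_refl]])
    have "(-1) ^ j * of_nat ((Suc i' + j) choose j) * t
      = (-1) ^ Suc j * of_nat ((i' + Suc j) choose Suc j) * t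
      - (-1) ^ Suc j * of_nat ((Suc i' + Suc j) choose Suc j) * t" for j and t :: 'k
      by (simp add: algebra_simps)
    then show ?thesis unfolding l r1 r2 unfolding sum.atMost_Suc_shift Suc
      by (simp add: sum_subtractf[symmetric] del: funpow.simps binomial_Suc_Suc power_Suc)
  qed
qed simp

text \<open>In the composite of two actions the terms are grouped by the total number
  \<open>n\<close> of applications of \<open>ad x\<close>. The binomial factors then turn into those
  of the Leibniz rule for the n-th power of \<open>ad x\<close> on \<open>[u, w]\<close>.\<close>

lemma act_bracket_lam_cent:
  assumes IH: "\<And>u w f al. u \<in> lam_cent y h \<Longrightarrow> w \<in> lam_cent y h \<Longrightarrow>
      act ps (bracket u w) f al = act ps u (act ps w f) al - act ps w (act ps u f) al"
    and u: "u \<in> lam_cent y h" and w: "w \<in> lam_cent y h"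
  shows "act ((x, y) # ps) (bracket u w) f al
    = act ((x, y) # ps) u (act ((x, y) # ps) w f) al - act ((x, y) # ps) w (act ((x, y) # ps) u f) al"
proof (cases al)
  case (Cons i be)
  \<comment> \<open>If \<open>j + k\<close> exceeds \<open>K\<close>, then \<open>j\<close> or
    \<open>k\<close> is at least \<open>N\<close> and the term vanishes; so the square may be
    replaced by the triangle.\<close>
  define K where "K = N + N"
  have K: "N \<le> K" by (simp add: K_def)
  let ?f = "\<lambda>n be. f ((i + n) # be)"
  let ?c = "\<lambda>n. (-1) ^ n * of_nat ((i + n) choose n) :: 'k"
  have comp: "act ((x, y) # ps) u (act ((x, y) # ps) w f) al
    = (\<Sum>n\<le>K. ?c n * (\<Sum>j\<le>n. of_nat (n choose j) * act ps (ad x j u) (act ps (ad x (n - j) w) (?f n)) be))"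
    if u: "u \<in> lam_cent y h" and w: "w \<in> lam_cent y h" for u w
  proof -
    let ?g = "\<lambda>j k. (-1) ^ (j + k) * (of_nat ((i + j) choose j) * of_nat ((i + j + k) choose k)) *
      act ps (ad x j u) (act ps (ad x k w) (?f (j + k))) be"
    have "act ((x, y) # ps) u (act ((x, y) # ps) w f) al = (\<Sum>j\<le>K. \<Sum>k\<le>K. ?g j k)"
      unfolding Cons act_lam_cent[OF u K] act_lam_cent[OF w K] act_sum_right act_scale_right
      by (simp add: sum_distrib_left power_add mult_ac add_ac)
    also have "\<dots> = (\<Sum>(j, k)\<in>{..K} \<times> {..K}. ?g j k)" by (simp add: sum.cartesian_product)
    also have "\<dots> = (\<Sum>(j, k)\<in>{(j, k). j + k \<le> K}. ?g j k)"
    proof (rule sum.mono_neutral_right)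
      show "\<forall>p\<in>{..K} \<times> {..K} - {(j, k). j + k \<le> K}. (case p of (j, k) \<Rightarrow> ?g j k) = 0"
      proof
        fix p assume p: "p \<in> {..K} \<times> {..K} - {(j, k). j + k \<le> K}"
        obtain j k where jk: "p = (j, k)" by (cases p)
        then have "N \<le> j \<or> N \<le> k" using p by (auto simp: K_def)
        then show "(case p of (j, k) \<Rightarrow> ?g j k) = 0" unfolding jk
          by (auto simp: ad_vanish)
      qed
    qed auto
    also have "\<dots> = (\<Sum>n\<le>K. \<Sum>j\<le>n. ?g j (n - j))" by (rule sum.triangle_reindex_eq)
    also have "\<dots> = (\<Sum>n\<le>K. ?c n * (\<Sum>j\<le>n. of_nat (n choose j) * act ps (ad x j u) (act ps (ad x (n - j) w) (?f n)) be))"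
    proof (rule sum.cong[OF refl])
      fix n
      have "?g j (n - j) = ?c n * (of_nat (n choose j) * act ps (ad x j u) (act ps (ad x (n - j) w) (?f n)) be)"
        if "j \<le> n" for j
      proof -
        have "((j + i + (n - j)) choose (j + (n - j))) * ((j + (n - j)) choose (n - j))
            = ((j + i + (n - j)) choose (n - j)) * ((j + i) choose j)" by (rule choose_mult_lemma)
        then have "((i + j) choose j) * ((i + n) choose (n - j)) = ((i + n) choose n) * (n choose j)"
          using that by (simp add: add_ac mult_ac binomial_symmetric[of j n])
        then have "of_nat ((i + j) choose j) * of_nat ((i + n) choose (n - j))
            = (of_nat ((i + n) choose n) * of_nat (n choose j) :: 'k)"
          by (simp flip: of_nat_mult)
        then show ?thesis using that by (simp add: mult.assoc)
      qed
      then show "(\<Sum>j\<le>n. ?g j (n - j)) = ?c n * (\<Sum>j\<le>n. of_nat (n choose j) * act ps (ad x j u) (act ps (ad x (n - j) w) (?f n)) be)"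
        unfolding sum_distrib_left by (intro sum.cong) auto
    qed
    finally show ?thesis .
  qed
  have rev: "(\<Sum>j\<le>n. of_nat (n choose j) * act ps (ad x j w) (act ps (ad x (n - j) u) (?f n)) be)
    = (\<Sum>j\<le>n. of_nat (n choose j) * act ps (ad x (n - j) w) (act ps (ad x j u) (?f n)) be)" for n
    by (rule sum.reindex_bij_witness[of _ "\<lambda>j. n - j" "\<lambda>j. n - j"]) (auto simp: binomial_symmetric[symmetric])
  have "act ((x, y) # ps) (bracket u w) f al
    = (\<Sum>n\<le>K. ?c n * act ps (ad x n (bracket u w)) (?f n) be)"
    unfolding Cons by (rule act_lam_cent[OF _ K]) (intro bracket_in_lam_cent lam_cent_sub_h u w)
  also have "\<dots> = (\<Sum>n\<le>K. ?c n * (\<Sum>j\<le>n. of_nat (n choose j) *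
      (act ps (ad x j u) (act ps (ad x (n - j) w) (?f n)) be - act ps (ad x (n - j) w) (act ps (ad x j u) (?f n)) be)))"
    by (simp add: ad_Leibniz act_sum_left act_scale_left IH ad_in_lam_cent u w)
  finally show ?thesis
    unfolding comp[OF u w] comp[OF w u] rev by (simp add: right_diff_distrib sum_subtractf)
qed simp

end

text \<open>By bilinearity it suffices to treat \<open>x\<close> with itself, \<open>x\<close> with
  the complement, and the complement with itself; the last case uses the shorter chain.\<close>

lemma act_bracket:
  assumes "adapted ps h" "u \<in> h" "w \<in> h"
  shows "act ps (bracket u w) f al = act ps u (act ps w f) al - act ps w (act ps u f) al"
  using assms
proof (induction ps arbitrary: h u w f al)
  case (Cons q ps)
  obtain x y where q: "q = (x, y)" by (cases q)
  have adp: "adapted ((x, y) # ps) h" using Cons.prems q by simp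
  let ?a = "act ((x, y) # ps)"
  let ?u = "prj x y u" and ?w = "prj x y w" and ?c = "mu x y u" and ?d = "mu x y w"
  note uc = prj_in_lam_cent[OF adp Cons.prems(2)] and wc = prj_in_lam_cent[OF adp Cons.prems(3)]
  have rep: "?a (bracket v v') f al = ?a v (?a v' f) al - ?a v' (?a v f) al"
    if "v \<in> lam_cent y h" "v' \<in> lam_cent y h" for v v'
    by (rule act_bracket_lam_cent[OF adp _ that], rule Cons.IH) (use adp in auto)
  have su: "?a u g = (\<lambda>al. ?c * ?a x g al + ?a ?u g al)" and
    sw: "?a w g = (\<lambda>al. ?d * ?a x g al + ?a ?w g al)" for g
    by (rule act_split[OF adp])+
  have "bracket u w = bracket (scale ?c x + ?u) (scale ?d x + ?w)" by (simp add: prj_def)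
  also have "\<dots> = scale ?c (bracket x ?w) + scale (- ?d) (bracket x ?u) + bracket ?u ?w"
    using bracket_anti[of ?u x]
    by (simp add: bracket_add_left bracket_add_right bracket_scale_left bracket_scale_right bracket_alternating)
  finally have "?a (bracket u w) f al
    = ?c * ?a (bracket x ?w) f al - ?d * ?a (bracket x ?u) f al + ?a (bracket ?u ?w) f al"
    by (simp only: act_add_left act_scale_left) simp
  also have "\<dots> = ?c * (?a x (?a ?w f) al - ?a ?w (?a x f) al) - ?d * (?a x (?a ?u f) al - ?a ?u (?a x f) al)
     + (?a ?u (?a ?w f) al - ?a ?w (?a ?u f) al)"
    by (simp only: act_bracket_x[OF adp uc] act_bracket_x[OF adp wc] rep[OF uc wc])
  also have "\<dots> = ?a u (?a w f) al - ?a w (?a u f) al"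
    by (simp only: su sw act_add_right act_scale_right) (simp add: algebra_simps)
  finally show ?case using q by simp
qed simp


text \<open>\<open>ad x\<close> preserves the ideal, so the claim descends to the empty chain, where
  the action is multiplication by \<open>lam\<close>.\<close>

lemma act_ideal:
  assumes "adapted ps h" "ideal_in a h" "u \<in> a" "length al = length ps"
  shows "act ps u f al = 0"
  using assms
proof (induction ps arbitrary: h u f al)
  case (Cons q ps)
  obtain x y where q: "q = (x, y)" by (cases q)
  obtain i be where al: "al = i # be" "length be = length ps" using Cons.prems(4) by (cases al) auto
  have adp: "adapted ((x, y) # ps) h" using Cons.prems q by simp
  have adc: "adapted ps (lam_cent y h)" using adp by simp
  have ic: "ideal_in a (lam_cent y h)" using ideal_in_lam_cent Cons.prems(2) y_in(1)[OF adp] by blast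
  then have uc: "u \<in> lam_cent y h" using Cons.prems(3) by (auto simp: ideal_in_def)
  have "ad x j u \<in> a" for j
    by (induction j) (use Cons.prems(2,3) x_in(1)[OF adp] in \<open>auto simp: ideal_in_def\<close>)
  then have "act ps (ad x j u) f be = 0" for j f using Cons.IH[OF adc ic _ al(2)] by blast
  then show ?case unfolding q al(1) act_lam_cent[OF adp uc order_refl] by simp
qed (simp add: ideal_in_def)

text \<open>\<open>u\<close> is central modulo \<open>a\<close>, so all terms with
  \<open>j > 0\<close> act through \<open>a\<close>, hence as zero; only the term
  \<open>j = 0\<close> remains along the chain.\<close>

lemma act_scalar:
  assumes "adapted ps h" "ideal_in a h" "u \<in> h" "\<And>w. w \<in> h \<Longrightarrow> bracket w u \<in> a" "length al = length ps"
  shows "act ps u f al = lam u * f al"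
  using assms
proof (induction ps arbitrary: h u f al)
  case (Cons q ps)
  obtain x y where q: "q = (x, y)" by (cases q)
  obtain i be where al: "al = i # be" "length be = length ps" using Cons.prems(5) by (cases al) auto
  have adp: "adapted ((x, y) # ps) h" using Cons.prems q by simp
  have adc: "adapted ps (lam_cent y h)" using adp by simp
  have ic: "ideal_in a (lam_cent y h)" using ideal_in_lam_cent Cons.prems(2) y_in(1)[OF adp] by blast
  have "bracket y u \<in> a" using Cons.prems(4) y_in(1)[OF adp] by blast
  then have uc: "u \<in> lam_cent y h"
    using Cons.prems(2,3) bracket_anti[of u y] by (auto simp: ideal_in_def lam_cent_def lam_minus)
  have "ad x (Suc j) u \<in> a" for j
    by (induction j) (use Cons.prems(2,4) x_in(1)[OF adp] in \<open>auto simp: ideal_in_def\<close>)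
  then have z: "act ps (ad x j u) f be = 0" if "j \<noteq> 0" for j f
    using act_ideal[OF adc ic _ al(2)] that by (metis not0_implies_Suc)
  have "act ps u (\<lambda>be. f (i # be)) be = lam u * f (i # be)"
    using Cons.IH[OF adc ic uc _ al(2)] Cons.prems(4) lam_cent_sub_h[OF adp] by blast
  moreover have "(\<Sum>j\<le>N. (-1) ^ j * of_nat ((i + j) choose j) * act ps (ad x j u) (\<lambda>be. f ((i + j) # be)) be)
    = (\<Sum>j\<in>{0}. (-1) ^ j * of_nat ((i + j) choose j) * act ps (ad x j u) (\<lambda>be. f ((i + j) # be)) be)"
    using z by (intro sum.mono_neutral_right) auto
  ultimately show ?case unfolding q al(1) act_lam_cent[OF adp uc order_refl] by simp
qed simp

subsection \<open>Boundedness and convergence\<close>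

definition bdd :: "real \<Rightarrow> (nat list \<Rightarrow> 'k) \<Rightarrow> bool" where
  "bdd R f \<longleftrightarrow> (\<forall>al. absv (f al) \<le> R)"

text \<open>The space underlying the Tate algebra in \<open>d\<close> variables: only finitely many
  coefficients exceed any given bound. Multi-indices are lists of length \<open>d\<close>.\<close>

definition Mset :: "nat \<Rightarrow> (nat list \<Rightarrow> 'k) set" where
  "Mset d = {f. (\<forall>al. f al \<noteq> 0 \<longrightarrow> length al = d) \<and> (\<forall>n. finite {al. \<not> absv (f al) \<le> r ^ n})}"

lemma bddD: "bdd R f \<Longrightarrow> absv (f al) \<le> R"
  by (simp add: bdd_def)

lemma bdd_nonneg: "bdd R f \<Longrightarrow> 0 \<le> R"
  using absv_nonneg bddD order_trans by blast

lemma bdd_add: "bdd R f \<Longrightarrow> bdd R g \<Longrightarrow> bdd R (\<lambda>al. f al + g al)"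
  by (simp add: bdd_def absv_add_le)

lemma bdd_diff: "bdd R f \<Longrightarrow> bdd R g \<Longrightarrow> bdd R (\<lambda>al. f al - g al)"
  by (simp add: bdd_def absv_diff_le)

lemma bdd_scale: "bdd R f \<Longrightarrow> absv c \<le> S \<Longrightarrow> bdd (S * R) (\<lambda>al. c * f al)"
  by (simp add: bdd_def absv_mult_le)

lemma bdd_0: "0 \<le> R \<Longrightarrow> bdd R (\<lambda>al. 0)"
  by (simp add: bdd_def)

lemma mu_le_1:
  assumes "adapted ((x, y) # ps) h" "u \<in> h \<inter> L" shows "absv (mu x y u) \<le> 1"
proof -
  have "absv (lam (bracket u y)) \<le> absv (lam (bracket x y))" using assms by auto
  moreover have "absv (lam (bracket x y)) > 0" using lam_xy[OF assms(1)] by (simp add: less_le)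
  ultimately show ?thesis by (simp add: mu_def absv_divide)
qed

text \<open>Here the maximality in \<open>adapted\<close> pays off: \<open>mu x y u\<close> is
  integral, hence \<open>prj x y u\<close> and its images under \<open>ad x\<close> stay in the
  lattice. All other coefficients are integers.\<close>

lemma act_bdd:
  assumes "adapted ps h" "u \<in> h" "u \<in> L" "bdd R f"
  shows "bdd R (act ps u f)"
  using assms
proof (induction ps arbitrary: h u f)
  case Nil
  then show ?case using lam_L by (simp add: bdd_def absv_mult_le1)
next
  case (Cons q ps)
  obtain x y where q: "q = (x, y)" by (cases q)
  have adp: "adapted ((x, y) # ps) h" using Cons.prems q by simp
  have adc: "adapted ps (lam_cent y h)" using adp by simp
  have c: "absv (mu x y u) \<le> 1" using mu_le_1[OF adp] Cons.prems by simp
  have pL: "prj x y u \<in> L" unfolding prj_def using L_diff L_scale[OF c] x_in(2)[OF adp] Cons.prems by blast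
  have adL: "ad x j (prj x y u) \<in> L" for j
    by (induction j) (use pL L_bracket x_in(2)[OF adp] in auto)
  have b: "absv (act ps (ad x j (prj x y u)) (\<lambda>be. f (k # be)) be) \<le> R" for j k be
    using Cons.IH[OF adc ad_in_lam_cent[OF adp prj_in_lam_cent[OF adp Cons.prems(2)]] adL, of "\<lambda>be. f (k # be)"] Cons.prems(4)
    by (simp add: bdd_def)
  have R: "0 \<le> R" using bdd_nonneg[OF Cons.prems(4)] .
  show ?case unfolding bdd_def
  proof
    fix al
    show "absv (act (q # ps) u f al) \<le> R"
    proof (cases al)
      case (Cons i be)
      have t: "absv ((-1) ^ j * of_nat ((i + j) choose j) * act ps (ad x j (prj x y u)) (\<lambda>be. f ((i + j) # be)) be) \<le> R" for j
      proof -
        have "absv ((-1) ^ j * of_nat ((i + j) choose j)) \<le> 1 * 1"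
          by (rule absv_mult_le) (simp_all add: absv_of_nat_le)
        then show ?thesis using absv_mult_le1 b by simp
      qed
      have "absv (if i = 0 then 0 else mu x y u * f ((i - 1) # be)) \<le> R"
        using R absv_mult_le1[OF c] bddD[OF Cons.prems(4)] by auto
      then show ?thesis unfolding q Cons act.simps
        by (rule absv_add_le) (rule absv_sum_le[OF R t])
    qed (use q R in simp)
  qed
qed

lemma act_finite:
  "finite {al. f al \<noteq> 0} \<Longrightarrow> finite {al. act ps u f al \<noteq> 0}"
proof (induction ps arbitrary: u f)
  case Nil
  have "{al. act [] u f al \<noteq> 0} \<subseteq> {al. f al \<noteq> 0}" by auto
  then show ?case using Nil finite_subset by blast
next
  case (Cons q ps)
  obtain x y where q: "q = (x, y)" by (cases q)
  have slice: "finite {be. f (k # be) \<noteq> 0}" for k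
    using finite_vimageI[OF Cons.prems, of "(#) k"] by (simp add: vimage_def inj_on_def)
  define S where "S i = {be. f ((i - 1) # be) \<noteq> 0} \<union>
     (\<Union>j\<in>{..N}. {be. act ps (ad x j (prj x y u)) (\<lambda>be. f ((i + j) # be)) be \<noteq> 0})" for i
  have fS: "finite (S i)" for i unfolding S_def by (intro finite_UnI finite_UN_I finite_atMost slice Cons.IH)
  have "finite (hd ` {al. f al \<noteq> 0})" using Cons.prems by blast
  then obtain B where B: "\<And>al. f al \<noteq> 0 \<Longrightarrow> hd al \<le> B" using finite_nat_set_iff_bounded_le by auto
  have "{al. act (q # ps) u f al \<noteq> 0} \<subseteq> (\<lambda>(i, be). i # be) ` (SIGMA i:{..Suc B}. S i)"
  proof
    fix al assume "al \<in> {al. act (q # ps) u f al \<noteq> 0}"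
    then have ne: "act (q # ps) u f al \<noteq> 0" by simp
    then obtain i be where al: "al = i # be" using q by (cases al) auto
    have "be \<in> S i"
    proof (rule ccontr)
      assume "be \<notin> S i"
      then show False using ne unfolding q al S_def by (auto split: if_splits)
    qed
    moreover have "i \<le> Suc B"
    proof (rule ccontr)
      assume "\<not> i \<le> Suc B"
      then have "f (k # be') = 0" if "i - 1 \<le> k" for k be' using B[of "k # be'"] that by fastforce
      then show False using ne unfolding q al by (auto split: if_splits)
    qed
    ultimately show "al \<in> (\<lambda>(i, be). i # be) ` (SIGMA i:{..Suc B}. S i)" unfolding al by force
  qed
  then show ?case by (rule finite_subset) (intro finite_imageI finite_SigmaI fS; simp)
qed

lemma MsetD: "f \<in> Mset d \<Longrightarrow> f al \<noteq> 0 \<Longrightarrow> length al = d" "f \<in> Mset d \<Longrightarrow> finite {al. \<not> absv (f al) \<le> r ^ n}"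
  by (auto simp: Mset_def)

text \<open>Uniform limits: beyond the finite exceptional set of \<open>g\<close>, both
  \<open>g\<close> and the error are at most \<open>r ^ n\<close>.\<close>

lemma MsetI_approx:
  assumes "\<And>al. f al \<noteq> 0 \<Longrightarrow> length al = d"
    and "\<And>n. \<exists>g. finite {al. \<not> absv (g al) \<le> r ^ n} \<and> bdd (r ^ n) (\<lambda>al. f al - g al)"
  shows "f \<in> Mset d"
proof -
  have "finite {al. \<not> absv (f al) \<le> r ^ n}" for n
  proof -
    obtain g where g: "finite {al. \<not> absv (g al) \<le> r ^ n}" "bdd (r ^ n) (\<lambda>al. f al - g al)" using assms(2) by blast
    have "absv (f al) \<le> r ^ n" if "absv (g al) \<le> r ^ n" for al
      using absv_add_le[OF bddD[OF g(2), of al] that] by simp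
    then have "{al. \<not> absv (f al) \<le> r ^ n} \<subseteq> {al. \<not> absv (g al) \<le> r ^ n}" by auto
    then show ?thesis using g(1) finite_subset by blast
  qed
  then show ?thesis using assms(1) by (auto simp: Mset_def)
qed

lemma Mset_add: "f \<in> Mset d \<Longrightarrow> g \<in> Mset d \<Longrightarrow> (\<lambda>al. f al + g al) \<in> Mset d"
proof -
  assume f: "f \<in> Mset d" and g: "g \<in> Mset d"
  have "finite {al. \<not> absv (f al + g al) \<le> r ^ n}" for n
  proof (rule finite_subset)
    show "{al. \<not> absv (f al + g al) \<le> r ^ n} \<subseteq> {al. \<not> absv (f al) \<le> r ^ n} \<union> {al. \<not> absv (g al) \<le> r ^ n}"
      using absv_add_le by blast
  qed (use MsetD(2)[OF f] MsetD(2)[OF g] in simp)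
  moreover have "length al = d" if "f al + g al \<noteq> 0" for al
    using MsetD(1)[OF f, of al] MsetD(1)[OF g, of al] that by fastforce
  ultimately show ?thesis by (simp add: Mset_def)
qed

lemma Mset_scale: "f \<in> Mset d \<Longrightarrow> (\<lambda>al. c * f al) \<in> Mset d"
proof -
  assume f: "f \<in> Mset d"
  obtain m where m: "absv c \<le> inverse r ^ m" using absv_le_inverse_power by blast
  have "finite {al. \<not> absv (c * f al) \<le> r ^ n}" for n
  proof (rule finite_subset)
    show "{al. \<not> absv (c * f al) \<le> r ^ n} \<subseteq> {al. \<not> absv (f al) \<le> r ^ (n + m)}"
    proof
      fix al assume "al \<in> {al. \<not> absv (c * f al) \<le> r ^ n}"
      moreover have "absv (c * f al) \<le> r ^ n" if "absv (f al) \<le> r ^ (n + m)"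
        using absv_mult_le[OF m that] by (simp add: power_add field_simps)
      ultimately show "al \<in> {al. \<not> absv (f al) \<le> r ^ (n + m)}" by blast
    qed
  qed (rule MsetD(2)[OF f])
  then show ?thesis using MsetD(1)[OF f] by (simp add: Mset_def)
qed

lemma Mset_0: "(\<lambda>al. 0) \<in> Mset d"
  by (simp add: Mset_def)

lemma Mset_diff: "f \<in> Mset d \<Longrightarrow> g \<in> Mset d \<Longrightarrow> (\<lambda>al. f al - g al) \<in> Mset d"
  using Mset_add[of f d "\<lambda>al. (-1) * g al"] Mset_scale[of g d "-1"] by simp

lemma Mset_sum: "(\<And>i. i \<in> A \<Longrightarrow> f i \<in> Mset d) \<Longrightarrow> (\<lambda>al. \<Sum>i\<in>A. f i al) \<in> Mset d"
  by (induction A rule: infinite_finite_induct) (simp_all add: Mset_0 Mset_add)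

lemma Mset_finite: "finite {al. f al \<noteq> 0} \<Longrightarrow> (\<And>al. f al \<noteq> 0 \<Longrightarrow> length al = d) \<Longrightarrow> f \<in> Mset d"
proof -
  assume f: "finite {al. f al \<noteq> 0}" and l: "\<And>al. f al \<noteq> 0 \<Longrightarrow> length al = d"
  have "{al. \<not> absv (f al) \<le> r ^ n} \<subseteq> {al. f al \<noteq> 0}" for n by auto
  then show ?thesis using l finite_subset[OF _ f] by (auto simp: Mset_def)
qed

lemma Mset_bdd:
  assumes "f \<in> Mset d" shows "\<exists>m. bdd (inverse r ^ m) f"
proof -
  let ?S = "{al. \<not> absv (f al) \<le> r ^ 0}"
  have fin: "finite ?S" by (rule MsetD(2)[OF assms])
  have "\<forall>al. \<exists>n. absv (f al) \<le> inverse r ^ n" using absv_le_inverse_power by blast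
  then obtain e where e: "\<And>al. absv (f al) \<le> inverse r ^ e al" by metis
  have ir: "1 \<le> inverse r" by (simp add: one_le_inverse_iff)
  \<comment> \<open>Only finitely many coefficients exceed 1; the sum of their exponents is a crude
    common bound.\<close>
  have "absv (f al) \<le> inverse r ^ (\<Sum>al\<in>?S. e al)" for al
  proof (cases "al \<in> ?S")
    case True
    then have "e al \<le> (\<Sum>al\<in>?S. e al)" using fin by (intro member_le_sum) auto
    then show ?thesis using e[of al] power_increasing[OF _ ir] order_trans by blast
  next
    case False
    then show ?thesis using one_le_power[OF ir] order_trans by fastforce
  qed
  then show ?thesis by (auto simp: bdd_def)
qed

definition trunc :: "nat \<Rightarrow> (nat list \<Rightarrow> 'k) \<Rightarrow> nat list \<Rightarrow> 'k" where
  "trunc n f al = (if absv (f al) \<le> r ^ n then 0 else f al)"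

lemma trunc_finite: "f \<in> Mset d \<Longrightarrow> finite {al. trunc n f al \<noteq> 0}"
  by (rule finite_subset[OF _ MsetD(2)[of f d n]]) (auto simp: trunc_def)

lemma trunc_bdd: "bdd (r ^ n) (\<lambda>al. f al - trunc n f al)"
  by (simp add: bdd_def trunc_def)

lemma trunc_support: "f \<in> Mset d \<Longrightarrow> trunc n f al \<noteq> 0 \<Longrightarrow> length al = d"
  using MsetD(1) by (auto simp: trunc_def split: if_splits)

text \<open>Polynomials are mapped to polynomials, and the action does not increase norms, so
  approximation by polynomials carries over.\<close>

lemma act_Mset_L:
  assumes "adapted ps h" "u \<in> h" "u \<in> L" "f \<in> Mset (length ps)"
  shows "act ps u f \<in> Mset (length ps)"
proof (rule MsetI_approx)
  show "length al = length ps" if "act ps u f al \<noteq> 0" for al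
    using act_support[of f ps u al] MsetD(1)[OF assms(4)] that by blast
  fix n
  define g where "g = trunc n f"
  have g: "finite {al. g al \<noteq> 0}" "bdd (r ^ n) (\<lambda>al. f al - g al)"
    unfolding g_def by (rule trunc_finite[OF assms(4)], rule trunc_bdd)
  have "{al. \<not> absv (act ps u g al) \<le> r ^ n} \<subseteq> {al. act ps u g al \<noteq> 0}" by auto
  then have "finite {al. \<not> absv (act ps u g al) \<le> r ^ n}" by (rule finite_subset) (rule act_finite[OF g(1)])
  moreover have "bdd (r ^ n) (\<lambda>al. act ps u f al - act ps u g al)"
    using act_bdd[OF assms(1-3) g(2)] by (simp add: act_diff_right bdd_def)
  ultimately show "\<exists>g. finite {al. \<not> absv (g al) \<le> r ^ n} \<and> bdd (r ^ n) (\<lambda>al. act ps u f al - g al)" by blast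
qed

lemma act_Mset:
  assumes "adapted ps h" "u \<in> h" "f \<in> Mset (length ps)"
  shows "act ps u f \<in> Mset (length ps)"
proof -
  obtain n where n: "scale (\<pi> ^ n) u \<in> L" using L_span by blast
  have "scale (\<pi> ^ n) u \<in> h" using adapted_subspace[OF assms(1)] assms(2) subspaceD(3) by blast
  then have "act ps (scale (\<pi> ^ n) u) f \<in> Mset (length ps)" using act_Mset_L assms(1,3) n by blast
  then have "(\<lambda>al. inverse (\<pi> ^ n) * act ps (scale (\<pi> ^ n) u) f al) \<in> Mset (length ps)" by (rule Mset_scale)
  then show ?thesis by (simp add: act_scale_left mult.assoc[symmetric])
qed

subsection \<open>Monomials\<close>

definition unit :: "nat list \<Rightarrow> nat list \<Rightarrow> 'k" where
  "unit al = (\<lambda>be. if be = al then 1 else 0)"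

text \<open>Series in the later variables, regarded as series of degree 0 in the first
  variable.\<close>

definition emb :: "(nat list \<Rightarrow> 'k) \<Rightarrow> nat list \<Rightarrow> 'k" where
  "emb m al = (case al of [] \<Rightarrow> 0 | i # be \<Rightarrow> if i = 0 then m be else 0)"

lemma emb_simps [simp]: "emb m [] = 0" "emb m (0 # be) = m be" "i \<noteq> 0 \<Longrightarrow> emb m (i # be) = 0"
  by (simp_all add: emb_def)

lemma unit_Mset: "unit al \<in> Mset (length al)"
  by (rule Mset_finite) (auto simp: unit_def split: if_splits)

lemma unit_bdd: "bdd 1 (unit al)"
  by (simp add: bdd_def unit_def)

lemma emb_unit: "emb (unit be) = unit (0 # be)"
  by (rule ext) (auto simp: emb_def unit_def split: list.split)

text \<open>Such a series has only the slice with first exponent 0, so the single term with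
  \<open>i + j = 0\<close> contributes: the first variable is invisible to
  \<open>lam_cent y h\<close>.\<close>

lemma act_emb:
  assumes adp: "adapted ((x, y) # ps) h" and w: "w \<in> lam_cent y h"
  shows "act ((x, y) # ps) w (emb m) = emb (act ps w m)"
proof
  fix al
  show "act ((x, y) # ps) w (emb m) al = emb (act ps w m) al"
  proof (cases al)
    case (Cons i be)
    have e: "(\<lambda>be. emb m (k # be)) = (if k = 0 then m else (\<lambda>be. 0))" for k by auto
    have "act ((x, y) # ps) w (emb m) (i # be)
      = (\<Sum>j\<le>N. (-1) ^ j * of_nat ((i + j) choose j) * act ps (ad x j w) (if i + j = 0 then m else (\<lambda>be. 0)) be)"
      unfolding act_lam_cent[OF adp w order_refl] e ..
    also have "\<dots> = (\<Sum>j\<in>{0}. (-1) ^ j * of_nat ((i + j) choose j) * act ps (ad x j w) (if i + j = 0 then m else (\<lambda>be. 0)) be)"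
      by (intro sum.mono_neutral_right) auto
    finally show ?thesis unfolding Cons by (auto simp: emb_def)
  qed simp
qed

fun mon :: "('g \<times> 'g) list \<Rightarrow> nat list \<Rightarrow> 'g list" where
  "mon ((x, y) # ps) (i # al) = replicate i x @ mon ps al"
| "mon _ _ = []"

definition actw :: "('g \<times> 'g) list \<Rightarrow> 'g list \<Rightarrow> (nat list \<Rightarrow> 'k) \<Rightarrow> nat list \<Rightarrow> 'k" where
  "actw ps ws f = foldr (act ps) ws f"

lemma actw_Nil [simp]: "actw ps [] f = f"
  and actw_Cons [simp]: "actw ps (u # ws) f = act ps u (actw ps ws f)"
  and actw_append: "actw ps (ws @ vs) f = actw ps ws (actw ps vs f)"
  by (simp_all add: actw_def)

lemma gens_in: "adapted ps h \<Longrightarrow> x \<in> fst ` set ps \<Longrightarrow> x \<in> h \<and> x \<in> L"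
  by (induction ps h rule: adapted.induct) (auto simp: lam_cent_def)

lemma mon_subset: "adapted ps h \<Longrightarrow> set (mon ps al) \<subseteq> h \<inter> L"
proof (induction ps al arbitrary: h rule: mon.induct)
  case (1 x y ps i al)
  then show ?case using 1(1)[of "lam_cent y h"] by (auto simp: lam_cent_def)
qed auto

lemma actw_mon:
  assumes "adapted ps h" "length al = length ps"
  shows "actw ps (mon ps al) (unit (replicate (length ps) 0)) = unit al"
  using assms
proof (induction ps arbitrary: h al)
  case (Cons q ps)
  obtain x y where q: "q = (x, y)" by (cases q)
  obtain i be where al: "al = i # be" "length be = length ps" using Cons.prems(2) by (cases al) auto
  have adp: "adapted ((x, y) # ps) h" using Cons.prems q by simp
  have adc: "adapted ps (lam_cent y h)" using adp by simp
  have e: "actw ((x, y) # ps) ws (emb m) = emb (actw ps ws m)" if "set ws \<subseteq> lam_cent y h" for ws m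
    using that by (induction ws) (simp_all add: act_emb[OF adp])
  have "actw ((x, y) # ps) (replicate i x) (unit (0 # be)) = unit (i # be)"
  proof (induction i)
    case (Suc i)
    have "act ((x, y) # ps) x (unit (i # be)) = unit (Suc i # be)"
    proof
      fix ga show "act ((x, y) # ps) x (unit (i # be)) ga = unit (Suc i # be) ga"
        by (cases ga) (use act_x[OF adp] in \<open>auto simp: unit_def simp del: act.simps(3)\<close>)
    qed
    then show ?case using Suc by simp
  qed simp
  then show ?case
    unfolding q al(1) using mon_subset[OF adc, of be] Cons.IH[OF adc al(2)]
    by (simp add: actw_append emb_unit[symmetric] e)
qed (simp add: unit_def)

subsection \<open>Closed stable subspaces\<close>

definition closed_sub :: "nat \<Rightarrow> (nat list \<Rightarrow> 'k) set \<Rightarrow> bool" where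
  "closed_sub d H \<longleftrightarrow> H \<subseteq> Mset d \<and> (\<forall>f\<in>H. \<forall>g\<in>H. (\<lambda>al. f al + g al) \<in> H) \<and>
     (\<forall>c. \<forall>f\<in>H. (\<lambda>al. c * f al) \<in> H) \<and>
     (\<forall>f\<in>Mset d. (\<forall>n. \<exists>g\<in>H. bdd (r ^ n) (\<lambda>al. f al - g al)) \<longrightarrow> f \<in> H)"

lemma closed_subD:
  assumes "closed_sub d H"
  shows "f \<in> H \<Longrightarrow> f \<in> Mset d" "f \<in> H \<Longrightarrow> g \<in> H \<Longrightarrow> (\<lambda>al. f al + g al) \<in> H"
    "f \<in> H \<Longrightarrow> (\<lambda>al. c * f al) \<in> H" "f \<in> H \<Longrightarrow> g \<in> H \<Longrightarrow> (\<lambda>al. f al - g al) \<in> H"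
    "f \<in> Mset d \<Longrightarrow> (\<And>n. \<exists>g\<in>H. bdd (r ^ n) (\<lambda>al. f al - g al)) \<Longrightarrow> f \<in> H"
proof -
  show "f \<in> H \<Longrightarrow> f \<in> Mset d" and a: "f \<in> H \<Longrightarrow> g \<in> H \<Longrightarrow> (\<lambda>al. f al + g al) \<in> H" and
    s: "f \<in> H \<Longrightarrow> (\<lambda>al. c * f al) \<in> H" and
    "f \<in> Mset d \<Longrightarrow> (\<And>n. \<exists>g\<in>H. bdd (r ^ n) (\<lambda>al. f al - g al)) \<Longrightarrow> f \<in> H" for f g c
    using assms by (auto simp: closed_sub_def)
  show "f \<in> H \<Longrightarrow> g \<in> H \<Longrightarrow> (\<lambda>al. f al - g al) \<in> H"
    using a[of f "\<lambda>al. (-1) * g al"] s[of g "-1"] by simp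
qed

lemma closed_sub_sum:
  assumes "closed_sub d H" "\<And>i. i \<in> A \<Longrightarrow> f i \<in> H" "(\<lambda>al. 0) \<in> H"
  shows "(\<lambda>al. \<Sum>i\<in>A. f i al) \<in> H"
  using assms(2) by (induction A rule: infinite_finite_induct) (use assms closed_subD(2)[OF assms(1)] in auto)

lemma emb_Mset_iff: "emb m \<in> Mset (Suc d) \<longleftrightarrow> m \<in> Mset d"
proof -
  have "{al. \<not> absv (emb m al) \<le> r ^ n} = (#) 0 ` {be. \<not> absv (m be) \<le> r ^ n}" for n
  proof (rule Set.set_eqI)
    fix al show "al \<in> {al. \<not> absv (emb m al) \<le> r ^ n} \<longleftrightarrow> al \<in> (#) 0 ` {be. \<not> absv (m be) \<le> r ^ n}"
      by (cases al) (auto simp: emb_def)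
  qed
  then have fin: "finite {al. \<not> absv (emb m al) \<le> r ^ n} \<longleftrightarrow> finite {be. \<not> absv (m be) \<le> r ^ n}" for n
    by (simp add: finite_image_iff)
  have "(\<forall>al. emb m al \<noteq> 0 \<longrightarrow> length al = Suc d) \<longleftrightarrow> (\<forall>be. m be \<noteq> 0 \<longrightarrow> length be = d)"
  proof
    assume a: "\<forall>al. emb m al \<noteq> 0 \<longrightarrow> length al = Suc d"
    show "\<forall>be. m be \<noteq> 0 \<longrightarrow> length be = d" using a[rule_format, of "0 # _"] by simp
  qed (auto simp: emb_def split: list.splits if_splits)
  then show ?thesis by (simp add: Mset_def fin)
qed

lemma slice_Mset: "f \<in> Mset (Suc d) \<Longrightarrow> (\<lambda>be. f (i # be)) \<in> Mset d"
proof -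
  assume f: "f \<in> Mset (Suc d)"
  have "finite {be. \<not> absv (f (i # be)) \<le> r ^ n}" for n
    using finite_vimageI[OF MsetD(2)[OF f, of n], of "(#) i"] by (simp add: vimage_def inj_on_def)
  then show ?thesis using MsetD(1)[OF f, of "i # _"] by (simp add: Mset_def)
qed

text \<open>The operator \<open>(d/dx)^k / k!\<close> for the first variable; \<open>shift k\<close>
  below is multiplication by \<open>x^k\<close>.\<close>

definition divided_deriv :: "nat \<Rightarrow> (nat list \<Rightarrow> 'k) \<Rightarrow> nat list \<Rightarrow> 'k" where
  "divided_deriv k f al = (case al of [] \<Rightarrow> 0 | i # be \<Rightarrow> of_nat ((i + k) choose k) * f ((i + k) # be))"

definition shift :: "nat \<Rightarrow> (nat list \<Rightarrow> 'k) \<Rightarrow> nat list \<Rightarrow> 'k" where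
  "shift k f al = (case al of [] \<Rightarrow> 0 | i # be \<Rightarrow> if i < k then 0 else f ((i - k) # be))"

text \<open>Modulo the ideal of the chain, \<open>y\<close> is central in
  \<open>lam_cent y h\<close> and \<open>[x, y]\<close> is central in \<open>h\<close>. So both act
  as scalars, and the terms from \<open>(ad x)^2 y\<close> on vanish.\<close>

lemma act_y:
  assumes adp: "adapted ((x, y) # ps) h" and f: "f \<in> Mset (Suc (length ps))"
  shows "act ((x, y) # ps) y f al = lam y * f al - lam (bracket x y) * divided_deriv 1 f al"
proof (cases "length al = Suc (length ps)")
  case True
  then obtain i be where al: "al = i # be" "length be = length ps" by (cases al) auto
  have adc: "adapted ps (lam_cent y h)" using adp by simp
  obtain a where a: "ideal_in a h" "\<And>u. u \<in> lam_cent y h \<Longrightarrow> bracket u y \<in> a"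
    "\<And>u w. u \<in> h \<Longrightarrow> w \<in> h \<Longrightarrow> bracket u (bracket w y) \<in> a" using adp by auto
  have ac: "ideal_in a (lam_cent y h)" using ideal_in_lam_cent[OF a(1) y_in(1)[OF adp]] .
  have yc: "y \<in> lam_cent y h" and xh: "x \<in> h" and yh: "y \<in> h" using y_in[OF adp] x_in[OF adp] by auto
  have xyc: "bracket x y \<in> lam_cent y h" using bracket_in_lam_cent[OF adp xh yh] .
  have "ad x (Suc (Suc j)) y \<in> a" for j
    by (induction j) (use a xh yh in \<open>auto simp: ideal_in_def\<close>)
  then have z: "act ps (ad x j y) g be = 0" if "j \<notin> {0, 1}" for j g
    using act_ideal[OF adc ac _ al(2)] that by (cases j rule: nat.exhaust; cases "j - 1" rule: nat.exhaust) auto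
  let ?t = "\<lambda>j. (-1) ^ j * of_nat ((i + j) choose j) * act ps (ad x j y) (\<lambda>be. f ((i + j) # be)) be"
  \<comment> \<open>The range is enlarged so that it contains the index 1 whatever \<open>N\<close>
    is.\<close>
  have "act ((x, y) # ps) y f al = (\<Sum>j\<le>Suc N. ?t j)"
    unfolding al(1) by (rule act_lam_cent[OF adp yc]) simp
  also have "\<dots> = (\<Sum>j\<in>{0, 1}. ?t j)"
    using z by (intro sum.mono_neutral_right) auto
  also have "\<dots> = act ps y (\<lambda>be. f (i # be)) be - of_nat (Suc i) * act ps (bracket x y) (\<lambda>be. f (Suc i # be)) be"
    by (simp add: algebra_simps)
  also have "act ps y (\<lambda>be. f (i # be)) be = lam y * f (i # be)"
    using act_scalar[OF adc ac yc _ al(2)] a(2) by blast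
  also have "act ps (bracket x y) (\<lambda>be. f (Suc i # be)) be = lam (bracket x y) * f (Suc i # be)"
    by (rule act_scalar[OF adc ac xyc _ al(2)]) (simp add: a(3) lam_cent_sub_h[OF adp] xh)
  finally show ?thesis by (simp add: al divided_deriv_def algebra_simps)
next
  case False
  have "f be = 0" if "length be \<noteq> Suc (length ps)" for be using MsetD(1)[OF f, of be] that by auto
  moreover have "act ((x, y) # ps) y f al = 0"
    using act_support[of f "(x, y) # ps" y al] MsetD(1)[OF f] False by auto
  ultimately show ?thesis using False by (auto simp: divided_deriv_def split: list.split)
qed

text \<open>
  As \<open>y\<close> acts as \<open>lam y\<close> minus a multiple of \<open>d/dx\<close>, stable subspaces are closed under the divided
  derivatives, and hence under evaluation at \<open>x = 0\<close>, which is the operator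
  \<open>\<Sum>\<^sub>k (-1)\<^sup>k x\<^sup>k (d/dx)\<^sup>k / k!\<close>.
\<close>

lemma closed_stable:
  assumes "adapted ps h" "closed_sub (length ps) H"
    and "\<And>u f. u \<in> h \<Longrightarrow> f \<in> H \<Longrightarrow> act ps u f \<in> H" "f \<in> H" "f al0 \<noteq> 0"
  shows "unit (replicate (length ps) 0) \<in> H"
  using assms
proof (induction ps arbitrary: h H f al0)
  case Nil
  have "al0 = []" using MsetD(1)[OF closed_subD(1)[OF Nil(2,4)] Nil(5)] by simp
  have "(\<lambda>al. inverse (f []) * f al) = unit []"
  proof
    fix al show "inverse (f []) * f al = unit [] al"
      using MsetD(1)[OF closed_subD(1)[OF Nil(2,4)], of al] Nil(5) \<open>al0 = []\<close> by (cases "al = []") (auto simp: unit_def)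
  qed
  then show ?case using closed_subD(3)[OF Nil(2,4), of "inverse (f [])"] by simp
next
  case (Cons q ps)
  obtain x y where q: "q = (x, y)" by (cases q)
  have adp: "adapted ((x, y) # ps) h" using Cons.prems(1) q by simp
  have adc: "adapted ps (lam_cent y h)" using adp by simp
  have cl: "closed_sub (Suc (length ps)) H" using Cons.prems(2) by simp
  note H = closed_subD[OF cl]
  have st: "act ((x, y) # ps) u f \<in> H" if "u \<in> h" "f \<in> H" for u f using Cons.prems(3) that q by simp
  have H0: "(\<lambda>al. 0) \<in> H" using H(3)[OF Cons.prems(4), of 0] by simp
  have d1: "divided_deriv 1 g \<in> H" if g: "g \<in> H" for g
  proof -
    have "divided_deriv 1 g = (\<lambda>al. inverse (lam (bracket x y)) * (lam y * g al - act ((x, y) # ps) y g al))"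
      using act_y[OF adp H(1)[OF g]] lam_xy[OF adp] by auto
    also have "\<dots> \<in> H" by (intro H(3) H(4) g st y_in(1)[OF adp])
    finally show ?thesis .
  qed
  \<comment> \<open>Dividing the iterated derivative by \<open>Suc k\<close> at each step is
    possible because the field has characteristic 0 and \<open>H\<close> is a subspace over
    it.\<close>
  have dk: "divided_deriv k g \<in> H" if g: "g \<in> H" for k g
  proof (induction k)
    case 0
    have "divided_deriv 0 g = g" using MsetD(1)[OF H(1)[OF g], of "[]"] by (auto simp: divided_deriv_def fun_eq_iff split: list.split)
    then show ?case using g by simp
  next
    case (Suc k)
    have "divided_deriv (Suc k) g = (\<lambda>al. inverse (of_nat (Suc k)) * divided_deriv 1 (divided_deriv k g) al)"
    proof
      fix al
      have "of_nat (Suc i) * of_nat (Suc i + k choose k) = (of_nat (Suc k) * of_nat (i + Suc k choose Suc k) :: 'k)" for i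
      proof -
        have "Suc k * (Suc (i + k) choose Suc k) = Suc (i + k) * (i + k choose k)"
          using Suc_times_binomial_eq[of "i + k" k] by (simp add: mult.commute del: binomial_Suc_Suc)
        moreover have "Suc i * (Suc (i + k) choose k) = Suc (i + k) * (i + k choose k)"
          using binomial_absorb_comp[of "Suc (i + k)" k] by (simp add: Suc_diff_le del: binomial_Suc_Suc)
        ultimately have "Suc i * (Suc i + k choose k) = Suc k * (i + Suc k choose Suc k)" by simp
        then show ?thesis by (metis of_nat_mult)
      qed
      then show "divided_deriv (Suc k) g al = inverse (of_nat (Suc k)) * divided_deriv 1 (divided_deriv k g) al"
        using char_0[of "Suc k"]
        by (auto simp: divided_deriv_def field_simps split: list.split simp del: of_nat_Suc binomial_Suc_Suc)
    qed
    also have "\<dots> \<in> H" by (intro H(3) d1 Suc)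
    finally show ?case .
  qed
  have sk: "shift k g \<in> H" if g: "g \<in> H" for k g
  proof (induction k)
    case 0
    have "shift 0 g = g" using MsetD(1)[OF H(1)[OF g], of "[]"] by (auto simp: shift_def fun_eq_iff split: list.split)
    then show ?case using g by simp
  next
    case (Suc k)
    have "shift (Suc k) g = act ((x, y) # ps) x (shift k g)"
    proof
      fix al show "shift (Suc k) g al = act ((x, y) # ps) x (shift k g) al"
        by (cases al) (auto simp: act_x[OF adp] shift_def simp del: act.simps(3) split: nat.split)
    qed
    then show ?case using st[OF x_in(1)[OF adp] Suc] by simp
  qed
  have P: "emb (\<lambda>be. g (0 # be)) \<in> H" if g: "g \<in> H" for g
  proof (rule H(5))
    note gM = H(1)[OF g]
    show "emb (\<lambda>be. g (0 # be)) \<in> Mset (Suc (length ps))"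
      unfolding emb_Mset_iff by (rule slice_Mset[OF gM])
    fix m
    have "finite (hd ` {al. \<not> absv (g al) \<le> r ^ m})" using MsetD(2)[OF gM] by blast
    then obtain n where n: "\<And>al. \<not> absv (g al) \<le> r ^ m \<Longrightarrow> hd al \<le> n" using finite_nat_set_iff_bounded_le by auto
    \<comment> \<open>A partial sum of the evaluation operator. Coefficients above
      \<open>r ^ m\<close> occur only for first exponents up to \<open>n\<close>, so the sum is cut
      off there.\<close>
    define p where "p = (\<lambda>al. \<Sum>k\<le>n. (-1) ^ k * shift k (divided_deriv k g) al)"
    have "p \<in> H" unfolding p_def by (intro closed_sub_sum[OF cl _ H0] H(3) sk dk g)
    moreover have "bdd (r ^ m) (\<lambda>al. emb (\<lambda>be. g (0 # be)) al - p al)"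
      unfolding bdd_def
    proof
      fix al
      show "absv (emb (\<lambda>be. g (0 # be)) al - p al) \<le> r ^ m"
      proof (cases al)
        case Nil
        then show ?thesis by (simp add: p_def shift_def)
      next
        case (Cons i be)
        \<comment> \<open>The monomial \<open>x^i\<close> is an eigenvector of
          \<open>x^k (d/dx)^k / k!\<close> with eigenvalue \<open>i choose k\<close>. The
          alternating sum of these vanishes for \<open>i > 0\<close> once the range reaches
          \<open>i\<close>.\<close>
        have "shift k (divided_deriv k g) al = of_nat (i choose k) * g al" for k
          by (simp add: Cons shift_def divided_deriv_def binomial_eq_0)
        then have pal: "p al = (\<Sum>k\<le>n. (-1) ^ k * of_nat (i choose k)) * g al"
          unfolding p_def sum_distrib_right by (simp add: mult.assoc)
        show ?thesis
        proof (cases "i \<le> n")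
          case True
          have "(\<Sum>k\<le>n. (-1) ^ k * of_nat (i choose k)) = (\<Sum>k\<le>i. (-1) ^ k * of_nat (i choose k) :: 'k)"
            using True by (intro sum.mono_neutral_right) (simp_all add: binomial_eq_0 not_le)
          also have "\<dots> = (if i = 0 then 1 else 0)" using choose_alternating_sum[of i, where ?'a = 'k] by auto
          finally show ?thesis using pal Cons by (auto simp: emb_def)
        next
          case False
          then have g1: "absv (g al) \<le> r ^ m" using n[of al] Cons by auto
          \<comment> \<open>For exponents beyond the cut-off the alternating sum is incomplete, but
            it is still an integer and the coefficient is small.\<close>
          have "absv (\<Sum>k\<le>n. (-1) ^ k * of_nat (i choose k)) \<le> 1"
            by (intro absv_sum_le) (auto intro!: absv_mult_le1 simp: absv_of_nat_le)
          then have "absv (p al) \<le> r ^ m" unfolding pal using g1 by (rule absv_mult_le1)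
          moreover have "emb (\<lambda>be. g (0 # be)) al = 0" using False Cons by simp
          ultimately show ?thesis by simp
        qed
      qed
    qed
    ultimately show "\<exists>p\<in>H. bdd (r ^ m) (\<lambda>al. emb (\<lambda>be. g (0 # be)) al - p al)" by blast
  qed
  \<comment> \<open>The elements of \<open>H\<close> that do not involve the first variable, seen as
    series for the shorter chain.\<close>
  define H' where "H' = {m \<in> Mset (length ps). emb m \<in> H}"
  obtain j be0 where al0: "al0 = j # be0"
    using MsetD(1)[OF H(1)[OF Cons.prems(4)] Cons.prems(5)] by (cases al0) auto
  have "unit (replicate (length ps) 0) \<in> H'"
  proof (rule Cons.IH[OF adc])
    have emb_lin: "emb (\<lambda>al. f al + g al) = (\<lambda>al. emb f al + emb g al)"
      "emb (\<lambda>al. f al - g al) = (\<lambda>al. emb f al - emb g al)"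
      "emb (\<lambda>al. c * f al) = (\<lambda>al. c * emb f al)" for f g and c :: 'k
      by (auto simp: emb_def split: list.split)
    show "closed_sub (length ps) H'"
      unfolding closed_sub_def
    proof (intro conjI ballI allI impI)
      show "H' \<subseteq> Mset (length ps)" by (auto simp: H'_def)
      fix f g assume "f \<in> H'" "g \<in> H'"
      then show "(\<lambda>al. f al + g al) \<in> H'" by (simp add: H'_def emb_lin Mset_add H(2))
    next
      fix c f assume "f \<in> H'"
      then show "(\<lambda>al. c * f al) \<in> H'" by (simp add: H'_def emb_lin Mset_scale H(3))
    next
      fix f assume f: "f \<in> Mset (length ps)" and ap: "\<forall>n. \<exists>g\<in>H'. bdd (r ^ n) (\<lambda>al. f al - g al)"
      have "emb f \<in> H"
      proof (rule H(5))
        show "emb f \<in> Mset (Suc (length ps))" using f by (simp add: emb_Mset_iff)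
        fix n
        obtain g where g: "g \<in> H'" "bdd (r ^ n) (\<lambda>al. f al - g al)" using ap by blast
        have "bdd (r ^ n) (\<lambda>al. emb f al - emb g al)"
          using bddD[OF g(2)] unfolding emb_lin(2)[symmetric] by (auto simp: bdd_def emb_def split: list.split)
        then show "\<exists>g\<in>H. bdd (r ^ n) (\<lambda>al. emb f al - g al)" using g(1) by (auto simp: H'_def)
      qed
      then show "f \<in> H'" using f by (simp add: H'_def)
    qed
    show "act ps u f \<in> H'" if "u \<in> lam_cent y h" "f \<in> H'" for u f
      using that st[OF lam_cent_sub_h[OF adp that(1)], of "emb f"] act_Mset[OF adc that(1)]
      by (simp add: H'_def act_emb[OF adp that(1)])
    \<comment> \<open>The \<open>j\<close>-th divided derivative moves the slice that contains the
      nonzero coefficient to exponent 0, where evaluation can isolate it.\<close>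
    have "emb (\<lambda>be. divided_deriv j f (0 # be)) \<in> H" by (intro P dk Cons.prems(4))
    moreover have "(\<lambda>be. divided_deriv j f (0 # be)) = (\<lambda>be. f (j # be))" by (simp add: divided_deriv_def)
    ultimately show "(\<lambda>be. f (j # be)) \<in> H'"
      using slice_Mset[OF H(1)[OF Cons.prems(4)]] by (simp add: H'_def)
    show "f (j # be0) \<noteq> 0" using Cons.prems(5) al0 by simp
  qed
  then show ?case by (simp add: H'_def emb_unit)
qed

end

section \<open>Completed enveloping algebras\<close>

lemma poly_mapping_expand: "q = (\<Sum>w\<in>Poly_Mapping.keys q. Poly_Mapping.single w (Poly_Mapping.lookup q w))"
  by (rule poly_mapping_eqI) (auto simp: lookup_sum lookup_single when_def in_keys_iff)

lemma free_scalar_mult: "free_scalar a * free_scalar b = free_scalar (a * b)"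
  and free_scalar_add: "free_scalar a + free_scalar b = free_scalar (a + b)"
  and free_scalar_1: "free_scalar 1 = 1" and free_scalar_0: "free_scalar 0 = 0"
  by (simp_all add: free_scalar_def mult_single single_add)

lemma free_scalar_single: "free_scalar a * Poly_Mapping.single w b = Poly_Mapping.single w (a * b)"
  by (simp add: free_scalar_def mult_single)

lemma free_scalar_central:
  fixes q :: "'g word \<Rightarrow>\<^sub>0 'k::field"
  shows "free_scalar a * q = q * free_scalar a"
proof -
  have "free_scalar a * Poly_Mapping.single w b = Poly_Mapping.single w b * free_scalar a" for w :: "'g word" and b
    by (simp add: free_scalar_def mult_single mult.commute)
  then have "free_scalar a * (\<Sum>w\<in>Poly_Mapping.keys q. Poly_Mapping.single w (Poly_Mapping.lookup q w))
    = (\<Sum>w\<in>Poly_Mapping.keys q. Poly_Mapping.single w (Poly_Mapping.lookup q w)) * free_scalar a"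
    by (simp add: sum_distrib_left sum_distrib_right)
  then show ?thesis by (simp flip: poly_mapping_expand)
qed

lemma ring_of_type_simps [simp]:
  "carrier ring_of_type_algebra = UNIV" "x \<otimes>\<^bsub>ring_of_type_algebra\<^esub> y = x * y"
  "x \<oplus>\<^bsub>ring_of_type_algebra\<^esub> y = x + y" "\<one>\<^bsub>ring_of_type_algebra\<^esub> = 1" "\<zero>\<^bsub>ring_of_type_algebra\<^esub> = 0"
  by (simp_all add: ring_of_type_algebra_def)

text \<open>Used for two submodules: the given lattice and its intersection with the
  polarisation.\<close>

locale env_lattice = complete_dvf absv \<pi> + affinoid_enveloping "valuation_ring absv" \<pi> scale bracket
  for absv :: "'k::field \<Rightarrow> real" and \<pi> :: 'k
    and scale :: "'k \<Rightarrow> 'g::ab_group_add \<Rightarrow> 'g" and bracket :: "'g \<Rightarrow> 'g \<Rightarrow> 'g" +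
  fixes L :: "'g set"
  assumes L_add: "x \<in> L \<Longrightarrow> y \<in> L \<Longrightarrow> x + y \<in> L"
    and L_scale: "absv c \<le> 1 \<Longrightarrow> x \<in> L \<Longrightarrow> scale c x \<in> L"
    and L_bracket: "x \<in> L \<Longrightarrow> y \<in> L \<Longrightarrow> bracket x y \<in> L"
begin

abbreviation "FA \<equiv> free_algebra (valuation_ring absv) L"
abbreviation "fa \<equiv> carrier FA"
abbreviation "I \<equiv> env_ideal L"
abbreviation "fs \<equiv> (free_scalar :: 'k \<Rightarrow> 'g word \<Rightarrow>\<^sub>0 'k)"
abbreviation "H \<equiv> U_hat L"

lemma FA_simps [simp]:
  "p \<otimes>\<^bsub>FA\<^esub> q = p * q" "p \<oplus>\<^bsub>FA\<^esub> q = p + q" "\<one>\<^bsub>FA\<^esub> = 1" "\<zero>\<^bsub>FA\<^esub> = 0"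
  by (simp_all add: free_algebra_def)

lemma fa_iff: "q \<in> fa \<longleftrightarrow> (\<forall>w\<in>Poly_Mapping.keys q. set (letters w) \<subseteq> L) \<and> (\<forall>w. absv (Poly_Mapping.lookup q w) \<le> 1)"
  by (simp add: free_algebra_def valuation_ring_def)

lemma vr_iff: "c \<in> valuation_ring absv \<longleftrightarrow> absv c \<le> 1"
  by (simp add: valuation_ring_def)

lemma fa_single: "set (letters w) \<subseteq> L \<Longrightarrow> absv c \<le> 1 \<Longrightarrow> Poly_Mapping.single w c \<in> fa"
  by (auto simp: fa_iff lookup_single when_def)

lemma fa_0 [simp]: "0 \<in> fa" and fa_add: "p \<in> fa \<Longrightarrow> q \<in> fa \<Longrightarrow> p + q \<in> fa"
  and fa_minus: "p \<in> fa \<Longrightarrow> - p \<in> fa"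
proof -
  show "0 \<in> fa" by (simp add: fa_iff)
  assume p: "p \<in> fa"
  show "- p \<in> fa" using p by (simp add: fa_iff)
  assume "q \<in> fa"
  with p have "set (letters w) \<subseteq> L" if "w \<in> Poly_Mapping.keys p \<union> Poly_Mapping.keys q" for w
    using that unfolding fa_iff by blast
  with p \<open>q \<in> fa\<close> show "p + q \<in> fa"
    using subsetD[OF keys_add[of p q]] unfolding fa_iff lookup_add by (simp add: absv_add_le)
qed

lemma fa_diff: "p \<in> fa \<Longrightarrow> q \<in> fa \<Longrightarrow> p - q \<in> fa"
  using fa_add[of p "- q"] fa_minus by simp

lemma fa_sum: "(\<And>i. i \<in> A \<Longrightarrow> f i \<in> fa) \<Longrightarrow> sum f A \<in> fa"
  by (induction A rule: infinite_finite_induct) (simp_all add: fa_add)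

lemma fa_mult: "p \<in> fa \<Longrightarrow> q \<in> fa \<Longrightarrow> p * q \<in> fa"
proof -
  assume p: "p \<in> fa" and q: "q \<in> fa"
  have "p * q = (\<Sum>w\<in>Poly_Mapping.keys p. \<Sum>v\<in>Poly_Mapping.keys q.
      Poly_Mapping.single (w + v) (Poly_Mapping.lookup p w * Poly_Mapping.lookup q v))"
    by (subst (1) poly_mapping_expand[of p], subst (1) poly_mapping_expand[of q])
      (simp add: sum_distrib_left sum_distrib_right mult_single sum.swap[of _ "Poly_Mapping.keys q"])
  also have "\<dots> \<in> fa"
    using p q by (intro fa_sum fa_single) (auto simp: fa_iff plus_word_def absv_mult_le1)
  finally show ?thesis .
qed

lemma fa_scalar: "absv c \<le> 1 \<Longrightarrow> fs c \<in> fa"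
  unfolding free_scalar_def by (rule fa_single) (simp_all add: zero_word_def)

lemma fa_1 [simp]: "1 \<in> fa"
  using fa_scalar[of 1] by (simp add: free_scalar_1)

lemma fa_pi: "fs (\<pi> ^ n) \<in> fa"
  by (rule fa_scalar) simp

lemma fa_gen: "x \<in> L \<Longrightarrow> free_gen x \<in> fa"
  unfolding free_gen_def by (rule fa_single) simp_all

lemma fa_power: "q \<in> fa \<Longrightarrow> q ^ n \<in> fa"
  by (induction n) (simp_all add: fa_mult)

lemma ring_FA: "ring FA"
proof (rule ringI)
  show "abelian_group FA"
  proof (rule abelian_groupI)
    fix q assume "q \<in> fa"
    then show "\<exists>p\<in>fa. p \<oplus>\<^bsub>FA\<^esub> q = \<zero>\<^bsub>FA\<^esub>" using fa_minus by (intro bexI[of _ "- q"]) auto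
  qed (simp_all add: fa_add add_ac)
  show "Group.monoid FA" by (rule monoidI) (simp_all add: fa_mult mult.assoc)
qed (simp_all add: algebra_simps)

lemma relators_subset: "env_relators (valuation_ring absv) scale bracket L \<subseteq> fa"
  unfolding env_relators_def
  by (auto simp: vr_iff intro!: fa_diff fa_mult fa_gen fa_scalar L_add L_scale L_bracket)

lemma ideal_I: "ideal I FA"
  unfolding env_ideal_def by (rule ring.genideal_ideal[OF ring_FA relators_subset])

lemma relators_I: "env_relators (valuation_ring absv) scale bracket L \<subseteq> I"
  unfolding env_ideal_def by (rule ring.genideal_self[OF ring_FA relators_subset])

lemma I_minimal: "ideal J FA \<Longrightarrow> env_relators (valuation_ring absv) scale bracket L \<subseteq> J \<Longrightarrow> I \<subseteq> J"
  unfolding env_ideal_def by (rule ring.genideal_minimal[OF ring_FA])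

lemma I_fa: "i \<in> I \<Longrightarrow> i \<in> fa"
  using ideal.Icarr[OF ideal_I] .

lemma I_0: "0 \<in> I" and I_add: "i \<in> I \<Longrightarrow> j \<in> I \<Longrightarrow> i + j \<in> I"
  and I_left: "i \<in> I \<Longrightarrow> q \<in> fa \<Longrightarrow> q * i \<in> I" and I_right: "i \<in> I \<Longrightarrow> q \<in> fa \<Longrightarrow> i * q \<in> I"
  using additive_subgroup.zero_closed[OF ideal.axioms(1)[OF ideal_I]]
    additive_subgroup.a_closed[OF ideal.axioms(1)[OF ideal_I], of i j]
    ideal.I_l_closed[OF ideal_I, of i q] ideal.I_r_closed[OF ideal_I, of i q] by simp_all

lemma I_minus: "i \<in> I \<Longrightarrow> - i \<in> I"
  using I_left[of i "- 1"] fa_minus[of 1] by simp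

lemma I_diff: "i \<in> I \<Longrightarrow> j \<in> I \<Longrightarrow> i - j \<in> I"
  using I_add[of i "- j"] I_minus by simp

lemma I_rel_add: "x \<in> L \<Longrightarrow> y \<in> L \<Longrightarrow> free_gen (x + y) - free_gen x - free_gen y \<in> I"
  and I_rel_scale: "absv c \<le> 1 \<Longrightarrow> x \<in> L \<Longrightarrow> free_gen (scale c x) - fs c * free_gen x \<in> I"
  and I_rel_bracket: "x \<in> L \<Longrightarrow> y \<in> L \<Longrightarrow>
    free_gen x * free_gen y - free_gen y * free_gen x - free_gen (bracket x y) \<in> I"
  using relators_I unfolding env_relators_def vr_iff by blast+

lemma ring_U: "ring (U L)"
  unfolding U_def by (rule ideal.quotient_is_ring[OF ideal_I])

lemma U_class_closed: "q \<in> fa \<Longrightarrow> U_class L q \<in> carrier (U L)"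
  unfolding U_def U_class_def by (rule ideal.coset_in_Quot[OF ideal_I])

lemma carrier_U: "u \<in> carrier (U L) \<Longrightarrow> \<exists>q\<in>fa. u = U_class L q"
  unfolding U_def U_class_def using ideal.coset_nonempty[OF ideal_I] ideal.coset_rep[OF ideal_I] by metis

lemma mem_U_class: "q \<in> fa \<Longrightarrow> p \<in> U_class L q \<longleftrightarrow> p - q \<in> I"
proof -
  assume q: "q \<in> fa"
  show ?thesis
  proof
    assume "p \<in> U_class L q"
    then show "p - q \<in> I" by (auto simp: U_class_def a_r_coset_def' )
  next
    assume "p - q \<in> I"
    then show "p \<in> U_class L q" by (auto simp: U_class_def a_r_coset_def' intro!: bexI[of _ "p - q"])
  qed
qed

lemma U_class_eq_iff: "p \<in> fa \<Longrightarrow> q \<in> fa \<Longrightarrow> U_class L p = U_class L q \<longleftrightarrow> p - q \<in> I"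
proof
  assume p: "p \<in> fa" and q: "q \<in> fa"
  show "p - q \<in> I" if "U_class L p = U_class L q"
    using mem_U_class[OF p, of p] mem_U_class[OF q, of p] that I_0 by simp
  assume d: "p - q \<in> I"
  show "U_class L p = U_class L q"
  proof (rule Set.set_eqI)
    fix x
    show "x \<in> U_class L p \<longleftrightarrow> x \<in> U_class L q"
      using I_add[OF _ d, of "x - p"] I_diff[OF _ d, of "x - q"] mem_U_class p q by auto
  qed
qed

lemma U_class_add: "p \<in> fa \<Longrightarrow> q \<in> fa \<Longrightarrow> U_class L p \<oplus>\<^bsub>U L\<^esub> U_class L q = U_class L (p + q)"
  using ideal.Quot_add[OF ideal_I, of p q] by (simp add: U_def U_class_def)

lemma U_class_mult: "p \<in> fa \<Longrightarrow> q \<in> fa \<Longrightarrow> U_class L p \<otimes>\<^bsub>U L\<^esub> U_class L q = U_class L (p * q)"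
  using ideal.Quot_mult[OF ideal_I, of p q] by (simp add: U_def U_class_def)

lemma U_class_1: "\<one>\<^bsub>U L\<^esub> = U_class L 1"
  by (simp add: U_def U_class_def FactRing_def)

lemma U_class_0: "\<zero>\<^bsub>U L\<^esub> = U_class L 0"
proof -
  have "U_class L 0 = I" using mem_U_class[of 0] by auto
  then show ?thesis by (simp add: U_def FactRing_def)
qed

abbreviation "tU \<equiv> U_class L (fs \<pi>)"

lemma central_tU: "central_element (U L) tU"
proof (intro central_element.intro central_element_axioms.intro ring_U)
  have p: "fs \<pi> \<in> fa" using fa_pi[of 1] by simp
  then show "tU \<in> carrier (U L)" by (rule U_class_closed)
  fix u assume "u \<in> carrier (U L)"
  then obtain q where "q \<in> fa" "u = U_class L q" using carrier_U by auto
  then show "tU \<otimes>\<^bsub>U L\<^esub> u = u \<otimes>\<^bsub>U L\<^esub> tU" using p by (simp add: U_class_mult free_scalar_central)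
qed

lemma tU_pow: "tU [^]\<^bsub>U L\<^esub> (n::nat) = U_class L (fs (\<pi> ^ n))"
proof (induction n)
  case 0
  then show ?case by (simp add: U_class_1 free_scalar_1)
next
  case (Suc n)
  then show ?case using fa_pi[of n] fa_pi[of 1]
    by (simp add: U_class_mult free_scalar_mult mult.commute)
qed

text \<open>The preimage in the free algebra of \<open>\<pi>^n U\<close>. It allows calculating with
  polynomials in place of cosets of cosets.\<close>

definition J :: "nat \<Rightarrow> ('g word \<Rightarrow>\<^sub>0 'k) set" where
  "J n = {fs (\<pi> ^ n) * s + i | s i. s \<in> fa \<and> i \<in> I}"

lemma JI: "s \<in> fa \<Longrightarrow> i \<in> I \<Longrightarrow> fs (\<pi> ^ n) * s + i \<in> J n"
  by (auto simp: J_def)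

lemma I_J: "i \<in> I \<Longrightarrow> i \<in> J n"
  using JI[of 0 i n] by simp

lemma J_pi: "s \<in> fa \<Longrightarrow> fs (\<pi> ^ n) * s \<in> J n"
  using JI[of s 0 n] I_0 by simp

lemma J_add: "d \<in> J n \<Longrightarrow> e \<in> J n \<Longrightarrow> d + e \<in> J n"
proof -
  assume "d \<in> J n" "e \<in> J n"
  then obtain s i s' i' where "s \<in> fa" "i \<in> I" "s' \<in> fa" "i' \<in> I" "d = fs (\<pi> ^ n) * s + i" "e = fs (\<pi> ^ n) * s' + i'"
    by (auto simp: J_def)
  then have "d + e = fs (\<pi> ^ n) * (s + s') + (i + i')" "s + s' \<in> fa" "i + i' \<in> I"
    by (simp_all add: algebra_simps fa_add I_add)
  then show ?thesis using JI by metis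
qed

lemma J_left: "d \<in> J n \<Longrightarrow> q \<in> fa \<Longrightarrow> q * d \<in> J n"
proof -
  assume "d \<in> J n" and q: "q \<in> fa"
  then obtain s i where s: "s \<in> fa" "i \<in> I" "d = fs (\<pi> ^ n) * s + i" by (auto simp: J_def)
  have "q * d = fs (\<pi> ^ n) * (q * s) + q * i"
    unfolding s(3) distrib_left mult.assoc[symmetric] free_scalar_central[of _ q] ..
  then show ?thesis using JI fa_mult I_left q s(1,2) by metis
qed

lemma J_right: "d \<in> J n \<Longrightarrow> q \<in> fa \<Longrightarrow> d * q \<in> J n"
proof -
  assume "d \<in> J n" and q: "q \<in> fa"
  then obtain s i where s: "s \<in> fa" "i \<in> I" "d = fs (\<pi> ^ n) * s + i" by (auto simp: J_def)
  have "d * q = fs (\<pi> ^ n) * (s * q) + i * q" unfolding s(3) distrib_right mult.assoc ..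
  then show ?thesis using JI fa_mult I_right q s(1,2) by metis
qed

lemma J_minus: "d \<in> J n \<Longrightarrow> - d \<in> J n"
  using J_left[of d n "- 1"] fa_minus[of 1] by simp

lemma J_zero: "0 \<in> J n"
  using I_J I_0 by blast

lemma J_sum: "(\<And>i. i \<in> A \<Longrightarrow> f i \<in> J n) \<Longrightarrow> sum f A \<in> J n"
  by (induction A rule: infinite_finite_induct) (simp_all add: J_add J_zero)

lemma J_mult_diff:
  assumes "q' - q \<in> J n" "p' - p \<in> J n" "q \<in> fa" "p' \<in> fa"
  shows "q' * p' - q * p \<in> J n"
proof -
  have "q' * p' - q * p = (q' - q) * p' + q * (p' - p)" by (simp add: algebra_simps)
  then show ?thesis using J_add[OF J_right[OF assms(1,4)] J_left[OF assms(2,3)]] by simp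
qed

lemma J_power_diff:
  assumes "q' - q \<in> J n" "q \<in> fa" "q' \<in> fa" shows "q' ^ k - q ^ k \<in> J n"
  by (induction k) (simp_all add: J_zero J_mult_diff assms fa_power)

text \<open>
  The \<open>n\<close>-th component of an element of the completion is a coset of \<open>\<pi>\<^sup>n\<close>, so membership is
  congruence modulo \<open>\<pi>\<^sup>n\<close>.
\<close>

definition rep :: "('k, 'g) env_hat \<Rightarrow> nat \<Rightarrow> ('g word \<Rightarrow>\<^sub>0 'k) \<Rightarrow> bool" where
  "rep u n q \<longleftrightarrow> q \<in> fa \<and> U_class L q \<in> u n"

lemma H_eq: "H = adic_completion (U L) tU"
  by (simp add: U_hat_def)

lemma ring_H: "ring H"
  unfolding H_eq by (rule central_element.ring_C[OF central_tU])

lemma rep_fa: "rep u n q \<Longrightarrow> q \<in> fa"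
  by (simp add: rep_def)

lemma rep_exists: "u \<in> carrier H \<Longrightarrow> \<exists>q. rep u n q"
  using central_element.C_rep_exists[OF central_tU, of u n] central_element.C_carr[OF central_tU, of u _ n] carrier_U
  unfolding H_eq rep_def by metis

lemma rep_Suc: "u \<in> carrier H \<Longrightarrow> rep u (Suc n) q \<Longrightarrow> rep u n q"
  using central_element.C_rep_Suc[OF central_tU, of u _ n] unfolding H_eq rep_def by blast

lemma U_coset_J:
  assumes "p \<in> fa" "q \<in> fa"
  shows "(\<exists>v\<in>carrier (U L). U_class L q = U_class L p \<oplus>\<^bsub>U L\<^esub> tU [^]\<^bsub>U L\<^esub> n \<otimes>\<^bsub>U L\<^esub> v) \<longleftrightarrow> q - p \<in> J n"
proof
  assume "\<exists>v\<in>carrier (U L). U_class L q = U_class L p \<oplus>\<^bsub>U L\<^esub> tU [^]\<^bsub>U L\<^esub> n \<otimes>\<^bsub>U L\<^esub> v"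
  then obtain s where s: "s \<in> fa" "U_class L q = U_class L p \<oplus>\<^bsub>U L\<^esub> tU [^]\<^bsub>U L\<^esub> n \<otimes>\<^bsub>U L\<^esub> U_class L s"
    using carrier_U by metis
  then have "U_class L q = U_class L (p + fs (\<pi> ^ n) * s)"
    using assms by (simp add: tU_pow U_class_mult U_class_add fa_pi fa_mult)
  then have "q - (p + fs (\<pi> ^ n) * s) \<in> I"
    using assms s by (simp add: U_class_eq_iff fa_add fa_mult fa_pi)
  from JI[OF s(1) this, of n] show "q - p \<in> J n" by simp
next
  assume "q - p \<in> J n"
  then obtain s i where s: "s \<in> fa" "i \<in> I" "q - p = fs (\<pi> ^ n) * s + i" by (auto simp: J_def)
  then have "q - (p + fs (\<pi> ^ n) * s) = i" by (simp add: algebra_simps)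
  then have "U_class L q = U_class L (p + fs (\<pi> ^ n) * s)"
    using s(1,2) assms by (simp add: U_class_eq_iff fa_add fa_mult fa_pi)
  then show "\<exists>v\<in>carrier (U L). U_class L q = U_class L p \<oplus>\<^bsub>U L\<^esub> tU [^]\<^bsub>U L\<^esub> n \<otimes>\<^bsub>U L\<^esub> v"
    using s(1) assms by (intro bexI[of _ "U_class L s"] U_class_closed) (simp_all add: tU_pow U_class_mult U_class_add fa_pi fa_mult)
qed

lemma rep_diff: "u \<in> carrier H \<Longrightarrow> rep u n p \<Longrightarrow> rep u n q \<Longrightarrow> q - p \<in> J n"
  using central_element.C_diff[OF central_tU, of u "U_class L p" n "U_class L q"] U_coset_J[of p q n]
  unfolding H_eq rep_def by blast

lemma rep_shift: "u \<in> carrier H \<Longrightarrow> rep u n p \<Longrightarrow> q \<in> fa \<Longrightarrow> q - p \<in> J n \<Longrightarrow> rep u n q"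
  using central_element.C_shift[OF central_tU, of u "U_class L p" n] U_coset_J[of p q n]
  unfolding H_eq rep_def by metis

lemma rep_0_level: "u \<in> carrier H \<Longrightarrow> q \<in> fa \<Longrightarrow> rep u 0 q"
proof -
  assume u: "u \<in> carrier H" and q: "q \<in> fa"
  obtain p where p: "rep u 0 p" using rep_exists[OF u] by blast
  have "q - p \<in> J 0" using J_pi[of "q - p" 0] fa_diff[OF q rep_fa[OF p]] by (simp add: free_scalar_1)
  then show ?thesis using rep_shift[OF u p q] by blast
qed

lemma rep_add: "u \<in> carrier H \<Longrightarrow> w \<in> carrier H \<Longrightarrow> rep u n p \<Longrightarrow> rep w n q \<Longrightarrow> rep (u \<oplus>\<^bsub>H\<^esub> w) n (p + q)"
  using central_element.C_add_rep(2)[OF central_tU, of u w "U_class L p" n "U_class L q"]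
  unfolding H_eq rep_def by (simp add: U_class_add fa_add)

lemma rep_mult: "u \<in> carrier H \<Longrightarrow> w \<in> carrier H \<Longrightarrow> rep u n p \<Longrightarrow> rep w n q \<Longrightarrow> rep (u \<otimes>\<^bsub>H\<^esub> w) n (p * q)"
  using central_element.C_mult_rep(2)[OF central_tU, of u w "U_class L p" n "U_class L q"]
  unfolding H_eq rep_def by (simp add: U_class_mult fa_mult)

lemma rep_eqI: "u \<in> carrier H \<Longrightarrow> w \<in> carrier H \<Longrightarrow> (\<And>n. \<exists>q. rep u n q \<and> rep w n q) \<Longrightarrow> u = w"
  using central_element.C_eqI[OF central_tU, of u w] unfolding H_eq rep_def by blast

lemma rep_construct:
  assumes "\<And>n. q n \<in> fa" "\<And>n. q (Suc n) - q n \<in> J n"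
  shows "\<exists>u\<in>carrier H. \<forall>n. rep u n (q n)"
proof -
  have "\<exists>v\<in>carrier (U L). U_class L (q (Suc n)) = U_class L (q n) \<oplus>\<^bsub>U L\<^esub> tU [^]\<^bsub>U L\<^esub> n \<otimes>\<^bsub>U L\<^esub> v" for n
    using U_coset_J assms by blast
  note c = central_element.C_cosetsI[OF central_tU, of "\<lambda>n. U_class L (q n)", OF U_class_closed[OF assms(1)] this]
  show ?thesis unfolding H_eq rep_def
    by (rule bexI[OF _ c(1)]) (intro allI conjI assms(1) c(2))
qed

lemma hat_class_closed: "q \<in> fa \<Longrightarrow> U_hat_class L (U_class L q) \<in> carrier H"
  and rep_class: "q \<in> fa \<Longrightarrow> rep (U_hat_class L (U_class L q)) n q"
  using central_element.to_completion_closed[OF central_tU U_class_closed]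
    central_element.to_completion_rep[OF central_tU U_class_closed]
  unfolding H_eq rep_def U_hat_class_def by auto

lemma H_one: "\<one>\<^bsub>H\<^esub> = U_hat_class L (U_class L 1)" and H_zero: "\<zero>\<^bsub>H\<^esub> = U_hat_class L (U_class L 0)"
  unfolding H_eq U_hat_class_def central_element.C_one[OF central_tU] central_element.C_zero[OF central_tU]
    U_class_1 U_class_0 by simp_all

lemma rep_one: "rep \<one>\<^bsub>H\<^esub> n 1" and rep_zero: "rep \<zero>\<^bsub>H\<^esub> n 0"
  unfolding H_one H_zero by (rule rep_class; simp)+

text \<open>A \<open>\<pi>\<close>-adic expansion with coefficients in the free algebra. Each new
  coefficient corrects the preceding partial sum by a multiple of the current power of
  \<open>\<pi>\<close>, so one sequence serves all levels. Starting at level \<open>n\<close>, the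
  whole series is visibly divisible by \<open>\<pi> ^ n\<close>.\<close>

lemma rep_series_from:
  assumes u: "u \<in> carrier H" and z: "rep u n 0"
  shows "\<exists>s. (\<forall>k. s k \<in> fa) \<and> (\<forall>m. rep u (n + m) (fs (\<pi> ^ n) * (\<Sum>k<m. fs (\<pi> ^ k) * s k)))"
proof -
  have step: "\<exists>s\<in>fa. rep u (Suc m) (p + fs (\<pi> ^ m) * s)" if p: "rep u m p" for m p
  proof -
    obtain q where q: "rep u (Suc m) q" using rep_exists[OF u] by blast
    obtain s i where s: "s \<in> fa" "i \<in> I" "q - p = fs (\<pi> ^ m) * s + i"
      using rep_diff[OF u p rep_Suc[OF u q]] by (auto simp: J_def)
    have "p + fs (\<pi> ^ m) * s - q = - i" using s(3) by (simp add: algebra_simps)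
    then have "p + fs (\<pi> ^ m) * s - q \<in> J (Suc m)" using I_J[OF I_minus[OF s(2)]] by simp
    with rep_shift[OF u q fa_add[OF rep_fa[OF p] fa_mult[OF fa_pi s(1)]]] s(1) show ?thesis by blast
  qed
  \<comment> \<open>A choice function of the level and the current partial sum, so that the
    expansion can be defined by recursion.\<close>
  define sel where "sel m p = (SOME s. s \<in> fa \<and> rep u (Suc m) (p + fs (\<pi> ^ m) * s))" for m p
  have sel: "sel m p \<in> fa \<and> rep u (Suc m) (p + fs (\<pi> ^ m) * sel m p)" if "rep u m p" for m p
    unfolding sel_def by (rule someI_ex) (use step[OF that] in blast)
  define P where "P = rec_nat 0 (\<lambda>k p. p + fs (\<pi> ^ (n + k)) * sel (n + k) p)"
  have P: "P 0 = 0" "P (Suc k) = P k + fs (\<pi> ^ (n + k)) * sel (n + k) (P k)" for k by (simp_all add: P_def)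
  have repP: "rep u (n + k) (P k)" for k
    by (induction k) (use z sel in \<open>auto simp: P\<close>)
  have S: "P m = fs (\<pi> ^ n) * (\<Sum>k<m. fs (\<pi> ^ k) * sel (n + k) (P k))" for m
    by (induction m) (simp_all add: P distrib_left power_add free_scalar_mult[symmetric] mult.assoc)
  show ?thesis
  proof (intro exI[of _ "\<lambda>k. sel (n + k) (P k)"] conjI allI)
    show "sel (n + k) (P k) \<in> fa" for k using sel[OF repP] by blast
    show "rep u (n + m) (fs (\<pi> ^ n) * (\<Sum>k<m. fs (\<pi> ^ k) * sel (n + k) (P k)))" for m
      using repP[of m] by (simp only: S[symmetric])
  qed
qed

lemma rep_series:
  assumes u: "u \<in> carrier H"
  shows "\<exists>s. (\<forall>n. s n \<in> fa) \<and> (\<forall>n. rep u n (\<Sum>k<n. fs (\<pi> ^ k) * s k))"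
  using rep_series_from[OF u rep_0_level[OF u fa_0]] by (simp add: free_scalar_1)

lemma rep_series_construct:
  assumes "\<And>n. s n \<in> fa" shows "\<exists>u\<in>carrier H. \<forall>n. rep u n (\<Sum>k<n. fs (\<pi> ^ k) * s k)"
  by (rule rep_construct) (auto intro!: fa_sum fa_mult fa_pi assms J_pi)

section \<open>Scalars, and the algebra after inverting the uniformiser\<close>

abbreviation "sc c \<equiv> U_hat_class L (U_class L (fs c))"

lemma sc_closed: "absv c \<le> 1 \<Longrightarrow> sc c \<in> carrier H" and rep_sc: "absv c \<le> 1 \<Longrightarrow> rep (sc c) n (fs c)"
  using hat_class_closed rep_class fa_scalar by blast+

lemma sc_central: "absv c \<le> 1 \<Longrightarrow> u \<in> carrier H \<Longrightarrow> u \<otimes>\<^bsub>H\<^esub> sc c = sc c \<otimes>\<^bsub>H\<^esub> u"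
proof -
  assume c: "absv c \<le> 1" and u: "u \<in> carrier H"
  interpret H: ring H by (rule ring_H)
  show ?thesis
  proof (rule rep_eqI)
    fix n
    obtain q where q: "rep u n q" using rep_exists[OF u] by blast
    show "\<exists>q. rep (u \<otimes>\<^bsub>H\<^esub> sc c) n q \<and> rep (sc c \<otimes>\<^bsub>H\<^esub> u) n q"
      using rep_mult[OF u sc_closed[OF c] q rep_sc[OF c]] rep_mult[OF sc_closed[OF c] u rep_sc[OF c] q]
      by (auto simp: free_scalar_central)
  qed (use u sc_closed[OF c] in auto)
qed

lemma hat_act_eq: "U_hat_act L u c = u \<otimes>\<^bsub>H\<^esub> sc c"
  by (simp add: U_hat_act_def)

lemma rep_hat_act: "absv c \<le> 1 \<Longrightarrow> u \<in> carrier H \<Longrightarrow> rep u n q \<Longrightarrow> rep (U_hat_act L u c) n (fs c * q)"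
  using rep_mult[OF _ sc_closed _ rep_sc, of u c n q] by (simp add: hat_act_eq free_scalar_central)

lemma hat_act_closed: "absv c \<le> 1 \<Longrightarrow> u \<in> carrier H \<Longrightarrow> U_hat_act L u c \<in> carrier H"
proof -
  interpret H: ring H by (rule ring_H)
  show "absv c \<le> 1 \<Longrightarrow> u \<in> carrier H \<Longrightarrow> U_hat_act L u c \<in> carrier H"
    unfolding hat_act_eq using sc_closed by simp
qed

lemma tensor_alg_UK: "tensor_alg H ring_of_type_algebra (valuation_ring absv) (U_hat_act L) (*)"
proof -
  interpret H: ring H by (rule ring_H)
  interpret K: ring "ring_of_type_algebra :: 'k ring" by (rule ring_from_type_algebra)
  have mem: "c \<in> valuation_ring absv \<longleftrightarrow> absv c \<le> 1" for c by (simp add: valuation_ring_def)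
  show ?thesis
  proof (intro tensor_alg.intro tensor.intro tensor_alg_axioms.intro H.ring_axioms K.ring_axioms H.a_comm_group K.a_comm_group)
    fix a m c assume "a \<in> carrier H" "m \<in> carrier H" "c \<in> valuation_ring absv"
    then show "a \<otimes>\<^bsub>H\<^esub> U_hat_act L m c = U_hat_act L (a \<otimes>\<^bsub>H\<^esub> m) c"
      and "U_hat_act L m c \<otimes>\<^bsub>H\<^esub> a = U_hat_act L (m \<otimes>\<^bsub>H\<^esub> a) c"
      using sc_closed sc_central[of c a] unfolding hat_act_eq mem by (simp_all add: H.m_assoc)
  qed (simp_all add: hat_act_closed mem)
qed

abbreviation "R \<equiv> U_K L"

lemma R_eq: "R = tensor_algebra H ring_of_type_algebra (valuation_ring absv) (U_hat_act L) (*)"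
  by (simp add: U_K_def)

lemma ring_R: "ring R"
  unfolding R_eq by (rule tensor_alg.ring_TA[OF tensor_alg_UK])

definition el :: "('k, 'g) env_hat \<Rightarrow> 'k \<Rightarrow> ('k, 'g) env_K" where
  "el u a = U_K_class L (frag_of (u, a))"

lemma tensor_UK: "tensor (add_monoid H) (add_monoid ring_of_type_algebra) (valuation_ring absv) (U_hat_act L) (*)"
  using tensor_alg.axioms(3)[OF tensor_alg_UK] .

lemma el_closed: "u \<in> carrier H \<Longrightarrow> el u a \<in> carrier R"
  unfolding R_eq tensor_alg.carrier_TA[OF tensor_alg_UK] el_def U_K_class_def
  by (rule tensor.cls_in_T[OF tensor_UK]) simp

lemma el_add_left: "u \<in> carrier H \<Longrightarrow> w \<in> carrier H \<Longrightarrow> el u a \<oplus>\<^bsub>R\<^esub> el w a = el (u \<oplus>\<^bsub>H\<^esub> w) a"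
  unfolding R_eq tensor_alg.TA_add[OF tensor_alg_UK] el_def U_K_class_def
  using tensor.T_mult[OF tensor_UK, of "frag_of (u, a)" "frag_of (w, a)"]
    tensor.cls_add_left[OF tensor_UK, of u w a] by simp

lemma el_balance: "u \<in> carrier H \<Longrightarrow> absv c \<le> 1 \<Longrightarrow> el (U_hat_act L u c) a = el u (c * a)"
  unfolding el_def U_K_class_def
  using tensor.cls_balance[OF tensor_UK, of u c a] by (simp add: valuation_ring_def)

lemma el_mult: "u \<in> carrier H \<Longrightarrow> w \<in> carrier H \<Longrightarrow> el u a \<otimes>\<^bsub>R\<^esub> el w b = el (u \<otimes>\<^bsub>H\<^esub> w) (a * b)"
  unfolding R_eq el_def U_K_class_def
  using tensor_alg.TA_mult[OF tensor_alg_UK, of "frag_of (u, a)" "frag_of (w, b)"] by simp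

lemma el_one: "\<one>\<^bsub>R\<^esub> = el \<one>\<^bsub>H\<^esub> 1"
  unfolding R_eq tensor_alg.TA_one[OF tensor_alg_UK] el_def U_K_class_def by simp

lemma R_zero: "\<zero>\<^bsub>R\<^esub> = U_K_class L 0"
  unfolding R_eq tensor_alg.TA_zero[OF tensor_alg_UK] U_K_class_def by simp

lemma el_zero_left: "el \<zero>\<^bsub>H\<^esub> a = \<zero>\<^bsub>R\<^esub>"
proof -
  interpret R: ring R by (rule ring_R)
  interpret H: ring H by (rule ring_H)
  show ?thesis using el_add_left[of "\<zero>\<^bsub>H\<^esub>" "\<zero>\<^bsub>H\<^esub>" a] el_closed[of "\<zero>\<^bsub>H\<^esub>" a]
    by (metis R.r_zero R.add.l_cancel R.zero_closed H.l_zero H.zero_closed)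
qed

lemma carrier_R: "V \<in> carrier R \<longleftrightarrow> (\<exists>c. Poly_Mapping.keys c \<subseteq> carrier H \<times> UNIV \<and> V = U_K_class L c)"
  unfolding R_eq tensor_alg.carrier_TA[OF tensor_alg_UK] U_K_class_def
  using tensor.carrier_T[OF tensor_UK, of V] by simp

text \<open>Every tensor is pure: the integral part of a scalar moves to the left factor, and
  finitely many denominators have a common power of \<open>\<pi>\<close>.\<close>

lemma R_elements:
  assumes "V \<in> carrier R" shows "\<exists>u\<in>carrier H. \<exists>m. V = el u (inverse \<pi> ^ m)"
proof -
  interpret R: ring R by (rule ring_R)
  interpret H: ring H by (rule ring_H)
  let ?cls = "tensor_class (add_monoid H) (add_monoid ring_of_type_algebra) (valuation_ring absv) (U_hat_act L) (*)"
  have raise: "\<exists>w\<in>carrier H. el u (inverse \<pi> ^ m) = el w (inverse \<pi> ^ (m + k))" if u: "u \<in> carrier H" for u m k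
  proof (intro bexI)
    have "inverse \<pi> ^ m = \<pi> ^ k * inverse \<pi> ^ (m + k)"
      by (simp add: power_add mult.left_commute flip: power_mult_distrib)
    then show "el u (inverse \<pi> ^ m) = el (U_hat_act L u (\<pi> ^ k)) (inverse \<pi> ^ (m + k))"
      using el_balance[OF u, of "\<pi> ^ k"] by simp
    show "U_hat_act L u (\<pi> ^ k) \<in> carrier H" using hat_act_closed u by simp
  qed
  obtain c where kc: "Poly_Mapping.keys c \<subseteq> carrier H \<times> (UNIV :: 'k set)" and V: "V = U_K_class L c" using assms carrier_R by auto
  from kc have "\<exists>u\<in>carrier H. \<exists>m. U_K_class L c = el u (inverse \<pi> ^ m)"
  proof (induction rule: frag_induction)
    case zero
    show ?case using el_zero_left[of "inverse \<pi> ^ 0"] R_zero H.zero_closed by metis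
  next
    case (one x)
    obtain u a where x: "x = (u, a)" "u \<in> carrier H" using one by (cases x) auto
    \<comment> \<open>Written as \<open>(a * \<pi>^m) * \<pi>^(-m)\<close>, the first factor of the
      scalar is integral and is absorbed by balance.\<close>
    obtain m where m: "absv a \<le> inverse r ^ m" using absv_le_inverse_power by blast
    have "absv (a * \<pi> ^ m) \<le> 1"
    proof -
      have "absv (a * \<pi> ^ m) \<le> inverse r ^ m * r ^ m" using m by (intro absv_mult_le) simp_all
      then show ?thesis by (simp flip: power_mult_distrib)
    qed
    moreover have e: "a * \<pi> ^ m * inverse \<pi> ^ m = a" by (simp add: mult.assoc flip: power_mult_distrib)
    ultimately have "el u a = el (U_hat_act L u (a * \<pi> ^ m)) (inverse \<pi> ^ m)"
      using el_balance[OF x(2), of "a * \<pi> ^ m" "inverse \<pi> ^ m", unfolded e] by simp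
    moreover have "U_hat_act L u (a * \<pi> ^ m) \<in> carrier H" using hat_act_closed x(2) \<open>absv (a * \<pi> ^ m) \<le> 1\<close> by simp
    ultimately show ?case unfolding x el_def by blast
  next
    case (diff c d)
    obtain u m where u: "u \<in> carrier H" "U_K_class L c = el u (inverse \<pi> ^ m)" using diff by auto
    obtain w k where w: "w \<in> carrier H" "U_K_class L d = el w (inverse \<pi> ^ k)" using diff by auto
    obtain u' where u': "u' \<in> carrier H" "U_K_class L c = el u' (inverse \<pi> ^ (m + k))" using raise[OF u(1), of m k] u by auto
    obtain w' where w': "w' \<in> carrier H" "U_K_class L d = el w' (inverse \<pi> ^ (m + k))" using raise[OF w(1), of k m] w by (auto simp: add.commute)
    have cl: "?cls (frag_of (u', a)) = ?cls (frag_of (u' \<ominus>\<^bsub>H\<^esub> w', a) + frag_of (w', a))" for a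
      using tensor.cls_add_left[OF tensor_UK, of "u' \<ominus>\<^bsub>H\<^esub> w'" w' a] u'(1) w'(1)
      by (simp add: H.minus_eq H.a_assoc H.l_neg)
    have k: "frag_of (u', inverse \<pi> ^ (m + k)) - (frag_of (u' \<ominus>\<^bsub>H\<^esub> w', inverse \<pi> ^ (m + k)) + frag_of (w', inverse \<pi> ^ (m + k)))
       \<in> tensor_kernel (add_monoid H) (add_monoid ring_of_type_algebra) (valuation_ring absv) (U_hat_act L) (*)"
      unfolding tensor.cls_eq_iff[OF tensor_UK, symmetric] by (rule cl)
    have kc: "c - frag_of (u', inverse \<pi> ^ (m + k)) \<in> tensor_kernel (add_monoid H) (add_monoid ring_of_type_algebra) (valuation_ring absv) (U_hat_act L) (*)"
      and kd: "d - frag_of (w', inverse \<pi> ^ (m + k)) \<in> tensor_kernel (add_monoid H) (add_monoid ring_of_type_algebra) (valuation_ring absv) (U_hat_act L) (*)"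
      unfolding tensor.cls_eq_iff[OF tensor_UK, symmetric]
      using u'(2)[unfolded el_def U_K_class_def] w'(2)[unfolded el_def U_K_class_def] .
    have "(c - d) - frag_of (u' \<ominus>\<^bsub>H\<^esub> w', inverse \<pi> ^ (m + k)) \<in> tensor_kernel (add_monoid H) (add_monoid ring_of_type_algebra) (valuation_ring absv) (U_hat_act L) (*)"
      using tensor.Ker_add[OF tensor_UK tensor.Ker_diff[OF tensor_UK kc kd] k] by (simp add: algebra_simps)
    then have "U_K_class L (c - d) = el (u' \<ominus>\<^bsub>H\<^esub> w') (inverse \<pi> ^ (m + k))"
      unfolding el_def U_K_class_def tensor.cls_eq_iff[OF tensor_UK] .
    then show ?case using u'(1) w'(1) by blast
  qed
  then show ?thesis using V by simp
qed

text \<open>The geometric series. Since \<open>c\<close> is divisible by \<open>\<pi>\<close>, the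
  k-th power of \<open>c u\<close> is divisible by \<open>\<pi>^k\<close>, and the first
  \<open>n\<close> terms represent the inverse at level \<open>n\<close>. A right inverse is enough
  for homomorphisms to a field.\<close>

lemma one_plus_invertible:
  assumes u: "u \<in> carrier H" and c: "absv c \<le> r"
  shows "\<exists>w\<in>carrier H. (\<one>\<^bsub>H\<^esub> \<ominus>\<^bsub>H\<^esub> U_hat_act L u c) \<otimes>\<^bsub>H\<^esub> w = \<one>\<^bsub>H\<^esub>"
proof -
  interpret H: ring H by (rule ring_H)
  have c1: "absv c \<le> 1" using c r_le_1 by linarith
  define d where "d = c / \<pi>"
  have d: "absv d \<le> 1" "c = \<pi> * d" using c by (simp_all add: d_def absv_divide)
  let ?z = "U_hat_act L u c"
  have z: "?z \<in> carrier H" using hat_act_closed[OF c1 u] .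
  have "\<forall>n. \<exists>q. rep u n q" using rep_exists[OF u] by blast
  then obtain q where q: "\<And>n. rep u n (q n)" by metis
  define zz where "zz n = fs c * q n" for n
  have zfa: "zz n \<in> fa" for n unfolding zz_def using fa_mult fa_scalar[OF c1] rep_fa[OF q] by blast
  have zrep: "rep ?z n (zz n)" for n unfolding zz_def by (rule rep_hat_act[OF c1 u q])
  have zJ: "zz n ^ k \<in> J k" for n k
  proof -
    have "zz n ^ k = fs (\<pi> ^ k) * (fs d * q n) ^ k" for k
    proof (induction k)
      case (Suc k)
      have "zz n * zz n ^ k = fs \<pi> * (fs d * q n) * (fs (\<pi> ^ k) * (fs d * q n) ^ k)"
        using Suc by (simp add: zz_def d(2) free_scalar_mult[symmetric] mult.assoc)
      also have "\<dots> = fs \<pi> * ((fs d * q n) * fs (\<pi> ^ k)) * (fs d * q n) ^ k"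
        by (simp only: mult.assoc)
      also have "(fs d * q n) * fs (\<pi> ^ k) = fs (\<pi> ^ k) * (fs d * q n)"
        by (rule free_scalar_central[symmetric])
      also have "fs \<pi> * (fs (\<pi> ^ k) * (fs d * q n)) * (fs d * q n) ^ k
          = (fs \<pi> * fs (\<pi> ^ k)) * ((fs d * q n) * (fs d * q n) ^ k)"
        by (simp only: mult.assoc)
      finally show ?case by (simp add: free_scalar_mult)
    qed (simp add: free_scalar_1)
    then show ?thesis using J_pi[OF fa_power[OF fa_mult[OF fa_scalar[OF d(1)] rep_fa[OF q]]]] by simp
  qed
  define p where "p n = (\<Sum>k<n. zz n ^ k)" for n
  have pfa: "p n \<in> fa" for n unfolding p_def by (intro fa_sum fa_power zfa)
  have "p (Suc n) - p n \<in> J n" for n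
  proof -
    have dz: "zz (Suc n) - zz n \<in> J n" using rep_diff[OF z zrep rep_Suc[OF z zrep]] .
    have "p (Suc n) - p n = (\<Sum>k<n. zz (Suc n) ^ k - zz n ^ k) + zz (Suc n) ^ n"
      by (simp add: p_def sum_subtractf)
    then show ?thesis using J_add[OF J_sum[OF J_power_diff[OF dz zfa zfa]] zJ] by simp
  qed
  then obtain w where w: "w \<in> carrier H" "\<And>n. rep w n (p n)" using rep_construct[of p, OF pfa] by blast
  have one_z: "rep (\<one>\<^bsub>H\<^esub> \<ominus>\<^bsub>H\<^esub> ?z) n (1 - zz n)" for n
  proof -
    have cl: "\<one>\<^bsub>H\<^esub> \<ominus>\<^bsub>H\<^esub> ?z \<in> carrier H" using z by simp
    obtain e where e: "rep (\<one>\<^bsub>H\<^esub> \<ominus>\<^bsub>H\<^esub> ?z) n e" using rep_exists[OF cl] by blast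
    have "(\<one>\<^bsub>H\<^esub> \<ominus>\<^bsub>H\<^esub> ?z) \<oplus>\<^bsub>H\<^esub> ?z = \<one>\<^bsub>H\<^esub>" using z by (simp add: H.minus_eq H.a_assoc H.l_neg)
    then have "rep \<one>\<^bsub>H\<^esub> n (e + zz n)" using rep_add[OF cl z e zrep] by simp
    from rep_diff[OF H.one_closed this rep_one] have "1 - (e + zz n) \<in> J n" .
    then show ?thesis using rep_shift[OF cl e fa_diff[OF fa_1 zfa]] by (simp add: algebra_simps)
  qed
  have "(\<one>\<^bsub>H\<^esub> \<ominus>\<^bsub>H\<^esub> ?z) \<otimes>\<^bsub>H\<^esub> w = \<one>\<^bsub>H\<^esub>"
  proof (rule rep_eqI)
    fix n
    have "(1 - zz n) * p n = 1 - zz n ^ n"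
    proof -
      have "(1 - y) * (\<Sum>k<m. y ^ k) = 1 - y ^ m" for y :: "'g word \<Rightarrow>\<^sub>0 'k" and m
      proof (induction m)
        case (Suc m)
        have "(1 - y) * (\<Sum>k<Suc m. y ^ k) = (1 - y) * (\<Sum>k<m. y ^ k) + (1 - y) * y ^ m"
          by (simp only: sum.lessThan_Suc distrib_left)
        then show ?case unfolding Suc by (simp add: left_diff_distrib)
      qed simp
      then show ?thesis by (simp add: p_def)
    qed
    then have "(1 - zz n) * p n - 1 \<in> J n" using J_minus[OF zJ[of n n]] by simp
    then have "rep \<one>\<^bsub>H\<^esub> n ((1 - zz n) * p n)"
      using rep_shift[OF H.one_closed rep_one fa_mult[OF fa_diff[OF fa_1 zfa] pfa]] by blast
    moreover have "rep ((\<one>\<^bsub>H\<^esub> \<ominus>\<^bsub>H\<^esub> ?z) \<otimes>\<^bsub>H\<^esub> w) n ((1 - zz n) * p n)"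
      using rep_mult[OF _ w(1) one_z w(2)] z by simp
    ultimately show "\<exists>q. rep ((\<one>\<^bsub>H\<^esub> \<ominus>\<^bsub>H\<^esub> ?z) \<otimes>\<^bsub>H\<^esub> w) n q \<and> rep \<one>\<^bsub>H\<^esub> n q" by blast
  qed (use z w in auto)
  then show ?thesis using w(1) by blast
qed

text \<open>Characters are bounded, because \<open>1 - c u\<close> is invertible for every topologically nilpotent \<open>c\<close>.\<close>

lemma character_bounded:
  assumes chi: "is_character lam L \<chi>" and u: "u \<in> carrier H"
  shows "absv (\<chi> (el u 1)) \<le> 1"
proof (rule ccontr)
  assume gt: "\<not> absv (\<chi> (el u 1)) \<le> 1"
  interpret H: ring H by (rule ring_H)
  interpret R: ring R by (rule ring_R)
  have hom: "\<chi> \<in> ring_hom R ring_of_type_algebra" and sca: "\<And>a. \<chi> (U_K_scalar L a) = a"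
    using chi by (simp_all add: is_character_def)
  have add: "\<chi> (V \<oplus>\<^bsub>R\<^esub> W) = \<chi> V + \<chi> W" and mult: "\<chi> (V \<otimes>\<^bsub>R\<^esub> W) = \<chi> V * \<chi> W"
    if "V \<in> carrier R" "W \<in> carrier R" for V W
    using ring_hom_add[OF hom that] ring_hom_mult[OF hom that] by simp_all
  have one: "\<chi> (el \<one>\<^bsub>H\<^esub> 1) = 1" using ring_hom_one[OF hom] by (simp add: el_one)
  define b where "b = \<chi> (el u 1)"
  \<comment> \<open>With this \<open>c\<close> the character would send \<open>c u\<close> to 1,
    hence the invertible element \<open>1 - c u\<close> to 0.\<close>
  define c where "c = inverse b"
  have b: "b \<noteq> 0" "absv c < 1" using gt by (auto simp: b_def c_def absv_inverse inverse_less_1_iff)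
  then have cr: "absv c \<le> r" and c1: "absv c \<le> 1" using absv_less_1 by auto
  let ?z = "U_hat_act L u c"
  have z: "?z \<in> carrier H" using hat_act_closed[OF c1 u] .
  have "el ?z 1 = el u 1 \<otimes>\<^bsub>R\<^esub> el \<one>\<^bsub>H\<^esub> c"
    using el_balance[OF u c1, of 1] el_mult[OF u H.one_closed, of 1 c] u by simp
  then have chz: "\<chi> (el ?z 1) = 1"
    using mult[OF el_closed[OF u] el_closed[OF H.one_closed]] sca[of c] b
    by (simp add: U_K_scalar_def el_def[symmetric] b_def[symmetric] c_def)
  obtain w where w: "w \<in> carrier H" "(\<one>\<^bsub>H\<^esub> \<ominus>\<^bsub>H\<^esub> ?z) \<otimes>\<^bsub>H\<^esub> w = \<one>\<^bsub>H\<^esub>"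
    using one_plus_invertible[OF u cr] by blast
  have cl: "\<one>\<^bsub>H\<^esub> \<ominus>\<^bsub>H\<^esub> ?z \<in> carrier H" using z by simp
  have "\<chi> (el (\<one>\<^bsub>H\<^esub> \<ominus>\<^bsub>H\<^esub> ?z) 1) + \<chi> (el ?z 1) = \<chi> (el \<one>\<^bsub>H\<^esub> 1)"
    using add[OF el_closed[OF cl, of 1] el_closed[OF z, of 1]] el_add_left[OF cl z, of 1] z
    by (simp add: H.minus_eq H.a_assoc H.l_neg)
  then have "\<chi> (el (\<one>\<^bsub>H\<^esub> \<ominus>\<^bsub>H\<^esub> ?z) 1) = 0" using chz one by simp
  moreover have "\<chi> (el (\<one>\<^bsub>H\<^esub> \<ominus>\<^bsub>H\<^esub> ?z) 1) * \<chi> (el w 1) = 1"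
    using mult[OF el_closed[OF cl] el_closed[OF w(1)], of 1 1] el_mult[OF cl w(1), of 1 1] w(2) one by simp
  ultimately show False by simp
qed

end

text \<open>The maps induced by the inclusion are unions over representatives. They are well defined
  because congruence modulo \<open>\<pi>^n\<close> and the relations for \<open>B\<close> implies
  the same for \<open>L\<close>; representatives are thus kept unchanged.\<close>

lemma env_incl:
  assumes L: "env_lattice absv \<pi> scale bracket L" and B: "env_lattice absv \<pi> scale bracket B" and sub: "B \<subseteq> L"
    and f: "f \<in> carrier (affinoid_enveloping.U_hat (valuation_ring absv) \<pi> scale bracket B)"
  defines "g \<equiv> affinoid_enveloping.U_hat_incl (valuation_ring absv) \<pi> scale bracket L f"
  shows "g \<in> carrier (affinoid_enveloping.U_hat (valuation_ring absv) \<pi> scale bracket L)"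
    and "env_lattice.rep absv scale bracket B f n q \<Longrightarrow> env_lattice.rep absv scale bracket L g n q"
proof -
  interpret L: env_lattice absv \<pi> scale bracket L by (rule L)
  interpret B: env_lattice absv \<pi> scale bracket B by (rule B)
  have fa: "q \<in> L.fa" if "q \<in> B.fa" for q using that sub by (auto simp: L.fa_iff B.fa_iff)
  have I: "i \<in> L.I" if "i \<in> B.I" for i
  proof -
    \<comment> \<open>The relations of \<open>L\<close> cut out an ideal of the smaller free
      algebra, and it contains the relators of \<open>B\<close>; so it contains the ideal that they
      generate.\<close>
    have "ideal (L.I \<inter> B.fa) B.FA"
    proof (rule idealI)
      show "subgroup (L.I \<inter> B.fa) (add_monoid B.FA)"
      proof (rule group.subgroupI[OF abelian_group.a_group[OF ring.is_abelian_group[OF B.ring_FA]]])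
        show "L.I \<inter> B.fa \<noteq> {}" using L.I_0 B.fa_0 by blast
        fix a assume a: "a \<in> L.I \<inter> B.fa"
        have "\<ominus>\<^bsub>B.FA\<^esub> a = - a"
          using a B.fa_minus by (intro abelian_group.minus_equality[OF ring.is_abelian_group[OF B.ring_FA]]) auto
        then show "inv\<^bsub>add_monoid B.FA\<^esub> a \<in> L.I \<inter> B.fa"
          using a L.I_minus B.fa_minus unfolding a_inv_def[symmetric] by simp
      qed (auto simp: L.I_add B.fa_add)
    qed (use L.I_left L.I_right fa B.fa_mult B.ring_FA in auto)
    moreover have "env_relators (valuation_ring absv) scale bracket B \<subseteq> L.I \<inter> B.fa"
    proof -
      have "env_relators (valuation_ring absv) scale bracket B \<subseteq> env_relators (valuation_ring absv) scale bracket L"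
        using sub unfolding env_relators_def by blast
      then show ?thesis using L.relators_I B.relators_subset by blast
    qed
    ultimately show ?thesis using B.I_minimal that by blast
  qed
  have J: "d \<in> L.J n" if "d \<in> B.J n" for d n using that I fa unfolding L.J_def B.J_def by blast
  have incl: "L.U_incl L (L.U_class B q) = L.U_class L q" if q: "q \<in> B.fa" for q
  proof -
    have "L.U_class L p = L.U_class L q" if p: "p \<in> L.U_class B q" for p
    proof -
      have d: "p - q \<in> B.I" using p B.mem_U_class[OF q] by simp
      then have "p \<in> B.fa" using B.fa_add[OF B.I_fa[OF d] q] by simp
      then show ?thesis using L.U_class_eq_iff[OF fa fa[OF q]] I[OF d] by simp
    qed
    moreover have "q \<in> L.U_class B q" using B.mem_U_class[OF q] B.I_0 by simp
    ultimately show ?thesis unfolding L.U_incl_def by blast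
  qed
  have "\<forall>n. \<exists>q. B.rep f n q" using B.rep_exists f by blast
  then obtain qq where q: "\<And>n. B.rep f n (qq n)" by metis
  have gn: "g n = L.U_hat_class L (L.U_class L p) n" if p: "B.rep f n p" for n p
  proof -
    have "L.U_hat_class L (L.U_incl L u) n = L.U_hat_class L (L.U_class L p) n" if u: "u \<in> f n" for u
    proof -
      obtain q' where q': "q' \<in> B.fa" "u = L.U_class B q'"
        using central_element.C_carr[OF B.central_tU] B.carrier_U u f unfolding B.H_eq by metis
      then have r': "B.rep f n q'" using u by (simp add: B.rep_def)
      have d: "q' - p \<in> L.J n" using J[OF B.rep_diff[OF f p r']] .
      have pfa: "p \<in> L.fa" using fa B.rep_fa[OF p] by blast
      have "L.rep (L.U_hat_class L (L.U_class L p)) n q'"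
        using L.rep_shift[OF L.hat_class_closed[OF pfa] L.rep_class[OF pfa] fa[OF q'(1)] d] .
      then have "L.U_class L q' \<in> L.U_hat_class L (L.U_class L p) n" "L.U_class L q' \<in> L.U_hat_class L (L.U_class L q') n"
        using L.rep_class[OF fa[OF q'(1)], of n] by (simp_all add: L.rep_def)
      then show ?thesis
        using central_element.C_coset[OF L.central_tU] L.hat_class_closed[OF pfa] L.hat_class_closed[OF fa[OF q'(1)]]
        unfolding L.H_eq q'(2) incl[OF q'(1)] by metis
    qed
    moreover have "L.U_class B p \<in> f n" using p by (simp add: B.rep_def)
    ultimately show ?thesis unfolding g_def L.U_hat_incl_def by blast
  qed
  have cons: "qq (Suc n) - qq n \<in> L.J n" for n
    using J[OF B.rep_diff[OF f q B.rep_Suc[OF f q]]] .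
  obtain u where u: "u \<in> carrier (L.U_hat L)" "\<And>n. L.rep u n (qq n)"
    using L.rep_construct[of qq, OF fa[OF B.rep_fa[OF q]] cons] by blast
  have "g n = u n" for n
  proof -
    have pfa: "qq n \<in> L.fa" using fa B.rep_fa[OF q] by blast
    have "L.U_class L (qq n) \<in> L.U_hat_class L (L.U_class L (qq n)) n" "L.U_class L (qq n) \<in> u n"
      using L.rep_class[OF pfa, of n] u(2)[of n] by (simp_all add: L.rep_def)
    then show ?thesis unfolding gn[OF q]
      using central_element.C_coset[OF L.central_tU] L.hat_class_closed[OF pfa] u(1)
      unfolding L.H_eq by metis
  qed
  then have "g = u" by (rule ext)
  then show "g \<in> carrier (L.U_hat L)" using u(1) by simp
  show "L.rep g n q" if "B.rep f n q"
    using L.rep_class[OF fa[OF B.rep_fa[OF that]], of n] gn[OF that] by (simp add: L.rep_def)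
qed

section \<open>The action of the completed enveloping algebra\<close>

text \<open>Instantiated twice: with the lattice, the whole algebra and its full chain, which gives
  the module \<open>M\<close>, and with the lattice of the polarisation and the empty chain, which
  gives the one-dimensional module defined by \<open>lam\<close>.\<close>

locale rep_setup = lie_setup absv \<pi> scale bracket L lam N
  for absv :: "'k::field \<Rightarrow> real" and \<pi> :: 'k
    and scale :: "'k \<Rightarrow> 'g::ab_group_add \<Rightarrow> 'g" and bracket :: "'g \<Rightarrow> 'g \<Rightarrow> 'g"
    and L lam N +
  fixes B :: "'g set" and h :: "'g set" and ps :: "('g \<times> 'g) list"
  assumes adp: "adapted ps h"
    and B_h: "B \<subseteq> h" and B_L: "B \<subseteq> L"
    and B_add: "x \<in> B \<Longrightarrow> y \<in> B \<Longrightarrow> x + y \<in> B"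
    and B_scale: "absv c \<le> 1 \<Longrightarrow> x \<in> B \<Longrightarrow> scale c x \<in> B"
    and B_bracket: "x \<in> B \<Longrightarrow> y \<in> B \<Longrightarrow> bracket x y \<in> B"
begin

sublocale E: env_lattice absv \<pi> scale bracket B
  by unfold_locales (use B_add B_scale B_bracket in auto)

abbreviation "d \<equiv> length ps"
abbreviation "M \<equiv> Mset d"
abbreviation "e0 \<equiv> unit (replicate d 0)"

lemma e0_M: "e0 \<in> M"
  using unit_Mset[of "replicate d 0"] by simp

lemma actw_add: "actw ps ws (\<lambda>be. f be + g be) = (\<lambda>al. actw ps ws f al + actw ps ws g al)"
  by (induction ws) (auto simp: act_add_right)

lemma actw_scale: "actw ps ws (\<lambda>be. c * f be) = (\<lambda>al. c * actw ps ws f al)"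
  by (induction ws) (auto simp: act_scale_right)

lemma actw_sum: "actw ps ws (\<lambda>be. \<Sum>i\<in>A. f i be) = (\<lambda>al. \<Sum>i\<in>A. actw ps ws (f i) al)"
proof (induction A rule: infinite_finite_induct)
  have z: "actw ps ws (\<lambda>be. 0) = (\<lambda>al. 0)" using actw_scale[of ws 0 "\<lambda>be. 0"] by simp
  case (infinite A)
  then show ?case using z by simp
next
  have z: "actw ps ws (\<lambda>be. 0) = (\<lambda>al. 0)" using actw_scale[of ws 0 "\<lambda>be. 0"] by simp
  case empty
  then show ?case using z by simp
qed (simp add: actw_add)

lemma actw_bdd: "set ws \<subseteq> B \<Longrightarrow> bdd R f \<Longrightarrow> bdd R (actw ps ws f)"
  by (induction ws) (auto intro!: act_bdd[OF adp] subsetD[OF B_h] subsetD[OF B_L])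

lemma actw_M: "set ws \<subseteq> B \<Longrightarrow> f \<in> M \<Longrightarrow> actw ps ws f \<in> M"
  by (induction ws) (auto intro!: act_Mset_L[OF adp] subsetD[OF B_h] subsetD[OF B_L])

definition rho :: "('g word \<Rightarrow>\<^sub>0 'k) \<Rightarrow> (nat list \<Rightarrow> 'k) \<Rightarrow> nat list \<Rightarrow> 'k" where
  "rho q f al = (\<Sum>w\<in>Poly_Mapping.keys q. Poly_Mapping.lookup q w * actw ps (letters w) f al)"

lemma rho_superset: "finite S \<Longrightarrow> Poly_Mapping.keys q \<subseteq> S \<Longrightarrow>
    rho q f al = (\<Sum>w\<in>S. Poly_Mapping.lookup q w * actw ps (letters w) f al)"
  unfolding rho_def by (intro sum.mono_neutral_left) (auto simp: in_keys_iff)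

lemma rho_0 [simp]: "rho 0 f = (\<lambda>al. 0)"
  by (auto simp: rho_def)

lemma rho_add: "rho (p + q) f al = rho p f al + rho q f al"
proof -
  let ?S = "Poly_Mapping.keys p \<union> Poly_Mapping.keys q"
  have "Poly_Mapping.keys (p + q) \<subseteq> ?S" by (rule keys_add)
  then show ?thesis by (simp add: rho_superset[of ?S] lookup_add distrib_right sum.distrib)
qed

lemma rho_diff: "rho (p - q) f al = rho p f al - rho q f al"
  using rho_add[of "p - q" q f al] by simp

lemma rho_sum: "rho (sum q A) f al = (\<Sum>i\<in>A. rho (q i) f al)"
  by (induction A rule: infinite_finite_induct) (simp_all add: rho_add)

lemma rho_single: "rho (Poly_Mapping.single w c) f al = c * actw ps (letters w) f al"
  by (cases "c = 0") (simp_all add: rho_def)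

lemma rho_mult: "rho (p * q) f = rho p (rho q f)"
proof
  fix al
  have "p * q = (\<Sum>w\<in>Poly_Mapping.keys p. \<Sum>v\<in>Poly_Mapping.keys q.
      Poly_Mapping.single (w + v) (Poly_Mapping.lookup p w * Poly_Mapping.lookup q v))"
    by (subst (1) poly_mapping_expand[of p], subst (1) poly_mapping_expand[of q])
      (simp add: sum_distrib_left sum_distrib_right mult_single sum.swap[of _ "Poly_Mapping.keys q"])
  then have "rho (p * q) f al = (\<Sum>w\<in>Poly_Mapping.keys p. \<Sum>v\<in>Poly_Mapping.keys q.
      Poly_Mapping.lookup p w * Poly_Mapping.lookup q v * actw ps (letters w) (actw ps (letters v) f) al)"
    by (simp add: rho_sum rho_single plus_word_def actw_append)
  also have "\<dots> = rho p (rho q f) al"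
    unfolding rho_def[of p] rho_def[of q, abs_def] by (simp add: actw_sum actw_scale sum_distrib_left mult.assoc)
  finally show "rho (p * q) f al = rho p (rho q f) al" .
qed

lemma rho_1: "rho 1 f = f"
proof
  fix al show "rho 1 f al = f al"
    using rho_single[of 0 1 f al] by simp (simp add: zero_word_def)
qed

lemma rho_scalar: "rho (free_scalar c) f = (\<lambda>al. c * f al)"
  by (rule ext) (simp add: free_scalar_def rho_single zero_word_def)

lemma rho_gen: "rho (free_gen x) f = act ps x f"
  by (rule ext) (simp add: free_gen_def rho_single)

lemma rho_add_right: "rho q (\<lambda>be. f be + g be) al = rho q f al + rho q g al"
  by (simp add: rho_def actw_add distrib_left sum.distrib)

lemma rho_scale_right: "rho q (\<lambda>be. c * f be) al = c * rho q f al"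
  by (simp add: rho_def actw_scale sum_distrib_left mult.left_commute)

lemma rho_diff_right: "rho q (\<lambda>be. f be - g be) al = rho q f al - rho q g al"
  using rho_add_right[of q "\<lambda>be. f be - g be" g al] by simp

lemma rho_bdd: "q \<in> E.fa \<Longrightarrow> bdd R f \<Longrightarrow> bdd R (rho q f)"
  using bdd_nonneg[of R f] actw_bdd[of "letters _" R f] unfolding E.fa_iff rho_def bdd_def
  by (auto intro!: absv_sum_le absv_mult_le1)

lemma rho_M: "q \<in> E.fa \<Longrightarrow> f \<in> M \<Longrightarrow> rho q f \<in> M"
  unfolding rho_def[abs_def] E.fa_iff by (intro Mset_sum Mset_scale actw_M) auto

text \<open>The elements acting as zero form an ideal that contains the relators; for the bracket
  relators this is \<open>act_bracket\<close>.\<close>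

lemma rho_I: "i \<in> E.I \<Longrightarrow> rho i f = (\<lambda>al. 0)"
proof -
  define Z where "Z = {q \<in> E.fa. \<forall>f. rho q f = (\<lambda>al. 0)}"
  have z: "rho q (\<lambda>be. 0) = (\<lambda>al. 0)" for q using rho_scale_right[of q 0 "\<lambda>be. 0"] by auto
  have "ideal Z E.FA"
  proof (rule idealI[OF E.ring_FA])
    interpret FA: ring E.FA by (rule E.ring_FA)
    show "subgroup Z (add_monoid E.FA)"
    proof (rule group.subgroupI[OF FA.a_group])
      show "Z \<noteq> {}" using E.fa_0 by (auto simp: Z_def)
      fix a assume a: "a \<in> Z"
      have "\<ominus>\<^bsub>E.FA\<^esub> a = - a" using a E.fa_minus by (intro FA.minus_equality) (auto simp: Z_def)
      moreover have "- a \<in> Z" using a E.fa_minus rho_diff[of 0 a] by (auto simp: Z_def)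
      ultimately show "inv\<^bsub>add_monoid E.FA\<^esub> a \<in> Z" unfolding a_inv_def[symmetric] by simp
    qed (auto simp: Z_def E.fa_add rho_add)
  qed (auto simp: Z_def E.fa_mult rho_mult z)
  moreover have "env_relators (valuation_ring absv) scale bracket B \<subseteq> Z"
  proof
    fix q assume q: "q \<in> env_relators (valuation_ring absv) scale bracket B"
    then have "q \<in> E.fa" using E.relators_subset by blast
    moreover have "rho q f al = 0" for f al
      using q unfolding env_relators_def
    proof (elim UnE CollectE exE conjE)
      fix x y assume "q = free_gen (x + y) - free_gen x - free_gen y"
      then show ?thesis by (simp add: rho_diff rho_gen act_add_left)
    next
      fix c x assume "q = free_gen (scale c x) - free_scalar c * free_gen x"
      then show ?thesis by (simp add: rho_diff rho_gen rho_mult rho_scalar act_scale_left)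
    next
      fix x y assume "q = free_gen x * free_gen y - free_gen y * free_gen x - free_gen (bracket x y)" "x \<in> B" "y \<in> B"
      then show ?thesis using act_bracket[OF adp subsetD[OF B_h] subsetD[OF B_h], of x y f al] by (auto simp: rho_diff rho_gen rho_mult)
    qed
    ultimately show "q \<in> Z" by (auto simp: Z_def)
  qed
  ultimately have "E.I \<subseteq> Z" by (rule E.I_minimal)
  then show "i \<in> E.I \<Longrightarrow> rho i f = (\<lambda>al. 0)" by (auto simp: Z_def)
qed

lemma rho_J: "x \<in> E.J n \<Longrightarrow> bdd R f \<Longrightarrow> bdd (r ^ n * R) (rho x f)"
proof -
  assume "x \<in> E.J n" and f: "bdd R f"
  then obtain s i where s: "s \<in> E.fa" "i \<in> E.I" "x = free_scalar (\<pi> ^ n) * s + i" by (auto simp: E.J_def)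
  have "rho x f al = \<pi> ^ n * rho s f al" for al
    unfolding s(3) rho_add rho_I[OF s(2)] by (simp add: rho_mult rho_scalar)
  then show ?thesis using bdd_scale[OF rho_bdd[OF s(1) f], of "\<pi> ^ n" "r ^ n"] by (simp add: bdd_def)
qed

text \<open>The value is characterised by its approximations, so \<open>hat\<close> is the continuous extension of \<open>rho\<close>.\<close>

definition hat_rel where
  "hat_rel u f al a \<longleftrightarrow> (\<forall>n q R. E.rep u n q \<longrightarrow> bdd R f \<longrightarrow> absv (a - rho q f al) \<le> r ^ n * R)"

definition hat :: "('k, 'g) env_hat \<Rightarrow> (nat list \<Rightarrow> 'k) \<Rightarrow> nat list \<Rightarrow> 'k" where
  "hat u f al = (THE a. hat_rel u f al a)"

lemma hat_rel_unique:
  assumes "u \<in> carrier E.H" "f \<in> M" "hat_rel u f al a" "hat_rel u f al b" shows "a = b"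
proof -
  obtain m where m: "bdd (inverse r ^ m) f" using Mset_bdd[OF assms(2)] by blast
  have "absv (a - b) \<le> r ^ n * inverse r ^ m" for n
  proof -
    obtain q where q: "E.rep u n q" using E.rep_exists[OF assms(1)] by blast
    have "absv ((a - rho q f al) - (b - rho q f al)) \<le> r ^ n * inverse r ^ m"
      using assms(3,4) q m unfolding hat_rel_def by (intro absv_diff_le[of "_ - _"]) blast+
    then show ?thesis by simp
  qed
  then have "a - b = 0" by (rule eq_0_if_absv_le_power)
  then show ?thesis by simp
qed

lemma rep_mono: "u \<in> carrier E.H \<Longrightarrow> n \<le> m \<Longrightarrow> E.rep u m q \<Longrightarrow> E.rep u n q"
proof -
  assume u: "u \<in> carrier E.H" and "n \<le> m" "E.rep u m q"
  from this(2,3) show ?thesis by (induction rule: dec_induct) (auto dest: E.rep_Suc[OF u])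
qed

lemma hat_rel_exists:
  assumes u: "u \<in> carrier E.H" and f: "f \<in> M" shows "\<exists>a. hat_rel u f al a"
proof -
  obtain m where m: "bdd (inverse r ^ m) f" using Mset_bdd[OF f] by blast
  have "\<forall>n. \<exists>q. E.rep u n q" using E.rep_exists[OF u] by blast
  then obtain q where q: "\<And>n. E.rep u n (q n)" by metis
  have diff: "absv (rho p f al - rho p' f al) \<le> r ^ n * R" if "E.rep u n p" "E.rep u n p'" "bdd R f" for n p p' R
    using bddD[OF rho_J[OF E.rep_diff[OF u that(2,1)] that(3)], of al] by (simp add: rho_diff)
  \<comment> \<open>The shift by \<open>m\<close> compensates the norm of \<open>f\<close>, so that
    successive terms differ by at most \<open>r ^ n\<close>.\<close>
  define a where "a n = rho (q (n + m)) f al" for n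
  have "\<exists>s. \<forall>n. absv (s - a n) \<le> r ^ n"
  proof (rule complete)
    fix n
    have "absv (a (Suc n) - a n) \<le> r ^ (n + m) * inverse r ^ m"
      unfolding a_def by (rule diff[OF _ q m]) (use E.rep_Suc[OF u] q in simp)
    then show "absv (a (Suc n) - a n) \<le> r ^ n" by (simp add: power_add mult.assoc flip: power_mult_distrib)
  qed
  then obtain s where s: "\<And>n. absv (s - a n) \<le> r ^ n" by blast
  have "hat_rel u f al s" unfolding hat_rel_def
  proof (intro allI impI)
    fix n p R assume p: "E.rep u n p" and R: "bdd R f"
    show "absv (s - rho p f al) \<le> r ^ n * R"
    proof (rule ccontr)
      assume neg: "\<not> absv (s - rho p f al) \<le> r ^ n * R"
      \<comment> \<open>When the claimed bound fails, the ultrametric inequality leaves only the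
        error of the approximation to \<open>s\<close>, which is arbitrarily small.\<close>
      have k: "absv (s - rho p f al) \<le> r ^ k" for k
      proof -
        have "E.rep u n (q (n + k + m))" using rep_mono[OF u _ q] by simp
        then have "absv (a (n + k) - rho p f al) \<le> r ^ n * R"
          unfolding a_def using diff[OF _ p R] by simp
        moreover have "absv (s - rho p f al) \<le> max (absv (s - a (n + k))) (absv (a (n + k) - rho p f al))"
          using absv_ultra[of "s - a (n + k)" "a (n + k) - rho p f al"] by simp
        moreover have "r ^ (n + k) \<le> r ^ k" by (rule power_decreasing) simp_all
        ultimately show ?thesis using s[of "n + k"] neg by linarith
      qed
      then have "s - rho p f al = 0" using eq_0_if_absv_le_power[of "s - rho p f al" 1] by simp
      then show False using neg bdd_nonneg[OF R] by simp
    qed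
  qed
  then show ?thesis by blast
qed

lemma hat_rel_hat: "u \<in> carrier E.H \<Longrightarrow> f \<in> M \<Longrightarrow> hat_rel u f al (hat u f al)"
  unfolding hat_def by (rule theI') (use hat_rel_exists hat_rel_unique in blast)

lemma hat_approx:
  "u \<in> carrier E.H \<Longrightarrow> f \<in> M \<Longrightarrow> bdd R f \<Longrightarrow> E.rep u n q \<Longrightarrow> bdd (r ^ n * R) (\<lambda>al. hat u f al - rho q f al)"
  using hat_rel_hat unfolding hat_rel_def bdd_def by blast

text \<open>The constant \<open>S\<close> need not be related to the norm of \<open>f\<close>: both
  approximations are compared with the larger of the two constants.\<close>

lemma hat_eqI:
  assumes u: "u \<in> carrier E.H" and f: "f \<in> M"
    and g: "\<And>n. \<exists>q. E.rep u n q \<and> bdd (r ^ n * S) (\<lambda>al. g al - rho q f al)"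
  shows "hat u f = g"
proof
  fix al
  obtain m where m: "bdd (inverse r ^ m) f" using Mset_bdd[OF f] by blast
  let ?S = "max S (inverse r ^ m)"
  have "absv (hat u f al - g al) \<le> r ^ n * ?S" for n
  proof -
    obtain q where q: "E.rep u n q" "bdd (r ^ n * S) (\<lambda>al. g al - rho q f al)" using g by blast
    have 1: "r ^ n * S \<le> r ^ n * ?S" "r ^ n * inverse r ^ m \<le> r ^ n * ?S" by (simp_all add: mult_left_mono)
    have "absv ((hat u f al - rho q f al) - (g al - rho q f al)) \<le> r ^ n * ?S"
      using order_trans[OF bddD[OF hat_approx[OF u f m q(1)], of al] 1(2)] order_trans[OF bddD[OF q(2), of al] 1(1)]
      by (rule absv_diff_le)
    then show ?thesis by simp
  qed
  then have "hat u f al - g al = 0" using eq_0_if_absv_le_power by blast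
  then show "hat u f al = g al" by simp
qed

lemma hat_bdd: "u \<in> carrier E.H \<Longrightarrow> f \<in> M \<Longrightarrow> bdd R f \<Longrightarrow> bdd R (hat u f)"
proof -
  assume u: "u \<in> carrier E.H" and f: "f \<in> M" and R: "bdd R f"
  obtain q where q: "E.rep u 0 q" using E.rep_exists[OF u] by blast
  show ?thesis using bdd_add[OF hat_approx[OF u f R q, simplified] rho_bdd[OF E.rep_fa[OF q] R]] by simp
qed

lemma hat_M: "u \<in> carrier E.H \<Longrightarrow> f \<in> M \<Longrightarrow> hat u f \<in> M"
proof -
  assume u: "u \<in> carrier E.H" and f: "f \<in> M"
  obtain m where m: "bdd (inverse r ^ m) f" using Mset_bdd[OF f] by blast
  have ap: "\<exists>g\<in>M. bdd (r ^ n) (\<lambda>al. hat u f al - g al)" for n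
  proof -
    obtain q where q: "E.rep u (n + m) q" using E.rep_exists[OF u] by blast
    have "r ^ (n + m) * inverse r ^ m = r ^ n" by (simp add: power_add mult.assoc flip: power_mult_distrib)
    then show ?thesis using hat_approx[OF u f m q] rho_M[OF E.rep_fa[OF q] f] by auto
  qed
  show ?thesis
  proof (rule MsetI_approx)
    show "length al = d" if ne: "hat u f al \<noteq> 0" for al
    proof (rule ccontr)
      assume l: "length al \<noteq> d"
      have "absv (hat u f al) \<le> r ^ n * 1" for n
      proof -
        obtain g where g: "g \<in> M" "bdd (r ^ n) (\<lambda>al. hat u f al - g al)" using ap by blast
        have "g al = 0" using MsetD(1)[OF g(1)] l by blast
        then show ?thesis using bddD[OF g(2), of al] by simp
      qed
      then show False using ne eq_0_if_absv_le_power by blast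
    qed
    show "\<exists>g. finite {al. \<not> absv (g al) \<le> r ^ n} \<and> bdd (r ^ n) (\<lambda>al. hat u f al - g al)" for n
      using ap[of n] MsetD(2) by blast
  qed
qed

lemma hat_add:
  assumes u: "u \<in> carrier E.H" and w: "w \<in> carrier E.H" and f: "f \<in> M"
  shows "hat (u \<oplus>\<^bsub>E.H\<^esub> w) f = (\<lambda>al. hat u f al + hat w f al)"
proof -
  interpret H: ring E.H by (rule E.ring_H)
  obtain m where m: "bdd (inverse r ^ m) f" using Mset_bdd[OF f] by blast
  show ?thesis
  proof (rule hat_eqI)
    fix n
    obtain p q where p: "E.rep u n p" and q: "E.rep w n q" using E.rep_exists u w by blast
    show "\<exists>q. E.rep (u \<oplus>\<^bsub>E.H\<^esub> w) n q \<and> bdd (r ^ n * inverse r ^ m) (\<lambda>al. hat u f al + hat w f al - rho q f al)"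
      using E.rep_add[OF u w p q] bdd_add[OF hat_approx[OF u f m p] hat_approx[OF w f m q]]
      by (intro exI[of _ "p + q"]) (simp add: rho_add algebra_simps)
  qed (use u w f in auto)
qed

lemma hat_mult:
  assumes u: "u \<in> carrier E.H" and w: "w \<in> carrier E.H" and f: "f \<in> M"
  shows "hat (u \<otimes>\<^bsub>E.H\<^esub> w) f = hat u (hat w f)"
proof -
  interpret H: ring E.H by (rule E.ring_H)
  obtain m where m: "bdd (inverse r ^ m) f" using Mset_bdd[OF f] by blast
  show ?thesis
  proof (rule hat_eqI)
    fix n
    obtain p q where p: "E.rep u n p" and q: "E.rep w n q" using E.rep_exists u w by blast
    have 1: "bdd (r ^ n * inverse r ^ m) (\<lambda>al. hat u (hat w f) al - rho p (hat w f) al)"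
      by (rule hat_approx[OF u hat_M[OF w f] hat_bdd[OF w f m] p])
    have 2: "bdd (r ^ n * inverse r ^ m) (rho p (\<lambda>al. hat w f al - rho q f al))"
      by (rule rho_bdd[OF E.rep_fa[OF p] hat_approx[OF w f m q]])
    show "\<exists>q. E.rep (u \<otimes>\<^bsub>E.H\<^esub> w) n q \<and> bdd (r ^ n * inverse r ^ m) (\<lambda>al. hat u (hat w f) al - rho q f al)"
      using E.rep_mult[OF u w p q] bdd_add[OF 1 2]
      by (intro exI[of _ "p * q"]) (simp add: rho_mult rho_diff_right[abs_def])
  qed (use u w f in auto)
qed

lemma hat_class:
  assumes "\<And>n. E.rep u n q" "u \<in> carrier E.H" "f \<in> M" shows "hat u f = rho q f"
  using bdd_0[of 0] by (intro hat_eqI[of _ _ 0] exI[of _ q] conjI assms) simp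

lemma hat_one: "f \<in> M \<Longrightarrow> hat \<one>\<^bsub>E.H\<^esub> f = f"
  using hat_class[OF E.rep_one ring.ring_simprules(6)[OF E.ring_H]] by (simp add: rho_1)

lemma hat_act:
  assumes u: "u \<in> carrier E.H" and c: "absv c \<le> 1" and f: "f \<in> M"
  shows "hat (E.U_hat_act B u c) f = (\<lambda>al. c * hat u f al)"
proof -
  obtain m where m: "bdd (inverse r ^ m) f" using Mset_bdd[OF f] by blast
  show ?thesis
  proof (rule hat_eqI)
    fix n
    obtain p where p: "E.rep u n p" using E.rep_exists u by blast
    show "\<exists>q. E.rep (E.U_hat_act B u c) n q \<and> bdd (r ^ n * inverse r ^ m) (\<lambda>al. c * hat u f al - rho q f al)"
      using E.rep_hat_act[OF c u p] bdd_scale[OF hat_approx[OF u f m p] c]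
      by (intro exI[of _ "free_scalar c * p"]) (simp add: rho_mult rho_scalar right_diff_distrib)
  qed (use E.hat_act_closed u c f in auto)
qed

lemma hat_scale_right:
  assumes u: "u \<in> carrier E.H" and f: "f \<in> M"
  shows "hat u (\<lambda>al. c * f al) = (\<lambda>al. c * hat u f al)"
proof -
  obtain m where m: "bdd (inverse r ^ m) f" using Mset_bdd[OF f] by blast
  show ?thesis
  proof (rule hat_eqI)
    fix n
    obtain p where p: "E.rep u n p" using E.rep_exists u by blast
    show "\<exists>q. E.rep u n q \<and> bdd (r ^ n * (absv c * inverse r ^ m)) (\<lambda>al. c * hat u f al - rho q (\<lambda>al. c * f al) al)"
      using p bdd_scale[OF hat_approx[OF u f m p] order_refl, of c]
      by (intro exI[of _ p]) (simp add: rho_scale_right right_diff_distrib mult_ac)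
  qed (use u f Mset_scale in auto)
qed

definition sig :: "('k, 'g) env_K \<Rightarrow> (nat list \<Rightarrow> 'k) \<Rightarrow> nat list \<Rightarrow> 'k" where
  "sig V f al = frag_sum (\<lambda>(u, a). a * hat u f al) (SOME c. c \<in> V)"

text \<open>The action of \<open>u\<close> scaled by \<open>a\<close> is additive in both and
  balanced over the valuation ring by \<open>hat_act\<close>, so the chosen representative does not
  matter.\<close>

lemma sig_class:
  assumes f: "f \<in> M" shows "sig (E.U_K_class B c) f al = frag_sum (\<lambda>(u, a). a * hat u f al) c"
proof -
  let ?h = "\<lambda>(u, a). a * hat u f al"
  have "c \<in> E.U_K_class B c" unfolding E.U_K_class_def by (rule tensor.self_mem_cls[OF E.tensor_UK])
  then have "(SOME c'. c' \<in> E.U_K_class B c) \<in> E.U_K_class B c" by (rule someI)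
  then have k: "(SOME c'. c' \<in> E.U_K_class B c) - c \<in>
      tensor_kernel (add_monoid E.H) (add_monoid ring_of_type_algebra) (valuation_ring absv) (E.U_hat_act B) (*)"
    unfolding E.U_K_class_def tensor.mem_cls_iff[OF E.tensor_UK] .
  have "frag_sum ?h ((SOME c'. c' \<in> E.U_K_class B c) - c) = 0"
    by (rule tensor.frag_sum_Ker[OF E.tensor_UK k])
      (simp_all add: hat_add f hat_act E.vr_iff distrib_left distrib_right mult_ac)
  then show ?thesis by (simp add: frag_sum_diff sig_def)
qed

lemma sig_el: "f \<in> M \<Longrightarrow> sig (E.el u a) f = (\<lambda>al. a * hat u f al)"
  by (rule ext) (simp add: E.el_def sig_class)

lemma sig_add:
  assumes "V \<in> carrier E.R" "W \<in> carrier E.R" "f \<in> M"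
  shows "sig (V \<oplus>\<^bsub>E.R\<^esub> W) f = (\<lambda>al. sig V f al + sig W f al)"
proof
  fix al
  obtain c e where c: "Poly_Mapping.keys c \<subseteq> carrier E.H \<times> UNIV" "V = E.U_K_class B c"
    and e: "Poly_Mapping.keys e \<subseteq> carrier E.H \<times> UNIV" "W = E.U_K_class B e"
    using assms E.carrier_R by metis
  have "V \<oplus>\<^bsub>E.R\<^esub> W = E.U_K_class B (c + e)"
    unfolding E.R_eq tensor_alg.TA_add[OF E.tensor_alg_UK] c(2) e(2) E.U_K_class_def
    by (rule tensor.T_mult[OF E.tensor_UK]) (use c e in simp_all)
  then show "sig (V \<oplus>\<^bsub>E.R\<^esub> W) f al = sig V f al + sig W f al"
    by (simp add: c(2) e(2) sig_class assms(3) frag_sum_add)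
qed

lemma sig_M: "V \<in> carrier E.R \<Longrightarrow> f \<in> M \<Longrightarrow> sig V f \<in> M"
  using E.R_elements[of V] by (auto simp: sig_el intro!: Mset_scale hat_M)

lemma sig_mult:
  assumes "V \<in> carrier E.R" "W \<in> carrier E.R" "f \<in> M"
  shows "sig (V \<otimes>\<^bsub>E.R\<^esub> W) f = sig V (sig W f)"
proof -
  obtain u a where u: "u \<in> carrier E.H" "V = E.el u a" using E.R_elements assms by blast
  obtain w b where w: "w \<in> carrier E.H" "W = E.el w b" using E.R_elements assms by blast
  have wf: "hat w f \<in> M" using hat_M w assms by blast
  show ?thesis
    unfolding u(2) w(2) E.el_mult[OF u(1) w(1)] sig_el[OF assms(3)] sig_el[OF Mset_scale[OF wf]]
      hat_scale_right[OF u(1) wf] hat_mult[OF u(1) w(1) assms(3)] by (simp add: mult.assoc)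
qed

lemma sig_one: "f \<in> M \<Longrightarrow> sig \<one>\<^bsub>E.R\<^esub> f = f"
  by (simp add: E.el_one sig_el hat_one)

lemma sig_scale_right: "V \<in> carrier E.R \<Longrightarrow> f \<in> M \<Longrightarrow> sig V (\<lambda>al. c * f al) = (\<lambda>al. c * sig V f al)"
  using E.R_elements[of V] by (auto simp: sig_el Mset_scale hat_scale_right mult_ac)

lemma sig_scalar: "f \<in> M \<Longrightarrow> sig (E.U_K_scalar B a) f = (\<lambda>al. a * f al)"
  using sig_el[of f "\<one>\<^bsub>E.H\<^esub>" a] by (simp add: E.U_K_scalar_def E.el_def hat_one)

lemma sig_gen: "f \<in> M \<Longrightarrow> x \<in> B \<Longrightarrow> sig (E.U_K_gen B x) f = act ps x f"
  using sig_el[of f "E.U_hat_class B (E.U_class B (free_gen x))" 1]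
    hat_class[OF E.rep_class E.hat_class_closed, of "free_gen x" f] E.fa_gen[of x]
  by (simp add: E.U_K_gen_def E.el_def rho_gen)

end

section \<open>Leading exponents\<close>

lemma lex_total: "length xs = length ys \<Longrightarrow> xs = ys \<or> (xs, ys) \<in> lex less_than \<or> (ys, xs) \<in> lex less_than"
  by (induction xs ys rule: list_induct2) (auto simp: neq_iff)

lemma lex_finite_max:
  assumes "finite S" "S \<noteq> {}" shows "\<exists>xs\<in>S. \<forall>ys\<in>S. (xs, ys) \<notin> lex less_than"
proof -
  let ?R = "{(ys, xs). xs \<in> S \<and> ys \<in> S \<and> (xs, ys) \<in> lex less_than}"
  have "?R \<subseteq> S \<times> S" by auto
  then have "finite ?R" by (rule finite_subset) (use assms(1) in simp)
  moreover have "acyclic ((lex less_than)\<inverse>)" using wf_acyclic[OF wf_lex[OF wf_less_than]] by (simp add: acyclic_converse)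
  then have "acyclic ?R" by (rule acyclic_subset) auto
  ultimately have "wf ?R" by (rule finite_acyclic_wf)
  then show ?thesis using assms(2) by (metis (mono_tags, lifting) ex_in_conv mem_Collect_eq wfE_min case_prodI)
qed

text \<open>A finite set \<open>F\<close> dominates the tails of all lists in \<open>E\<close>.
  Lifted with some heads \<open>c be\<close>, it handles all lists whose head exceeds the maximum
  \<open>m\<close> of these; the finitely many smaller heads are treated one slice at a
  time.\<close>

lemma Dickson:
  "E \<subseteq> {al. length al = d} \<Longrightarrow> \<exists>F. finite F \<and> F \<subseteq> E \<and> (\<forall>al\<in>E. \<exists>be\<in>F. list_all2 (\<le>) be (al :: nat list))"
proof (induction d arbitrary: E)
  case 0
  then have "E \<subseteq> {[]}" by auto
  then have "finite E" using finite_subset by blast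
  then show ?case by (intro exI[of _ E]) (auto intro: list_all2_refl)
next
  case (Suc d)
  define T where "T i = {be. i # be \<in> E}" for i
  have Tl: "T i \<subseteq> {al. length al = d}" for i using Suc.prems by (auto simp: T_def)
  then have "(\<Union>i. T i) \<subseteq> {al. length al = d}" by blast
  from Suc.IH[OF this] obtain F where F: "finite F" "F \<subseteq> (\<Union>i. T i)" "\<forall>al\<in>(\<Union>i. T i). \<exists>be\<in>F. list_all2 (\<le>) be al" by blast
  have "\<forall>be. \<exists>i. be \<in> F \<longrightarrow> i # be \<in> E" using F(2) by (auto simp: T_def)
  then obtain c where c: "\<And>be. be \<in> F \<Longrightarrow> c be # be \<in> E" by metis
  obtain m where m: "\<And>be. be \<in> F \<Longrightarrow> c be \<le> m"
    using F(1) finite_nat_set_iff_bounded_le[of "c ` F"] by auto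
  have "\<forall>i. \<exists>G. finite G \<and> G \<subseteq> T i \<and> (\<forall>al\<in>T i. \<exists>be\<in>G. list_all2 (\<le>) be al)" using Suc.IH[OF Tl] by blast
  then obtain G where G: "\<And>i. finite (G i)" "\<And>i. G i \<subseteq> T i" "\<And>i. \<forall>al\<in>T i. \<exists>be\<in>G i. list_all2 (\<le>) be al" by metis
  let ?F = "(\<lambda>be. c be # be) ` F \<union> (\<Union>i\<in>{..m}. (#) i ` G i)"
  have dom: "\<exists>be\<in>?F. list_all2 (\<le>) be al" if al: "al \<in> E" for al
  proof -
    obtain i be where ib: "al = i # be" using al Suc.prems by (cases al) auto
    then have beT: "be \<in> T i" using al by (simp add: T_def)
    show ?thesis
    proof (cases "i \<le> m")
      case True
      obtain ga where "ga \<in> G i" "list_all2 (\<le>) ga be" using G(3) beT by blast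
      then show ?thesis using True ib by (intro bexI[of _ "i # ga"]) auto
    next
      case False
      obtain ga where ga: "ga \<in> F" "list_all2 (\<le>) ga be" using F(3) beT by blast
      then have "c ga \<le> i" using m[OF ga(1)] False by simp
      then show ?thesis using ga ib by (intro bexI[of _ "c ga # ga"]) auto
    qed
  qed
  have fin: "finite ?F" using F(1) G(1) by (intro finite_UnI finite_imageI finite_UN_I) auto
  have sub: "?F \<subseteq> E" using c G(2) by (auto simp: T_def)
  show ?case by (intro exI[of _ ?F] conjI ballI fin sub dom)
qed

context lie_setup
begin

text \<open>The lexicographically largest exponent in the reduction of \<open>f\<close> modulo
  \<open>\<pi>\<close>, for \<open>f\<close> of norm 1.\<close>

definition lead :: "(nat list \<Rightarrow> 'k) \<Rightarrow> nat list \<Rightarrow> bool" where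
  "lead f al \<longleftrightarrow> bdd 1 f \<and> absv (f al) = 1 \<and> (\<forall>be. (al, be) \<in> lex less_than \<longrightarrow> absv (f be) \<le> r)"

lemma lead_exists:
  assumes "f \<in> Mset d" "bdd 1 f" "\<not> bdd r f" shows "\<exists>al. length al = d \<and> lead f al"
proof -
  let ?S = "{al. \<not> absv (f al) \<le> r}"
  have "finite ?S" using MsetD(2)[OF assms(1), of 1] by simp
  moreover have "?S \<noteq> {}" using assms(3) by (auto simp: bdd_def)
  ultimately obtain al where al: "al \<in> ?S" "\<And>be. be \<in> ?S \<Longrightarrow> (al, be) \<notin> lex less_than" using lex_finite_max by meson
  then have "absv (f al) = 1" using absv_eq_1 bddD[OF assms(2)] by blast
  moreover from this have "length al = d" using MsetD(1)[OF assms(1), of al] by fastforce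
  ultimately show ?thesis using al assms(2) unfolding lead_def by blast
qed

lemma absv_add_eq_1: "absv a = 1 \<Longrightarrow> absv b \<le> r \<Longrightarrow> absv (a + b) = 1"
proof (rule absv_eq_1)
  assume a: "absv a = 1" and b: "absv b \<le> r"
  show "absv (a + b) \<le> 1" using a order_trans[OF b r_le_1] by (intro absv_add_le) auto
  show "\<not> absv (a + b) \<le> r"
  proof
    assume "absv (a + b) \<le> r"
    then have "absv ((a + b) - b) \<le> r" using b by (rule absv_diff_le)
    then show False using a absv_pi_less_1 by simp
  qed
qed

text \<open>Moving a later variable past the first one creates terms taken from slices with a
  strictly larger first exponent. These are divisible by \<open>\<pi>\<close>, as the leading
  exponent is the largest, so modulo \<open>\<pi>\<close> the variable acts as if all variables
  commuted.\<close>

lemma lead_act: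
  assumes "adapted ps h" "f \<in> Mset (length ps)" "length al = length ps" "lead f al" "j < length ps"
  shows "lead (act ps (fst (ps ! j)) f) (al[j := Suc (al ! j)])"
  using assms
proof (induction ps arbitrary: h f al j)
  case (Cons q ps)
  obtain x y where q: "q = (x, y)" by (cases q)
  obtain i be where al: "al = i # be" "length be = length ps" using Cons.prems(3) by (cases al) auto
  have adp: "adapted ((x, y) # ps) h" using Cons.prems q by simp
  have adc: "adapted ps (lam_cent y h)" using adp by simp
  have f1: "bdd 1 f" and fal: "absv (f al) = 1" and fbe: "\<And>be. (al, be) \<in> lex less_than \<Longrightarrow> absv (f be) \<le> r"
    using Cons.prems(4) by (auto simp: lead_def)
  have M: "f \<in> Mset (Suc (length ps))" using Cons.prems(2) by simp
  have small: "absv (f (k # ga)) \<le> r" if "i < k" for k ga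
  proof (cases "length ga = length ps")
    case True
    then show ?thesis using fbe[of "k # ga"] that al by simp
  next
    case False
    then have "f (k # ga) = 0" using MsetD(1)[OF M, of "k # ga"] by auto
    then show ?thesis by simp
  qed
  show ?case
  proof (cases j)
    case 0
    have b: "bdd 1 (act ((x, y) # ps) x f)" using act_bdd[OF adp x_in[OF adp] f1] .
    have "absv (act ((x, y) # ps) x f be') \<le> r" if lx: "(Suc i # be, be') \<in> lex less_than" for be'
    proof -
      obtain k ga where be': "be' = k # ga" using lx by (cases be') auto
      have "k \<noteq> 0" "((i # be), (k - 1) # ga) \<in> lex less_than" using lx be' by auto
      then show ?thesis unfolding be' act_x[OF adp] using fbe al by simp
    qed
    then show ?thesis using b fal act_x[OF adp, of f "Suc i" be] unfolding q al lead_def 0 by (simp del: act.simps(3))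
  next
    case (Suc j')
    let ?w = "fst (ps ! j')"
    have "?w \<in> fst ` set ps" using Suc Cons.prems(5) by simp
    then have w: "?w \<in> lam_cent y h" "?w \<in> L" using gens_in[OF adc] by blast+
    have adL: "ad x m ?w \<in> L" for m by (induction m) (use w(2) L_bracket x_in(2)[OF adp] in auto)
    let ?t = "\<lambda>k m ga. (-1) ^ m * of_nat ((k + m) choose m) * act ps (ad x m ?w) (\<lambda>be. f ((k + m) # be)) ga"
    have exp: "act ((x, y) # ps) ?w f (k # ga) = (\<Sum>m\<le>N. ?t k m ga)" for k ga
      by (rule act_lam_cent[OF adp w(1) order_refl])
    \<comment> \<open>In the slice \<open>k = i\<close> this concerns all terms but
      \<open>m = 0\<close>; for \<open>k > i\<close> it concerns all terms.\<close>
    have tr: "absv (?t k m ga) \<le> r" if "i < k + m" for k m ga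
    proof -
      have "bdd r (\<lambda>be. f ((k + m) # be))" using small[OF that] by (simp add: bdd_def)
      from bddD[OF act_bdd[OF adc ad_in_lam_cent[OF adp w(1)] adL this]]
      have a: "absv (act ps (ad x m ?w) (\<lambda>be. f ((k + m) # be)) ga) \<le> r" .
      have b: "absv ((-1) ^ m * of_nat ((k + m) choose m)) \<le> 1"
        by (rule absv_mult_le1) (simp_all add: absv_of_nat_le)
      show ?thesis by (rule absv_mult_le1[OF b a])
    qed
    have r0: "0 \<le> r" by simp
    have split: "(\<Sum>m\<le>N. ?t i m ga) = act ps ?w (\<lambda>be. f (i # be)) ga + (\<Sum>m\<in>{..N} - {0}. ?t i m ga)" for ga
      by (subst sum.remove[of _ 0]) auto
    have rest: "absv (\<Sum>m\<in>{..N} - {0}. ?t i m ga) \<le> r" for ga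
      by (rule absv_sum_le[OF r0 tr]) auto
    have lf: "lead (\<lambda>be. f (i # be)) be"
      unfolding lead_def using f1 fal fbe al by (auto simp: bdd_def)
    have IH: "lead (act ps ?w (\<lambda>be. f (i # be))) (be[j' := Suc (be ! j')])"
      using Cons.IH[OF adc slice_Mset[OF M] al(2) lf] Suc Cons.prems(5) by simp
    let ?be = "be[j' := Suc (be ! j')]"
    have "absv (act ((x, y) # ps) ?w f (i # ?be)) = 1"
      unfolding exp split using IH rest by (intro absv_add_eq_1) (auto simp: lead_def)
    moreover have "absv (act ((x, y) # ps) ?w f be') \<le> r" if lx: "(i # ?be, be') \<in> lex less_than" for be'
    proof -
      obtain k ga where be': "be' = k # ga" using lx by (cases be') auto
      show ?thesis
      proof (cases "i < k")
        case True
        then show ?thesis unfolding be' exp by (intro absv_sum_le r0 tr) auto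
      next
        case False
        then have "k = i" "(?be, ga) \<in> lex less_than" using lx be' by auto
        then show ?thesis unfolding be' exp \<open>k = i\<close> split
          using IH rest by (intro absv_add_le) (auto simp: lead_def)
      qed
    qed
    moreover have "bdd 1 (act ((x, y) # ps) ?w f)" by (rule act_bdd[OF adp lam_cent_sub_h[OF adp w(1)] w(2) f1])
    ultimately show ?thesis unfolding q al Suc lead_def by simp
  qed
qed simp

text \<open>The series 1 does not involve the first variable, so \<open>act_emb\<close> passes to
  the shorter chain until the chain is empty and only \<open>lam b\<close> is left.\<close>

lemma act_base:
  "adapted ps h \<Longrightarrow> b \<in> base ps h \<Longrightarrow>
    act ps b (unit (replicate (length ps) 0)) = (\<lambda>al. lam b * unit (replicate (length ps) 0) al)"
proof (induction ps arbitrary: h)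
  case (Cons q ps)
  obtain x y where q: "q = (x, y)" by (cases q)
  have adp: "adapted ((x, y) # ps) h" using Cons.prems q by simp
  have adc: "adapted ps (lam_cent y h)" using adp by simp
  have b: "b \<in> base ps (lam_cent y h)" using Cons.prems q by simp
  then have bc: "b \<in> lam_cent y h" using base_subset by blast
  show ?case
    unfolding q length_Cons replicate_Suc emb_unit[symmetric] act_emb[OF adp bc] Cons.IH[OF adc b]
    by (auto simp: emb_def fun_eq_iff split: list.split)
qed auto

end

section \<open>Submodules of the module of convergent series\<close>

locale main_setup = rep_setup absv \<pi> scale bracket L lam N L UNIV ps
  for absv :: "'k::field \<Rightarrow> real" and \<pi> :: 'k
    and scale :: "'k \<Rightarrow> 'g::ab_group_add \<Rightarrow> 'g" and bracket :: "'g \<Rightarrow> 'g \<Rightarrow> 'g"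
    and L lam N ps
begin

text \<open>Exponents are raised one unit at a time with \<open>lead_act\<close>. Thus the set of
  leading exponents of a submodule is closed upwards, which makes Dickson's lemma
  applicable.\<close>

lemma lead_grow:
  "g \<in> M \<Longrightarrow> length be = d \<Longrightarrow> lead g be \<Longrightarrow> list_all2 (\<le>) be al \<Longrightarrow> \<exists>q\<in>E.fa. lead (rho q g) al"
proof (induction "sum_list al - sum_list be" arbitrary: g be)
  case 0
  have "al = be"
  proof -
    have len: "length be = length al" using 0(5) by (rule list_all2_lengthD)
    then show ?thesis using 0(1,5)
    proof (induction be al rule: list_induct2)
      case (Cons x xs y ys)
      have "sum_list xs \<le> sum_list ys" if "list_all2 (\<le>) xs ys" for xs ys :: "nat list"
        using that by (induction rule: list_all2_induct) auto
      then show ?case using Cons by auto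
    qed simp
  qed
  then show ?case using 0 by (intro bexI[of _ 1]) (simp_all add: rho_1)
next
  case (Suc n)
  have len: "length be = length al" using Suc.prems(4) by (rule list_all2_lengthD)
  have le: "be ! j \<le> al ! j" if "j < d" for j using Suc.prems(2,4) that by (simp add: list_all2_conv_all_nth)
  have "al \<noteq> be" using Suc.hyps(2) by auto
  then obtain j where j: "j < d" "be ! j \<noteq> al ! j" using len Suc.prems(2) by (metis nth_equalityI)
  let ?be = "be[j := Suc (be ! j)]"
  let ?x = "fst (ps ! j)"
  have xL: "?x \<in> L" using gens_in[OF adp, of ?x] j(1) by simp
  have fa: "free_gen ?x \<in> E.fa" using E.fa_gen[OF xL] .
  have "sum_list ?be = Suc (sum_list be)"
    using j(1) Suc.prems(2) elem_le_sum_list[of j be] by (simp add: sum_list_update)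
  then have n: "n = sum_list al - sum_list ?be" using Suc.hyps(2) by simp
  have la: "list_all2 (\<le>) ?be al"
    unfolding list_all2_conv_all_nth using len Suc.prems(2) le j by (auto simp: nth_list_update le_neq_implies_less Suc_leI)
  have ld: "lead (rho (free_gen ?x) g) ?be"
    unfolding rho_gen by (rule lead_act[OF adp Suc.prems(1,2,3) j(1)])
  have "length ?be = d" using Suc.prems(2) by simp
  from Suc.hyps(1)[OF n rho_M[OF fa Suc.prems(1)] this ld la]
  obtain q where "q \<in> E.fa" "lead (rho q (rho (free_gen ?x) g)) al" by blast
  then show ?case using E.fa_mult[OF _ fa] by (intro bexI[of _ "q * free_gen ?x"]) (simp_all add: rho_mult)
qed

definition stable :: "(nat list \<Rightarrow> 'k) set \<Rightarrow> bool" where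
  "stable S \<longleftrightarrow> S \<subseteq> M \<and> (\<lambda>al. 0) \<in> S \<and> (\<forall>f\<in>S. \<forall>g\<in>S. (\<lambda>al. f al + g al) \<in> S) \<and>
     (\<forall>V\<in>carrier E.R. \<forall>f\<in>S. sig V f \<in> S)"

context
  fixes S :: "(nat list \<Rightarrow> 'k) set"
  assumes S: "stable S"
begin

lemma S_M: "f \<in> S \<Longrightarrow> f \<in> M" and S_0: "(\<lambda>al. 0) \<in> S"
  and S_add: "f \<in> S \<Longrightarrow> g \<in> S \<Longrightarrow> (\<lambda>al. f al + g al) \<in> S"
  and S_sig: "V \<in> carrier E.R \<Longrightarrow> f \<in> S \<Longrightarrow> sig V f \<in> S"
  using S by (auto simp: stable_def)

lemma S_scale: "f \<in> S \<Longrightarrow> (\<lambda>al. c * f al) \<in> S"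
proof -
  assume f: "f \<in> S"
  interpret H: ring E.H by (rule E.ring_H)
  have "E.el \<one>\<^bsub>E.H\<^esub> c \<in> carrier E.R" by (rule E.el_closed) simp
  from S_sig[OF this f] show ?thesis by (simp add: sig_el S_M[OF f] hat_one)
qed

lemma S_diff: "f \<in> S \<Longrightarrow> g \<in> S \<Longrightarrow> (\<lambda>al. f al - g al) \<in> S"
  using S_add[of f "\<lambda>al. (-1) * g al"] S_scale[of g "-1"] by simp

lemma S_sum: "(\<And>i. i \<in> A \<Longrightarrow> f i \<in> S) \<Longrightarrow> (\<lambda>al. \<Sum>i\<in>A. f i al) \<in> S"
  by (induction A rule: infinite_finite_induct) (simp_all add: S_0 S_add)

lemma S_hat: "u \<in> carrier E.H \<Longrightarrow> f \<in> S \<Longrightarrow> hat u f \<in> S"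
  using S_sig[OF E.el_closed[of u 1], of f] by (simp add: sig_el S_M)

lemma S_rho: "q \<in> E.fa \<Longrightarrow> f \<in> S \<Longrightarrow> rho q f \<in> S"
  using S_hat[OF E.hat_class_closed, of q f] hat_class[OF E.rep_class E.hat_class_closed, of q f] S_M by simp

definition closure_S :: "(nat list \<Rightarrow> 'k) set" where
  "closure_S = {f \<in> M. \<forall>n. \<exists>g\<in>S. bdd (r ^ n) (\<lambda>al. f al - g al)}"

lemma closure_S_diff_S: "f \<in> closure_S \<Longrightarrow> g \<in> S \<Longrightarrow> (\<lambda>al. f al - g al) \<in> closure_S"
proof -
  assume f: "f \<in> closure_S" and g: "g \<in> S"
  have "\<exists>g'\<in>S. bdd (r ^ n) (\<lambda>al. f al - g al - g' al)" for n
  proof -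
    obtain g' where "g' \<in> S" "bdd (r ^ n) (\<lambda>al. f al - g' al)" using f by (auto simp: closure_S_def)
    then show ?thesis using S_diff[OF _ g, of g'] by (intro bexI[of _ "\<lambda>al. g' al - g al"]) simp_all
  qed
  then show ?thesis using f Mset_diff[OF _ S_M[OF g]] by (simp add: closure_S_def)
qed

lemma closure_S_scale: "f \<in> closure_S \<Longrightarrow> (\<lambda>al. c * f al) \<in> closure_S"
proof -
  assume f: "f \<in> closure_S"
  obtain m where m: "absv c \<le> inverse r ^ m" using absv_le_inverse_power by blast
  have "\<exists>g\<in>S. bdd (r ^ n) (\<lambda>al. c * f al - g al)" for n
  proof -
    obtain g where g: "g \<in> S" "bdd (r ^ (n + m)) (\<lambda>al. f al - g al)" using f by (auto simp: closure_S_def)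
    have "inverse r ^ m * r ^ (n + m) = r ^ n" by (simp add: power_add mult.left_commute flip: power_mult_distrib)
    then show ?thesis using bdd_scale[OF g(2) m] S_scale[OF g(1), of c]
      by (intro bexI[of _ "\<lambda>al. c * g al"]) (simp_all add: right_diff_distrib)
  qed
  then show ?thesis using f Mset_scale by (simp add: closure_S_def)
qed

text \<open>An approximation with error at most \<open>r\<close> has the same reduction modulo
  \<open>\<pi>\<close>, hence the same leading exponent.\<close>

lemma lead_of_closure_S:
  assumes f: "f \<in> closure_S" "lead f al" shows "\<exists>g\<in>S. lead g al"
proof -
  obtain g where g: "g \<in> S" "bdd (r ^ 1) (\<lambda>al. f al - g al)" using f unfolding closure_S_def by blast
  have fg: "absv (f be - g be) \<le> r" for be using bddD[OF g(2)] by simp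
  have gf: "g be = f be + (- (f be - g be))" for be by simp
  have "absv (g al) = 1"
    by (subst gf) (rule absv_add_eq_1, use f(2) fg in \<open>simp_all only: lead_def absv_minus\<close>)
  moreover have "absv (g be) \<le> r" if "absv (f be) \<le> r" for be
    by (subst gf) (rule absv_add_le, use fg that in \<open>simp_all only: absv_minus\<close>)
  moreover have "absv (g be) \<le> 1" for be
    by (subst gf) (rule absv_add_le, use f(2) order_trans[OF fg r_le_1] in \<open>simp_all only: lead_def bdd_def absv_minus\<close>)
  ultimately have "lead g al" using f(2) unfolding lead_def bdd_def by blast
  then show ?thesis using g(1) by blast
qed

text \<open>
  Subtracting a multiple of a divisor cancels the leading term and lowers the leading exponent, which
  can only happen finitely often since the lexicographic order on exponents is wellfounded.
\<close>

lemma division: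
  assumes G: "\<And>be. be \<in> F \<Longrightarrow> G be \<in> S \<and> length be = d \<and> lead (G be) be" and fin: "finite F"
    and F: "\<And>al g. length al = d \<Longrightarrow> g \<in> S \<Longrightarrow> lead g al \<Longrightarrow> \<exists>be\<in>F. list_all2 (\<le>) be al"
    and f: "f \<in> closure_S" "bdd 1 f"
  shows "\<exists>q. (\<forall>be. q be \<in> E.fa) \<and> bdd r (\<lambda>al. f al - (\<Sum>be\<in>F. rho (q be) (G be) al))"
proof (cases "bdd r f")
  case True
  then show ?thesis by (intro exI[of _ "\<lambda>_. 0"]) simp
next
  case False
  have fM: "f \<in> M" using f by (simp add: closure_S_def)
  obtain al where "length al = d" "lead f al" using lead_exists[OF fM f(2) False] by blast
  then show ?thesis using f
  proof (induction al arbitrary: f rule: wf_induct_rule[OF wf_lex[OF wf_less_than]])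
    case (1 al)
    obtain g where "g \<in> S" "lead g al" using lead_of_closure_S 1(3,4) by blast
    then obtain be where be: "be \<in> F" "list_all2 (\<le>) be al" using F 1(2) by blast
    then obtain q0 where q0: "q0 \<in> E.fa" "lead (rho q0 (G be)) al"
      using lead_grow[of "G be" be al] G[OF be(1)] S_M by blast
    \<comment> \<open>A quotient of two units, chosen so that the coefficients at \<open>al\<close>
      cancel.\<close>
    define c where "c = f al / rho q0 (G be) al"
    have fal: "absv (f al) = 1" and gal: "absv (rho q0 (G be) al) = 1" using 1(3) q0(2) by (auto simp: lead_def)
    have c: "absv c \<le> 1" "c * rho q0 (G be) al = f al"
      using fal gal by (auto simp: c_def absv_divide)
    define q1 where "q1 = free_scalar c * q0"
    have q1: "q1 \<in> E.fa" unfolding q1_def using E.fa_mult E.fa_scalar c(1) q0(1) by blast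
    have rq1: "rho q1 (G be) ga = c * rho q0 (G be) ga" for ga by (simp add: q1_def rho_mult rho_scalar)
    define f' where "f' = (\<lambda>ga. f ga - rho q1 (G be) ga)"
    have f'cl: "f' \<in> closure_S" unfolding f'_def using closure_S_diff_S[OF 1(4) S_rho[OF q1]] G[OF be(1)] by blast
    have f'b: "bdd 1 f'" unfolding f'_def
      using bdd_diff[OF 1(5) rho_bdd[OF q1]] G[OF be(1)] by (auto simp: lead_def)
    have f'M: "f' \<in> M" using f'cl by (simp add: closure_S_def)
    show ?case
    proof (cases "bdd r f'")
      case True
      have "(\<Sum>be'\<in>F. rho (if be' = be then q1 else 0) (G be') ga) = rho q1 (G be) ga" for ga
      proof -
        have "(\<Sum>be'\<in>F. rho (if be' = be then q1 else 0) (G be') ga) = (\<Sum>be'\<in>F. if be' = be then rho q1 (G be) ga else 0)"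
          by (intro sum.cong) auto
        then show ?thesis using fin be(1) by simp
      qed
      then show ?thesis using True q1 unfolding f'_def
        by (intro exI[of _ "\<lambda>be'. if be' = be then q1 else 0"]) auto
    next
      case False
      obtain al' where al': "length al' = d" "lead f' al'" using lead_exists[OF f'M f'b False] by blast
      have "f' al = 0" unfolding f'_def rq1 c(2) by simp
      then have "al' \<noteq> al" using al'(2) by (auto simp: lead_def)
      \<comment> \<open>Beyond \<open>al\<close> both \<open>f\<close> and the subtracted multiple
        are divisible by \<open>\<pi>\<close>.\<close>
      moreover have "(al, al') \<notin> lex less_than"
      proof
        assume lx: "(al, al') \<in> lex less_than"
        have "absv (f' al') \<le> r" unfolding f'_def rq1
          using 1(3) q0(2) lx c(1) by (intro absv_diff_le absv_mult_le1) (auto simp: lead_def)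
        then show False using al'(2) absv_pi_less_1 by (simp add: lead_def)
      qed
      ultimately have "(al', al) \<in> lex less_than" using lex_total[of al' al] al'(1) 1(2) by auto
      from 1(1)[OF this al' f'cl f'b] obtain q where q: "\<And>be. q be \<in> E.fa"
        "bdd r (\<lambda>al. f' al - (\<Sum>be\<in>F. rho (q be) (G be) al))" by blast
      have "(\<Sum>be'\<in>F. rho (if be' = be then q be + q1 else q be') (G be') ga)
        = rho q1 (G be) ga + (\<Sum>be\<in>F. rho (q be) (G be) ga)" for ga
      proof -
        have "(\<Sum>be'\<in>F. rho (if be' = be then q be + q1 else q be') (G be') ga)
          = (\<Sum>be'\<in>F. (if be' = be then rho q1 (G be) ga else 0) + rho (q be') (G be') ga)"
          by (intro sum.cong) (auto simp: rho_add)
        then show ?thesis using fin be(1) by (simp add: sum.distrib)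
      qed
      then show ?thesis using q q1 E.fa_add unfolding f'_def
        by (intro exI[of _ "\<lambda>be'. if be' = be then q be + q1 else q be'"]) (simp add: diff_diff_eq)
    qed
  qed
qed

text \<open>Division leaves a remainder divisible by \<open>\<pi>\<close>. Divided by
  \<open>\<pi>\<close> it lies again in the closure with norm at most 1, so the process repeats with
  the same finitely many divisors.\<close>

lemma closure_S_subset_bdd:
  assumes f: "f \<in> closure_S" "bdd 1 f" shows "f \<in> S"
proof -
  define EE where "EE = {al. length al = d \<and> (\<exists>g\<in>S. lead g al)}"
  have "EE \<subseteq> {al. length al = d}" by (auto simp: EE_def)
  from Dickson[OF this] obtain F where F: "finite F" "F \<subseteq> EE" "\<forall>al\<in>EE. \<exists>be\<in>F. list_all2 (\<le>) be al" by (elim exE conjE)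
  have "\<forall>be. \<exists>g. be \<in> F \<longrightarrow> g \<in> S \<and> lead g be" using F(2) by (auto simp: EE_def)
  then obtain G where G0: "\<And>be. be \<in> F \<Longrightarrow> G be \<in> S \<and> lead (G be) be" by metis
  have G: "G be \<in> S \<and> length be = d \<and> lead (G be) be" if "be \<in> F" for be
    using G0[OF that] F(2) that by (auto simp: EE_def)
  have Fle: "\<exists>be\<in>F. list_all2 (\<le>) be al" if "length al = d" "g \<in> S" "lead g al" for al g
  proof -
    have "al \<in> EE" unfolding EE_def using that by blast
    with F(3) show ?thesis by (rule bspec)
  qed
  define P where "P f q \<longleftrightarrow> (\<forall>be. q be \<in> E.fa) \<and> bdd r (\<lambda>al. f al - (\<Sum>be\<in>F. rho (q be) (G be) al))" for f q
  define Q where "Q f = (SOME q. P f q)" for f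
  have Q: "P f (Q f)" if "f \<in> closure_S" "bdd 1 f" for f
  proof -
    have "\<exists>q. P f q" unfolding P_def by (rule division[OF G F(1) _ that]) (use Fle in blast)+
    then show ?thesis unfolding Q_def by (rule someI_ex)
  qed
  define nx where "nx f = (\<lambda>al. inverse \<pi> * (f al - (\<Sum>be\<in>F. rho (Q f be) (G be) al)))" for f
  define ff where "ff n = (nx ^^ n) f" for n
  have nx: "nx f \<in> closure_S \<and> bdd 1 (nx f)" if "f \<in> closure_S" "bdd 1 f" for f
  proof
    have P: "\<And>be. Q f be \<in> E.fa" "bdd r (\<lambda>al. f al - (\<Sum>be\<in>F. rho (Q f be) (G be) al))" using Q[OF that] by (auto simp: P_def)
    show "nx f \<in> closure_S" unfolding nx_def
      by (intro closure_S_scale closure_S_diff_S that S_sum S_rho P) (use G in blast)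
    show "bdd 1 (nx f)" unfolding nx_def using bdd_scale[OF P(2), of "inverse \<pi>" "inverse r"] by (simp add: absv_inverse)
  qed
  have ff: "ff n \<in> closure_S \<and> bdd 1 (ff n)" for n by (induction n) (use f nx in \<open>auto simp: ff_def\<close>)
  have Qfa: "Q (ff n) be \<in> E.fa" for n be using Q ff unfolding P_def by blast
  have step: "ff n al = (\<Sum>be\<in>F. rho (Q (ff n) be) (G be) al) + \<pi> * ff (Suc n) al" for n al
    by (simp add: ff_def nx_def mult.assoc[symmetric] pi_nonzero)
  \<comment> \<open>For each divisor the successive quotients, weighted by powers of
    \<open>\<pi>\<close>, sum to an element of the completed algebra. This makes the limit a finite
    combination of elements of \<open>S\<close>.\<close>
  have "\<forall>be. \<exists>u. u \<in> carrier E.H \<and> (\<forall>n. E.rep u n (\<Sum>k<n. free_scalar (\<pi> ^ k) * Q (ff k) be))"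
    unfolding Bex_def[symmetric] by (rule allI) (rule E.rep_series_construct[OF Qfa])
  from choice[OF this] obtain u where "\<forall>be. u be \<in> carrier E.H \<and> (\<forall>n. E.rep (u be) n (\<Sum>k<n. free_scalar (\<pi> ^ k) * Q (ff k) be))"
    by (elim exE)
  then have u: "\<And>be. u be \<in> carrier E.H" "\<And>be n. E.rep (u be) n (\<Sum>k<n. free_scalar (\<pi> ^ k) * Q (ff k) be)"
    by simp_all
  have part: "f al = (\<Sum>be\<in>F. rho (\<Sum>k<n. free_scalar (\<pi> ^ k) * Q (ff k) be) (G be) al) + \<pi> ^ n * ff n al" for n al
  proof (induction n)
    case (Suc n)
    have "\<pi> ^ n * ff n al = (\<Sum>be\<in>F. rho (free_scalar (\<pi> ^ n) * Q (ff n) be) (G be) al) + \<pi> ^ Suc n * ff (Suc n) al"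
      by (subst step) (simp add: distrib_left sum_distrib_left rho_mult rho_scalar mult_ac)
    then show ?case using Suc by (simp add: rho_add sum.distrib)
  qed (simp add: ff_def)
  have "f = (\<lambda>al. \<Sum>be\<in>F. hat (u be) (G be) al)"
  proof
    fix al
    have "absv (f al - (\<Sum>be\<in>F. hat (u be) (G be) al)) \<le> r ^ n * 1" for n
    proof -
      let ?q = "\<lambda>be. \<Sum>k<n. free_scalar (\<pi> ^ k) * Q (ff k) be"
      have "absv (\<pi> ^ n * ff n al) \<le> r ^ n * 1" using ff bddD by (intro absv_mult_le) auto
      moreover have "absv (\<Sum>be\<in>F. hat (u be) (G be) al - rho (?q be) (G be) al) \<le> r ^ n * 1"
      proof (rule absv_sum_le)
        fix be assume "be \<in> F"
        then have "G be \<in> M" "bdd 1 (G be)" using G S_M by (auto simp: lead_def)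
        from bddD[OF hat_approx[OF u(1) this u(2)]]
        show "absv (hat (u be) (G be) al - rho (?q be) (G be) al) \<le> r ^ n * 1" .
      qed simp
      ultimately have "absv (\<pi> ^ n * ff n al - (\<Sum>be\<in>F. hat (u be) (G be) al - rho (?q be) (G be) al)) \<le> r ^ n * 1"
        by (rule absv_diff_le)
      then show ?thesis by (subst part[of al n]) (simp add: sum_subtractf algebra_simps)
    qed
    then have "f al - (\<Sum>be\<in>F. hat (u be) (G be) al) = 0" by (rule eq_0_if_absv_le_power)
    then show "f al = (\<Sum>be\<in>F. hat (u be) (G be) al)" by simp
  qed
  also have "\<dots> \<in> S" by (intro S_sum S_hat u) (use G in blast)
  finally show ?thesis .
qed

lemma closure_S_subset: "f \<in> closure_S \<Longrightarrow> f \<in> S"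
proof -
  assume f: "f \<in> closure_S"
  then have "f \<in> M" by (simp add: closure_S_def)
  then obtain m where m: "bdd (inverse r ^ m) f" using Mset_bdd by blast
  have "bdd 1 (\<lambda>al. \<pi> ^ m * f al)"
    using bdd_scale[OF m, of "\<pi> ^ m" "r ^ m"] by (simp flip: power_mult_distrib)
  then have "(\<lambda>al. \<pi> ^ m * f al) \<in> S" using closure_S_subset_bdd closure_S_scale[OF f] by blast
  from S_scale[OF this, of "inverse (\<pi> ^ m)"] show ?thesis by (simp add: mult.assoc[symmetric])
qed

lemma S_closed: "closed_sub d S"
  unfolding closed_sub_def
proof (intro conjI subsetI ballI allI impI)
  fix f assume "f \<in> Mset d" "\<forall>n. \<exists>g\<in>S. bdd (r ^ n) (\<lambda>al. f al - g al)"
  then have "f \<in> closure_S" unfolding closure_S_def by (intro CollectI conjI)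
  then show "f \<in> S" by (rule closure_S_subset)
qed (rule S_M S_add S_scale; assumption)+

lemma S_act: "f \<in> S \<Longrightarrow> act ps x f \<in> S"
proof -
  assume f: "f \<in> S"
  obtain n where n: "scale (\<pi> ^ n) x \<in> L" using L_span by blast
  have "rho (free_gen (scale (\<pi> ^ n) x)) f \<in> S" using S_rho[OF E.fa_gen[OF n] f] .
  from S_scale[OF this, of "inverse (\<pi> ^ n)"]
  show ?thesis by (simp add: rho_gen act_scale_left mult.assoc[symmetric])
qed

lemma stable_cases: "S = {\<lambda>al. 0} \<or> S = M"
proof (cases "\<exists>f\<in>S. f \<noteq> (\<lambda>al. 0)")
  case True
  then obtain f al where f: "f \<in> S" "f al \<noteq> 0" by (auto simp: fun_eq_iff)
  have e0: "e0 \<in> S" by (rule closed_stable[OF adp S_closed S_act f])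
  \<comment> \<open>Every monomial arises from 1 by its own word in the \<open>x\<^sub>i\<close>,
    and polynomials are dense.\<close>
  have un: "unit al \<in> S" if "length al = d" for al
  proof -
    have "actw ps ws e0 \<in> S" for ws by (induction ws) (simp_all add: e0 S_act)
    from this[of "mon ps al"] show ?thesis by (simp only: actw_mon[OF adp that])
  qed
  have "g \<in> S" if g: "g \<in> M" for g
  proof (rule closed_subD(5)[OF S_closed g])
    fix n
    have "trunc n g = (\<lambda>be. \<Sum>al | trunc n g al \<noteq> 0. trunc n g al * unit al be)"
    proof
      fix be
      have "(\<Sum>al | trunc n g al \<noteq> 0. trunc n g al * unit al be) = (\<Sum>al | trunc n g al \<noteq> 0. if al = be then trunc n g al else 0)"
        by (intro sum.cong) (auto simp: unit_def)
      then show "trunc n g be = (\<Sum>al | trunc n g al \<noteq> 0. trunc n g al * unit al be)"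
        using trunc_finite[OF g, of n] by simp
    qed
    also have "\<dots> \<in> S" by (intro S_sum S_scale un) (use trunc_support[OF g] in auto)
    finally show "\<exists>g'\<in>S. bdd (r ^ n) (\<lambda>al. g al - g' al)" using trunc_bdd by blast
  qed
  then show ?thesis using S_M by blast
next
  case False
  then show ?thesis using S_0 by blast
qed

end

section \<open>Spanning by ordered monomials\<close>

abbreviation "bb \<equiv> base ps UNIV"
abbreviation "BL \<equiv> bb \<inter> L"

definition base_gens :: "'g set" where
  "base_gens = (SOME F. finite F \<and> F \<subseteq> BL \<and> (\<forall>b\<in>BL. \<exists>c. (\<forall>f\<in>F. absv (c f) \<le> 1) \<and> b = (\<Sum>f\<in>F. scale (c f) f)))"

lemma base_gens: "finite base_gens" "base_gens \<subseteq> BL"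
  "b \<in> BL \<Longrightarrow> \<exists>c. (\<forall>f\<in>base_gens. absv (c f) \<le> 1) \<and> b = (\<Sum>f\<in>base_gens. scale (c f) f)"
proof -
  have "finite base_gens \<and> base_gens \<subseteq> BL \<and> (\<forall>b\<in>BL. \<exists>c. (\<forall>f\<in>base_gens. absv (c f) \<le> 1) \<and> b = (\<Sum>f\<in>base_gens. scale (c f) f))"
    unfolding base_gens_def by (rule someI_ex[OF submod_fg[OF submod_Int]]) (use base_subalgebra[OF adp] in \<open>simp add: subalgebra_def\<close>)
  then show "finite base_gens" "base_gens \<subseteq> BL"
    "b \<in> BL \<Longrightarrow> \<exists>c. (\<forall>f\<in>base_gens. absv (c f) \<le> 1) \<and> b = (\<Sum>f\<in>base_gens. scale (c f) f)" by blast+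
qed

definition annih_gen :: "'g \<Rightarrow> ('g word \<Rightarrow>\<^sub>0 'k)" where
  "annih_gen b = free_gen b - free_scalar (lam b)"

lemma annih_gen_fa: "b \<in> L \<Longrightarrow> annih_gen b \<in> E.fa"
  unfolding annih_gen_def by (intro E.fa_diff E.fa_gen E.fa_scalar lam_L)

text \<open>The preimage in the free algebra of the left ideal of the enveloping algebra generated
  by the \<open>annih_gen b\<close>. Coefficients are indexed by the fixed finite set
  \<open>base_gens\<close>, so that series of such elements can be summed generator by
  generator.\<close>

definition annih_ideal :: "('g word \<Rightarrow>\<^sub>0 'k) set" where
  "annih_ideal = {(\<Sum>b\<in>base_gens. t b * annih_gen b) + i | t i. (\<forall>b. t b \<in> E.fa) \<and> i \<in> E.I}"

lemma annih_ideal_I: "i \<in> E.I \<Longrightarrow> i \<in> annih_ideal"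
  unfolding annih_ideal_def by (intro CollectI exI[of _ "\<lambda>_. 0"] exI[of _ i]) simp

lemma annih_ideal_add: "x \<in> annih_ideal \<Longrightarrow> y \<in> annih_ideal \<Longrightarrow> x + y \<in> annih_ideal"
proof -
  assume "x \<in> annih_ideal" "y \<in> annih_ideal"
  then obtain t i t' i' where "\<forall>b. t b \<in> E.fa" "i \<in> E.I" "x = (\<Sum>b\<in>base_gens. t b * annih_gen b) + i"
    "\<forall>b. t' b \<in> E.fa" "i' \<in> E.I" "y = (\<Sum>b\<in>base_gens. t' b * annih_gen b) + i'" by (auto simp: annih_ideal_def)
  then show ?thesis unfolding annih_ideal_def
    by (intro CollectI exI[of _ "\<lambda>b. t b + t' b"] exI[of _ "i + i'"])
      (simp add: distrib_right sum.distrib add_ac E.fa_add E.I_add)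
qed

lemma annih_ideal_left: "x \<in> annih_ideal \<Longrightarrow> q \<in> E.fa \<Longrightarrow> q * x \<in> annih_ideal"
proof -
  assume "x \<in> annih_ideal" and q: "q \<in> E.fa"
  then obtain t i where "\<forall>b. t b \<in> E.fa" "i \<in> E.I" "x = (\<Sum>b\<in>base_gens. t b * annih_gen b) + i" by (auto simp: annih_ideal_def)
  then show ?thesis unfolding annih_ideal_def using q
    by (intro CollectI exI[of _ "\<lambda>b. q * t b"] exI[of _ "q * i"])
      (simp add: distrib_left sum_distrib_left mult.assoc E.fa_mult E.I_left)
qed

lemma annih_ideal_sum: "(\<And>i. i \<in> A \<Longrightarrow> f i \<in> annih_ideal) \<Longrightarrow> sum f A \<in> annih_ideal"
  by (induction A rule: infinite_finite_induct) (simp_all add: annih_ideal_add annih_ideal_I E.I_0)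

lemma annih_ideal_annih_gen_base_gens: "b \<in> base_gens \<Longrightarrow> annih_gen b \<in> annih_ideal"
proof -
  assume b: "b \<in> base_gens"
  have "(\<Sum>b'\<in>base_gens. (if b' = b then 1 else 0) * annih_gen b') = (\<Sum>b'\<in>base_gens. if b' = b then annih_gen b' else 0)"
    by (intro sum.cong) auto
  also have "\<dots> = annih_gen b" using base_gens(1) b by simp
  finally show ?thesis unfolding annih_ideal_def
    by (intro CollectI exI[of _ "\<lambda>b'. if b' = b then 1 else 0"] exI[of _ 0]) (simp add: E.I_0)
qed

lemma annih_gen_sum:
  assumes "finite F" "F \<subseteq> L" "\<And>f. f \<in> F \<Longrightarrow> absv (c f) \<le> 1"
  shows "(\<Sum>f\<in>F. scale (c f) f) \<in> L \<and> annih_gen (\<Sum>f\<in>F. scale (c f) f) - (\<Sum>f\<in>F. free_scalar (c f) * annih_gen f) \<in> E.I"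
  using assms
proof (induction F rule: finite_induct)
  case empty
  \<comment> \<open>The additivity relator for \<open>0 + 0\<close> is \<open>- free_gen 0\<close>,
    so the generator of the zero vector lies in the ideal.\<close>
  have "- (free_gen (0 + 0) - free_gen 0 - free_gen 0) \<in> E.I"
    by (intro E.I_minus E.I_rel_add L_0)
  then show ?case using L_0 by (simp add: annih_gen_def free_scalar_0)
next
  case (insert f F)
  let ?s = "\<Sum>f\<in>F. scale (c f) f"
  have IH: "?s \<in> L" "annih_gen ?s - (\<Sum>f\<in>F. free_scalar (c f) * annih_gen f) \<in> E.I" using insert by auto
  have f: "f \<in> L" "scale (c f) f \<in> L" "absv (c f) \<le> 1" using insert.prems L_scale by auto
  have mem: "(free_gen (scale (c f) f + ?s) - free_gen (scale (c f) f) - free_gen ?s)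
    + (free_gen (scale (c f) f) - free_scalar (c f) * free_gen f)
    + (annih_gen ?s - (\<Sum>f\<in>F. free_scalar (c f) * annih_gen f)) \<in> E.I"
    by (intro E.I_add IH E.I_rel_add E.I_rel_scale f)
  have eq: "annih_gen (scale (c f) f + ?s) = free_gen (scale (c f) f + ?s) - free_scalar (c f) * free_scalar (lam f) - free_scalar (lam ?s)"
    by (simp add: annih_gen_def lam_add lam_scale free_scalar_mult free_scalar_add[symmetric])
  have eq2: "annih_gen (scale (c f) f + ?s) - (free_scalar (c f) * annih_gen f + (\<Sum>f\<in>F. free_scalar (c f) * annih_gen f))
    = (free_gen (scale (c f) f + ?s) - free_gen (scale (c f) f) - free_gen ?s)
    + (free_gen (scale (c f) f) - free_scalar (c f) * free_gen f)
    + (annih_gen ?s - (\<Sum>f\<in>F. free_scalar (c f) * annih_gen f))"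
    unfolding eq annih_gen_def[of f] annih_gen_def[of ?s] by (simp add: algebra_simps)
  have "annih_gen (scale (c f) f + ?s) - (free_scalar (c f) * annih_gen f + (\<Sum>f\<in>F. free_scalar (c f) * annih_gen f)) \<in> E.I"
    unfolding eq2 by (rule mem)
  then show ?case using insert.hyps L_add[OF f(2) IH(1)] by simp
qed

lemma annih_ideal_annih_gen: "b \<in> BL \<Longrightarrow> annih_gen b \<in> annih_ideal"
proof -
  assume "b \<in> BL"
  then obtain c where c: "\<forall>f\<in>base_gens. absv (c f) \<le> 1" "b = (\<Sum>f\<in>base_gens. scale (c f) f)" using base_gens(3) by blast
  have "annih_gen b - (\<Sum>f\<in>base_gens. free_scalar (c f) * annih_gen f) \<in> E.I"
    unfolding c(2) using annih_gen_sum[OF base_gens(1), of c] c(1) base_gens(2) by blast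
  moreover have "(\<Sum>f\<in>base_gens. free_scalar (c f) * annih_gen f) \<in> annih_ideal"
    by (intro annih_ideal_sum annih_ideal_left annih_ideal_annih_gen_base_gens E.fa_scalar) (use c in auto)
  ultimately show ?thesis using annih_ideal_add[OF annih_ideal_I] by fastforce
qed

lemma rho_annih_ideal: "x \<in> annih_ideal \<Longrightarrow> rho x e0 = (\<lambda>al. 0)"
proof -
  assume "x \<in> annih_ideal"
  then obtain t i where t: "\<forall>b. t b \<in> E.fa" "i \<in> E.I" "x = (\<Sum>b\<in>base_gens. t b * annih_gen b) + i" by (auto simp: annih_ideal_def)
  have "rho (annih_gen b) e0 = (\<lambda>al. 0)" if "b \<in> base_gens" for b
    using act_base[OF adp, of b] that base_gens(2) by (intro ext) (auto simp: annih_gen_def rho_diff rho_gen rho_scalar)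
  moreover have "rho q (\<lambda>be. 0) al = 0" for q al using rho_scale_right[of q 0 "\<lambda>be. 0"] by simp
  ultimately show ?thesis using rho_I[OF t(2)] by (auto simp: t(3) rho_add rho_sum rho_mult)
qed

section \<open>Ordered monomials span modulo the left ideal\<close>

definition ord_mon :: "('g \<times> 'g) list \<Rightarrow> nat list \<Rightarrow> ('g word \<Rightarrow>\<^sub>0 'k)" where
  "ord_mon qs al = Poly_Mapping.single (Word (mon qs al)) 1"

inductive_set mon_span :: "('g \<times> 'g) list \<Rightarrow> ('g word \<Rightarrow>\<^sub>0 'k) set" for qs where
  mon: "absv c \<le> 1 \<Longrightarrow> length al = length qs \<Longrightarrow> free_scalar c * ord_mon qs al \<in> mon_span qs"
| annih_ideal: "x \<in> annih_ideal \<Longrightarrow> x \<in> mon_span qs"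
| add: "x \<in> mon_span qs \<Longrightarrow> y \<in> mon_span qs \<Longrightarrow> x + y \<in> mon_span qs"

lemma mon_span_scalar: "x \<in> mon_span qs \<Longrightarrow> absv c \<le> 1 \<Longrightarrow> free_scalar c * x \<in> mon_span qs"
proof (induction rule: mon_span.induct)
  case (mon e al)
  then show ?case using mon_span.mon[of "c * e" al qs] absv_mult_le1 by (simp add: mult.assoc[symmetric] free_scalar_mult)
next
  case (annih_ideal x)
  then show ?case using annih_ideal_left E.fa_scalar mon_span.annih_ideal by blast
qed (simp add: distrib_left mon_span.add)

lemma ord_mon_Suc: "ord_mon ((x, y) # qs) (Suc i # al) = free_gen x * ord_mon ((x, y) # qs) (i # al)"
  by (simp add: ord_mon_def free_gen_def mult_single plus_word_def)

lemma ord_mon_0: "ord_mon ((x, y) # qs) (0 # al) = ord_mon qs al"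
  by (simp add: ord_mon_def)

lemma mon_span_shift: "q \<in> mon_span ((x, y) # qs) \<Longrightarrow> x \<in> L \<Longrightarrow> free_gen x * q \<in> mon_span ((x, y) # qs)"
proof (induction rule: mon_span.induct)
  case (mon c al)
  obtain i be where al: "al = i # be" "length be = length qs" using mon by (cases al) auto
  have "free_gen x * (free_scalar c * ord_mon ((x, y) # qs) al) = free_scalar c * ord_mon ((x, y) # qs) (Suc i # be)"
    unfolding al ord_mon_Suc by (simp only: mult.assoc[symmetric] free_scalar_central[of c "free_gen x", symmetric])
  then show ?case using mon_span.mon[of c "Suc i # be" "(x, y) # qs"] mon al by simp
next
  case (annih_ideal z)
  then show ?case using annih_ideal_left E.fa_gen mon_span.annih_ideal by blast
qed (simp add: distrib_left mon_span.add)

lemma mon_span_embed: "q \<in> mon_span qs \<Longrightarrow> q \<in> mon_span ((x, y) # qs)"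
proof (induction rule: mon_span.induct)
  case (mon c al)
  then show ?case using mon_span.mon[of c "0 # al" "(x, y) # qs"] by (simp add: ord_mon_0)
qed (auto intro: mon_span.intros)

lemma ord_mon_fa: "adapted qs h \<Longrightarrow> ord_mon qs al \<in> E.fa"
  unfolding ord_mon_def using mon_subset[of qs h al] by (intro E.fa_single) auto

text \<open>The rewriting step. A vector in front of \<open>x\<close> is moved to the right by
  \<open>u x = x u + [u, x]\<close>; in front of the later variables it is split into its
  \<open>x\<close>-part and its projection to the next subalgebra. At the end of the chain it lies
  in the polarisation and is replaced by the scalar \<open>lam u\<close>.\<close>

lemma gen_ord_mon:
  "adapted qs h \<Longrightarrow> base qs h = bb \<Longrightarrow> u \<in> h \<Longrightarrow> u \<in> L \<Longrightarrow> length al = length qs \<Longrightarrow> free_gen u * ord_mon qs al \<in> mon_span qs"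
proof (induction qs arbitrary: h u al)
  case Nil
  have "ord_mon [] [] = 1" by (simp add: ord_mon_def zero_word_def[symmetric])
  then have "free_gen u * ord_mon [] [] = annih_gen u + free_scalar (lam u) * ord_mon [] []" by (simp add: annih_gen_def)
  moreover have "annih_gen u \<in> annih_ideal" using Nil annih_ideal_annih_gen[of u] by simp
  ultimately show ?case using Nil mon_span.mon[OF lam_L, of u "[]" "[]"] mon_span.add[OF mon_span.annih_ideal] by simp
next
  case (Cons q qs)
  obtain x y where q: "q = (x, y)" by (cases q)
  obtain i be where al: "al = i # be" "length be = length qs" using Cons.prems(5) by (cases al) auto
  have adq: "adapted ((x, y) # qs) h" using Cons.prems q by simp
  have adc: "adapted qs (lam_cent y h)" using adq by simp
  have bc: "base qs (lam_cent y h) = bb" using Cons.prems(2) q by simp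
  have xL: "x \<in> L" and xh: "x \<in> h" using x_in[OF adq] by auto
  have "free_gen u * ord_mon ((x, y) # qs) (i # be) \<in> mon_span ((x, y) # qs)" if "u \<in> h" "u \<in> L" for u
    using that
  proof (induction i arbitrary: u)
    case 0
    let ?c = "mu x y u" and ?u = "prj x y u"
    have c: "absv ?c \<le> 1" using mu_le_1[OF adq] 0 by simp
    have uL: "?u \<in> L" unfolding prj_def using L_diff L_scale[OF c xL] 0 by blast
    have uc: "?u \<in> lam_cent y h" using prj_in_lam_cent[OF adq 0(1)] .
    have us: "u = scale ?c x + ?u" by (simp add: prj_def)
    have sx: "scale ?c x \<in> L" using L_scale[OF c xL] .
    have "(free_gen (scale ?c x + ?u) - free_gen (scale ?c x) - free_gen ?u)
      + (free_gen (scale ?c x) - free_scalar ?c * free_gen x) \<in> E.I"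
      by (intro E.I_add E.I_rel_add E.I_rel_scale sx uL xL c)
    then have i: "free_gen u - free_scalar ?c * free_gen x - free_gen ?u \<in> E.I"
      unfolding us[symmetric] by (simp add: algebra_simps)
    have ord_mon: "ord_mon qs be \<in> E.fa" using ord_mon_fa[OF adc] .
    have "free_gen u * ord_mon ((x, y) # qs) (0 # be)
      = (free_gen u - free_scalar ?c * free_gen x - free_gen ?u) * ord_mon qs be
        + free_scalar ?c * (free_gen x * ord_mon ((x, y) # qs) (0 # be)) + free_gen ?u * ord_mon qs be"
      by (simp add: ord_mon_0 algebra_simps)
    also have "\<dots> \<in> mon_span ((x, y) # qs)"
    proof (intro mon_span.add)
      show "(free_gen u - free_scalar ?c * free_gen x - free_gen ?u) * ord_mon qs be \<in> mon_span ((x, y) # qs)"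
        by (intro mon_span.annih_ideal annih_ideal_I E.I_right i ord_mon)
      show "free_scalar ?c * (free_gen x * ord_mon ((x, y) # qs) (0 # be)) \<in> mon_span ((x, y) # qs)"
        using mon_span.mon[of ?c "Suc 0 # be" "(x, y) # qs"] c al by (simp add: ord_mon_Suc)
      show "free_gen ?u * ord_mon qs be \<in> mon_span ((x, y) # qs)"
        by (intro mon_span_embed Cons.IH[OF adc bc uc uL al(2)])
    qed
    finally show ?case .
  next
    case (Suc i)
    \<comment> \<open>The commutator term has one factor \<open>x\<close> less, which is why the
      inner induction is over \<open>i\<close> with \<open>u\<close> arbitrary.\<close>
    have br: "bracket u x \<in> h" "bracket u x \<in> L"
      using bracket_in_lam_cent[OF adq Suc.prems(1) xh] L_bracket[OF Suc.prems(2) xL] by (auto simp: lam_cent_def)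
    let ?ord_mon = "ord_mon ((x, y) # qs) (i # be)"
    have "free_gen u * ord_mon ((x, y) # qs) (Suc i # be)
      = (free_gen u * free_gen x - free_gen x * free_gen u - free_gen (bracket u x)) * ?ord_mon
        + free_gen x * (free_gen u * ?ord_mon) + free_gen (bracket u x) * ?ord_mon"
      by (simp add: ord_mon_Suc algebra_simps)
    also have "\<dots> \<in> mon_span ((x, y) # qs)"
      by (intro mon_span.add mon_span.annih_ideal annih_ideal_I E.I_right E.I_rel_bracket Suc.prems xL ord_mon_fa[OF adq] mon_span_shift Suc.IH br)
    finally show ?case .
  qed
  then show ?case using Cons.prems q al by simp
qed

lemma mon_span_gen: "q \<in> mon_span ps \<Longrightarrow> u \<in> L \<Longrightarrow> free_gen u * q \<in> mon_span ps"
proof (induction rule: mon_span.induct)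
  case (mon c al)
  have "free_gen u * (free_scalar c * ord_mon ps al) = free_scalar c * (free_gen u * ord_mon ps al)"
    by (simp only: mult.assoc[symmetric] free_scalar_central[of c "free_gen u", symmetric])
  then show ?case using mon_span_scalar[OF gen_ord_mon[OF adp refl UNIV_I mon(3,2)] mon(1)] by simp
next
  case (annih_ideal z)
  then show ?case using annih_ideal_left E.fa_gen mon_span.annih_ideal by blast
qed (simp add: distrib_left mon_span.add)

lemma ord_mon_zero: "adapted qs h \<Longrightarrow> ord_mon qs (replicate (length qs) 0) = 1"
proof (induction qs arbitrary: h)
  case Nil
  show ?case by (simp add: ord_mon_def zero_word_def[symmetric])
next
  case (Cons q qs)
  then show ?case by (cases q) (auto simp: ord_mon_0)
qed

lemma fa_mon_span: "q \<in> E.fa \<Longrightarrow> q \<in> mon_span ps"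
proof -
  assume q: "q \<in> E.fa"
  have "Poly_Mapping.single (Word ws) 1 \<in> mon_span ps" if "set ws \<subseteq> L" for ws
    using that
  proof (induction ws)
    case Nil
    show ?case using mon_span.mon[of 1 "replicate d 0" ps] ord_mon_zero[OF adp] by (simp add: free_scalar_1 zero_word_def[symmetric])
  next
    case (Cons x ws)
    then show ?case using mon_span_gen[of "Poly_Mapping.single (Word ws) 1" x]
      by (simp add: free_gen_def mult_single plus_word_def)
  qed
  then have single: "Poly_Mapping.single w (Poly_Mapping.lookup q w) \<in> mon_span ps" if "w \<in> Poly_Mapping.keys q" for w
    using mon_span_scalar[of "Poly_Mapping.single w 1" ps "Poly_Mapping.lookup q w"] q that
    by (cases w) (auto simp: E.fa_iff free_scalar_single)
  have sum: "sum f A \<in> mon_span ps" if "\<And>i. i \<in> A \<Longrightarrow> f i \<in> mon_span ps" for f and A :: "'g word set"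
    using that by (induction A rule: infinite_finite_induct) (auto intro: mon_span.add mon_span.annih_ideal annih_ideal_I E.I_0)
  show ?thesis by (subst poly_mapping_expand) (rule sum, rule single)
qed

text \<open>The normally ordered polynomial with given coefficients; a section of the map
  \<open>rho _ e0\<close> on finitely supported families.\<close>

definition Psi :: "(nat list \<Rightarrow> 'k) \<Rightarrow> ('g word \<Rightarrow>\<^sub>0 'k)" where
  "Psi f = (\<Sum>al | f al \<noteq> 0. free_scalar (f al) * ord_mon ps al)"

lemma Psi_superset: "finite A \<Longrightarrow> {al. f al \<noteq> 0} \<subseteq> A \<Longrightarrow> Psi f = (\<Sum>al\<in>A. free_scalar (f al) * ord_mon ps al)"
  unfolding Psi_def by (intro sum.mono_neutral_left) (auto simp: free_scalar_0)

lemma Psi_add: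
  assumes "finite {al. f al \<noteq> 0}" "finite {al. g al \<noteq> 0}"
  shows "Psi (\<lambda>al. f al + g al) = Psi f + Psi g"
proof -
  let ?A = "{al. f al \<noteq> 0} \<union> {al. g al \<noteq> 0}"
  have "{al. f al + g al \<noteq> 0} \<subseteq> ?A" by auto
  then show ?thesis using assms
    by (simp add: Psi_superset[of ?A] free_scalar_add[symmetric] distrib_right sum.distrib)
qed

lemma Psi_scale:
  assumes "finite {al. f al \<noteq> 0}" shows "Psi (\<lambda>al. c * f al) = free_scalar c * Psi f"
proof -
  have "{al. c * f al \<noteq> 0} \<subseteq> {al. f al \<noteq> 0}" by auto
  then show ?thesis using assms
    by (simp add: Psi_superset[of "{al. f al \<noteq> 0}"] free_scalar_mult[symmetric] sum_distrib_left mult.assoc)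
qed

lemma Psi_fa: "finite {al. f al \<noteq> 0} \<Longrightarrow> bdd 1 f \<Longrightarrow> Psi f \<in> E.fa"
  unfolding Psi_def by (intro E.fa_sum E.fa_mult E.fa_scalar ord_mon_fa[OF adp]) (auto simp: bdd_def)

lemma mon_span_normal:
  "q \<in> mon_span ps \<Longrightarrow> \<exists>f. finite {al. f al \<noteq> 0} \<and> (\<forall>al. f al \<noteq> 0 \<longrightarrow> length al = d) \<and> q - Psi f \<in> annih_ideal"
proof (induction rule: mon_span.induct)
  case (mon c al)
  let ?f = "\<lambda>be. if be = al then c else 0"
  have "{be. ?f be \<noteq> 0} \<subseteq> {al}" by auto
  then have "Psi ?f = free_scalar c * ord_mon ps al" by (simp add: Psi_superset[of "{al}"])
  then show ?case using mon annih_ideal_I[OF E.I_0] by (intro exI[of _ ?f]) auto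
next
  case (annih_ideal x)
  then show ?case by (intro exI[of _ "\<lambda>_. 0"]) (simp add: Psi_def)
next
  case (add x y)
  obtain f where f: "finite {al. f al \<noteq> 0}" "\<forall>al. f al \<noteq> 0 \<longrightarrow> length al = d" "x - Psi f \<in> annih_ideal" using add by blast
  obtain g where g: "finite {al. g al \<noteq> 0}" "\<forall>al. g al \<noteq> 0 \<longrightarrow> length al = d" "y - Psi g \<in> annih_ideal" using add by blast
  have fin: "finite {al. f al + g al \<noteq> 0}"
    by (rule finite_subset[of _ "{al. f al \<noteq> 0} \<union> {al. g al \<noteq> 0}"]) (use f g in auto)
  have eq: "x + y - Psi (\<lambda>al. f al + g al) = (x - Psi f) + (y - Psi g)"
    unfolding Psi_add[OF f(1) g(1)] by simp
  have len: "length al = d" if "f al + g al \<noteq> 0" for al using f(2) g(2) that by (cases "f al = 0") simp_all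
  show ?case
    by (intro exI[of _ "\<lambda>al. f al + g al"] conjI allI impI) (rule fin, erule len, unfold eq, rule annih_ideal_add[OF f(3) g(3)])
qed

lemma rho_ord_mon: "length al = d \<Longrightarrow> rho (ord_mon ps al) e0 = unit al"
  by (rule ext) (simp add: ord_mon_def rho_single actw_mon[OF adp])

lemma rho_Psi:
  assumes "finite {al. f al \<noteq> 0}" "\<And>al. f al \<noteq> 0 \<Longrightarrow> length al = d"
  shows "rho (Psi f) e0 = f"
proof
  fix be
  have "rho (Psi f) e0 be = (\<Sum>al | f al \<noteq> 0. f al * unit al be)"
    unfolding Psi_def rho_sum using assms(2) by (intro sum.cong) (auto simp: rho_mult rho_scalar rho_ord_mon)
  also have "\<dots> = (\<Sum>al | f al \<noteq> 0. if al = be then f al else 0)" by (intro sum.cong) (auto simp: unit_def)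
  also have "\<dots> = f be" using assms(1) by simp
  finally show "rho (Psi f) e0 be = f be" .
qed

text \<open>The left ideal kills the generator and ordered monomials send it to the corresponding
  unit vectors. So the coefficients in any expansion are read off from the action on the generator,
  and in particular they are unique.\<close>

lemma normal_form:
  assumes "q \<in> E.fa"
  shows "finite {al. rho q e0 al \<noteq> 0}" "q - Psi (rho q e0) \<in> annih_ideal"
proof -
  obtain f where f: "finite {al. f al \<noteq> 0}" "\<forall>al. f al \<noteq> 0 \<longrightarrow> length al = d" "q - Psi f \<in> annih_ideal"
    using mon_span_normal[OF fa_mon_span[OF assms]] by blast
  have "rho q e0 al = f al" for al
    using fun_cong[OF rho_annih_ideal[OF f(3)], of al] fun_cong[OF rho_Psi[OF f(1)], of al] f(2) by (simp add: rho_diff)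
  then have "rho q e0 = f" by blast
  then show "finite {al. rho q e0 al \<noteq> 0}" "q - Psi (rho q e0) \<in> annih_ideal" using f by simp_all
qed

end

context env_lattice
begin

lemma rep_divisible:
  assumes u: "u \<in> carrier H" and z: "rep u n 0"
  shows "\<exists>w\<in>carrier H. u = U_hat_act L w (\<pi> ^ n)"
proof -
  obtain s where s: "\<And>k. s k \<in> fa" "\<And>m. rep u (n + m) (fs (\<pi> ^ n) * (\<Sum>k<m. fs (\<pi> ^ k) * s k))"
    using rep_series_from[OF u z] by blast
  obtain w where w: "w \<in> carrier H" "\<And>m. rep w m (\<Sum>k<m. fs (\<pi> ^ k) * s k)"
    using rep_series_construct[of s, OF s(1)] by blast
  have pn: "absv (\<pi> ^ n) \<le> 1" by simp
  have "u = U_hat_act L w (\<pi> ^ n)"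
  proof (rule rep_eqI[OF u hat_act_closed[OF pn w(1)]])
    fix m
    have "rep u (k + m) q \<Longrightarrow> rep u m q" for k q by (induction k) (auto dest: rep_Suc[OF u])
    then have "rep u m (fs (\<pi> ^ n) * (\<Sum>k<m. fs (\<pi> ^ k) * s k))" using s(2) by blast
    moreover have "rep (U_hat_act L w (\<pi> ^ n)) m (fs (\<pi> ^ n) * (\<Sum>k<m. fs (\<pi> ^ k) * s k))"
      by (rule rep_hat_act[OF pn w])
    ultimately show "\<exists>q. rep u m q \<and> rep (U_hat_act L w (\<pi> ^ n)) m q" by blast
  qed
  then show ?thesis using w(1) by blast
qed

lemma hat_class_add: "p \<in> fa \<Longrightarrow> q \<in> fa \<Longrightarrow>
    U_hat_class L (U_class L (p + q)) = U_hat_class L (U_class L p) \<oplus>\<^bsub>H\<^esub> U_hat_class L (U_class L q)"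
proof (rule rep_eqI)
  interpret H: ring H by (rule ring_H)
  assume p: "p \<in> fa" and q: "q \<in> fa"
  show "U_hat_class L (U_class L (p + q)) \<in> carrier H" by (intro hat_class_closed fa_add p q)
  show "U_hat_class L (U_class L p) \<oplus>\<^bsub>H\<^esub> U_hat_class L (U_class L q) \<in> carrier H"
    by (intro H.a_closed hat_class_closed p q)
  show "\<exists>s. rep (U_hat_class L (U_class L (p + q))) n s \<and> rep (U_hat_class L (U_class L p) \<oplus>\<^bsub>H\<^esub> U_hat_class L (U_class L q)) n s" for n
    using rep_class[OF fa_add[OF p q]] rep_add[OF hat_class_closed[OF p] hat_class_closed[OF q] rep_class[OF p] rep_class[OF q]]
    by blast
qed

lemma hat_class_mult: "p \<in> fa \<Longrightarrow> q \<in> fa \<Longrightarrow>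
    U_hat_class L (U_class L (p * q)) = U_hat_class L (U_class L p) \<otimes>\<^bsub>H\<^esub> U_hat_class L (U_class L q)"
proof (rule rep_eqI)
  interpret H: ring H by (rule ring_H)
  assume p: "p \<in> fa" and q: "q \<in> fa"
  show "U_hat_class L (U_class L (p * q)) \<in> carrier H" by (intro hat_class_closed fa_mult p q)
  show "U_hat_class L (U_class L p) \<otimes>\<^bsub>H\<^esub> U_hat_class L (U_class L q) \<in> carrier H"
    by (intro H.m_closed hat_class_closed p q)
  show "\<exists>s. rep (U_hat_class L (U_class L (p * q))) n s \<and> rep (U_hat_class L (U_class L p) \<otimes>\<^bsub>H\<^esub> U_hat_class L (U_class L q)) n s" for n
    using rep_class[OF fa_mult[OF p q]] rep_mult[OF hat_class_closed[OF p] hat_class_closed[OF q] rep_class[OF p] rep_class[OF q]]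
    by blast
qed

end

section \<open>The affinoid Dixmier module\<close>

context main_setup
begin

text \<open>For the empty chain the series have no variables, and the action is multiplication by
  \<open>lam\<close>.\<close>

lemma rep_setup_BL: "rep_setup absv \<pi> scale bracket L lam N BL bb []"
proof unfold_locales
  have sub: "subalgebra bb" using base_subalgebra[OF adp] .
  then have ss: "subspace bb" by (simp add: subalgebra_def)
  show "adapted [] bb" using sub lam_base[OF adp] by simp
  show "x + y \<in> BL" if "x \<in> BL" "y \<in> BL" for x y using that subspaceD(2)[OF ss] L_add by blast
  show "scale c x \<in> BL" if "absv c \<le> 1" "x \<in> BL" for c x using that subspaceD(3)[OF ss] L_scale by blast
  show "bracket x y \<in> BL" if "x \<in> BL" "y \<in> BL" for x y using that sub L_bracket by (auto simp: subalgebra_def)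
qed auto

sublocale C: rep_setup absv \<pi> scale bracket L lam N BL bb "[]"
  by (rule rep_setup_BL)

section \<open>The map of completed algebras induced by the inclusion of lattices\<close>

abbreviation "inc \<equiv> E.U_hat_incl L"

lemma BL_sub: "BL \<subseteq> L"
  by blast

lemma inc_closed: "f \<in> carrier C.E.H \<Longrightarrow> inc f \<in> carrier E.H"
  and inc_rep: "f \<in> carrier C.E.H \<Longrightarrow> C.E.rep f n q \<Longrightarrow> E.rep (inc f) n q"
  using env_incl[OF E.env_lattice_axioms C.E.env_lattice_axioms BL_sub] by blast+

lemma fa_incl: "q \<in> C.E.fa \<Longrightarrow> q \<in> E.fa"
  by (auto simp: C.E.fa_iff E.fa_iff)

lemma inc_add: "f \<in> carrier C.E.H \<Longrightarrow> g \<in> carrier C.E.H \<Longrightarrow> inc (f \<oplus>\<^bsub>C.E.H\<^esub> g) = inc f \<oplus>\<^bsub>E.H\<^esub> inc g"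
proof -
  assume f: "f \<in> carrier C.E.H" and g: "g \<in> carrier C.E.H"
  interpret HC: ring C.E.H by (rule C.E.ring_H)
  interpret HE: ring E.H by (rule E.ring_H)
  have fg: "f \<oplus>\<^bsub>C.E.H\<^esub> g \<in> carrier C.E.H" using f g by simp
  show ?thesis
  proof (rule E.rep_eqI[OF inc_closed[OF fg] HE.a_closed[OF inc_closed[OF f] inc_closed[OF g]]])
    fix n
    obtain p q where p: "C.E.rep f n p" and q: "C.E.rep g n q" using C.E.rep_exists f g by blast
    show "\<exists>q. E.rep (inc (f \<oplus>\<^bsub>C.E.H\<^esub> g)) n q \<and> E.rep (inc f \<oplus>\<^bsub>E.H\<^esub> inc g) n q"
      using inc_rep[OF fg C.E.rep_add[OF f g p q]]
        E.rep_add[OF inc_closed[OF f] inc_closed[OF g] inc_rep[OF f p] inc_rep[OF g q]] by blast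
  qed
qed

lemma inc_act: "f \<in> carrier C.E.H \<Longrightarrow> absv c \<le> 1 \<Longrightarrow> inc (E.U_hat_act BL f c) = E.U_hat_act L (inc f) c"
proof -
  assume f: "f \<in> carrier C.E.H" and c: "absv c \<le> 1"
  have fc: "E.U_hat_act BL f c \<in> carrier C.E.H" using C.E.hat_act_closed[OF c f] .
  show ?thesis
  proof (rule E.rep_eqI[OF inc_closed[OF fc] E.hat_act_closed[OF c inc_closed[OF f]]])
    fix n
    obtain p where p: "C.E.rep f n p" using C.E.rep_exists f by blast
    show "\<exists>q. E.rep (inc (E.U_hat_act BL f c)) n q \<and> E.rep (E.U_hat_act L (inc f) c) n q"
      using inc_rep[OF fc C.E.rep_hat_act[OF c f p]] E.rep_hat_act[OF c inc_closed[OF f] inc_rep[OF f p]] by blast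
  qed
qed

lemma inc_class: "q \<in> C.E.fa \<Longrightarrow> inc (E.U_hat_class BL (E.U_class BL q)) = E.U_hat_class L (E.U_class L q)"
  using inc_rep[OF C.E.hat_class_closed C.E.rep_class, of q] E.rep_class[OF fa_incl, of q]
  by (intro E.rep_eqI inc_closed C.E.hat_class_closed E.hat_class_closed fa_incl) blast+

abbreviation "kerB \<equiv> tensor_kernel (add_monoid C.E.H) (add_monoid ring_of_type_algebra) (valuation_ring absv) (E.U_hat_act BL) (*)"
abbreviation "kerL \<equiv> tensor_kernel (add_monoid E.H) (add_monoid ring_of_type_algebra) (valuation_ring absv) (E.U_hat_act L) (*)"

text \<open>The inclusion is additive and commutes with the scalars, so it maps relators to relators
  and induces a map on tensors.\<close>

lemma incK_el:
  assumes f: "f \<in> carrier C.E.H" shows "E.U_K_incl L (C.E.el f a) = E.el (inc f) a"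
proof -
  let ?h = "\<lambda>(f, a). frag_of (inc f, a)"
  have ker: "frag_extend ?h c \<in> kerL" if c: "c \<in> kerB" for c
  proof (rule tensor.frag_extend_Ker[OF C.E.tensor_UK c])
    show "0 \<in> kerL" by (rule tensor.Ker_0[OF E.tensor_UK])
    show "c - d \<in> kerL" if "c \<in> kerL" "d \<in> kerL" for c d using tensor.Ker_diff[OF E.tensor_UK that] .
    fix c assume c: "c \<in> tensor_relators (add_monoid C.E.H) (add_monoid ring_of_type_algebra) (valuation_ring absv) (E.U_hat_act BL) (*)"
    show "frag_extend ?h c \<in> kerL"
    proof (rule tensor.Ker_rel[OF E.tensor_UK])
      show "frag_extend ?h c \<in> tensor_relators (add_monoid E.H) (add_monoid ring_of_type_algebra) (valuation_ring absv) (E.U_hat_act L) (*)"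
        using c[unfolded tensor_relators_def]
      proof (elim UnE CollectE exE conjE)
        fix m m' n assume *: "c = frag_of (m \<otimes>\<^bsub>add_monoid C.E.H\<^esub> m', n) - frag_of (m, n) - frag_of (m', n)"
          "m \<in> carrier (add_monoid C.E.H)" "m' \<in> carrier (add_monoid C.E.H)"
        then have "frag_extend ?h c = frag_of (inc m \<otimes>\<^bsub>add_monoid E.H\<^esub> inc m', n) - frag_of (inc m, n) - frag_of (inc m', n)"
          by (simp add: frag_extend_diff inc_add)
        then show ?thesis unfolding tensor_relators_def
          using inc_closed[of m] inc_closed[of m'] *(2,3) by (intro UnI1 CollectI exI[of _ "inc m"] exI[of _ "inc m'"] exI[of _ n] conjI) auto
      next
        fix m n n' assume *: "c = frag_of (m, n \<otimes>\<^bsub>add_monoid ring_of_type_algebra\<^esub> n') - frag_of (m, n) - frag_of (m, n')"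
          "m \<in> carrier (add_monoid C.E.H)"
        then have "frag_extend ?h c = frag_of (inc m, n \<otimes>\<^bsub>add_monoid ring_of_type_algebra\<^esub> n') - frag_of (inc m, n) - frag_of (inc m, n')"
          by (simp add: frag_extend_diff)
        then show ?thesis unfolding tensor_relators_def
          using inc_closed[of m] *(2) by (intro UnI1 UnI2 CollectI exI[of _ "inc m"] exI[of _ n] exI[of _ n'] conjI) auto
      next
        fix m s n assume *: "c = frag_of (E.U_hat_act BL m s, n) - frag_of (m, s * n)"
          "m \<in> carrier (add_monoid C.E.H)" "s \<in> valuation_ring absv"
        then have "frag_extend ?h c = frag_of (E.U_hat_act L (inc m) s, n) - frag_of (inc m, s * n)"
          by (simp add: frag_extend_diff inc_act E.vr_iff)
        then show ?thesis unfolding tensor_relators_def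
          using inc_closed[of m] *(2,3) by (intro UnI2 CollectI exI[of _ "inc m"] exI[of _ s] exI[of _ n] conjI) auto
      qed
    qed
  qed
  have "E.U_K_class L (frag_extend ?h c) = E.el (inc f) a" if "c \<in> C.E.el f a" for c
  proof -
    have "c - frag_of (f, a) \<in> kerB"
      using that unfolding C.E.el_def E.U_K_class_def tensor.mem_cls_iff[OF C.E.tensor_UK] .
    from ker[OF this] have "frag_extend ?h c - frag_of (inc f, a) \<in> kerL" by (simp add: frag_extend_diff)
    then show ?thesis unfolding E.el_def E.U_K_class_def tensor.cls_eq_iff[OF E.tensor_UK] .
  qed
  moreover have "frag_of (f, a) \<in> C.E.el f a"
    unfolding C.E.el_def E.U_K_class_def by (rule tensor.self_mem_cls[OF C.E.tensor_UK])
  ultimately show ?thesis unfolding E.U_K_incl_def by blast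
qed

lemma incK_closed: "V \<in> carrier C.E.R \<Longrightarrow> E.U_K_incl L V \<in> carrier E.R"
  using C.E.R_elements[of V] incK_el inc_closed E.el_closed by metis

lemma C_M: "f \<in> C.M \<Longrightarrow> f = (\<lambda>al. f [] * C.e0 al)"
  using MsetD(1)[of f 0] by (auto simp: unit_def fun_eq_iff)

text \<open>The definition of the one-dimensional module chooses some character. One exists because
  the representation for the empty chain is one-dimensional; its eigenvalue is a
  homomorphism.\<close>

lemma character_exists: "E.is_character lam BL (\<lambda>V. C.sig V C.e0 [])"
  unfolding E.is_character_def
proof (intro conjI allI ballI)
  interpret R: ring C.E.R by (rule C.E.ring_R)
  have e1: "C.e0 [] = 1" by (simp add: unit_def)
  show "(\<lambda>V. C.sig V C.e0 []) \<in> ring_hom C.E.R ring_of_type_algebra"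
  proof (rule ring_hom_memI)
    fix V W assume V: "V \<in> carrier C.E.R" and W: "W \<in> carrier C.E.R"
    have "C.sig (V \<otimes>\<^bsub>C.E.R\<^esub> W) C.e0 = C.sig V (C.sig W C.e0)" by (rule C.sig_mult[OF V W C.e0_M])
    also have "C.sig W C.e0 = (\<lambda>al. C.sig W C.e0 [] * C.e0 al)" by (rule C_M[OF C.sig_M[OF W C.e0_M]])
    also have "C.sig V \<dots> = (\<lambda>al. C.sig W C.e0 [] * C.sig V C.e0 al)" by (rule C.sig_scale_right[OF V C.e0_M])
    finally show "C.sig (V \<otimes>\<^bsub>C.E.R\<^esub> W) C.e0 [] = C.sig V C.e0 [] \<otimes>\<^bsub>ring_of_type_algebra\<^esub> C.sig W C.e0 []" by simp
    show "C.sig (V \<oplus>\<^bsub>C.E.R\<^esub> W) C.e0 [] = C.sig V C.e0 [] \<oplus>\<^bsub>ring_of_type_algebra\<^esub> C.sig W C.e0 []"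
      using C.sig_add[OF V W C.e0_M] by simp
  qed (use e1 C.sig_one[OF C.e0_M] in auto)
  show "C.sig (E.U_K_scalar BL a) C.e0 [] = a" for a using C.sig_scalar[OF C.e0_M, of a] e1 by simp
  show "C.sig (E.U_K_gen BL x) C.e0 [] = lam x" if "x \<in> BL" for x using C.sig_gen[OF C.e0_M that] e1 by simp
qed

definition chi :: "('k, 'g) env_K \<Rightarrow> 'k" where
  "chi = (SOME \<chi>. E.is_character lam BL \<chi>)"

lemma chi: "E.is_character lam BL chi"
  unfolding chi_def by (rule someI[where P = "E.is_character lam BL", OF character_exists])

lemma chi_add: "V \<in> carrier C.E.R \<Longrightarrow> W \<in> carrier C.E.R \<Longrightarrow> chi (V \<oplus>\<^bsub>C.E.R\<^esub> W) = chi V + chi W"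
  and chi_mult: "V \<in> carrier C.E.R \<Longrightarrow> W \<in> carrier C.E.R \<Longrightarrow> chi (V \<otimes>\<^bsub>C.E.R\<^esub> W) = chi V * chi W"
  using chi ring_hom_add[of chi C.E.R ring_of_type_algebra V W] ring_hom_mult[of chi C.E.R ring_of_type_algebra V W]
  by (simp_all add: E.is_character_def)

lemma chi_scalar: "chi (C.E.el \<one>\<^bsub>C.E.H\<^esub> a) = a"
  using chi by (simp add: E.is_character_def E.U_K_scalar_def C.E.el_def)

lemma chi_el: "u \<in> carrier C.E.H \<Longrightarrow> chi (C.E.el u a) = a * chi (C.E.el u 1)"
proof -
  assume u: "u \<in> carrier C.E.H"
  interpret H: ring C.E.H by (rule C.E.ring_H)
  have "C.E.el u a = C.E.el \<one>\<^bsub>C.E.H\<^esub> a \<otimes>\<^bsub>C.E.R\<^esub> C.E.el u 1" using C.E.el_mult[OF H.one_closed u, of a 1] u by simp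
  then show ?thesis using chi_mult[OF C.E.el_closed[OF H.one_closed] C.E.el_closed[OF u], of a 1] by (simp add: chi_scalar)
qed

definition chi_free :: "('g word \<Rightarrow>\<^sub>0 'k) \<Rightarrow> 'k" where
  "chi_free q = chi (C.E.el (E.U_hat_class BL (E.U_class BL q)) 1)"

lemma chi_free_add: "p \<in> C.E.fa \<Longrightarrow> q \<in> C.E.fa \<Longrightarrow> chi_free (p + q) = chi_free p + chi_free q"
  unfolding chi_free_def C.E.hat_class_add
  using C.E.el_add_left[OF C.E.hat_class_closed C.E.hat_class_closed, of p q 1]
    chi_add[OF C.E.el_closed C.E.el_closed, OF C.E.hat_class_closed C.E.hat_class_closed, of p q 1 1] by simp

lemma chi_free_mult: "p \<in> C.E.fa \<Longrightarrow> q \<in> C.E.fa \<Longrightarrow> chi_free (p * q) = chi_free p * chi_free q"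
  unfolding chi_free_def C.E.hat_class_mult
  using C.E.el_mult[OF C.E.hat_class_closed C.E.hat_class_closed, of p q 1 1]
    chi_mult[OF C.E.el_closed C.E.el_closed, OF C.E.hat_class_closed C.E.hat_class_closed, of p q 1 1] by simp

lemma chi_free_scalar: "absv c \<le> 1 \<Longrightarrow> chi_free (free_scalar c) = c"
proof -
  assume c: "absv c \<le> 1"
  interpret H: ring C.E.H by (rule C.E.ring_H)
  have "C.E.sc c = E.U_hat_act BL \<one>\<^bsub>C.E.H\<^esub> c" using C.E.sc_closed[OF c] by (simp add: C.E.hat_act_eq)
  then show ?thesis unfolding chi_free_def using C.E.el_balance[OF H.one_closed c, of 1] by (simp add: chi_scalar)
qed

lemma chi_free_gen: "b \<in> BL \<Longrightarrow> chi_free (free_gen b) = lam b"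
  using chi unfolding E.is_character_def chi_free_def C.E.el_def E.U_K_gen_def by blast

text \<open>The generator of \<open>M\<close> is a common eigenvector of the polarisation. On
  polynomials its eigenvalue and the character agree because both are multiplicative, linear over
  the integral scalars, and equal to \<open>lam\<close> on generators.\<close>

lemma rho_chi_free:
  assumes q: "q \<in> C.E.fa" shows "rho q e0 = (\<lambda>al. chi_free q * e0 al)"
proof -
  have w: "rho (Poly_Mapping.single (Word ws) 1) e0 = (\<lambda>al. chi_free (Poly_Mapping.single (Word ws) 1) * e0 al)"
    if "set ws \<subseteq> BL" for ws
    using that
  proof (induction ws)
    case Nil
    show ?case using chi_free_scalar[of 1] by (simp add: zero_word_def[symmetric] rho_1 free_scalar_1)
  next
    case (Cons b ws)
    have e: "Poly_Mapping.single (Word (b # ws)) 1 = free_gen b * Poly_Mapping.single (Word ws) (1 :: 'k)"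
      by (simp add: free_gen_def mult_single plus_word_def)
    have fa: "free_gen b \<in> C.E.fa" "Poly_Mapping.single (Word ws) 1 \<in> C.E.fa"
      using Cons.prems by (auto intro!: C.E.fa_gen C.E.fa_single)
    have IH: "rho (Poly_Mapping.single (Word ws) 1) e0 = (\<lambda>al. chi_free (Poly_Mapping.single (Word ws) 1) * e0 al)"
      using Cons by simp
    have b: "b \<in> BL" using Cons.prems by simp
    then have "act ps b e0 = (\<lambda>al. lam b * e0 al)" using act_base[OF adp, of b] by blast
    then show ?case unfolding e rho_mult IH chi_free_mult[OF fa] chi_free_gen[OF b]
      by (intro ext) (simp only: rho_scale_right, simp add: rho_gen mult_ac)
  qed
  have s: "Poly_Mapping.single w (Poly_Mapping.lookup q w) \<in> C.E.fa \<and>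
      rho (Poly_Mapping.single w (Poly_Mapping.lookup q w)) e0 = (\<lambda>al. chi_free (Poly_Mapping.single w (Poly_Mapping.lookup q w)) * e0 al)"
    if "w \<in> Poly_Mapping.keys q" for w
  proof -
    have l: "set (letters w) \<subseteq> BL" and c: "absv (Poly_Mapping.lookup q w) \<le> 1" using q that by (auto simp: C.E.fa_iff)
    have e: "Poly_Mapping.single w (Poly_Mapping.lookup q w) = free_scalar (Poly_Mapping.lookup q w) * Poly_Mapping.single w 1"
      by (simp add: free_scalar_single)
    have fa: "free_scalar (Poly_Mapping.lookup q w) \<in> C.E.fa" "Poly_Mapping.single w 1 \<in> C.E.fa"
      using l c by (auto intro!: C.E.fa_scalar C.E.fa_single)
    have "rho (Poly_Mapping.single w 1) e0 = (\<lambda>al. chi_free (Poly_Mapping.single w 1) * e0 al)"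
      using w[OF l] by (cases w) simp
    then show ?thesis unfolding e using fa
      by (auto simp: rho_mult rho_scalar chi_free_mult chi_free_scalar c mult.assoc C.E.fa_mult)
  qed
  have "(\<Sum>i\<in>A. f i) \<in> C.E.fa \<and> rho (\<Sum>i\<in>A. f i) e0 = (\<lambda>al. chi_free (\<Sum>i\<in>A. f i) * e0 al)"
    if "finite A" "\<And>i. i \<in> A \<Longrightarrow> f i \<in> C.E.fa \<and> rho (f i) e0 = (\<lambda>al. chi_free (f i) * e0 al)" for f and A :: "'g word set"
    using that
  proof (induction A rule: finite_induct)
    case empty
    show ?case using chi_free_scalar[of 0] by (simp add: free_scalar_0)
  next
    case (insert i A)
    have IH: "(\<Sum>i\<in>A. f i) \<in> C.E.fa \<and> rho (\<Sum>i\<in>A. f i) e0 = (\<lambda>al. chi_free (\<Sum>i\<in>A. f i) * e0 al)"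
      and fi: "f i \<in> C.E.fa \<and> rho (f i) e0 = (\<lambda>al. chi_free (f i) * e0 al)" using insert by auto
    show ?case using insert.hyps IH fi by (auto simp: rho_add chi_free_add distrib_right C.E.fa_add)
  qed
  from this[of "Poly_Mapping.keys q" "\<lambda>w. Poly_Mapping.single w (Poly_Mapping.lookup q w)", OF finite_keys s]
  show ?thesis by (simp flip: poly_mapping_expand)
qed

text \<open>Continuity of the chosen character: the difference of \<open>f\<close> and
  \<open>q\<close> is \<open>\<pi> ^ n\<close> times an element of the completed algebra, where the
  character is bounded by 1.\<close>

lemma chi_approx:
  assumes f: "f \<in> carrier C.E.H" and q: "C.E.rep f n q"
  shows "absv (chi (C.E.el f 1) - chi_free q) \<le> r ^ n"
proof -
  interpret H: ring C.E.H by (rule C.E.ring_H)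
  let ?q = "E.U_hat_class BL (E.U_class BL q)"
  have qfa: "q \<in> C.E.fa" by (rule C.E.rep_fa[OF q])
  have qc: "?q \<in> carrier C.E.H" by (rule C.E.hat_class_closed[OF qfa])
  let ?u = "f \<ominus>\<^bsub>C.E.H\<^esub> ?q"
  have u: "?u \<in> carrier C.E.H" using f qc by simp
  have fu: "?u \<oplus>\<^bsub>C.E.H\<^esub> ?q = f" using f qc by (simp add: H.minus_eq H.a_assoc H.l_neg)
  obtain e where e: "C.E.rep ?u n e" using C.E.rep_exists[OF u] by blast
  have "C.E.rep f n (e + q)" using C.E.rep_add[OF u qc e C.E.rep_class[OF qfa]] fu by simp
  from C.E.rep_diff[OF f this q] have "0 - e \<in> C.E.J n" by simp
  then have "C.E.rep ?u n 0" using C.E.rep_shift[OF u e C.E.fa_0] by blast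
  then obtain w where w: "w \<in> carrier C.E.H" "?u = E.U_hat_act BL w (\<pi> ^ n)" using C.E.rep_divisible[OF u] by blast
  have "chi (C.E.el f 1) = chi (C.E.el ?u 1) + chi_free q"
    using chi_add[OF C.E.el_closed[OF u] C.E.el_closed[OF qc], of 1 1] C.E.el_add_left[OF u qc, of 1] fu by (simp add: chi_free_def)
  moreover have "chi (C.E.el ?u 1) = \<pi> ^ n * chi (C.E.el w 1)"
    unfolding w(2) using C.E.el_balance[OF w(1), of "\<pi> ^ n" 1] chi_el[OF w(1), of "\<pi> ^ n"] by simp
  moreover have "absv (\<pi> ^ n * chi (C.E.el w 1)) \<le> r ^ n * 1"
    by (intro absv_mult_le C.E.character_bounded[OF chi w(1)]) simp
  ultimately show ?thesis by simp
qed

lemma chi_hat: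
  assumes f: "f \<in> carrier C.E.H" shows "hat (inc f) e0 = (\<lambda>al. chi (C.E.el f 1) * e0 al)"
proof (rule hat_eqI[OF inc_closed[OF f] e0_M])
  fix n
  obtain q where q: "C.E.rep f n q" using C.E.rep_exists[OF f] by blast
  have "bdd (r ^ n * 1) (\<lambda>al. (chi (C.E.el f 1) - chi_free q) * e0 al)"
    by (rule bdd_scale[OF unit_bdd chi_approx[OF f q]])
  then show "\<exists>q. E.rep (inc f) n q \<and> bdd (r ^ n * 1) (\<lambda>al. chi (C.E.el f 1) * e0 al - rho q e0 al)"
    using inc_rep[OF f q] rho_chi_free[OF C.E.rep_fa[OF q]] by (intro exI[of _ q]) (simp add: left_diff_distrib)
qed

lemma chi_sig:
  assumes "V \<in> carrier C.E.R" shows "sig (E.U_K_incl L V) e0 = (\<lambda>al. chi V * e0 al)"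
proof -
  obtain f a where f: "f \<in> carrier C.E.H" "V = C.E.el f a" using C.E.R_elements[OF assms] by blast
  show ?thesis unfolding f(2) incK_el[OF f(1)] sig_el[OF e0_M] chi_hat[OF f(1)] chi_el[OF f(1), of a] by (simp add: mult.assoc)
qed

section \<open>The induced module and its embedding into the convergent series\<close>

abbreviation "K_lam \<equiv> E.K_module lam BL"

lemma K_lam_simps: "carrier K_lam = UNIV" "V \<odot>\<^bsub>K_lam\<^esub> k = chi V * k" "\<zero>\<^bsub>K_lam\<^esub> = 0" "x \<oplus>\<^bsub>K_lam\<^esub> y = x + y"
  by (simp_all add: E.K_module_def chi_def)

lemma K_lam_c: "k \<in> carrier K_lam"
  by (simp add: K_lam_simps)

lemma abelian_group_K_lam: "abelian_group K_lam"
proof (rule abelian_groupI)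
  show "\<exists>y\<in>carrier K_lam. y \<oplus>\<^bsub>K_lam\<^esub> x = \<zero>\<^bsub>K_lam\<^esub>" for x
    by (intro bexI[of _ "- x"]) (simp_all add: K_lam_simps)
qed (simp_all add: K_lam_simps add_ac)

lemma induced_D: "induced E.R C.E.R (E.U_K_incl L) K_lam"
proof -
  interpret R: ring E.R by (rule E.ring_R)
  interpret Nm: abelian_group K_lam by (rule abelian_group_K_lam)
  show ?thesis
    by (intro induced.intro tensor.intro induced_axioms.intro R.ring_axioms abelian_group_K_lam R.a_comm_group Nm.a_comm_group)
      (simp_all add: incK_closed K_lam_simps)
qed

sublocale D: induced E.R C.E.R "E.U_K_incl L" K_lam
  by (rule induced_D)

lemma dixmier_eq: "E.dixmier_module L lam bb = D.D"
  by (simp add: E.dixmier_module_def Let_def)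

definition dixmier_vec :: "('k, 'g) env_K \<Rightarrow> (('k, 'g) env_K \<times> 'k \<Rightarrow>\<^sub>0 int) set" where
  "dixmier_vec V = D.cls (frag_of (V, 1))"

lemma dixmier_vec_closed: "V \<in> carrier E.R \<Longrightarrow> dixmier_vec V \<in> carrier D.D"
  unfolding D.D_simps dixmier_vec_def by (rule D.cls_in_T) (simp add: K_lam_simps)

lemma dixmier_vec_add: "V \<in> carrier E.R \<Longrightarrow> W \<in> carrier E.R \<Longrightarrow> dixmier_vec V \<oplus>\<^bsub>D.D\<^esub> dixmier_vec W = dixmier_vec (V \<oplus>\<^bsub>E.R\<^esub> W)"
  unfolding D.D_simps dixmier_vec_def
  using D.T_mult[of "frag_of (V, 1)" "frag_of (W, 1)"] D.cls_add_left[of V W 1] K_lam_c[of 1] by simp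

lemma dixmier_vec_smult: "a \<in> carrier E.R \<Longrightarrow> a \<odot>\<^bsub>D.D\<^esub> dixmier_vec V = dixmier_vec (a \<otimes>\<^bsub>E.R\<^esub> V)"
  unfolding dixmier_vec_def by (simp only: D.smult_cls D.tr_of)

text \<open>A scalar in the right factor is the value of the character on a scalar of the algebra
  and can be moved to the left. So all tensors have the form \<open>V \<otimes> 1\<close>.\<close>

lemma cls_pair:
  assumes V: "V \<in> carrier E.R"
  shows "\<exists>W\<in>carrier E.R. D.cls (frag_of (V, k)) = dixmier_vec W"
proof -
  interpret HC: ring C.E.H by (rule C.E.ring_H)
  let ?s = "C.E.el \<one>\<^bsub>C.E.H\<^esub> k"
  have s: "?s \<in> carrier C.E.R" by (rule C.E.el_closed) simp
  have "D.cls (frag_of (V \<otimes>\<^bsub>E.R\<^esub> E.U_K_incl L ?s, 1)) = D.cls (frag_of (V, ?s \<odot>\<^bsub>K_lam\<^esub> 1))"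
    by (rule D.cls_balance) (use V s K_lam_c in simp_all)
  also have "?s \<odot>\<^bsub>K_lam\<^esub> 1 = k" by (simp add: K_lam_simps chi_scalar)
  finally have "dixmier_vec (V \<otimes>\<^bsub>E.R\<^esub> E.U_K_incl L ?s) = D.cls (frag_of (V, k))" unfolding dixmier_vec_def .
  moreover have "V \<otimes>\<^bsub>E.R\<^esub> E.U_K_incl L ?s \<in> carrier E.R" using V incK_closed[OF s] by simp
  ultimately show ?thesis by metis
qed

lemma D_elements:
  assumes "Z \<in> carrier D.D" shows "\<exists>V\<in>carrier E.R. Z = dixmier_vec V"
proof -
  obtain c where c: "Poly_Mapping.keys c \<subseteq> carrier (add_monoid E.R) \<times> carrier (add_monoid K_lam)" and Z: "Z = D.cls c"
    using assms unfolding D.D_simps D.carrier_T by (elim exE conjE)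
  have k: "Poly_Mapping.keys c \<subseteq> carrier E.R \<times> (UNIV :: 'k set)" using c by auto
  from k have "\<exists>V\<in>carrier E.R. D.cls c = dixmier_vec V"
  proof (induction rule: frag_induction)
    case zero
    have "frag_of (\<zero>\<^bsub>E.R\<^esub>, 1) - 0 \<in> D.Ker"
    proof -
      have "frag_of (\<zero>\<^bsub>E.R\<^esub>, 1) - (frag_of (\<zero>\<^bsub>E.R\<^esub>, 1) + frag_of (\<zero>\<^bsub>E.R\<^esub>, 1)) \<in> D.Ker"
        using D.cls_add_left[of "\<zero>\<^bsub>E.R\<^esub>" "\<zero>\<^bsub>E.R\<^esub>" 1] K_lam_c[of 1] unfolding D.cls_eq_iff by simp
      from D.Ker_minus[OF this] show ?thesis by simp
    qed
    then have "dixmier_vec \<zero>\<^bsub>E.R\<^esub> = D.cls 0" unfolding dixmier_vec_def D.cls_eq_iff .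
    then show ?case using D.A.zero_closed by metis
  next
    case (one x)
    then show ?case using cls_pair by (cases x) auto
  next
    case (diff c d)
    obtain V W where V: "V \<in> carrier E.R" "D.cls c = dixmier_vec V" and W: "W \<in> carrier E.R" "D.cls d = dixmier_vec W" using diff by blast
    have eq: "V = (V \<ominus>\<^bsub>E.R\<^esub> W) \<oplus>\<^bsub>E.R\<^esub> W" using V W by (simp add: D.A.minus_eq D.A.a_assoc D.A.l_neg)
    have k: "frag_of (V, 1) - (frag_of (V \<ominus>\<^bsub>E.R\<^esub> W, 1) + frag_of (W, 1)) \<in> D.Ker"
      using D.cls_add_left[of "V \<ominus>\<^bsub>E.R\<^esub> W" W 1] V(1) W(1) eq K_lam_c[of 1] unfolding D.cls_eq_iff by simp
    have kc: "c - frag_of (V, 1) \<in> D.Ker" using V(2) unfolding dixmier_vec_def D.cls_eq_iff .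
    have kd: "d - frag_of (W, 1) \<in> D.Ker" using W(2) unfolding dixmier_vec_def D.cls_eq_iff .
    have "(c - d) - frag_of (V \<ominus>\<^bsub>E.R\<^esub> W, 1) \<in> D.Ker"
      using D.Ker_add[OF D.Ker_diff[OF kc kd] k] by (simp add: algebra_simps)
    then have "D.cls (c - d) = dixmier_vec (V \<ominus>\<^bsub>E.R\<^esub> W)" unfolding dixmier_vec_def D.cls_eq_iff .
    then show ?case using V(1) W(1) D.A.minus_closed by blast
  qed
  then show ?thesis using Z by simp
qed

definition Phi :: "(('k, 'g) env_K \<times> 'k \<Rightarrow>\<^sub>0 int) set \<Rightarrow> nat list \<Rightarrow> 'k" where
  "Phi Z al = frag_sum (\<lambda>(V, k). k * sig V e0 al) (SOME c. c \<in> Z)"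

text \<open>The function is balanced over the algebra of the polarisation because the generator of
  \<open>M\<close> is an eigenvector with the chosen character (\<open>chi_sig\<close>).\<close>

lemma Phi_dixmier_vec: "V \<in> carrier E.R \<Longrightarrow> Phi (dixmier_vec V) = sig V e0"
proof
  fix al assume V: "V \<in> carrier E.R"
  let ?h = "\<lambda>(V, k). k * sig V e0 al"
  have "frag_of (V, 1) \<in> dixmier_vec V" unfolding dixmier_vec_def by (rule D.self_mem_cls)
  then have "(SOME c. c \<in> dixmier_vec V) \<in> dixmier_vec V" by (rule someI)
  then have k: "(SOME c. c \<in> dixmier_vec V) - frag_of (V, 1) \<in> D.Ker" unfolding dixmier_vec_def D.mem_cls_iff .
  have "frag_sum ?h ((SOME c. c \<in> dixmier_vec V) - frag_of (V, 1)) = 0"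
  proof (rule D.frag_sum_Ker[OF k])
    fix W s n assume "W \<in> carrier (add_monoid E.R)" "s \<in> carrier C.E.R"
    then have "sig (W \<otimes>\<^bsub>E.R\<^esub> E.U_K_incl L s) e0 = (\<lambda>al. chi s * sig W e0 al)"
      using sig_mult[OF _ incK_closed e0_M, of W s] chi_sig[of s] sig_scale_right[OF _ e0_M, of W "chi s"] by simp
    then show "(case (W \<otimes>\<^bsub>E.R\<^esub> E.U_K_incl L s, n) of (V, k) \<Rightarrow> k * sig V e0 al) = (case (W, s \<odot>\<^bsub>K_lam\<^esub> n) of (V, k) \<Rightarrow> k * sig V e0 al)"
      by (simp add: K_lam_simps mult_ac)
  qed (simp_all add: sig_add[OF _ _ e0_M] K_lam_simps algebra_simps)
  then show "Phi (dixmier_vec V) al = sig V e0 al" by (simp add: Phi_def frag_sum_diff)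
qed

text \<open>\<open>b - lam b\<close> comes from the algebra of the polarisation and can be moved
  across the tensor sign, where the character sends it to 0.\<close>

lemma dixmier_vec_annih_gen:
  assumes v: "v \<in> carrier E.H" and b: "b \<in> BL"
  shows "dixmier_vec (E.el (v \<otimes>\<^bsub>E.H\<^esub> E.U_hat_class L (E.U_class L (annih_gen b))) 1) = \<zero>\<^bsub>D.D\<^esub>"
proof -
  interpret HC: ring C.E.H by (rule C.E.ring_H)
  have lb: "absv (lam b) \<le> 1" using lam_L b by blast
  have fa: "annih_gen b \<in> C.E.fa" unfolding annih_gen_def by (intro C.E.fa_diff C.E.fa_gen C.E.fa_scalar lb b)
  let ?g = "E.U_hat_class BL (E.U_class BL (annih_gen b))"
  have g: "?g \<in> carrier C.E.H" by (rule C.E.hat_class_closed[OF fa])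
  have gL: "E.U_hat_class L (E.U_class L (annih_gen b)) \<in> carrier E.H" by (rule E.hat_class_closed[OF fa_incl[OF fa]])
  have "chi_free (annih_gen b) + chi_free (free_scalar (lam b)) = chi_free (annih_gen b + free_scalar (lam b))"
    by (rule chi_free_add[symmetric, OF fa C.E.fa_scalar[OF lb]])
  also have "annih_gen b + free_scalar (lam b) = free_gen b" by (simp add: annih_gen_def)
  finally have chi0: "chi (C.E.el ?g 1) = 0" using chi_free_gen[OF b] chi_free_scalar[OF lb] by (simp add: chi_free_def)
  have el: "E.el (v \<otimes>\<^bsub>E.H\<^esub> E.U_hat_class L (E.U_class L (annih_gen b))) 1 = E.el v 1 \<otimes>\<^bsub>E.R\<^esub> E.U_K_incl L (C.E.el ?g 1)"
    unfolding incK_el[OF g] inc_class[OF fa] using E.el_mult[OF v gL, of 1 1] by simp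
  have "D.cls (frag_of (E.el v 1 \<otimes>\<^bsub>E.R\<^esub> E.U_K_incl L (C.E.el ?g 1), 1)) = D.cls (frag_of (E.el v 1, C.E.el ?g 1 \<odot>\<^bsub>K_lam\<^esub> 1))"
    by (rule D.cls_balance) (use E.el_closed[OF v, of 1] C.E.el_closed[OF g, of 1] K_lam_c in simp_all)
  also have "C.E.el ?g 1 \<odot>\<^bsub>K_lam\<^esub> 1 = 0" using chi0 by (simp add: K_lam_simps)
  finally have 1: "dixmier_vec (E.el (v \<otimes>\<^bsub>E.H\<^esub> E.U_hat_class L (E.U_class L (annih_gen b))) 1) = D.cls (frag_of (E.el v 1, 0))"
    unfolding dixmier_vec_def el .
  have z: "(0 :: 'k) \<oplus>\<^bsub>K_lam\<^esub> 0 = 0" by (simp add: K_lam_simps)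
  have "frag_of (E.el v 1, 0) - (frag_of (E.el v 1, 0) + frag_of (E.el v 1, 0)) \<in> D.Ker"
    using D.cls_add_right[of "E.el v 1" 0 0] E.el_closed[OF v, of 1] z K_lam_c[of 0] unfolding D.cls_eq_iff by simp
  from D.Ker_minus[OF this] have "frag_of (E.el v 1, 0) - 0 \<in> D.Ker" by simp
  then show ?thesis unfolding 1 D.D_simps D.cls_eq_iff .
qed

lemma dixmier_vec_zero: "dixmier_vec \<zero>\<^bsub>E.R\<^esub> = \<zero>\<^bsub>D.D\<^esub>"
proof -
  interpret LM: left_module E.R D.D by (rule D.left_module_D)
  have "dixmier_vec \<zero>\<^bsub>E.R\<^esub> \<oplus>\<^bsub>D.D\<^esub> dixmier_vec \<zero>\<^bsub>E.R\<^esub> = dixmier_vec \<zero>\<^bsub>E.R\<^esub>" using dixmier_vec_add[OF D.A.zero_closed D.A.zero_closed] by simp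
  then show ?thesis using dixmier_vec_closed[OF D.A.zero_closed] by (metis LM.M.add.l_cancel_one' )
qed

text \<open>
  A series annihilating the generator lies in the left ideal generated by the finitely many
  \<open>annih_gen b\<close>: peel off the normal form of each coefficient of its expansion in powers of \<open>\<pi>\<close>.
\<close>

lemma annihilator:
  assumes u: "u \<in> carrier E.H" and z: "hat u e0 = (\<lambda>al. 0)"
  shows "dixmier_vec (E.el u 1) = \<zero>\<^bsub>D.D\<^esub>"
proof -
  interpret H: ring E.H by (rule E.ring_H)
  interpret LM: left_module E.R D.D by (rule D.left_module_D)
  obtain s where s: "\<And>n. s n \<in> E.fa" "\<And>n. E.rep u n (\<Sum>k<n. free_scalar (\<pi> ^ k) * s k)" using E.rep_series[OF u] by blast
  have "\<forall>k. \<exists>z. (\<forall>b. fst z b \<in> E.fa) \<and> snd z \<in> E.I \<and> s k - Psi (rho (s k) e0) = (\<Sum>b\<in>base_gens. fst z b * annih_gen b) + snd z"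
  proof
    fix k
    obtain t i where "\<forall>b. t b \<in> E.fa" "i \<in> E.I" "s k - Psi (rho (s k) e0) = (\<Sum>b\<in>base_gens. t b * annih_gen b) + i"
      using normal_form(2)[OF s(1), of k] unfolding annih_ideal_def by (elim CollectE exE conjE)
    then show "\<exists>z. (\<forall>b. fst z b \<in> E.fa) \<and> snd z \<in> E.I \<and> s k - Psi (rho (s k) e0) = (\<Sum>b\<in>base_gens. fst z b * annih_gen b) + snd z"
      by (intro exI[of _ "(t, i)"]) simp
  qed
  from choice[OF this] obtain z where z': "\<forall>k. (\<forall>b. fst (z k) b \<in> E.fa) \<and> snd (z k) \<in> E.I \<and>
      s k - Psi (rho (s k) e0) = (\<Sum>b\<in>base_gens. fst (z k) b * annih_gen b) + snd (z k)" by (elim exE)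
  define t where "t k = fst (z k)" for k
  define i where "i k = snd (z k)" for k
  have t: "\<And>k b. t k b \<in> E.fa" "\<And>k. i k \<in> E.I"
    "\<And>k. s k - Psi (rho (s k) e0) = (\<Sum>b\<in>base_gens. t k b * annih_gen b) + i k" using z' by (simp_all add: t_def i_def)
  \<comment> \<open>For fixed \<open>b\<close> the left factors converge as \<open>n\<close> grows.
    Only finitely many \<open>b\<close> occur, so the limit is a finite sum of elements that vanish
    in the uncompleted tensor product.\<close>
  let ?p = "\<lambda>b n. (\<Sum>k<n. free_scalar (\<pi> ^ k) * t k b) * annih_gen b"
  have "\<exists>w\<in>carrier E.H. dixmier_vec (E.el w 1) = \<zero>\<^bsub>D.D\<^esub> \<and> (\<forall>n. E.rep w n (\<Sum>b\<in>F. ?p b n))" if "finite F" "F \<subseteq> base_gens" for F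
    using that
  proof (induction F rule: finite_induct)
    case empty
    show ?case using E.rep_zero H.zero_closed dixmier_vec_zero by (intro bexI[of _ "\<zero>\<^bsub>E.H\<^esub>"]) (simp_all add: E.el_zero_left)
  next
    case (insert b F)
    obtain w where w: "w \<in> carrier E.H" "dixmier_vec (E.el w 1) = \<zero>\<^bsub>D.D\<^esub>" "\<And>n. E.rep w n (\<Sum>b\<in>F. ?p b n)" using insert by auto
    obtain v where v: "v \<in> carrier E.H" "\<And>n. E.rep v n (\<Sum>k<n. free_scalar (\<pi> ^ k) * t k b)"
      using E.rep_series_construct[of "\<lambda>k. t k b", OF t(1)] by blast
    have b: "b \<in> BL" using insert.prems base_gens(2) by blast
    then have gfa: "annih_gen b \<in> E.fa" using annih_gen_fa by blast
    let ?g = "E.U_hat_class L (E.U_class L (annih_gen b))"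
    have g: "?g \<in> carrier E.H" by (rule E.hat_class_closed[OF gfa])
    let ?w = "v \<otimes>\<^bsub>E.H\<^esub> ?g \<oplus>\<^bsub>E.H\<^esub> w"
    have vg: "v \<otimes>\<^bsub>E.H\<^esub> ?g \<in> carrier E.H" using v g by simp
    have "E.rep ?w n (\<Sum>b\<in>insert b F. ?p b n)" for n
      using E.rep_add[OF vg w(1) E.rep_mult[OF v(1) g v(2) E.rep_class[OF gfa]] w(3)] insert.hyps by simp
    moreover have "dixmier_vec (E.el ?w 1) = \<zero>\<^bsub>D.D\<^esub>"
      using dixmier_vec_add[OF E.el_closed[OF vg, of 1] E.el_closed[OF w(1), of 1]] E.el_add_left[OF vg w(1), of 1]
        dixmier_vec_annih_gen[OF v(1) b] w(2) by simp
    ultimately show ?case using vg w(1) by (intro bexI[of _ ?w]) auto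
  qed
  from this[OF base_gens(1) order_refl] obtain w where
    w: "w \<in> carrier E.H" "dixmier_vec (E.el w 1) = \<zero>\<^bsub>D.D\<^esub>" "\<And>n. E.rep w n (\<Sum>b\<in>base_gens. ?p b n)" by blast
  have "u = w"
  proof (rule E.rep_eqI[OF u w(1)])
    fix n
    let ?q = "\<Sum>k<n. free_scalar (\<pi> ^ k) * s k"
    let ?f = "rho ?q e0"
    have qfa: "?q \<in> E.fa" by (rule E.rep_fa[OF s(2)])
    have fin: "finite {al. rho (s k) e0 al \<noteq> 0}" for k by (rule normal_form(1)[OF s(1)])
    have Ps: "Psi (\<lambda>al. \<Sum>k<m. \<pi> ^ k * rho (s k) e0 al) = (\<Sum>k<m. free_scalar (\<pi> ^ k) * Psi (rho (s k) e0))
        \<and> finite {al. (\<Sum>k<m. \<pi> ^ k * rho (s k) e0 al) \<noteq> 0}" for m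
    proof (induction m)
      case 0
      show ?case by (simp add: Psi_def)
    next
      case (Suc m)
      have f2: "finite {al. \<pi> ^ m * rho (s m) e0 al \<noteq> 0}" using fin[of m] by simp
      have "finite {al. (\<Sum>k<m. \<pi> ^ k * rho (s k) e0 al) + \<pi> ^ m * rho (s m) e0 al \<noteq> 0}"
        by (rule finite_subset[of _ "{al. (\<Sum>k<m. \<pi> ^ k * rho (s k) e0 al) \<noteq> 0} \<union> {al. \<pi> ^ m * rho (s m) e0 al \<noteq> 0}"])
          (use Suc f2 in auto)
      then show ?case using Suc Psi_add[OF _ f2, of "\<lambda>al. \<Sum>k<m. \<pi> ^ k * rho (s k) e0 al"] Psi_scale[OF fin[of m], of "\<pi> ^ m"]
        by simp
    qed
    have fe: "?f = (\<lambda>al. \<Sum>k<n. \<pi> ^ k * rho (s k) e0 al)"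
      by (auto simp: rho_sum rho_mult rho_scalar)
    \<comment> \<open>Since \<open>u\<close> kills the generator, the value of the approximation
      \<open>?q\<close> is nothing but its error. Its coefficients are thus divisible by
      \<open>\<pi> ^ n\<close>, and so is the normal form built from them.\<close>
    have fb: "bdd (r ^ n) ?f"
      using hat_approx[OF u e0_M unit_bdd s(2)[of n]] z by (simp add: bdd_def)
    define f' where "f' = (\<lambda>al. inverse (\<pi> ^ n) * ?f al)"
    have f'f: "finite {al. f' al \<noteq> 0}" unfolding f'_def using Ps[of n] fe by simp
    have f'b: "bdd 1 f'"
      unfolding f'_def using bdd_scale[OF fb, of "inverse (\<pi> ^ n)" "inverse (r ^ n)"] by (simp add: absv_inverse)
    have "?f = (\<lambda>al. \<pi> ^ n * f' al)" by (auto simp: f'_def mult.assoc[symmetric])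
    then have "Psi ?f = free_scalar (\<pi> ^ n) * Psi f'" using Psi_scale[OF f'f, of "\<pi> ^ n"] by simp
    then have PJ: "Psi ?f \<in> E.J n" using E.J_pi[OF Psi_fa[OF f'f f'b]] by simp
    have sk: "s k = Psi (rho (s k) e0) + (\<Sum>b\<in>base_gens. t k b * annih_gen b) + i k" for k
      using t(3)[of k] by (simp add: algebra_simps)
    have "?q = (\<Sum>k<n. free_scalar (\<pi> ^ k) * Psi (rho (s k) e0)) + (\<Sum>k<n. \<Sum>b\<in>base_gens. free_scalar (\<pi> ^ k) * t k b * annih_gen b)
        + (\<Sum>k<n. free_scalar (\<pi> ^ k) * i k)"
      by (subst sk) (simp only: distrib_left sum.distrib sum_distrib_left mult.assoc)
    also have "(\<Sum>k<n. \<Sum>b\<in>base_gens. free_scalar (\<pi> ^ k) * t k b * annih_gen b) = (\<Sum>b\<in>base_gens. ?p b n)"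
      by (subst sum.swap) (simp only: sum_distrib_right)
    also have "(\<Sum>k<n. free_scalar (\<pi> ^ k) * Psi (rho (s k) e0)) = Psi ?f" using Ps[of n] fe by simp
    finally have "?q - (\<Sum>b\<in>base_gens. ?p b n) = Psi ?f + (\<Sum>k<n. free_scalar (\<pi> ^ k) * i k)" by (simp add: algebra_simps)
    moreover have "(\<Sum>k<n. free_scalar (\<pi> ^ k) * i k) \<in> E.J n"
      by (intro E.J_sum E.I_J E.I_left t(2) E.fa_pi)
    ultimately have "?q - (\<Sum>b\<in>base_gens. ?p b n) \<in> E.J n" using E.J_add[OF PJ] by simp
    then have "E.rep w n ?q" using E.rep_shift[OF w(1) w(3) qfa] by blast
    then show "\<exists>q. E.rep u n q \<and> E.rep w n q" using s(2) by blast
  qed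
  then show ?thesis using w(2) by simp
qed

text \<open>After clearing the denominator this is \<open>annihilator\<close>; the denominator is
  then restored by the module action.\<close>

lemma Phi_inj:
  assumes "V \<in> carrier E.R" "sig V e0 = (\<lambda>al. 0)" shows "dixmier_vec V = \<zero>\<^bsub>D.D\<^esub>"
proof -
  interpret H: ring E.H by (rule E.ring_H)
  interpret LM: left_module E.R D.D by (rule D.left_module_D)
  obtain u m where u: "u \<in> carrier E.H" "V = E.el u (inverse \<pi> ^ m)" using E.R_elements[OF assms(1)] by blast
  let ?a = "inverse \<pi> ^ m"
  have "hat u e0 = (\<lambda>al. 0)"
  proof
    fix al show "hat u e0 al = 0" using fun_cong[OF assms(2), of al] by (simp add: u(2) sig_el[OF e0_M])
  qed
  from annihilator[OF u(1) this] have 0: "dixmier_vec (E.el u 1) = \<zero>\<^bsub>D.D\<^esub>" .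
  have s: "E.el \<one>\<^bsub>E.H\<^esub> ?a \<in> carrier E.R" by (rule E.el_closed) simp
  have "V = E.el \<one>\<^bsub>E.H\<^esub> ?a \<otimes>\<^bsub>E.R\<^esub> E.el u 1" using E.el_mult[OF H.one_closed u(1), of ?a 1] u by simp
  then have "dixmier_vec V = E.el \<one>\<^bsub>E.H\<^esub> ?a \<odot>\<^bsub>D.D\<^esub> \<zero>\<^bsub>D.D\<^esub>" using dixmier_vec_smult[OF s, of "E.el u 1"] 0 by simp
  also have "\<dots> = \<zero>\<^bsub>D.D\<^esub>"
    by (simp only: dixmier_vec_zero[symmetric] dixmier_vec_smult[OF s] D.A.r_null[OF s])
  finally show ?thesis .
qed

theorem irreducible_dixmier: "irreducible_module E.R (E.dixmier_module L lam bb)"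
  unfolding dixmier_eq irreducible_module_def
proof (intro conjI allI impI)
  interpret LM: left_module E.R D.D by (rule D.left_module_D)
  show "left_module E.R D.D" by (rule D.left_module_D)
  have "unit (replicate d 0) (replicate d 0) = (1 :: 'k)" by (simp add: unit_def)
  then have e0n: "e0 \<noteq> (\<lambda>al. 0)" by (metis zero_neq_one)
  have sig0: "sig \<zero>\<^bsub>E.R\<^esub> f = (\<lambda>al. 0)" if "f \<in> M" for f
    using fun_cong[OF sig_add[OF D.A.zero_closed D.A.zero_closed that], unfolded D.A.r_zero[OF D.A.zero_closed]]
    by (intro ext) (simp only: add_cancel_right_right)
  show "carrier D.D \<noteq> {\<zero>\<^bsub>D.D\<^esub>}"
  proof
    assume "carrier D.D = {\<zero>\<^bsub>D.D\<^esub>}"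
    then have "dixmier_vec \<one>\<^bsub>E.R\<^esub> = dixmier_vec \<zero>\<^bsub>E.R\<^esub>" using dixmier_vec_closed[OF D.A.one_closed] dixmier_vec_zero by simp
    then have "sig \<one>\<^bsub>E.R\<^esub> e0 = sig \<zero>\<^bsub>E.R\<^esub> e0" using Phi_dixmier_vec[OF D.A.one_closed] Phi_dixmier_vec[OF D.A.zero_closed] by metis
    then show False using e0n sig_one[OF e0_M] sig0[OF e0_M] by simp
  qed
  fix P assume P: "submodule P E.R D.D"
  interpret P: submodule P E.R D.D by (rule P)
  have PD: "P \<subseteq> carrier D.D" using P.subset by simp
  have P0: "\<zero>\<^bsub>D.D\<^esub> \<in> P" using P.one_closed by simp
  have Padd: "x \<oplus>\<^bsub>D.D\<^esub> y \<in> P" if "x \<in> P" "y \<in> P" for x y using P.m_closed[OF that] by simp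
  \<comment> \<open>The image of the submodule in \<open>M\<close>. Injectivity of the map recovers
    \<open>P\<close> from it in either of the two cases.\<close>
  define S where "S = {sig V e0 | V. V \<in> carrier E.R \<and> dixmier_vec V \<in> P}"
  have "stable S"
    unfolding stable_def
  proof (intro conjI ballI)
    show "S \<subseteq> M" by (auto simp: S_def intro: sig_M[OF _ e0_M])
    show "(\<lambda>al. 0) \<in> S" unfolding S_def using D.A.zero_closed dixmier_vec_zero P0 sig0[OF e0_M] by (intro CollectI exI[of _ "\<zero>\<^bsub>E.R\<^esub>"]) simp
    fix f assume "f \<in> S"
    then obtain V where V: "f = sig V e0" "V \<in> carrier E.R" "dixmier_vec V \<in> P" by (auto simp: S_def)
    show "(\<lambda>al. f al + g al) \<in> S" if g: "g \<in> S" for g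
    proof -
      obtain W where W: "g = sig W e0" "W \<in> carrier E.R" "dixmier_vec W \<in> P" using g by (auto simp: S_def)
      have "dixmier_vec (V \<oplus>\<^bsub>E.R\<^esub> W) \<in> P" using Padd[OF V(3) W(3)] dixmier_vec_add[OF V(2) W(2)] by simp
      then show ?thesis unfolding S_def using V W sig_add[OF V(2) W(2) e0_M]
        by (intro CollectI exI[of _ "V \<oplus>\<^bsub>E.R\<^esub> W"]) simp
    qed
  next
    fix W f assume W: "W \<in> carrier E.R" and "f \<in> S"
    then obtain V where V: "f = sig V e0" "V \<in> carrier E.R" "dixmier_vec V \<in> P" by (auto simp: S_def)
    have "dixmier_vec (W \<otimes>\<^bsub>E.R\<^esub> V) \<in> P" using P.smult_closed[OF W V(3)] dixmier_vec_smult[OF W, of V] by simp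
    then show "sig W f \<in> S" unfolding S_def using V W sig_mult[OF W V(2) e0_M]
      by (intro CollectI exI[of _ "W \<otimes>\<^bsub>E.R\<^esub> V"]) simp
  qed
  then consider "S = {\<lambda>al. 0}" | "S = M" using stable_cases by blast
  then show "P = {\<zero>\<^bsub>D.D\<^esub>} \<or> P = carrier D.D"
  proof cases
    case 1
    have "Z = \<zero>\<^bsub>D.D\<^esub>" if Z: "Z \<in> P" for Z
    proof -
      obtain V where V: "V \<in> carrier E.R" "Z = dixmier_vec V" using D_elements PD Z by blast
      then have "sig V e0 \<in> S" using Z by (auto simp: S_def)
      then show ?thesis using Phi_inj[OF V(1)] 1 V(2) by simp
    qed
    then show ?thesis using P0 by blast
  next
    case 2
    have "Z \<in> P" if Z: "Z \<in> carrier D.D" for Z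
    proof -
      obtain V where V: "V \<in> carrier E.R" "Z = dixmier_vec V" using D_elements Z by blast
      then have "sig V e0 \<in> S" using 2 sig_M[OF _ e0_M] by blast
      then obtain W where W: "sig V e0 = sig W e0" "W \<in> carrier E.R" "dixmier_vec W \<in> P" by (auto simp: S_def)
      have VW: "V \<ominus>\<^bsub>E.R\<^esub> W \<in> carrier E.R" using V W by simp
      have eq: "(V \<ominus>\<^bsub>E.R\<^esub> W) \<oplus>\<^bsub>E.R\<^esub> W = V" using V W by (simp add: D.A.minus_eq D.A.a_assoc D.A.l_neg)
      have "sig (V \<ominus>\<^bsub>E.R\<^esub> W) e0 = (\<lambda>al. 0)"
        using sig_add[OF VW W(2) e0_M] W(1) by (simp add: eq fun_eq_iff)
      from Phi_inj[OF VW this] have "dixmier_vec V = dixmier_vec W"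
        using dixmier_vec_add[OF VW W(2)] dixmier_vec_closed[OF W(2)] by (simp add: eq)
      then show ?thesis using V W by simp
    qed
    then show ?thesis using PD by blast
  qed
qed

end

section \<open>From the definition of a lattice to the conclusion\<close>

lemma lie_latticeD:
  assumes "lie_lattice (valuation_ring absv) \<pi> scale bracket L"
  shows "0 \<in> L" "x \<in> L \<Longrightarrow> y \<in> L \<Longrightarrow> x + y \<in> L" "absv c \<le> 1 \<Longrightarrow> x \<in> L \<Longrightarrow> scale c x \<in> L"
    "x \<in> L \<Longrightarrow> y \<in> L \<Longrightarrow> bracket x y \<in> L" "(\<Inter>n::nat. scale (\<pi> ^ n) ` L) = {0}"
  using assms unfolding lie_lattice_def valuation_ring_def by simp_all

text \<open>Surjectivity of the canonical map writes a vector as a finite sum of field multiples of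
  lattice vectors, and one power of \<open>\<pi>\<close> clears all denominators.\<close>

lemma (in complete_dvf) lie_lattice_span:
  fixes scale :: "'k \<Rightarrow> 'g::ab_group_add \<Rightarrow> 'g"
  assumes "vector_space scale" "lie_lattice (valuation_ring absv) \<pi> scale bracket L"
  shows "\<exists>n. scale (\<pi> ^ n) x \<in> L"
proof -
  interpret V: vector_space scale by (rule assms(1))
  let ?O = "valuation_ring absv"
  note L = lie_latticeD[OF assms(2)]
  define W where "W = {x. \<exists>n. scale (\<pi> ^ n) x \<in> L}"
  have up: "scale (\<pi> ^ (n + m)) x \<in> L" if "scale (\<pi> ^ n) x \<in> L" for n m x
    using L(3)[OF _ that, of "\<pi> ^ m"] by (simp add: power_add mult.commute)
  have Wadd: "x + y \<in> W" if xy: "x \<in> W" "y \<in> W" for x y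
  proof -
    obtain n m where "scale (\<pi> ^ n) x \<in> L" "scale (\<pi> ^ m) y \<in> L" using xy by (auto simp: W_def)
    then have "scale (\<pi> ^ (n + m)) (x + y) \<in> L"
      using L(2)[OF up[of n x m] up[of m y n]] by (simp add: V.scale_right_distrib add.commute)
    then show ?thesis by (auto simp: W_def)
  qed
  have Wsc: "scale a y \<in> W" if y: "y \<in> L" for a y
  proof -
    obtain n where n: "absv a \<le> inverse r ^ n" using absv_le_inverse_power by blast
    have "absv (\<pi> ^ n * a) \<le> r ^ n * inverse r ^ n" using n by (intro absv_mult_le) simp_all
    then have "absv (\<pi> ^ n * a) \<le> 1" by (simp flip: power_mult_distrib)
    then have "scale (\<pi> ^ n) (scale a y) \<in> L" using L(3)[OF _ y, of "\<pi> ^ n * a"] by simp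
    then show ?thesis by (auto simp: W_def)
  qed
  have "x \<in> lattice_tensor_map scale ` carrier (lattice_tensor ?O scale L)"
    using assms(2) unfolding lie_lattice_def bij_betw_def by blast
  then obtain Z where Z: "Z \<in> carrier (lattice_tensor ?O scale L)" "x = lattice_tensor_map scale Z" by blast
  define ev where "ev c = (\<Sum>(x, a)\<in>Poly_Mapping.keys c. scale (of_int (Poly_Mapping.lookup c (x, a)) * a) x)" for c :: "'g \<times> 'k \<Rightarrow>\<^sub>0 int"
  have evd: "ev (c - c') = ev c - ev c'" for c c'
  proof -
    let ?S = "Poly_Mapping.keys c \<union> Poly_Mapping.keys c'"
    have sup: "ev e = (\<Sum>(x, a)\<in>?S. scale (of_int (Poly_Mapping.lookup e (x, a)) * a) x)" if "Poly_Mapping.keys e \<subseteq> ?S" for e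
      unfolding ev_def using that by (intro sum.mono_neutral_left) (auto simp: in_keys_iff)
    show ?thesis
      using sup[OF keys_diff] sup[of c] sup[of c']
      by (simp add: lookup_minus left_diff_distrib V.scale_left_diff_distrib case_prod_unfold sum_subtractf)
  qed
  have ev1: "ev (frag_of (y, a)) = scale a y" for y a by (simp add: ev_def)
  interpret T: tensor "\<lparr>carrier = L, monoid.mult = (+), monoid.one = 0\<rparr>" "add_monoid (ring_of_type_algebra :: 'k ring)" "valuation_ring absv" "\<lambda>x c. scale c x" "(*)"
  proof (rule tensor.intro)
    show "comm_group \<lparr>carrier = L, monoid.mult = (+), monoid.one = 0\<rparr>"
    proof (rule comm_groupI)
      fix y assume y: "y \<in> carrier \<lparr>carrier = L, monoid.mult = (+), monoid.one = 0\<rparr>"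
      then have "- y \<in> L" using L(3)[of "- 1" y] by simp
      then show "\<exists>z\<in>carrier \<lparr>carrier = L, monoid.mult = (+), monoid.one = 0\<rparr>. z \<otimes>\<^bsub>\<lparr>carrier = L, monoid.mult = (+), monoid.one = 0\<rparr>\<^esub> y = \<one>\<^bsub>\<lparr>carrier = L, monoid.mult = (+), monoid.one = 0\<rparr>\<^esub>"
        by (intro bexI[of _ "- y"]) simp_all
    qed (use L(1,2) in \<open>simp_all add: add_ac\<close>)
    show "comm_group (add_monoid (ring_of_type_algebra :: 'k ring))"
      using ring.is_abelian_group[OF ring_from_type_algebra] by (rule abelian_group.a_comm_group)
  qed (use L(3) in \<open>auto simp: valuation_ring_def\<close>)
  obtain c where c: "Poly_Mapping.keys c \<subseteq> L \<times> UNIV" "Z = T.cls c"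
    using Z(1) unfolding lattice_tensor_def T.carrier_T by auto
  \<comment> \<open>Evaluation is bilinear and balanced, so all representatives of a tensor give the
    same vector and \<open>the_elem\<close> returns it.\<close>
  have ker: "ev k = 0" if "k \<in> T.Ker" for k
    using that
  proof (induction rule: T.Ker_induct)
    case (rel k)
    then show ?case unfolding tensor_relators_def
      by (auto simp: evd ev1 V.scale_right_distrib V.scale_left_distrib mult.commute)
  qed (simp_all add: evd, simp add: ev_def)
  have "ev ` Z = {ev c}"
  proof -
    have "ev e = ev c" if "e \<in> Z" for e
      using ker[of "e - c"] that unfolding c(2) T.mem_cls_iff by (simp add: evd)
    then show ?thesis using T.self_mem_cls[of c] c(2) by blast
  qed
  then have "x = ev c" using Z(2) unfolding lattice_tensor_map_def ev_def[abs_def] by simp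
  moreover have "ev c \<in> W"
    using c(1)
  proof (induction rule: frag_induction)
    case zero
    show ?case using L(1) by (auto simp: ev_def W_def)
  next
    case (one y)
    then show ?case using Wsc by (cases y) (auto simp: ev1)
  next
    case (diff a b)
    have "scale (-1) (ev b) \<in> W"
    proof -
      obtain n where "scale (\<pi> ^ n) (ev b) \<in> L" using diff by (auto simp: W_def)
      then have "scale (\<pi> ^ n) (scale (-1) (ev b)) \<in> L" using L(3)[of "-1"] by fastforce
      then show ?thesis unfolding W_def by blast
    qed
    then show ?case using Wadd[OF diff(1), of "scale (- 1) (ev b)"] by (simp add: evd)
  qed
  ultimately show ?thesis by (simp add: W_def)
qed

theorem theorem3p6:
  fixes p :: nat
    and \<iota> :: "(nat \<Rightarrow> rat) set \<Rightarrow> 'k::field" and absv :: "'k \<Rightarrow> real" and \<pi> :: 'k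
    and scale :: "'k \<Rightarrow> 'g::ab_group_add \<Rightarrow> 'g" and bracket :: "'g \<Rightarrow> 'g \<Rightarrow> 'g"
    and L :: "'g set" and lam :: "'g \<Rightarrow> 'k"
  defines "\<O> \<equiv> valuation_ring absv"
  assumes "padic_extension p \<iota> absv"
    and "uniformiser absv \<pi>"
    and "lie_algebra scale bracket"
    and "\<exists>basis. finite_dimensional_vector_space scale basis"
    and "lie_algebra.nilpotent scale bracket"
    and "lie_lattice \<O> \<pi> scale bracket L"
    and "Vector_Spaces.linear scale (*) lam"
    and "lam ` L \<subseteq> \<O>"
  shows "\<exists>\<bb>. lie_algebra.polarisation scale bracket lam \<bb> \<and>
           irreducible_module (affinoid_enveloping.U_K \<O> \<pi> scale bracket L)
             (affinoid_enveloping.dixmier_module \<O> \<pi> scale bracket L lam \<bb>)"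
proof -
  interpret K: complete_dvf absv \<pi>
    by (rule padic_extension.complete_dvf_if_uniformiser[OF assms(2,3)])
  interpret g: lie_algebra scale bracket by (rule assms(4))
  obtain N where N: "g.lower_central N = {0}" using assms(6) unfolding g.nilpotent_def by (elim exE)
  note L = lie_latticeD[OF assms(7)[unfolded \<O>_def]]
  have span: "\<exists>n. scale (\<pi> ^ n) x \<in> L" for x
    by (rule K.lie_lattice_span[OF g.vector_space_axioms assms(7)[unfolded \<O>_def]])
  interpret lam: Vector_Spaces.linear scale "(*)" lam by (rule assms(8))
  have lam_L: "absv (lam x) \<le> 1" if "x \<in> L" for x
    using subsetD[OF assms(9) imageI[OF that]] by (simp add: \<O>_def valuation_ring_def)
  interpret S: lie_setup absv \<pi> scale bracket L lam N
    by (intro lie_setup.intro lie_setup_axioms.intro K.complete_dvf_axioms g.lie_algebra_axioms assms(5) N L span lam.add lam.scale lam_L)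
  have "g.subalgebra UNIV" by (simp add: g.subalgebra_def)
  from S.exists_adapted[OF this] obtain ps where ps: "S.adapted ps UNIV" by (elim exE)
  interpret main_setup absv \<pi> scale bracket L lam N ps
    by (intro main_setup.intro rep_setup.intro rep_setup_axioms.intro S.lie_setup_axioms ps L subset_UNIV subset_refl)
  show ?thesis unfolding \<O>_def
    by (intro exI[of _ "S.base ps UNIV"] conjI S.polarisation_base[OF ps] irreducible_dixmier)
qed

end
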